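(* Let $0<\alpha<1$ and let $h:(0,\infty)\to[0,\infty)$ be integrable with respect to $f_\alpha$, normalized so that $\int_0^\infty h(t)f_\alpha(t)\,dt=1$; form the density $\gamma_\alpha(t)=h(t)f_\alpha(t)$. Then the exchangeable partition probability function (EPPF) of the $\mathrm{PK}(\rho_\alpha,\gamma_\alpha)$ random partition has the Gibbs form $$p_{\alpha,\gamma_\alpha}(n_1,\ldots,n_k)=V_{n,k}\prod_{j=1}^{k}[1-\alpha]_{n_j-1},\qquad n_1+\cdots+n_k=n,\ n_j\ge1,$$ where, for $k=1,\ldots,n$, $$V_{n,k}=\frac{\alpha^{k-1}\Gamma(k)}{\Gamma(n)}\,\mathbb{E}\left[h\!\left(\frac{S_{\alpha,k\alpha}}{\beta_{k\alpha,n-k\alpha}}\right)\right]=\frac{\alpha^{k-1}\Gamma(k)}{\Gamma(n)}\,\mathbb{E}\left[h\!\left(\frac{S_{\alpha,(k-1)\alpha}}{\beta_{(k-1)\alpha+1,\,n-1-(k-1)\alpha}}\right)\right]=\mathcal I^{(n,k)}_\alpha(h),$$ with $$\mathcal I^{(n,k)}_\alpha(h)=\alpha^{k-1}\int_0^\infty h(t)\,H^{0,1}_{1,1}\left[t\,\middle|\,\begin{matrix}(1-\frac1\alpha-k,\frac1\alpha)\\(-n,1)\end{matrix}\right]dt,$$ and $V_{1,1}=1$.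
   Context: For $0<\alpha<1$, $S_\alpha$ is a positive $\alpha$-stable random variable with $\mathbb{E}[e^{-\lambda S_\alpha}]=e^{-\lambda^\alpha}$, $\lambda>0$, and density $f_\alpha$. For $\theta>-\alpha$, $S_{\alpha,\theta}$ has density $\frac{\Gamma(\theta+1)}{\Gamma(\theta/\alpha+1)}t^{-\theta}f_\alpha(t)$, $t>0$. $\beta_{a,b}$ is a beta$(a,b)$ random variable, with the convention $\beta_{a,0}=1$. Random variables in the same product or quotient are independent. $[a]_n=\Gamma(a+n)/\Gamma(a)$. $\mathrm{PK}(\rho_\alpha,\gamma)$ partition: let $J_1\ge J_2\ge\cdots>0$ be the ranked jumps of a stable subordinator on $[0,1]$ with Lévy density $\rho_\alpha(s)=\frac{\alpha}{\Gamma(1-\alpha)}s^{-\alpha-1}$, so $\sum_iJ_i=S_\alpha$, and $P_i=J_i/S_\alpha$. $\mathrm{PK}(\rho_\alpha|t)$ is the law of $(P_i)$ given $S_\alpha=t$, and $\mathrm{PK}(\rho_\alpha,\gamma)=\int_0^\infty\mathrm{PK}(\rho_\alpha|t)\gamma(dt)$. The associated exchangeable random partition $(\Pi_n)$ of $\mathbb N$ is obtained by sampling, given $(P_i)$, i.i.d. indices with probabilities $P_i$ and putting two integers in the same block iff their indices coincide; its EPPF is $p(n_1,\ldots,n_k)=\mathbb P(\Pi_n=\{A_1,\ldots,A_k\})$ for any particular partition of $\{1,\ldots,n\}$ with block sizes $|A_i|=n_i$. By a known result of Pitman, for $\mathrm{PK}(\rho_\alpha|t)$ it equals $\mathbb{G}^{(n,k)}_\alpha(t)\prod_{j}[1-\alpha]_{n_j-1}$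 with $\mathbb{G}_{\alpha}^{(n,k)}(t)=\frac{\alpha^{k}t^{-k\alpha}}{\Gamma(n-k\alpha)f_{\alpha}(t)}\int_{0}^{1}f_{\alpha}(tu)(1-u)^{n-k\alpha-1}du$; thus for $\mathrm{PK}(\rho_\alpha,\gamma)$ it is $V_{n,k}\prod_j[1-\alpha]_{n_j-1}$ with $V_{n,k}=\int_0^\infty \mathbb{G}_{\alpha}^{(n,k)}(t)\gamma(dt)$. The Fox $H$-function here is $H^{0,1}_{1,1}\left[z\,\middle|\,\begin{matrix}(a,A)\\(b,B)\end{matrix}\right]=\frac1{2\pi i}\int_{\mathfrak L}\frac{\Gamma(1-a-As)}{\Gamma(1-b-Bs)}z^{-s}ds$, where $\mathfrak L$ is an infinite contour (a vertical contour from $\gamma-i\infty$ to $\gamma+i\infty$, or a loop from $+\infty+i\varphi_1$ to $+\infty+i\varphi_2$, $\varphi_1<\varphi_2$) with all poles of $\Gamma(1-a-As)$ to its right. *)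

theory Defs
  imports "HOL-Probability.Probability"
begin

text \<open>
  The Laplace transform determines the density up to null sets; every statement below is
  insensitive to the choice of version.
\<close>
definition positive_stable_density :: "real \<Rightarrow> (real \<Rightarrow> real) \<Rightarrow> bool" where
  "positive_stable_density \<alpha> f \<longleftrightarrow>
     f \<in> borel_measurable borel \<and> (\<forall>t. 0 \<le> f t) \<and> (\<forall>t\<le>0. f t = 0) \<and>
     (\<forall>x>0. has_bochner_integral lborel (\<lambda>t. exp (- x * t) * f t) (exp (- (x powr \<alpha>))))"

text \<open>The law of \<open>S\<^sub>\<alpha>\<^sub>,\<^sub>\<theta>\<close>, for \<open>\<theta> > -\<alpha>\<close>, where \<open>f\<close> is the density of \<open>S\<^sub>\<alpha>\<close>.\<close>
definition tilted_stable_law :: "(real \<Rightarrow> real) \<Rightarrow> real \<Rightarrow> real \<Rightarrow> real measure" where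
  "tilted_stable_law f \<alpha> \<theta> =
     density lborel (\<lambda>t. ennreal (Gamma (\<theta> + 1) / Gamma (\<theta> / \<alpha> + 1) * t powr (- \<theta>) * f t))"

definition beta_law :: "real \<Rightarrow> real \<Rightarrow> real measure" where
  "beta_law a b =
     (if b = 0 then return borel 1
      else density lborel (\<lambda>u. ennreal (indicator {0<..<1} u *
             (u powr (a - 1) * (1 - u) powr (b - 1) / Beta a b))))"

text \<open>
  A driftless subordinator \<open>(X t)\<close>, \<open>0 \<le> t \<le> 1\<close>, with Levy density \<open>\<rho>\<close>: the last clause
  is the Levy-Khintchine formula for the Laplace transform of \<open>X t\<close>.
\<close>
definition subordinator :: "'a measure \<Rightarrow> (real \<Rightarrow> 'a \<Rightarrow> real) \<Rightarrow> (real \<Rightarrow> real) \<Rightarrow> bool" where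
  "subordinator M X \<rho> \<longleftrightarrow>
     prob_space M \<and>
     (\<forall>t\<in>{0..1}. X t \<in> borel_measurable M) \<and>
     (AE \<omega> in M. X 0 \<omega> = 0 \<and> mono_on {0..1} (\<lambda>t. X t \<omega>) \<and>
        (\<forall>t\<in>{0..<1}. continuous (at_right t) (\<lambda>u. X u \<omega>))) \<and>
     (\<forall>(n::nat) t. 0 \<le> t 0 \<and> (\<forall>i<n. t i \<le> t (Suc i)) \<and> t n \<le> 1 \<longrightarrow>
        prob_space.indep_vars M (\<lambda>_. borel) (\<lambda>i \<omega>. X (t (Suc i)) \<omega> - X (t i) \<omega>) {..<n}) \<and>
     (\<forall>s t. 0 \<le> s \<and> s \<le> t \<and> t \<le> 1 \<longrightarrow>
        distr M borel (\<lambda>\<omega>. X t \<omega> - X s \<omega>) = distr M borel (X (t - s))) \<and>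
     (\<forall>x>0. 0 \<le> \<rho> x) \<and> set_integrable lborel {0<..} (\<lambda>x. min 1 x * \<rho> x) \<and>
     (\<forall>t\<in>{0..1}. \<forall>y>0. prob_space.expectation M (\<lambda>\<omega>. exp (- y * X t \<omega>)) =
        exp (- t * (LBINT x:{0<..}. (1 - exp (- y * x)) * \<rho> x)))"

definition stable_levy_density :: "real \<Rightarrow> real \<Rightarrow> real" where
  "stable_levy_density \<alpha> s = \<alpha> / Gamma (1 - \<alpha>) * s powr (- \<alpha> - 1)"

definition jump :: "(real \<Rightarrow> 'a \<Rightarrow> real) \<Rightarrow> 'a \<Rightarrow> real \<Rightarrow> real" where
  "jump X \<omega> t = X t \<omega> - Lim (at_left t) (\<lambda>u. X u \<omega>)"

text \<open>
  \<open>J 0 \<ge> J 1 \<ge> \<dots>\<close> lists the sizes of all positive jumps on the unit interval with multiplicity;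
  \<open>\<tau>\<close> lists the corresponding jump times. Ranks start at 0.
\<close>
definition ranked_jumps :: "'a measure \<Rightarrow> (real \<Rightarrow> 'a \<Rightarrow> real) \<Rightarrow> (nat \<Rightarrow> 'a \<Rightarrow> real) \<Rightarrow> bool" where
  "ranked_jumps M X J \<longleftrightarrow>
     (\<forall>i. J i \<in> borel_measurable M) \<and>
     (AE \<omega> in M. (\<forall>i. J (Suc i) \<omega> \<le> J i \<omega>) \<and>
        (\<exists>\<tau>. bij_betw \<tau> (UNIV :: nat set) {t \<in> {0<..1}. 0 < jump X \<omega> t} \<and>
             (\<forall>i. J i \<omega> = jump X \<omega> (\<tau> i))))"

definition total_mass :: "(nat \<Rightarrow> 'a \<Rightarrow> real) \<Rightarrow> 'a \<Rightarrow> real" where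
  "total_mass J \<omega> = (\<Sum>i. J i \<omega>)"

definition normalized_jumps :: "(nat \<Rightarrow> 'a \<Rightarrow> real) \<Rightarrow> 'a \<Rightarrow> nat \<Rightarrow> real" where
  "normalized_jumps J \<omega> = (\<lambda>i. J i \<omega> / total_mass J \<omega>)"

definition seq_space :: "(nat \<Rightarrow> real) measure" where
  "seq_space = PiM UNIV (\<lambda>_. borel)"

text \<open>\<open>K\<close> is a regular version of the conditional law of the sequence \<open>P\<close> given the variable \<open>S\<close>.\<close>
definition regular_conditional_law ::
  "'a measure \<Rightarrow> ('a \<Rightarrow> nat \<Rightarrow> real) \<Rightarrow> ('a \<Rightarrow> real) \<Rightarrow> (real \<Rightarrow> (nat \<Rightarrow> real) measure) \<Rightarrow> bool" where
  "regular_conditional_law M P S K \<longleftrightarrow>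
     K \<in> borel \<rightarrow>\<^sub>M prob_algebra seq_space \<and>
     (\<forall>A\<in>sets seq_space. \<forall>B\<in>sets borel.
        emeasure M {\<omega> \<in> space M. P \<omega> \<in> A \<and> S \<omega> \<in> B} =
        (\<integral>\<^sup>+ t \<in> B. emeasure (K t) A \<partial>(distr M borel S)))"

text \<open>
  \<open>K t\<close> is \<open>PK(\<rho>\<^sub>\<alpha>|t)\<close>. It is determined for almost every \<open>t\<close> only, which suffices to mix it
  over absolutely continuous laws on the positive half-line.
\<close>
definition PK_kernel :: "real \<Rightarrow> 'a measure \<Rightarrow> (real \<Rightarrow> 'a \<Rightarrow> real) \<Rightarrow> (nat \<Rightarrow> 'a \<Rightarrow> real) \<Rightarrow>
    (real \<Rightarrow> (nat \<Rightarrow> real) measure) \<Rightarrow> bool" where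
  "PK_kernel \<alpha> M X J K \<longleftrightarrow>
     subordinator M X (stable_levy_density \<alpha>) \<and> ranked_jumps M X J \<and>
     regular_conditional_law M (normalized_jumps J) (total_mass J) K"

definition PK_mixture :: "(real \<Rightarrow> (nat \<Rightarrow> real) measure) \<Rightarrow> real measure \<Rightarrow> (nat \<Rightarrow> real) measure" where
  "PK_mixture K \<gamma> = \<gamma> \<bind> K"

text \<open>
  On \<open>N\<close>, the sequence \<open>P\<close> has law \<open>\<mu>\<close> and, given \<open>P\<close>, the indices \<open>I 1, I 2, \<dots>\<close> are i.i.d.
  and equal to \<open>i\<close> with probability \<open>P i\<close>.
\<close>
definition iid_indices ::
  "'b measure \<Rightarrow> (nat \<Rightarrow> real) measure \<Rightarrow> ('b \<Rightarrow> nat \<Rightarrow> real) \<Rightarrow> (nat \<Rightarrow> 'b \<Rightarrow> nat) \<Rightarrow> bool" where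
  "iid_indices N \<mu> P I \<longleftrightarrow>
     prob_space N \<and> P \<in> N \<rightarrow>\<^sub>M seq_space \<and> distr N seq_space P = \<mu> \<and>
     (\<forall>j. I j \<in> N \<rightarrow>\<^sub>M count_space UNIV) \<and>
     (\<forall>A\<in>sets seq_space. \<forall>n (i :: nat \<Rightarrow> nat).
        has_bochner_integral N (\<lambda>\<omega>. indicator A (P \<omega>) * (\<Prod>j=1..n. P \<omega> (i j)))
          (measure N {\<omega> \<in> space N. P \<omega> \<in> A \<and> (\<forall>j\<in>{1..n}. I j \<omega> = i j)}))"

definition index_partition :: "(nat \<Rightarrow> 'b \<Rightarrow> nat) \<Rightarrow> nat \<Rightarrow> 'b \<Rightarrow> nat set set" where
  "index_partition I n \<omega> = {1..n} // {(i, j). i \<in> {1..n} \<and> j \<in> {1..n} \<and> I i \<omega> = I j \<omega>}"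

text \<open>The list \<open>As\<close> enumerates the blocks, so that \<open>map card As\<close> is \<open>(n\<^sub>1, \<dots>, n\<^sub>k)\<close>.\<close>
definition is_EPPF :: "'b measure \<Rightarrow> (nat \<Rightarrow> 'b \<Rightarrow> nat set set) \<Rightarrow> (nat list \<Rightarrow> real) \<Rightarrow> bool" where
  "is_EPPF N R p \<longleftrightarrow>
     (\<forall>n\<ge>1. \<forall>As. distinct As \<and> partition_on {1..n} (set As) \<longrightarrow>
        measure N {\<omega> \<in> space N. R n \<omega> = set As} = p (map card As))"

text \<open>
  \<open>Vertical c\<close> is the upward line through \<open>c\<close>. \<open>Loop c \<phi>\<^sub>1 \<phi>\<^sub>2\<close> comes in from \<open>+\<infinity> + i\<phi>\<^sub>1\<close>
  horizontally to real part \<open>c\<close>, goes up to \<open>c + i\<phi>\<^sub>2\<close>, and leaves horizontally to \<open>+\<infinity> + i\<phi>\<^sub>2\<close>.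
\<close>
datatype fox_contour = Vertical real | Loop real real real

fun right_side :: "fox_contour \<Rightarrow> complex set" where
  "right_side (Vertical c) = {s. c < Re s}"
| "right_side (Loop c \<phi>1 \<phi>2) = {s. c < Re s \<and> \<phi>1 < Im s \<and> Im s < \<phi>2}"

fun contour_converges :: "fox_contour \<Rightarrow> (complex \<Rightarrow> complex) \<Rightarrow> bool" where
  "contour_converges (Vertical c) F = integrable lborel (\<lambda>y. F (Complex c y))"
| "contour_converges (Loop c \<phi>1 \<phi>2) F =
     (set_integrable lborel {c..} (\<lambda>x. F (Complex x \<phi>1)) \<and>
      set_integrable lborel {\<phi>1..\<phi>2} (\<lambda>y. F (Complex c y)) \<and>
      set_integrable lborel {c..} (\<lambda>x. F (Complex x \<phi>2)))"

fun fox_contour_integral :: "fox_contour \<Rightarrow> (complex \<Rightarrow> complex) \<Rightarrow> complex" where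
  "fox_contour_integral (Vertical c) F = \<i> * (LBINT y. F (Complex c y))"
| "fox_contour_integral (Loop c \<phi>1 \<phi>2) F =
     - (LBINT x:{c..}. F (Complex x \<phi>1)) + \<i> * (LBINT y:{\<phi>1..\<phi>2}. F (Complex c y))
     + (LBINT x:{c..}. F (Complex x \<phi>2))"

text \<open>The poles of \<open>\<lambda>s. Gamma (1 - a - A * s)\<close> are the points where the argument is a nonpositive integer.\<close>
definition fox_admissible :: "fox_contour \<Rightarrow> real \<Rightarrow> real \<Rightarrow> bool" where
  "fox_admissible L a A \<longleftrightarrow>
     {s. 1 - of_real a - of_real A * s \<in> \<int>\<^sub>\<le>\<^sub>0} \<subseteq> right_side L"

text \<open>Zeros of the reciprocal Gamma factor come out right, since \<open>Gamma\<close> is 0 at its poles and \<open>x / 0 = 0\<close>.\<close>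
definition fox_integrand :: "real \<Rightarrow> real \<Rightarrow> real \<Rightarrow> real \<Rightarrow> real \<Rightarrow> complex \<Rightarrow> complex" where
  "fox_integrand a A b B z s =
     Gamma (1 - of_real a - of_real A * s) / Gamma (1 - of_real b - of_real B * s)
       * of_real z powr (- s)"

definition fox_H_converges :: "fox_contour \<Rightarrow> real \<Rightarrow> real \<Rightarrow> real \<Rightarrow> real \<Rightarrow> real \<Rightarrow> bool" where
  "fox_H_converges L a A b B z \<longleftrightarrow> contour_converges L (fox_integrand a A b B z)"

definition fox_H :: "fox_contour \<Rightarrow> real \<Rightarrow> real \<Rightarrow> real \<Rightarrow> real \<Rightarrow> real \<Rightarrow> complex" where
  "fox_H L a A b B z =
     1 / (2 * of_real pi * \<i>) * fox_contour_integral L (fox_integrand a A b B z)"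

text \<open>
  \<open>E[h(S / \<beta>)]\<close> for independent \<open>S\<close> and \<open>\<beta>\<close> with the given laws, preceded by the assertion that
  this expectation is finite.
\<close>
definition quotient_expectation_exists :: "(real \<Rightarrow> real) \<Rightarrow> real measure \<Rightarrow> real measure \<Rightarrow> bool" where
  "quotient_expectation_exists h \<sigma> \<beta> \<longleftrightarrow> integrable (\<sigma> \<Otimes>\<^sub>M \<beta>) (\<lambda>(s, u). h (s / u))"

definition quotient_expectation :: "(real \<Rightarrow> real) \<Rightarrow> real measure \<Rightarrow> real measure \<Rightarrow> real" where
  "quotient_expectation h \<sigma> \<beta> = (\<integral>(s, u). h (s / u) \<partial>(\<sigma> \<Otimes>\<^sub>M \<beta>))"

definition fox_weight :: "fox_contour \<Rightarrow> real \<Rightarrow> nat \<Rightarrow> nat \<Rightarrow> real \<Rightarrow> complex" where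
  "fox_weight L \<alpha> n k t = fox_H L (1 - 1 / \<alpha> - real k) (1 / \<alpha>) (- real n) 1 t"

definition fox_I :: "fox_contour \<Rightarrow> real \<Rightarrow> nat \<Rightarrow> nat \<Rightarrow> (real \<Rightarrow> real) \<Rightarrow> complex" where
  "fox_I L \<alpha> n k h =
     of_real (\<alpha> ^ (k - 1)) * (LBINT t:{0<..}. of_real (h t) * fox_weight L \<alpha> n k t)"

end

theory Submission
  imports Defs "HOL-Complex_Analysis.Complex_Analysis" "HOL-Real_Asymp.Real_Asymp"
begin

text \<open>
  Write \<open>S\<close> for the sum of the jumps \<open>J\<close>, and let \<open>n_1, ..., n_k\<close> be the sizes of the
  blocks, with sum \<open>n\<close>. Sampling from random weights \<open>P\<close> produces given blocks with
  probability \<open>E[D(P)]\<close>, where \<open>D(P)\<close> is the sum of \<open>P i_1 ^ n_1 * ... * P i_k ^ n_k\<close> over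
  distinct indices (\<open>distinct_sum\<close>). Under the mixture, the law of \<open>P\<close> is that of \<open>J / S\<close>
  weighted by \<open>h(S)\<close> (\<open>PK_mixture_eq\<close>). So the partition probability is \<open>E[h(S) D(J / S)]\<close>,
  the integral of \<open>h\<close> against a measure on the half-line that does not depend on \<open>h\<close>
  (\<open>block_measure\<close>). It remains to identify this measure.

  The tool is the transform \<open>l \<mapsto> \<integral> t^n exp (- l t)\<close>, which determines a
  measure on the half-line (\<open>measure_eq_if_moment_Laplace_eq\<close>). As \<open>D\<close> is homogeneous of
  degree \<open>n\<close>, the transform of the block measure is \<open>E[exp (- l S) D(J)]\<close>, which equals the
  product of the \<open>\<alpha> * pochhammer (1 - \<alpha>) (n_j - 1)\<close> times
  \<open>l^(k \<alpha> - n) exp (- l^\<alpha>)\<close> (\<open>Laplace_distinct_sum_jumps\<close>). A beta integral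
  shows that the transforms of both quotient laws have the same form, with the constant
  \<open>\<alpha> * Gamma n / Gamma k\<close> (\<open>gibbs_transform_quotient_tilted_k\<close>,
  \<open>gibbs_transform_quotient_tilted_k_minus_1\<close>). Hence all these measures are proportional,
  and comparing constants gives the Gibbs form with both expectations.

  The formula for the jumps is derived from the increments of the subordinator over \<open>2 ^ m\<close>
  equal intervals. They are independent with a common law whose weighted moments are
  derivatives of the Laplace transform, so \<open>E[exp (- l S) D(increments)]\<close> is explicit. As
  \<open>m\<close> grows, power sums of the increments of order at least 2 tend to those of the jumps by
  monotonicity of the paths (\<open>dyadic_sums_tendsto_jump_sum\<close>); the power sum of order 1 does
  so as well since the paths have no continuous part (\<open>AE_sum_J_eq\<close>). As \<open>D\<close> is a polynomial
  in the power sums (\<open>distinct_sum_recursion\<close>), it converges too.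

  For the Fox function, integrating the same transform against powers of \<open>l\<close> gives the
  Mellin transform of these measures: \<open>\<integral> t^(s - 1)\<close> is a constant times
  \<open>Gamma (k + (1 - s) / \<alpha>) / Gamma (n + 1 - s)\<close>, the Fox integrand without its power
  of \<open>t\<close> (\<open>Mellin_transform_if_gibbs_transform\<close>). On vertical lines this is integrable, so
  Fourier inversion on the logarithmic scale identifies their densities with the Fox
  integral, up to the constant (\<open>density_if_gibbs_transform\<close>). Loops are deformed into
  vertical lines, which is possible because the integrand decays exponentially to the right
  and away from the real axis (\<open>gamma_ratio_bound\<close>).
\<close>

section \<open>Weighted Laplace transforms determine measures on the half-line\<close>

text \<open>
  A measure can be traded for a finite one by a positive density and recovered afterwards.
\<close>
lemma density_density_inverse:
  fixes f :: "'a \<Rightarrow> real"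
  assumes [measurable]: "f \<in> borel_measurable M" and pos: "AE x in M. 0 < f x"
  shows "density (density M (\<lambda>x. ennreal (f x))) (\<lambda>x. ennreal (1 / f x)) = M"
proof -
  have "density (density M (\<lambda>x. ennreal (f x))) (\<lambda>x. ennreal (1 / f x))
      = density M (\<lambda>x. ennreal (f x) * ennreal (1 / f x))"
    by (rule density_density_eq) measurable
  also have "\<dots> = density M (\<lambda>_. 1)"
  proof (rule density_cong)
    show "AE x in M. ennreal (f x) * ennreal (1 / f x) = 1"
      using pos by eventually_elim (simp add: ennreal_mult[symmetric])
  qed measurable
  finally show ?thesis by (simp add: density_1)
qed

text \<open>
  By Weierstrass, the functions \<open>\<phi> (exp (- x))\<close> with continuous \<open>\<phi>\<close> are uniform
  limits on the half-line of combinations of \<open>exp (- j x)\<close>, so their integrals agree.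
  Indicators of \<open>{..a}\<close> are bounded pointwise limits of such functions, so the distribution
  functions agree.
\<close>
lemma finite_measure_eq_if_Laplace_eq_nat:
  fixes \<mu> \<nu> :: "real measure"
  assumes "finite_borel_measure \<mu>" and "finite_borel_measure \<nu>"
    and pos: "AE x in \<mu>. 0 \<le> x" "AE x in \<nu>. 0 \<le> x"
    and eq: "\<And>j::nat. (\<integral>x. exp (- real j * x) \<partial>\<mu>) = (\<integral>x. exp (- real j * x) \<partial>\<nu>)"
  shows "\<mu> = \<nu>"
proof -
  interpret m: finite_borel_measure \<mu> by fact
  interpret n: finite_borel_measure \<nu> by fact
  note [measurable_cong] = m.M_is_borel n.M_is_borel
  have [simp]: "(\<lambda>x. exp (- x)) ` {0..} \<subseteq> {0..(1::real)}" by auto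
  have cont: "(\<integral>x. \<phi> (exp (- x)) \<partial>\<mu>) = (\<integral>x. \<phi> (exp (- x)) \<partial>\<nu>)"
    if c: "continuous_on UNIV \<phi>" and b: "\<And>u. \<bar>\<phi> u\<bar> \<le> 1" for \<phi> :: "real \<Rightarrow> real"
  proof (rule ccontr)
    assume ne: "(\<integral>x. \<phi> (exp (- x)) \<partial>\<mu>) \<noteq> (\<integral>x. \<phi> (exp (- x)) \<partial>\<nu>)"
    define \<delta> where "\<delta> = \<bar>(\<integral>x. \<phi> (exp (- x)) \<partial>\<mu>) - (\<integral>x. \<phi> (exp (- x)) \<partial>\<nu>)\<bar>"
    define T where "T = measure \<mu> (space \<mu>) + measure \<nu> (space \<nu>)"
    have T: "0 \<le> T" by (simp add: T_def)
    have \<delta>: "0 < \<delta>" using ne by (simp add: \<delta>_def)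
    have e: "0 < \<delta> / (T + 1)" using \<delta> T by simp
    obtain p where p: "real_polynomial_function p"
      and papp: "\<And>u. u \<in> {0..1} \<Longrightarrow> \<bar>\<phi> u - p u\<bar> < \<delta> / (T + 1)"
      using Stone_Weierstrass_real_polynomial_function[of "{0..1}" \<phi>, OF _ _ e] c
        continuous_on_subset by (metis compact_Icc subset_UNIV)
    obtain a N where p_eq: "p = (\<lambda>x. \<Sum>i\<le>N. a i * x ^ i)"
      using p real_polynomial_function_iff_sum by blast
    have [measurable]: "\<phi> \<in> borel_measurable borel"
      using c by (intro borel_measurable_continuous_onI)
    have [measurable]: "p \<in> borel_measurable borel" unfolding p_eq by measurable
    have expint: "integrable \<rho> (\<lambda>x. exp (- real j * x))"
      if "finite_measure \<rho>" "sets \<rho> = sets borel" "AE x in \<rho>. 0 \<le> x" for \<rho> :: "real measure" and j :: nat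
    proof -
      interpret finite_measure \<rho> by fact
      note [measurable_cong] = that(2)
      show ?thesis
        by (rule integrable_const_bound[where B=1])
          (use that(3) in \<open>auto elim!: eventually_mono\<close>)
    qed
    have pint: "integrable \<rho> (\<lambda>x. p (exp (- x)))" and
         pval: "(\<integral>x. p (exp (- x)) \<partial>\<rho>) = (\<Sum>i\<le>N. a i * (\<integral>x. exp (- real i * x) \<partial>\<rho>))"
      if "finite_measure \<rho>" "sets \<rho> = sets borel" "AE x in \<rho>. 0 \<le> x" for \<rho> :: "real measure"
    proof -
      have *: "p (exp (- x)) = (\<Sum>i\<le>N. a i * exp (- real i * x))" for x
        by (simp add: p_eq exp_of_nat_mult[symmetric])
      show "integrable \<rho> (\<lambda>x. p (exp (- x)))"
        unfolding * using expint[OF that] by (intro Bochner_Integration.integrable_sum) auto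
      show "(\<integral>x. p (exp (- x)) \<partial>\<rho>) = (\<Sum>i\<le>N. a i * (\<integral>x. exp (- real i * x) \<partial>\<rho>))"
        unfolding * using expint[OF that] by (subst Bochner_Integration.integral_sum) auto
    qed
    have peq: "(\<integral>x. p (exp (- x)) \<partial>\<mu>) = (\<integral>x. p (exp (- x)) \<partial>\<nu>)"
      using pval[OF m.finite_measure_axioms m.M_is_borel pos(1)]
        pval[OF n.finite_measure_axioms n.M_is_borel pos(2)] eq by simp
    have bd: "\<bar>(\<integral>x. \<phi> (exp (- x)) \<partial>\<rho>) - (\<integral>x. p (exp (- x)) \<partial>\<rho>)\<bar> \<le> \<delta> / (T + 1) * measure \<rho> (space \<rho>)"
      if r: "finite_measure \<rho>" "sets \<rho> = sets borel" "AE x in \<rho>. 0 \<le> x" for \<rho> :: "real measure"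
    proof -
      interpret finite_measure \<rho> by fact
      note [measurable_cong] = r(2)
      have i1: "integrable \<rho> (\<lambda>x. \<phi> (exp (- x)))"
        by (rule integrable_const_bound[where B=1]) (use b in auto)
      note i2 = pint[OF r]
      have "\<bar>(\<integral>x. \<phi> (exp (- x)) \<partial>\<rho>) - (\<integral>x. p (exp (- x)) \<partial>\<rho>)\<bar> = \<bar>\<integral>x. \<phi> (exp (- x)) - p (exp (- x)) \<partial>\<rho>\<bar>"
        using i1 i2 by simp
      also have "\<dots> \<le> (\<integral>x. \<bar>\<phi> (exp (- x)) - p (exp (- x))\<bar> \<partial>\<rho>)"
        by (rule integral_abs_bound)
      also have "\<dots> \<le> (\<integral>x. \<delta> / (T + 1) \<partial>\<rho>)"
        using i1 i2 r(3) papp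
        by (intro integral_mono_AE) (auto elim!: eventually_mono intro!: less_imp_le)
      finally show ?thesis by (simp add: mult.commute)
    qed
    have "\<delta> \<le> \<delta> / (T + 1) * measure \<mu> (space \<mu>) + \<delta> / (T + 1) * measure \<nu> (space \<nu>)"
      using bd[OF m.finite_measure_axioms m.M_is_borel pos(1)]
        bd[OF n.finite_measure_axioms n.M_is_borel pos(2)] peq unfolding \<delta>_def by linarith
    also have "\<dots> = \<delta> / (T + 1) * T" by (simp add: T_def distrib_left)
    also have "\<dots> < \<delta>" using \<delta> T by (simp add: field_simps)
    finally show False by simp
  qed
  have "cdf \<mu> a = cdf \<nu> a" for a
  proof (cases "a < 0")
    case True
    have "measure \<rho> {..a} = 0" if "AE x in \<rho>. 0 \<le> x" "sets \<rho> = sets borel" for \<rho> :: "real measure"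
    proof -
      have "AE x in \<rho>. x \<notin> {..a}" using that(1) True by (auto elim!: eventually_mono)
      then have "emeasure \<rho> {..a} = 0"
        using that(2) by (subst (asm) AE_iff_measurable[of "{..a}"]) (auto dest: sets_eq_imp_space_eq)
      then show ?thesis by (simp add: measure_def)
    qed
    then show ?thesis using pos m.M_is_borel n.M_is_borel by (simp add: cdf_def)
  next
    case False
    \<comment> \<open>A ramp in the variable \<open>u = exp (- x)\<close>: it is 1 when \<open>x \<le> a\<close> and falls to 0 with
      slope \<open>k\<close>.\<close>
    define \<phi> where "\<phi> k u = max 0 (min 1 (1 + real k * (u - exp (- a))))" for k :: nat and u :: real
    have lim: "(\<lambda>k. \<phi> k (exp (- x))) \<longlonglongrightarrow> indicator {..a} x" for x
    proof (cases "x \<le> a")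
      case True
      then have "\<phi> k (exp (- x)) = 1" for k by (auto simp: \<phi>_def min_def max_def)
      then show ?thesis using True by simp
    next
      case False
      then have d: "0 < exp (- a) - exp (- x)" by simp
      have "\<phi> k (exp (- x)) = 0" if "k \<ge> nat \<lceil>1 / (exp (- a) - exp (- x))\<rceil>" for k
      proof -
        have "1 / (exp (- a) - exp (- x)) \<le> real k" using that by linarith
        then have "1 \<le> real k * (exp (- a) - exp (- x))" using d by (simp add: field_simps)
        then show ?thesis by (auto simp: \<phi>_def algebra_simps)
      qed
      then have "\<forall>\<^sub>F k in sequentially. \<phi> k (exp (- x)) = 0"
        unfolding eventually_sequentially by blast
      then show ?thesis using False by (simp add: tendsto_eventually)
    qed
    have dom: "(\<lambda>k. \<integral>x. \<phi> k (exp (- x)) \<partial>\<rho>) \<longlonglongrightarrow> measure \<rho> {..a}"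
      if r: "finite_measure \<rho>" "sets \<rho> = sets borel" for \<rho> :: "real measure"
    proof -
      interpret finite_measure \<rho> by fact
      note [measurable_cong] = r(2)
      have "(\<lambda>k. \<integral>x. \<phi> k (exp (- x)) \<partial>\<rho>) \<longlonglongrightarrow> (\<integral>x. indicator {..a} x \<partial>\<rho>)"
        by (rule integral_dominated_convergence[where w="\<lambda>_. 1"])
          (auto simp: lim, auto simp: \<phi>_def)
      then show ?thesis using r(2) by (simp add: sets_eq_imp_space_eq)
    qed
    have "(\<integral>x. \<phi> k (exp (- x)) \<partial>\<mu>) = (\<integral>x. \<phi> k (exp (- x)) \<partial>\<nu>)" for k
      by (rule cont) (auto simp: \<phi>_def intro!: continuous_intros)
    then show ?thesis
      using dom[OF m.finite_measure_axioms m.M_is_borel] dom[OF n.finite_measure_axioms n.M_is_borel]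
      unfolding cdf_def by (simp add: LIMSEQ_unique)
  qed
  then show ?thesis
    by (intro cdf_unique') (auto intro: assms)
qed

text \<open>
  The weighted transform makes sense for measures that are not known to be finite. With the
  density \<open>x ^ n * exp (- x)\<close> they become finite with equal Laplace transforms at the
  naturals, and the density can be divided out.
\<close>
lemma measure_eq_if_moment_Laplace_eq:
  fixes \<mu> \<nu> :: "real measure" and n :: nat
  assumes sets: "sets \<mu> = sets borel" "sets \<nu> = sets borel"
    and pos: "AE x in \<mu>. 0 < x" "AE x in \<nu>. 0 < x"
    and eq: "\<And>l. 0 < l \<Longrightarrow> (\<integral>\<^sup>+x. ennreal (x ^ n * exp (- l * x)) \<partial>\<mu>) = (\<integral>\<^sup>+x. ennreal (x ^ n * exp (- l * x)) \<partial>\<nu>)"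
    and fin: "\<And>l. 0 < l \<Longrightarrow> (\<integral>\<^sup>+x. ennreal (x ^ n * exp (- l * x)) \<partial>\<nu>) < \<infinity>"
  shows "\<mu> = \<nu>"
proof -
  note [measurable_cong] = sets
  define w where "w x = x ^ n * exp (- x)" for x :: real
  have [measurable]: "w \<in> borel_measurable borel" unfolding w_def by measurable
  have wpos: "0 < x \<Longrightarrow> 0 < w x" for x by (simp add: w_def)
  have nn: "(\<integral>\<^sup>+x. ennreal (exp (- real j * x)) \<partial>(density \<rho> w)) = (\<integral>\<^sup>+x. ennreal (x ^ n * exp (- (real j + 1) * x)) \<partial>\<rho>)"
    if r: "sets \<rho> = sets borel" "AE x in \<rho>. 0 < x" for \<rho> :: "real measure" and j :: nat
  proof -
    note [measurable_cong] = r(1)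
    have "(\<integral>\<^sup>+x. ennreal (exp (- real j * x)) \<partial>(density \<rho> w)) = (\<integral>\<^sup>+x. ennreal (w x) * ennreal (exp (- real j * x)) \<partial>\<rho>)"
      by (subst nn_integral_density) auto
    also have "\<dots> = (\<integral>\<^sup>+x. ennreal (x ^ n * exp (- (real j + 1) * x)) \<partial>\<rho>)"
      using r(2) by (intro nn_integral_cong_AE)
        (auto elim!: eventually_mono simp: w_def ennreal_mult[symmetric] exp_add[symmetric] algebra_simps)
    finally show ?thesis .
  qed
  have fb: "finite_borel_measure (density \<rho> w)" and AEw: "AE x in density \<rho> w. 0 \<le> x"
    if r: "sets \<rho> = sets borel" "AE x in \<rho>. 0 < x"
      and f: "(\<integral>\<^sup>+x. ennreal (x ^ n * exp (- 1 * x)) \<partial>\<rho>) < \<infinity>" for \<rho> :: "real measure"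
  proof -
    note [measurable_cong] = r(1)
    show "finite_borel_measure (density \<rho> w)"
    proof (intro finite_borel_measure.intro finite_measureI finite_borel_measure_axioms.intro)
      have "emeasure (density \<rho> w) (space (density \<rho> w)) = (\<integral>\<^sup>+x. ennreal (exp (- real 0 * x)) \<partial>(density \<rho> w))"
        by simp
      then show "emeasure (density \<rho> w) (space (density \<rho> w)) \<noteq> \<infinity>"
        using nn[OF r, of 0] f by simp
    qed (simp add: r)
    show "AE x in density \<rho> w. 0 \<le> x"
      using r(2) by (subst AE_density) (auto elim!: eventually_mono)
  qed
  have fm: "(\<integral>\<^sup>+x. ennreal (x ^ n * exp (- 1 * x)) \<partial>\<mu>) < \<infinity>" and fn: "(\<integral>\<^sup>+x. ennreal (x ^ n * exp (- 1 * x)) \<partial>\<nu>) < \<infinity>"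
    using fin[of 1] eq[of 1] by simp_all
  have "density \<mu> w = density \<nu> w"
  proof (rule finite_measure_eq_if_Laplace_eq_nat)
    fix j :: nat
    have "(\<integral>x. exp (- real j * x) \<partial>density \<mu> w) = enn2real (\<integral>\<^sup>+x. ennreal (exp (- real j * x)) \<partial>density \<mu> w)"
      by (rule integral_eq_nn_integral) auto
    also have "\<dots> = enn2real (\<integral>\<^sup>+x. ennreal (exp (- real j * x)) \<partial>density \<nu> w)"
      unfolding nn[OF sets(1) pos(1)] nn[OF sets(2) pos(2)] by (subst eq) auto
    also have "\<dots> = (\<integral>x. exp (- real j * x) \<partial>density \<nu> w)"
      by (rule integral_eq_nn_integral[symmetric]) auto
    finally show "(\<integral>x. exp (- real j * x) \<partial>density \<mu> w) = (\<integral>x. exp (- real j * x) \<partial>density \<nu> w)" .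
  qed (use fb[OF sets(1) pos(1) fm] fb[OF sets(2) pos(2) fn] AEw[OF sets(1) pos(1) fm] AEw[OF sets(2) pos(2) fn] in auto)
  then have "density (density \<mu> w) (\<lambda>x. ennreal (1 / w x)) = density (density \<nu> w) (\<lambda>x. ennreal (1 / w x))"
    by simp
  moreover have "density (density \<rho> w) (\<lambda>x. ennreal (1 / w x)) = \<rho>"
    if r: "sets \<rho> = sets borel" "AE x in \<rho>. 0 < x" for \<rho> :: "real measure"
  proof -
    note [measurable_cong] = r(1)
    show ?thesis
    proof (rule density_density_inverse)
      show "AE x in \<rho>. 0 < w x" using r(2) by eventually_elim (rule wpos)
    qed measurable
  qed
  ultimately show ?thesis using sets pos by simp
qed

section \<open>Laplace exponent and exponentially weighted moments of stable laws\<close>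

lemma nn_integral_Gamma_scaled:
  fixes s y :: real
  assumes s: "0 < s" and y: "0 < y"
  shows "(\<integral>\<^sup>+v. ennreal (indicator {0<..} v * (v powr (s - 1) * exp (- y * v))) \<partial>lborel) = ennreal (Gamma s * y powr (- s))"
proof -
  define G where "G v = ennreal (indicator {0..} v * v powr (s - 1) / exp v)" for v :: real
  have [measurable]: "G \<in> borel_measurable borel" unfolding G_def by measurable
  have "ennreal (Gamma s) = (\<integral>\<^sup>+v. G v \<partial>lborel)"
    using Gamma_conv_nn_integral_real[OF s] unfolding G_def .
  also have "\<dots> = ennreal \<bar>y\<bar> * (\<integral>\<^sup>+v. G (0 + y * v) \<partial>lborel)"
    by (rule nn_integral_real_affine) (use y in auto)
  also have "(\<integral>\<^sup>+v. G (0 + y * v) \<partial>lborel)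
      = (\<integral>\<^sup>+v. ennreal (y powr (s - 1)) * ennreal (indicator {0<..} v * (v powr (s - 1) * exp (- y * v))) \<partial>lborel)"
  proof (intro nn_integral_cong)
    fix v :: real
    show "G (0 + y * v) = ennreal (y powr (s - 1)) * ennreal (indicator {0<..} v * (v powr (s - 1) * exp (- y * v)))"
    proof (cases "0 < v")
      case True
      then show ?thesis using y
        by (simp add: G_def powr_mult ennreal_mult[symmetric] exp_minus field_simps)
    next
      case False
      then show ?thesis using y by (cases "v = 0") (auto simp: G_def mult_less_0_iff zero_le_mult_iff)
    qed
  qed
  also have "\<dots> = ennreal (y powr (s - 1)) * (\<integral>\<^sup>+v. ennreal (indicator {0<..} v * (v powr (s - 1) * exp (- y * v))) \<partial>lborel)"
    by (rule nn_integral_cmult) auto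
  finally have eq: "ennreal (Gamma s) = ennreal (y powr s) * (\<integral>\<^sup>+v. ennreal (indicator {0<..} v * (v powr (s - 1) * exp (- y * v))) \<partial>lborel)"
    using y by (simp add: mult.assoc[symmetric] ennreal_mult[symmetric] powr_mult_base)
  have "ennreal (Gamma s * y powr (- s)) = ennreal (y powr (- s)) * ennreal (Gamma s)"
    using s by (simp add: ennreal_mult mult.commute Gamma_real_pos less_imp_le)
  also have "\<dots> = (\<integral>\<^sup>+v. ennreal (indicator {0<..} v * (v powr (s - 1) * exp (- y * v))) \<partial>lborel)"
    unfolding eq using y by (simp add: mult.assoc[symmetric] ennreal_mult[symmetric] powr_add[symmetric])
  finally show ?thesis by simp
qed

text \<open>
  Write \<open>1 - exp (- y x)\<close> as the integral of \<open>y exp (- y v)\<close> over \<open>0 < v < x\<close> and exchange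
  the integrals: the tail of the Levy density is a power of \<open>v\<close>, and what remains is a Gamma
  integral.
\<close>
lemma stable_Laplace_exponent:
  assumes \<alpha>: "0 < \<alpha>" "\<alpha> < 1" and y: "0 < y"
  shows "(LBINT x:{0<..}. (1 - exp (- y * x)) * stable_levy_density \<alpha> x) = y powr \<alpha>"
proof -
  let ?c = "1 / Gamma (1 - \<alpha>)"
  have c: "0 < ?c" using \<alpha> by (simp add: Gamma_real_pos)
  define a where "a v = y * exp (- y * v)" for v :: real
  have [measurable]: "a \<in> borel_measurable borel" unfolding a_def by measurable
  have a_nonneg: "0 \<le> a v" for v using y by (simp add: a_def)
  have [measurable]: "stable_levy_density \<alpha> \<in> borel_measurable borel"
    unfolding stable_levy_density_def by measurable
  have \<rho>_nonneg: "0 \<le> stable_levy_density \<alpha> x" for x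
    using \<alpha> by (simp add: stable_levy_density_def Gamma_real_pos less_imp_le)
  have inner1: "(\<integral>\<^sup>+v. ennreal (a v) * indicator {0..x} v \<partial>lborel) = ennreal (1 - exp (- y * x))" if "0 < x" for x
    using that y
    by (subst nn_integral_FTC_Icc[where F="\<lambda>v. - exp (- y * v)"])
      (auto simp: a_def intro!: derivative_eq_intros)
  have inner2: "(\<integral>\<^sup>+x. ennreal (stable_levy_density \<alpha> x) * indicator {v..} x \<partial>lborel) = ennreal (?c * v powr (- \<alpha>))"
    if v: "0 < v" for v
  proof -
    have lim: "((\<lambda>x. - ?c * x powr (- \<alpha>)) \<longlongrightarrow> - ?c * 0) at_top"
      using \<alpha> by (intro tendsto_mult tendsto_const tendsto_neg_powr filterlim_ident) auto
    have "(\<integral>\<^sup>+x. ennreal (stable_levy_density \<alpha> x) * indicator {v..} x \<partial>lborel) = ennreal (- ?c * 0 - (- ?c * v powr (- \<alpha>)))"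
    proof (rule nn_integral_FTC_atLeast[OF _ _ _ lim])
      fix x assume "v \<le> x"
      then have x: "0 < x" using v by linarith
      show "((\<lambda>x. - ?c * x powr (- \<alpha>)) has_real_derivative stable_levy_density \<alpha> x) (at x)"
        by (rule DERIV_cong[OF DERIV_cmult[OF has_real_derivative_powr[OF x]]])
          (simp add: stable_levy_density_def)
    qed (use \<rho>_nonneg in auto)
    then show ?thesis by simp
  qed
  have "(\<integral>\<^sup>+x. ennreal (indicator {0<..} x * ((1 - exp (- y * x)) * stable_levy_density \<alpha> x)) \<partial>lborel)
      = (\<integral>\<^sup>+x. \<integral>\<^sup>+v. indicator {0<..} x * indicator {0<..x} v * ennreal (a v) * ennreal (stable_levy_density \<alpha> x) \<partial>lborel \<partial>lborel)"
  proof (intro nn_integral_cong)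
    fix x :: real
    show "ennreal (indicator {0<..} x * ((1 - exp (- y * x)) * stable_levy_density \<alpha> x))
      = (\<integral>\<^sup>+v. indicator {0<..} x * indicator {0<..x} v * ennreal (a v) * ennreal (stable_levy_density \<alpha> x) \<partial>lborel)"
    proof (cases "0 < x")
      case True
      have "(\<integral>\<^sup>+v. indicator {0<..} x * indicator {0<..x} v * ennreal (a v) * ennreal (stable_levy_density \<alpha> x) \<partial>lborel)
        = (\<integral>\<^sup>+v. ennreal (stable_levy_density \<alpha> x) * (ennreal (a v) * indicator {0..x} v) \<partial>lborel)"
        using AE_lborel_singleton[of 0] True
        by (intro nn_integral_cong_AE) (auto elim!: eventually_mono simp: indicator_def mult.commute)
      also have "\<dots> = ennreal (stable_levy_density \<alpha> x) * ennreal (1 - exp (- y * x))"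
        by (subst nn_integral_cmult) (auto simp: inner1[OF True])
      finally show ?thesis using True y \<rho>_nonneg
        by (simp add: ennreal_mult[symmetric] mult.commute)
    qed simp
  qed
  also have "\<dots> = (\<integral>\<^sup>+v. \<integral>\<^sup>+x. indicator {0<..} x * indicator {0<..x} v * ennreal (a v) * ennreal (stable_levy_density \<alpha> x) \<partial>lborel \<partial>lborel)"
    by (rule lborel_pair.Fubini') (simp add: indicator_def)
  also have "\<dots> = (\<integral>\<^sup>+v. ennreal (y * ?c) * ennreal (indicator {0<..} v * (v powr ((1 - \<alpha>) - 1) * exp (- y * v))) \<partial>lborel)"
  proof (intro nn_integral_cong)
    fix v :: real
    show "(\<integral>\<^sup>+x. indicator {0<..} x * indicator {0<..x} v * ennreal (a v) * ennreal (stable_levy_density \<alpha> x) \<partial>lborel)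
      = ennreal (y * ?c) * ennreal (indicator {0<..} v * (v powr ((1 - \<alpha>) - 1) * exp (- y * v)))"
    proof (cases "0 < v")
      case True
      have "(\<integral>\<^sup>+x. indicator {0<..} x * indicator {0<..x} v * ennreal (a v) * ennreal (stable_levy_density \<alpha> x) \<partial>lborel)
        = (\<integral>\<^sup>+x. ennreal (a v) * (ennreal (stable_levy_density \<alpha> x) * indicator {v..} x) \<partial>lborel)"
        using True by (intro nn_integral_cong) (auto simp: indicator_def)
      also have "\<dots> = ennreal (a v) * ennreal (?c * v powr (- \<alpha>))"
        by (subst nn_integral_cmult) (auto simp: inner2[OF True])
      also have "\<dots> = ennreal (y * ?c) * ennreal (indicator {0<..} v * (v powr ((1 - \<alpha>) - 1) * exp (- y * v)))"
        using True c y by (simp add: a_def ennreal_mult[symmetric] less_imp_le)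
      finally show ?thesis .
    next
      case False
      then have "indicator {0<..x} v = (0::ennreal)" for x by simp
      then show ?thesis using False by simp
    qed
  qed
  also have "\<dots> = ennreal (y * ?c) * ennreal (Gamma (1 - \<alpha>) * y powr (- (1 - \<alpha>)))"
    by (subst nn_integral_cmult, measurable, subst nn_integral_Gamma_scaled) (use \<alpha> y in auto)
  also have "\<dots> = ennreal (y powr \<alpha>)"
  proof -
    have "y * ?c * (Gamma (1 - \<alpha>) * y powr (- (1 - \<alpha>))) = y powr 1 * y powr (\<alpha> - 1)"
      using c y by simp
    also have "\<dots> = y powr \<alpha>" by (subst powr_add[symmetric]) simp
    finally show ?thesis using c y \<alpha> by (simp add: ennreal_mult[symmetric] less_imp_le Gamma_real_pos)
  qed
  finally have nn: "(\<integral>\<^sup>+x. ennreal (indicator {0<..} x * ((1 - exp (- y * x)) * stable_levy_density \<alpha> x)) \<partial>lborel) = ennreal (y powr \<alpha>)" .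
  have "(\<integral>x. indicator {0<..} x * ((1 - exp (- y * x)) * stable_levy_density \<alpha> x) \<partial>lborel) = y powr \<alpha>"
    by (subst integral_eq_nn_integral)
      (use nn y \<rho>_nonneg in \<open>auto simp: indicator_def\<close>)
  then show ?thesis by (simp add: set_lebesgue_integral_def)
qed

text \<open>
  Every power is dominated by an exponential, with a constant that stays explicit.
\<close>
lemma power_le_fact_exp:
  fixes y :: real
  assumes "0 \<le> y"
  shows "y ^ r \<le> fact r * exp y"
proof -
  have s: "(\<lambda>n. y ^ n /\<^sub>R fact n) sums exp y" by (rule exp_converges)
  have "(\<Sum>n\<in>{r}. y ^ n /\<^sub>R fact n) \<le> (\<Sum>n. y ^ n /\<^sub>R fact n)"
    using s assms by (intro sum_le_suminf) (auto simp: sums_iff)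
  then show ?thesis using s by (simp add: sums_iff field_simps)
qed

lemma abs_exp_minus_affine_le:
  fixes y :: real
  shows "\<bar>exp y - 1 - y\<bar> \<le> y\<^sup>2 * exp \<bar>y\<bar>"
proof -
  have a: "0 \<le> exp y - 1 - y" using exp_ge_add_one_self[of y] by linarith
  have b: "exp y - 1 \<le> y * exp y"
    using mult_right_mono[OF exp_ge_add_one_self[of "- y"], of "exp y"]
    by (simp add: exp_minus algebra_simps)
  show ?thesis
  proof (cases "0 \<le> y")
    case True
    have "exp y - 1 - y \<le> y * (exp y - 1)" using b by (simp add: algebra_simps)
    also have "\<dots> \<le> y * (y * exp y)" using b True by (rule mult_left_mono)
    finally show ?thesis using a True by (simp add: power2_eq_square)
  next
    case False
    have "exp y - 1 - y \<le> y * (exp y - 1)" using b by (simp add: algebra_simps)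
    also have "\<dots> \<le> y * y"
      using False by (intro mult_left_mono_neg) (use exp_ge_add_one_self[of y] in linarith)+
    also have "\<dots> \<le> y\<^sup>2 * exp \<bar>y\<bar>" by (simp add: power2_eq_square mult_le_cancel_left1)
    finally show ?thesis using a by simp
  qed
qed

context
  fixes M :: "'a measure" and D :: "'a \<Rightarrow> real"
  assumes D[measurable]: "D \<in> borel_measurable M" and D_nonneg: "AE \<omega> in M. 0 \<le> D \<omega>"
    and Laplace_finite: "\<And>l. 0 < l \<Longrightarrow> integrable M (\<lambda>\<omega>. exp (- l * D \<omega>))"
begin

lemma integrable_moment_Laplace:
  assumes "0 < l"
  shows "integrable M (\<lambda>\<omega>. D \<omega> ^ r * exp (- l * D \<omega>))"
proof (rule Bochner_Integration.integrable_bound)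
  show "integrable M (\<lambda>\<omega>. fact r * (2 / l) ^ r * exp (- (l / 2) * D \<omega>))"
    using Laplace_finite[of "l / 2"] assms by auto
  show "AE \<omega> in M. norm (D \<omega> ^ r * exp (- l * D \<omega>)) \<le> norm (fact r * (2 / l) ^ r * exp (- (l / 2) * D \<omega>))"
    using D_nonneg
  proof eventually_elim
    case (elim \<omega>)
    have "(l / 2 * D \<omega>) ^ r \<le> fact r * exp (l / 2 * D \<omega>)"
      using elim assms by (intro power_le_fact_exp) auto
    then have "D \<omega> ^ r \<le> fact r * (2 / l) ^ r * exp (l / 2 * D \<omega>)"
      using assms by (simp add: power_mult_distrib power_divide field_simps)
    then have "D \<omega> ^ r * exp (- l * D \<omega>) \<le> fact r * (2 / l) ^ r * exp (l / 2 * D \<omega>) * exp (- l * D \<omega>)"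
      by (rule mult_right_mono) simp
    also have "\<dots> = fact r * (2 / l) ^ r * exp (- (l / 2) * D \<omega>)"
      by (simp add: mult.assoc exp_add[symmetric])
    finally show ?case using elim assms by simp
  qed
qed simp

lemma moment_Laplace_has_derivative:
  assumes l: "0 < l"
  shows "((\<lambda>l. \<integral>\<omega>. D \<omega> ^ r * exp (- l * D \<omega>) \<partial>M) has_real_derivative
    - (\<integral>\<omega>. D \<omega> ^ Suc r * exp (- l * D \<omega>) \<partial>M)) (at l)"
proof -
  define m where "m r l = (\<integral>\<omega>. D \<omega> ^ r * exp (- l * D \<omega>) \<partial>M)" for r l
  have bd: "\<bar>(m r (l + u) - m r l) / u + m (Suc r) l\<bar> \<le> \<bar>u\<bar> * m (r + 2) (l / 2)"
    if u: "u \<noteq> 0" "\<bar>u\<bar> \<le> l / 2" for u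
  proof -
    have lu: "0 < l + u" using u l by linarith
    have eq: "(m r (l + u) - m r l) / u + m (Suc r) l =
      (\<integral>\<omega>. (D \<omega> ^ r * exp (- (l + u) * D \<omega>) - D \<omega> ^ r * exp (- l * D \<omega>)) / u + D \<omega> ^ Suc r * exp (- l * D \<omega>) \<partial>M)"
      unfolding m_def using integrable_moment_Laplace[OF l] integrable_moment_Laplace[OF lu]
      by (simp del: power_Suc)
    have "\<bar>(m r (l + u) - m r l) / u + m (Suc r) l\<bar> \<le> (\<integral>\<omega>. \<bar>u\<bar> * (D \<omega> ^ (r + 2) * exp (- (l / 2) * D \<omega>)) \<partial>M)"
      unfolding eq
    proof (rule order_trans[OF integral_abs_bound], rule integral_mono_AE)
      show "integrable M (\<lambda>\<omega>. \<bar>u\<bar> * (D \<omega> ^ (r + 2) * exp (- (l / 2) * D \<omega>)))"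
        using integrable_moment_Laplace[of "l / 2" "r + 2"] l by (intro integrable_mult_right) auto
      show "integrable M (\<lambda>\<omega>. \<bar>(D \<omega> ^ r * exp (- (l + u) * D \<omega>) - D \<omega> ^ r * exp (- l * D \<omega>)) / u + D \<omega> ^ Suc r * exp (- l * D \<omega>)\<bar>)"
        using integrable_moment_Laplace[OF l] integrable_moment_Laplace[OF lu] by (simp del: power_Suc)
      show "AE \<omega> in M. \<bar>(D \<omega> ^ r * exp (- (l + u) * D \<omega>) - D \<omega> ^ r * exp (- l * D \<omega>)) / u + D \<omega> ^ Suc r * exp (- l * D \<omega>)\<bar>
          \<le> \<bar>u\<bar> * (D \<omega> ^ (r + 2) * exp (- (l / 2) * D \<omega>))"
        using D_nonneg
      proof eventually_elim
        case (elim \<omega>)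
        define x where "x = D \<omega>"
        have x: "0 \<le> x" using elim by (simp add: x_def)
        have "(x ^ r * exp (- (l + u) * x) - x ^ r * exp (- l * x)) / u + x ^ Suc r * exp (- l * x)
          = x ^ r * exp (- l * x) * ((exp (- u * x) - 1 - (- u * x)) / u)"
          using u by (simp add: field_simps exp_add[symmetric])
        also have "\<bar>\<dots>\<bar> = x ^ r * exp (- l * x) * (\<bar>exp (- u * x) - 1 - (- u * x)\<bar> / \<bar>u\<bar>)"
          using x by (simp add: abs_mult)
        also have "\<dots> \<le> x ^ r * exp (- l * x) * (((- u * x)\<^sup>2 * exp \<bar>- u * x\<bar>) / \<bar>u\<bar>)"
          by (intro mult_left_mono divide_right_mono abs_exp_minus_affine_le) (use x in auto)
        also have "\<dots> = \<bar>u\<bar> * x ^ (r + 2) * (exp (- l * x) * exp (\<bar>u\<bar> * x))"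
        proof -
          have 1: "(- u * x)\<^sup>2 = \<bar>u\<bar> * (\<bar>u\<bar> * x\<^sup>2)"
            by (simp add: power_mult_distrib power2_eq_square)
          have 2: "\<bar>- u * x\<bar> = \<bar>u\<bar> * x" using x by (simp add: abs_mult)
          show ?thesis unfolding 1 2 using u by (simp add: power_add power2_eq_square)
        qed
        also have "\<dots> \<le> \<bar>u\<bar> * x ^ (r + 2) * exp (- (l / 2) * x)"
          using mult_right_mono[OF u(2) x] x
          by (intro mult_left_mono) (auto simp: exp_add[symmetric])
        finally show ?case by (simp only: x_def mult.assoc)
      qed
    qed
    then show ?thesis unfolding m_def by (simp only: integral_mult_right_zero)
  qed
  have "((\<lambda>u. (m r (l + u) - m r l) / u - (- m (Suc r) l)) \<longlongrightarrow> 0) (at 0)"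
  proof (rule Lim_null_comparison)
    have "\<forall>\<^sub>F u in at 0. u \<noteq> 0 \<and> \<bar>u\<bar> < l / 2"
      using l by (auto simp: eventually_at dist_real_def intro!: exI[of _ "l / 2"])
    then show "\<forall>\<^sub>F u in at 0. norm ((m r (l + u) - m r l) / u - (- m (Suc r) l)) \<le> \<bar>u\<bar> * m (r + 2) (l / 2)"
      by eventually_elim (use bd in auto)
    show "((\<lambda>u. \<bar>u\<bar> * m (r + 2) (l / 2)) \<longlongrightarrow> 0) (at (0::real))"
      by (auto intro!: tendsto_eq_intros)
  qed
  from LIM_zero_cancel[OF this] show ?thesis
    unfolding DERIV_def m_def .
qed

end

text \<open>
  If \<open>E[exp (- l D)] = exp (- t l^\<alpha>)\<close>, then \<open>E[D^r exp (- l D)]\<close> is the \<open>r\<close>-th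
  derivative in \<open>l\<close>, up to sign, namely \<open>exp (- t l^\<alpha>)\<close> times the sum over \<open>j\<close> of
  \<open>stable_coeff \<alpha> r j * t^j * l^(j \<alpha> - r)\<close>. The recursion is the product rule.
\<close>
primrec stable_coeff :: "real \<Rightarrow> nat \<Rightarrow> nat \<Rightarrow> real" where
  "stable_coeff \<alpha> 0 j = (if j = 0 then 1 else 0)"
| "stable_coeff \<alpha> (Suc r) j = (real r - real j * \<alpha>) * stable_coeff \<alpha> r j
     + (if j = 0 then 0 else \<alpha> * stable_coeff \<alpha> r (j - 1))"

lemma stable_coeff_eq_0: "r < j \<Longrightarrow> stable_coeff \<alpha> r j = 0"
  by (induction r arbitrary: j) auto

lemma stable_coeff_Suc_0: "stable_coeff \<alpha> (Suc r) 0 = 0"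
  by (induction r) auto

text \<open>
  Only the coefficient of the first power of \<open>t\<close> survives for small \<open>t\<close>; it is the source of
  the factors \<open>pochhammer (1 - \<alpha>) (n - 1)\<close> in the partition probabilities.
\<close>
lemma stable_coeff_1: "stable_coeff \<alpha> (Suc r) 1 = \<alpha> * pochhammer (1 - \<alpha>) r"
proof (induction r)
  case (Suc r)
  then show ?case
    using stable_coeff_Suc_0[of \<alpha> r]
    by (subst stable_coeff.simps) (simp add: pochhammer_rec' algebra_simps del: stable_coeff.simps)
qed simp

lemma stable_moment:
  fixes M :: "'a measure" and D :: "'a \<Rightarrow> real"
  assumes [measurable]: "D \<in> borel_measurable M" and "AE \<omega> in M. 0 \<le> D \<omega>"
    and Laplace: "\<And>l. 0 < l \<Longrightarrow> has_bochner_integral M (\<lambda>\<omega>. exp (- l * D \<omega>)) (exp (- t * l powr \<alpha>))"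
    and "0 < l"
  shows "(\<integral>\<omega>. D \<omega> ^ r * exp (- l * D \<omega>) \<partial>M) =
    (\<Sum>j\<le>r. stable_coeff \<alpha> r j * t ^ j * l powr (real j * \<alpha> - real r)) * exp (- t * l powr \<alpha>)"
  using \<open>0 < l\<close>
proof (induction r arbitrary: l)
  case 0
  then show ?case using has_bochner_integral_integral_eq[OF Laplace[OF 0]] by simp
next
  case (Suc r)
  define m where "m r l = (\<integral>\<omega>. D \<omega> ^ r * exp (- l * D \<omega>) \<partial>M)" for r l
  define p where "p r l = (\<Sum>j\<le>r. stable_coeff \<alpha> r j * t ^ j * l powr (real j * \<alpha> - real r))" for r l
  let ?e = "\<lambda>l. exp (- t * l powr \<alpha>)"
  have d1: "(m r has_real_derivative - m (Suc r) l) (at l)"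
  proof -
    have "integrable M (\<lambda>\<omega>. exp (- l * D \<omega>))" if "0 < l" for l
      using Laplace[OF that] by (rule has_bochner_integral_iff[THEN iffD1, THEN conjunct1])
    from moment_Laplace_has_derivative[OF assms(1,2) this Suc.prems, of r]
    show ?thesis unfolding m_def .
  qed
  have "((\<lambda>l. p r l * ?e l) has_real_derivative
    (\<Sum>j\<le>r. stable_coeff \<alpha> r j * t ^ j * ((real j * \<alpha> - real r) * l powr (real j * \<alpha> - real r - 1))) * ?e l
      + p r l * (?e l * (- t * (\<alpha> * l powr (\<alpha> - 1))))) (at l)"
  proof -
    have dp: "(p r has_real_derivative (\<Sum>j\<le>r. stable_coeff \<alpha> r j * t ^ j * ((real j * \<alpha> - real r) * l powr (real j * \<alpha> - real r - 1)))) (at l)"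
      unfolding p_def by (intro DERIV_sum DERIV_cmult has_real_derivative_powr Suc.prems)
    have de: "(?e has_real_derivative (?e l * (- t * (\<alpha> * l powr (\<alpha> - 1))))) (at l)"
      by (rule DERIV_fun_exp[OF DERIV_cmult[OF has_real_derivative_powr[OF Suc.prems]]])
    show ?thesis by (rule DERIV_cong[OF DERIV_mult[OF dp de]]) simp
  qed
  moreover have "(\<Sum>j\<le>r. stable_coeff \<alpha> r j * t ^ j * ((real j * \<alpha> - real r) * l powr (real j * \<alpha> - real r - 1))) * ?e l
      + p r l * (?e l * (- t * (\<alpha> * l powr (\<alpha> - 1)))) = - (p (Suc r) l * ?e l)"
  proof -
    let ?A = "\<Sum>j\<le>Suc r. (real r - real j * \<alpha>) * stable_coeff \<alpha> r j * t ^ j * l powr (real j * \<alpha> - real (Suc r))"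
    let ?B = "\<Sum>j\<le>Suc r. (if j = 0 then 0 else \<alpha> * stable_coeff \<alpha> r (j - 1)) * t ^ j * l powr (real j * \<alpha> - real (Suc r))"
    let ?A' = "\<Sum>j\<le>r. stable_coeff \<alpha> r j * t ^ j * ((real j * \<alpha> - real r) * l powr (real j * \<alpha> - real r - 1))"
    have p: "p (Suc r) l = ?A + ?B"
      unfolding p_def sum.distrib[symmetric] by (intro sum.cong refl) (simp add: algebra_simps)
    have A: "?A = - ?A'"
      unfolding sum.atMost_Suc stable_coeff_eq_0[OF lessI] sum_negf[symmetric]
      by (simp, intro sum.cong refl) (simp add: algebra_simps)
    have B: "?B = p r l * (t * (\<alpha> * l powr (\<alpha> - 1)))"
    proof -
      have powr: "l powr (real (Suc j) * \<alpha> - real (Suc r)) = l powr (real j * \<alpha> - real r) * l powr (\<alpha> - 1)" for j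
        using Suc.prems by (simp add: powr_add[symmetric] algebra_simps)
      have "?B = (\<Sum>j\<le>r. \<alpha> * stable_coeff \<alpha> r j * t ^ Suc j * l powr (real (Suc j) * \<alpha> - real (Suc r)))"
        unfolding sum.atMost_Suc_shift by simp
      also have "\<dots> = p r l * (t * (\<alpha> * l powr (\<alpha> - 1)))"
        unfolding p_def sum_distrib_right powr by (intro sum.cong refl) (simp only: power_Suc mult_ac)
      finally show ?thesis .
    qed
    show ?thesis unfolding p A B by (simp add: algebra_simps)
  qed
  ultimately have d2: "((\<lambda>l. p r l * ?e l) has_real_derivative - (p (Suc r) l * ?e l)) (at l)" by simp
  have "(m r has_real_derivative - (p (Suc r) l * ?e l)) (at l)"
  proof (rule has_field_derivative_transform_within_open[OF d2, of "{0<..}"])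
    show "p r x * ?e x = m r x" if "x \<in> {0<..}" for x
      using Suc.IH[of x] that unfolding m_def p_def by simp
  qed (use Suc.prems in auto)
  from DERIV_unique[OF d1 this] have "m (Suc r) l = p (Suc r) l * ?e l" by simp
  then show ?case unfolding m_def p_def .
qed

lemma stable_moment_asymptotics:
  fixes \<alpha> l :: real
  assumes "0 < l" "0 < r"
  shows "((\<lambda>t. (\<Sum>j\<le>r. stable_coeff \<alpha> r j * t ^ j * l powr (real j * \<alpha> - real r)) * exp (- t * l powr \<alpha>) / t)
    \<longlongrightarrow> \<alpha> * pochhammer (1 - \<alpha>) (r - 1) * l powr (\<alpha> - real r)) (at_right 0)"
proof -
  obtain r' where r: "r = Suc r'" using assms by (cases r) auto
  define G where "G t = (\<Sum>j\<le>r'. stable_coeff \<alpha> r (Suc j) * t ^ j * l powr (real (Suc j) * \<alpha> - real r)) * exp (- t * l powr \<alpha>)" for t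
  have "isCont G 0" unfolding G_def by (intro continuous_intros)
  then have lim: "(G \<longlongrightarrow> G 0) (at_right 0)"
    unfolding isCont_def filterlim_at_split by blast
  have G_0: "G 0 = \<alpha> * pochhammer (1 - \<alpha>) (r - 1) * l powr (\<alpha> - real r)"
  proof -
    show ?thesis
      unfolding G_def sum.atMost_shift r using stable_coeff_1[of \<alpha> r'] by (simp del: stable_coeff.simps)
  qed
  have "\<forall>\<^sub>F t in at_right 0. G t = (\<Sum>j\<le>r. stable_coeff \<alpha> r j * t ^ j * l powr (real j * \<alpha> - real r)) * exp (- t * l powr \<alpha>) / t"
  proof -
    have "\<forall>\<^sub>F t in at_right 0. 0 < (t::real)" by (simp add: eventually_at_right_less)
    then show ?thesis
    proof eventually_elim
      case (elim t)
      have "(\<Sum>j\<le>r. stable_coeff \<alpha> r j * t ^ j * l powr (real j * \<alpha> - real r)) =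
        (\<Sum>j\<le>r'. stable_coeff \<alpha> r (Suc j) * t ^ j * l powr (real (Suc j) * \<alpha> - real r)) * t"
        unfolding r sum.atMost_Suc_shift stable_coeff_Suc_0 sum_distrib_right
        by (simp del: stable_coeff.simps add: mult_ac)
      then show ?case using elim by (simp add: G_def)
    qed
  qed
  from Lim_transform_eventually[OF lim this] show ?thesis by (simp only: G_0)
qed

section \<open>Jumps of a monotone function as limits of dyadic increments\<close>

text \<open>
  The value 0 beyond the grid lets sums over the increments run over all naturals, like sums
  over the jumps.
\<close>
definition dyadic_increment :: "(real \<Rightarrow> real) \<Rightarrow> nat \<Rightarrow> nat \<Rightarrow> real" where
  "dyadic_increment F m l = (if l < 2 ^ m then F (real (Suc l) / 2 ^ m) - F (real l / 2 ^ m) else 0)"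

lemma dyadic_point_mem: "l \<le> 2 ^ m \<Longrightarrow> real l / 2 ^ m \<in> {0..1}"
  by (simp add: field_simps)

lemma dyadic_increment_nonneg:
  assumes "mono_on {0..1} F"
  shows "0 \<le> dyadic_increment F m l"
  using mono_onD[OF assms, of "real l / 2 ^ m" "real (Suc l) / 2 ^ m"] dyadic_point_mem[of l m] dyadic_point_mem[of "Suc l" m]
  by (simp add: dyadic_increment_def divide_right_mono)

lemma sum_dyadic_increment: "(\<Sum>l<2 ^ m. dyadic_increment F m l) = F 1 - F 0"
proof -
  have "(\<Sum>l<2 ^ m. dyadic_increment F m l) = (\<Sum>l<2 ^ m. F (real (Suc l) / 2 ^ m) - F (real l / 2 ^ m))"
    by (intro sum.cong) (auto simp: dyadic_increment_def)
  also have "\<dots> = F (real (2 ^ m) / 2 ^ m) - F (real 0 / 2 ^ m)"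
    by (rule sum_lessThan_telescope)
  finally show ?thesis by simp
qed

lemma dyadic_time_mem: "1 / 2 ^ m \<in> {0..(1::real)}"
  by simp

lemma inverse_dyadic_tendsto: "(\<lambda>m. 1 / 2 ^ m :: real) \<longlonglongrightarrow> 0"
  using LIMSEQ_power_zero[of "1 / 2 :: real"] by (simp add: power_divide)

lemma inverse_dyadic_at_right: "filterlim (\<lambda>m. 1 / 2 ^ m :: real) (at_right 0) sequentially"
  by (rule tendsto_imp_filterlim_at_right[OF inverse_dyadic_tendsto]) simp

text \<open>
  The measure of \<open>F\<close> on the unit interval turns sums over increments into integrals. It is
  built from the extension of \<open>F\<close> by constants, since interval measures are defined on the
  whole line.
\<close>
context
  fixes F :: "real \<Rightarrow> real"
  assumes F_mono: "mono_on {0..1} F" and F_0: "F 0 = 0"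
    and F_right_cont: "\<And>t. t \<in> {0..<1} \<Longrightarrow> continuous (at_right t) F"
begin

definition extension :: "real \<Rightarrow> real" where
  "extension t = F (max 0 (min 1 t))"

definition stieltjes :: "real measure" where
  "stieltjes = interval_measure extension"

lemma extension_mono: "x \<le> y \<Longrightarrow> extension x \<le> extension y"
  unfolding extension_def by (intro mono_onD[OF F_mono]) auto

lemma extension_eq: "t \<in> {0..1} \<Longrightarrow> extension t = F t"
  by (simp add: extension_def)

lemma extension_right_cont: "continuous (at_right a) extension"
proof (cases "a < 0 \<or> 1 \<le> a")
  case True
  obtain b where b: "a < b" "\<And>y. y \<in> {a<..<b} \<Longrightarrow> extension y = extension a"
  proof (cases "a < 0")
    case True then show ?thesis using that[of 0] by (auto simp: extension_def)
  next
    case False then show ?thesis using True that[of "a + 1"] by (auto simp: extension_def)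
  qed
  have "\<forall>\<^sub>F y in at_right a. extension y = extension a"
    using b by (auto simp: eventually_at_right intro!: exI[of _ b])
  then show ?thesis by (simp add: continuous_within tendsto_eventually)
next
  case False
  then have a: "a \<in> {0..<1}" by auto
  have "\<forall>\<^sub>F y in at_right a. F y = extension y"
    using a by (auto simp: eventually_at_right extension_def intro!: exI[of _ 1])
  moreover have "(F \<longlongrightarrow> F a) (at_right a)" using F_right_cont[OF a] by (simp add: continuous_within)
  ultimately have "(extension \<longlongrightarrow> F a) (at_right a)" by (rule Lim_transform_eventually[rotated])
  then show ?thesis using a by (simp add: continuous_within extension_def)
qed

lemma extension_at_bot: "(extension \<longlongrightarrow> 0) at_bot"
proof (rule tendsto_eventually)
  show "\<forall>\<^sub>F x in at_bot. extension x = 0"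
    using eventually_le_at_bot[of 0] by eventually_elim (simp add: extension_def F_0)
qed

lemma extension_at_top: "(extension \<longlongrightarrow> F 1) at_top"
proof (rule tendsto_eventually)
  show "\<forall>\<^sub>F x in at_top. extension x = F 1"
    using eventually_ge_at_top[of 1] by eventually_elim (simp add: extension_def)
qed

lemma F_1_nonneg: "0 \<le> F 1"
  using mono_onD[OF F_mono, of 0 1] F_0 by simp

lemma finite_borel_measure_stieltjes: "finite_borel_measure stieltjes"
  unfolding stieltjes_def
  by (rule finite_borel_measure_interval_measure[OF extension_mono extension_right_cont extension_at_bot extension_at_top F_1_nonneg])

lemma sets_stieltjes[measurable_cong]: "sets stieltjes = sets borel"
  by (simp add: stieltjes_def)

lemma space_stieltjes[simp]: "space stieltjes = UNIV"
  by (simp add: stieltjes_def)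

lemma emeasure_stieltjes_UNIV: "emeasure stieltjes UNIV = F 1"
  unfolding stieltjes_def
  by (rule interval_measure_UNIV[OF extension_mono extension_right_cont extension_at_bot extension_at_top F_1_nonneg])

lemma emeasure_stieltjes_Ioc:
  "0 \<le> a \<Longrightarrow> a \<le> b \<Longrightarrow> b \<le> 1 \<Longrightarrow> emeasure stieltjes {a<..b} = F b - F a"
  unfolding stieltjes_def
  by (subst emeasure_interval_measure_Ioc[OF _ extension_mono extension_right_cont]) (auto simp: extension_eq)

lemma measure_stieltjes_Ioc:
  "0 \<le> a \<Longrightarrow> a \<le> b \<Longrightarrow> b \<le> 1 \<Longrightarrow> measure stieltjes {a<..b} = F b - F a"
  using mono_onD[OF F_mono, of a b] by (simp add: measure_def emeasure_stieltjes_Ioc)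

text \<open>
  The atoms are the jumps.
\<close>
lemma measure_stieltjes_singleton:
  assumes t: "t \<in> {0<..1}"
  shows "measure stieltjes {t} = F t - Lim (at_left t) F"
proof -
  interpret finite_borel_measure stieltjes by (rule finite_borel_measure_stieltjes)
  have cdf: "cdf stieltjes = extension"
    unfolding stieltjes_def by (rule cdf_interval_measure[OF extension_mono extension_right_cont extension_at_bot])
  have "(extension \<longlongrightarrow> measure stieltjes {..<t}) (at_left t)"
    using cdf_at_left[of t] by (simp add: cdf)
  moreover have "\<forall>\<^sub>F u in at_left t. extension u = F u"
    using t by (auto simp: eventually_at_left extension_def intro!: exI[of _ 0])
  ultimately have "(F \<longlongrightarrow> measure stieltjes {..<t}) (at_left t)" by (rule Lim_transform_eventually)
  then have "Lim (at_left t) F = measure stieltjes {..<t}" by (intro tendsto_Lim) auto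
  moreover have "measure stieltjes {..t} = F t"
    using cdf t by (simp add: cdf_def fun_eq_iff extension_eq)
  moreover have "measure stieltjes {..t} = measure stieltjes {..<t} + measure stieltjes {t}"
    by (subst finite_measure_Union[symmetric]) (auto intro: arg_cong[where f="measure stieltjes"])
  ultimately show ?thesis by simp
qed

text \<open>
  A sum of \<open>x * q x\<close> over the increments is the integral against the Stieltjes measure of
  the step function that at \<open>t\<close> is \<open>q\<close> of the mass of the dyadic interval around \<open>t\<close>. These
  intervals shrink to \<open>{t}\<close>, so the step functions converge boundedly to \<open>q\<close> of the atom at
  \<open>t\<close>. As \<open>q 0 = 0\<close>, the limit only sees the atoms. For \<open>q = 1\<close> the statement fails: it
  would ignore a continuous part of \<open>F\<close>.
\<close>
lemma dyadic_sums_tendsto_jump_sum: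
  fixes \<tau> :: "nat \<Rightarrow> real" and q :: "real \<Rightarrow> real"
  assumes \<tau>: "bij_betw \<tau> UNIV {t \<in> {0<..1}. 0 < F t - Lim (at_left t) F}"
    and q_cont: "continuous_on UNIV q" and q_nonneg: "\<And>x. 0 \<le> x \<Longrightarrow> 0 \<le> q x" and q_0: "q 0 = 0"
  defines "J \<equiv> \<lambda>i. F (\<tau> i) - Lim (at_left (\<tau> i)) F"
  shows "(\<lambda>m. \<integral>\<^sup>+l. ennreal (dyadic_increment F m l * q (dyadic_increment F m l)) \<partial>count_space UNIV)
    \<longlonglongrightarrow> (\<integral>\<^sup>+i. ennreal (J i * q (J i)) \<partial>count_space UNIV)"
proof -
  interpret finite_borel_measure stieltjes by (rule finite_borel_measure_stieltjes)
  have [measurable]: "q \<in> borel_measurable borel" using q_cont by (rule borel_measurable_continuous_onI)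
  let ?D = "dyadic_increment F"
  define Iv where "Iv m l = {real l / 2 ^ m<..real (Suc l) / 2 ^ m}" for m l :: nat
  have [measurable]: "Iv m l \<in> sets borel" for m l by (simp add: Iv_def)
  have D_Iv: "?D m l = measure stieltjes (Iv m l)" "ennreal (?D m l) = emeasure stieltjes (Iv m l)" if "l < 2 ^ m" for m l
    using that dyadic_point_mem[of l m] dyadic_point_mem[of "Suc l" m]
    by (auto simp: dyadic_increment_def Iv_def measure_stieltjes_Ioc emeasure_stieltjes_Ioc divide_right_mono)
  have D_le: "?D m l \<in> {0..F 1}" for m l
  proof (cases "l < 2 ^ m")
    case True
    have "measure stieltjes (Iv m l) \<le> measure stieltjes UNIV" by (intro finite_measure_mono) auto
    also have "\<dots> = F 1" using F_1_nonneg by (simp add: measure_def emeasure_stieltjes_UNIV)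
    finally show ?thesis using True D_Iv by simp
  qed (simp add: dyadic_increment_def F_1_nonneg)
  obtain B where B: "\<And>x. x \<in> {0..F 1} \<Longrightarrow> q x \<le> B"
  proof -
    have "compact (q ` {0..F 1})"
      by (intro compact_continuous_image continuous_on_subset[OF q_cont]) auto
    then have "bdd_above (q ` {0..F 1})"
      by (intro bounded_imp_bdd_above compact_imp_bounded)
    then obtain b where "\<And>x. x \<in> {0..F 1} \<Longrightarrow> q x \<le> b"
      unfolding bdd_above_def by blast
    then show ?thesis by (rule that)
  qed
  define g where "g m t = (\<Sum>l<2 ^ m. ennreal (q (?D m l)) * indicator (Iv m l) t)" for m t
  have g_int: "(\<integral>\<^sup>+t. g m t \<partial>stieltjes) = (\<integral>\<^sup>+l. ennreal (?D m l * q (?D m l)) \<partial>count_space UNIV)" for m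
  proof -
    have "(\<integral>\<^sup>+t. g m t \<partial>stieltjes) = (\<Sum>l<2 ^ m. ennreal (q (?D m l)) * emeasure stieltjes (Iv m l))"
      unfolding g_def by (subst nn_integral_sum) (auto simp: nn_integral_cmult_indicator)
    also have "\<dots> = (\<Sum>l<2 ^ m. ennreal (?D m l * q (?D m l)))"
      using D_le by (intro sum.cong) (auto simp: D_Iv(2)[symmetric] ennreal_mult[symmetric] q_nonneg mult.commute)
    also have "\<dots> = (\<integral>\<^sup>+l. ennreal (?D m l * q (?D m l)) \<partial>count_space UNIV)"
      by (subst nn_integral_count_space'[where A="{..<2 ^ m}"]) (auto simp: dyadic_increment_def)
    finally show ?thesis .
  qed
  \<comment> \<open>The index of the dyadic interval of level \<open>m\<close> that contains \<open>t\<close>; the intervals are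
    closed on the right.\<close>
  define idx where "idx m t = nat (\<lceil>t * 2 ^ m\<rceil> - 1)" for m :: nat and t :: real
  have idx: "idx m t < 2 ^ m" "t \<in> Iv m l \<longleftrightarrow> l = idx m t" if t: "t \<in> {0<..1}" for m t l
  proof -
    have 0: "0 < t * 2 ^ m" using t by simp
    have le: "t * 2 ^ m \<le> 2 ^ m" using t by simp
    have "\<lceil>t * 2 ^ m\<rceil> \<le> 2 ^ m" using le by (simp add: ceiling_le_iff)
    moreover have c1: "1 \<le> \<lceil>t * 2 ^ m\<rceil>" using 0 by simp
    ultimately show "idx m t < 2 ^ m" unfolding idx_def
      by (subst nat_less_iff) auto
    have "t \<in> Iv m l \<longleftrightarrow> real l < t * 2 ^ m \<and> t * 2 ^ m \<le> real (Suc l)"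
      by (auto simp: Iv_def field_simps)
    also have "\<dots> \<longleftrightarrow> \<lceil>t * 2 ^ m\<rceil> = int (Suc l)"
      by (subst ceiling_eq_iff) auto
    also have "\<dots> \<longleftrightarrow> l = idx m t" using c1 by (auto simp: idx_def)
    finally show "t \<in> Iv m l \<longleftrightarrow> l = idx m t" .
  qed
  have g_eq: "g m t = ennreal (q (?D m (idx m t)))" if t: "t \<in> {0<..1}" for m t
  proof -
    have "g m t = (\<Sum>l<2 ^ m. if l = idx m t then ennreal (q (?D m l)) else 0)"
      unfolding g_def by (intro sum.cong refl) (auto simp: idx[OF t] indicator_def)
    then show ?thesis using idx(1)[OF t] by simp
  qed
  have g_0: "g m t = 0" if t: "t \<notin> {0<..1}" for m t
  proof -
    have "t \<notin> Iv m l" if "l < 2 ^ m" for l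
      using t that dyadic_point_mem[of l m] dyadic_point_mem[of "Suc l" m]
      unfolding Iv_def greaterThanAtMost_iff atLeastAtMost_iff by linarith
    then show ?thesis by (auto simp: g_def)
  qed
  define G where "G t = ennreal (q (measure stieltjes {t})) * indicator {0<..1} t" for t
  have D_lim: "(\<lambda>m. ?D m (idx m t)) \<longlonglongrightarrow> measure stieltjes {t}" if t: "t \<in> {0<..1}" for t
  proof -
    have Iv_idx: "Iv m (idx m t) = {(of_int \<lceil>t * 2 ^ m\<rceil> - 1) / 2 ^ m<..of_int \<lceil>t * 2 ^ m\<rceil> / 2 ^ m}" for m
    proof -
      have "1 \<le> \<lceil>t * 2 ^ m\<rceil>" using t by simp
      then have "real (idx m t) = of_int \<lceil>t * 2 ^ m\<rceil> - 1" by (simp add: idx_def)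
      then show ?thesis by (simp add: Iv_def)
    qed
    have dec: "decseq (\<lambda>m. Iv m (idx m t))"
    proof (rule decseq_SucI)
      fix m
      define y where "y = t * 2 ^ m"
      have y: "t * 2 ^ Suc m = 2 * y" by (simp add: y_def)
      have c: "\<lceil>2 * y\<rceil> \<le> 2 * \<lceil>y\<rceil>" "2 * (\<lceil>y\<rceil> - 1) \<le> \<lceil>2 * y\<rceil> - 1"
      proof -
        obtain a b where ab: "a = \<lceil>y\<rceil>" "b = \<lceil>2 * y\<rceil>" by blast
        have le: "of_int a - 1 < y" "y \<le> of_int a" "2 * y \<le> of_int b" "of_int b - 1 < 2 * y"
          using ceiling_correct[of y] ceiling_correct[of "2 * y"] unfolding ab by blast+
        have "of_int b < 2 * y + 1" "2 * y + 1 \<le> (of_int (2 * a + 1) :: real)"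
          using le by simp_all
        moreover have "of_int (2 * (a - 1)) < 2 * y" using le by simp
        ultimately have "of_int b < (of_int (2 * a + 1) :: real)" "of_int (2 * (a - 1)) < (of_int b :: real)"
          using le(3) by (blast intro: less_le_trans)+
        then show "\<lceil>2 * y\<rceil> \<le> 2 * \<lceil>y\<rceil>" "2 * (\<lceil>y\<rceil> - 1) \<le> \<lceil>2 * y\<rceil> - 1"
          unfolding of_int_less_iff ab by linarith+
      qed
      have "real_of_int \<lceil>2 * y\<rceil> / 2 ^ Suc m \<le> of_int \<lceil>y\<rceil> / 2 ^ m"
        using c(1) by (simp add: field_simps)
      moreover have "(real_of_int \<lceil>y\<rceil> - 1) / 2 ^ m \<le> (of_int \<lceil>2 * y\<rceil> - 1) / 2 ^ Suc m"
        using of_int_le_iff[where ?'a=real, THEN iffD2, OF c(2)] by (simp add: divide_simps)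
      ultimately show "Iv (Suc m) (idx (Suc m) t) \<subseteq> Iv m (idx m t)"
        unfolding Iv_idx y y_def[symmetric] by auto
    qed
    have "(\<Inter>m. Iv m (idx m t)) = {t}"
    proof (intro equalityI subsetI)
      fix s assume s: "s \<in> (\<Inter>m. Iv m (idx m t))"
      have "\<bar>s - t\<bar> \<le> (1/2) ^ m" for m
      proof -
        have "s \<in> Iv m (idx m t)" "t \<in> Iv m (idx m t)" using s idx[OF t] by auto
        then have "\<bar>s - t\<bar> \<le> real (Suc (idx m t)) / 2 ^ m - real (idx m t) / 2 ^ m"
          unfolding Iv_def by auto
        then show ?thesis by (simp add: field_simps power_divide)
      qed
      moreover have "(\<lambda>m. (1/2) ^ m :: real) \<longlonglongrightarrow> 0" by (intro LIMSEQ_power_zero) auto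
      ultimately have "\<bar>s - t\<bar> \<le> 0" by (intro LIMSEQ_le_const) auto
      then show "s \<in> {t}" by simp
    qed (use idx[OF t] in auto)
    moreover have "(\<lambda>m. measure stieltjes (Iv m (idx m t))) \<longlonglongrightarrow> measure stieltjes (\<Inter>m. Iv m (idx m t))"
      by (rule Lim_measure_decseq[OF _ dec]) (auto simp: sets_stieltjes)
    ultimately show ?thesis using idx(1)[OF t] by (simp add: D_Iv(1))
  qed
  have G_meas[measurable]: "G \<in> borel_measurable stieltjes" and "(\<lambda>m. \<integral>\<^sup>+t. g m t \<partial>stieltjes) \<longlonglongrightarrow> (\<integral>\<^sup>+t. G t \<partial>stieltjes)"
  proof -
    have lim: "(\<lambda>m. g m t) \<longlonglongrightarrow> G t" for t
    proof (cases "t \<in> {0<..1}")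
      case True
      have "(\<lambda>m. q (?D m (idx m t))) \<longlonglongrightarrow> q (measure stieltjes {t})"
        by (rule continuous_on_tendsto_compose[OF q_cont D_lim[OF True]]) auto
      then show ?thesis using True by (simp add: g_eq G_def)
    next
      case False
      then have "g m t = 0" for m by (rule g_0)
      moreover have "G t = 0" using False by (simp add: G_def)
      ultimately show ?thesis by simp
    qed
    have [measurable]: "g m \<in> borel_measurable stieltjes" for m
      unfolding g_def by measurable
    show *: "G \<in> borel_measurable stieltjes"
      by (rule borel_measurable_LIMSEQ_order[where u=g]) (use lim in auto)
    show "(\<lambda>m. \<integral>\<^sup>+t. g m t \<partial>stieltjes) \<longlonglongrightarrow> (\<integral>\<^sup>+t. G t \<partial>stieltjes)"
    proof (rule nn_integral_dominated_convergence[where w="\<lambda>_. ennreal B"])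
      show "AE t in stieltjes. g m t \<le> ennreal B" for m
      proof (rule AE_I2)
        fix t show "g m t \<le> ennreal B"
          by (cases "t \<in> {0<..1}") (auto simp: g_eq g_0 intro!: ennreal_leI B D_le)
      qed
      show "(\<integral>\<^sup>+t. ennreal B \<partial>stieltjes) < \<infinity>"
        by (simp add: emeasure_stieltjes_UNIV ennreal_mult_less_top)
    qed (use * lim in auto)
  qed
  moreover have "(\<integral>\<^sup>+t. G t \<partial>stieltjes) = (\<integral>\<^sup>+i. ennreal (J i * q (J i)) \<partial>count_space UNIV)"
  proof -
    have inj: "inj \<tau>" and ran: "range \<tau> = {t \<in> {0<..1}. 0 < F t - Lim (at_left t) F}"
      using \<tau> by (auto simp: bij_betw_def)
    have \<tau>_mem: "\<tau> i \<in> {0<..1}" for i using ran by auto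
    have J: "J i = measure stieltjes {\<tau> i}" for i
      using measure_stieltjes_singleton[OF \<tau>_mem] by (simp add: J_def)
    have G_sum: "G t = (\<integral>\<^sup>+i. ennreal (q (J i)) * indicator {\<tau> i} t \<partial>count_space UNIV)" for t
    proof (cases "t \<in> range \<tau>")
      case True
      then obtain i where i: "t = \<tau> i" by auto
      have "(\<integral>\<^sup>+j. ennreal (q (J j)) * indicator {\<tau> j} t \<partial>count_space UNIV) = (\<Sum>j\<in>{i}. ennreal (q (J j)) * indicator {\<tau> j} t)"
        by (rule nn_integral_count_space') (auto simp: i indicator_def injD[OF inj])
      then show ?thesis using \<tau>_mem by (simp add: G_def J i)
    next
      case False
      have "G t = 0"
      proof (cases "t \<in> {0<..1}")
        case True
        then have "measure stieltjes {t} = 0"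
          using False ran measure_stieltjes_singleton[OF True] measure_nonneg[of stieltjes "{t}"] by force
        then show ?thesis by (simp add: G_def q_0)
      qed (simp add: G_def)
      moreover have "indicator {\<tau> j} t = (0::ennreal)" for j using False by (auto simp: indicator_def)
      ultimately show ?thesis by simp
    qed
    have "(\<integral>\<^sup>+t. G t \<partial>stieltjes) = (\<integral>\<^sup>+i. \<integral>\<^sup>+t. ennreal (q (J i)) * indicator {\<tau> i} t \<partial>stieltjes \<partial>count_space UNIV)"
      unfolding G_sum by (rule nn_integral_count_space_nn_integral) auto
    also have "\<dots> = (\<integral>\<^sup>+i. ennreal (J i * q (J i)) \<partial>count_space UNIV)"
      by (intro nn_integral_cong)
        (simp add: nn_integral_cmult_indicator sets_stieltjes emeasure_eq_measure J ennreal_mult q_nonneg, simp add: mult.commute)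
    finally show ?thesis .
  qed
  ultimately show ?thesis by (simp add: g_int)
qed

lemma sum_jumps_le:
  fixes \<tau> :: "nat \<Rightarrow> real"
  assumes \<tau>: "bij_betw \<tau> UNIV {t \<in> {0<..1}. 0 < F t - Lim (at_left t) F}"
  shows "(\<integral>\<^sup>+i. ennreal (F (\<tau> i) - Lim (at_left (\<tau> i)) F) \<partial>count_space UNIV) \<le> ennreal (F 1)"
proof -
  interpret finite_borel_measure stieltjes by (rule finite_borel_measure_stieltjes)
  have inj: "inj \<tau>" and ran: "range \<tau> = {t \<in> {0<..1}. 0 < F t - Lim (at_left t) F}"
    using \<tau> by (auto simp: bij_betw_def)
  have \<tau>_mem: "\<tau> i \<in> {0<..1}" for i using ran by auto
  have "(\<integral>\<^sup>+i. ennreal (F (\<tau> i) - Lim (at_left (\<tau> i)) F) \<partial>count_space UNIV) = (\<integral>\<^sup>+i. emeasure stieltjes {\<tau> i} \<partial>count_space UNIV)"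
    using measure_stieltjes_singleton[OF \<tau>_mem] by (simp add: emeasure_eq_measure)
  also have "\<dots> = emeasure stieltjes (\<Union>i. {\<tau> i})"
    by (subst emeasure_UN_countable) (auto simp: disjoint_family_on_def sets_stieltjes dest: injD[OF inj])
  also have "\<dots> \<le> emeasure stieltjes UNIV" by (intro emeasure_mono) (auto simp: sets_stieltjes)
  finally show ?thesis by (simp add: emeasure_stieltjes_UNIV)
qed

end

section \<open>Sums over distinct indices\<close>

definition index_weight :: "(nat \<Rightarrow> ennreal) \<Rightarrow> nat list \<Rightarrow> nat list \<Rightarrow> ennreal" where
  "index_weight x ns ks = (\<Prod>j<length ns. x (ks ! j) ^ (ns ! j))"

text \<open>
  The sum of \<open>x i_1 ^ n_1 * ... * x i_k ^ n_k\<close> over tuples of pairwise distinct indices. For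
  a probability vector \<open>x\<close> it is the probability that independent samples from \<open>x\<close> realise a
  given partition into blocks of these sizes.
\<close>
definition distinct_sum :: "(nat \<Rightarrow> ennreal) \<Rightarrow> nat list \<Rightarrow> ennreal" where
  "distinct_sum x ns =
     (\<integral>\<^sup>+ks. (if length ks = length ns \<and> distinct ks then index_weight x ns ks else 0) \<partial>count_space UNIV)"

lemma index_weight_Cons: "index_weight x (n # ns) (i # ks) = x i ^ n * index_weight x ns ks"
  unfolding index_weight_def list.size add_Suc_right add_0_right prod.lessThan_Suc_shift by simp

lemma index_weight_list_update:
  assumes "j < length ns"
  shows "index_weight x (ns[j := ns ! j + n]) ks = x (ks ! j) ^ n * index_weight x ns ks"
proof -
  have "index_weight x (ns[j := ns ! j + n]) ks
      = (\<Prod>l<length ns. (if l = j then x (ks ! j) ^ n else 1) * x (ks ! l) ^ (ns ! l))"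
    unfolding index_weight_def by (intro prod.cong) (auto simp: nth_list_update power_add mult.commute)
  also have "\<dots> = (\<Prod>l<length ns. if l = j then x (ks ! j) ^ n else 1) * index_weight x ns ks"
    unfolding index_weight_def by (rule prod.distrib)
  also have "(\<Prod>l<length ns. if l = j then x (ks ! j) ^ n else 1) = x (ks ! j) ^ n"
    using assms by simp
  finally show ?thesis .
qed

lemma distinct_sum_Nil: "distinct_sum x [] = 1"
  unfolding distinct_sum_def
  by (subst nn_integral_count_space'[where A="{[]}"]) (auto simp: index_weight_def)

lemma nn_integral_count_space_list_Cons:
  fixes f :: "nat list \<Rightarrow> ennreal"
  assumes "f [] = 0"
  shows "(\<integral>\<^sup>+ks. f ks \<partial>count_space UNIV) = (\<integral>\<^sup>+ks. \<integral>\<^sup>+i. f (i # ks) \<partial>count_space UNIV \<partial>count_space UNIV)"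
proof -
  have bij: "bij_betw (\<lambda>(ks, i). i # ks) UNIV {ks :: nat list. ks \<noteq> []}"
    by (rule bij_betwI[where g="\<lambda>ks. (tl ks, hd ks)"]) auto
  have "(\<integral>\<^sup>+ks. f ks \<partial>count_space UNIV) = (\<integral>\<^sup>+ks. f ks * indicator {ks. ks \<noteq> []} ks \<partial>count_space UNIV)"
    using assms by (intro nn_integral_cong) (auto simp: indicator_def)
  also have "\<dots> = (\<integral>\<^sup>+ks. f ks \<partial>count_space {ks. ks \<noteq> []})"
    by (simp add: nn_integral_count_space_indicator)
  also have "\<dots> = (\<integral>\<^sup>+p. f (case p of (ks, i) \<Rightarrow> i # ks) \<partial>count_space UNIV)"
    using nn_integral_bij_count_space[OF bij, of f] by simp
  also have "\<dots> = (\<integral>\<^sup>+p. f (case p of (ks, i) \<Rightarrow> i # ks) \<partial>(count_space UNIV \<Otimes>\<^sub>M count_space UNIV))"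
    by (subst pair_measure_countable) auto
  also have "\<dots> = (\<integral>\<^sup>+ks. \<integral>\<^sup>+i. f (i # ks) \<partial>count_space UNIV \<partial>count_space UNIV)"
    by (subst sigma_finite_measure.nn_integral_fst[symmetric])
      (auto simp: pair_measure_countable sigma_finite_measure_count_space_countable)
  finally show ?thesis .
qed

text \<open>
  A new index \<open>i\<close> with weight \<open>x i ^ n\<close> is either different from the old ones, or equal to
  exactly one of them, and then it raises that exponent by \<open>n\<close>. Solved for the first term,
  this expresses \<open>distinct_sum\<close> through the power sums, which is how limits pass to it.
\<close>
lemma distinct_sum_recursion:
  "distinct_sum x (n # ns) + (\<Sum>j<length ns. distinct_sum x (ns[j := ns ! j + n]))
    = (\<integral>\<^sup>+i. x i ^ n \<partial>count_space UNIV) * distinct_sum x ns"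
proof -
  define W where "W ms ks = (if length ks = length ms \<and> distinct ks then index_weight x ms ks else 0)" for ms ks
  have D: "distinct_sum x ms = (\<integral>\<^sup>+ks. W ms ks \<partial>count_space UNIV)" for ms
    by (simp add: distinct_sum_def W_def)
  have step: "(\<integral>\<^sup>+i. x i ^ n * W ns ks \<partial>count_space UNIV)
      = (\<integral>\<^sup>+i. W (n # ns) (i # ks) \<partial>count_space UNIV) + (\<Sum>j<length ns. W (ns[j := ns ! j + n]) ks)" for ks
  proof (cases "length ks = length ns \<and> distinct ks")
    case True
    then have W: "W ns ks = index_weight x ns ks" by (simp add: W_def)
    have "(\<integral>\<^sup>+i. x i ^ n * W ns ks \<partial>count_space UNIV)
        = (\<integral>\<^sup>+i. W (n # ns) (i # ks) + (if i \<in> set ks then x i ^ n * W ns ks else 0) \<partial>count_space UNIV)"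
      using True by (intro nn_integral_cong) (auto simp: W_def index_weight_Cons)
    also have "\<dots> = (\<integral>\<^sup>+i. W (n # ns) (i # ks) \<partial>count_space UNIV)
        + (\<integral>\<^sup>+i. (if i \<in> set ks then x i ^ n * W ns ks else 0) \<partial>count_space UNIV)"
      by (rule nn_integral_add) auto
    also have "(\<integral>\<^sup>+i. (if i \<in> set ks then x i ^ n * W ns ks else 0) \<partial>count_space UNIV) = (\<Sum>i\<in>set ks. x i ^ n * W ns ks)"
      by (subst nn_integral_count_space'[where A="set ks"]) auto
    also have "\<dots> = (\<Sum>j<length ks. x (ks ! j) ^ n * W ns ks)"
      using True by (intro sum.reindex_bij_betw[symmetric] bij_betw_nth) auto
    also have "\<dots> = (\<Sum>j<length ns. W (ns[j := ns ! j + n]) ks)"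
      using True by (intro sum.cong) (auto simp: W index_weight_list_update W_def)
    finally show ?thesis .
  next
    case False
    then show ?thesis by (auto simp: W_def)
  qed
  have "(\<integral>\<^sup>+i. x i ^ n \<partial>count_space UNIV) * distinct_sum x ns
      = (\<integral>\<^sup>+ks. \<integral>\<^sup>+i. x i ^ n * W ns ks \<partial>count_space UNIV \<partial>count_space UNIV)"
    unfolding D by (simp add: nn_integral_cmult nn_integral_multc)
  also have "\<dots> = (\<integral>\<^sup>+ks. (\<integral>\<^sup>+i. W (n # ns) (i # ks) \<partial>count_space UNIV) \<partial>count_space UNIV)
      + (\<integral>\<^sup>+ks. (\<Sum>j<length ns. W (ns[j := ns ! j + n]) ks) \<partial>count_space UNIV)"
    unfolding step by (rule nn_integral_add) auto
  also have "(\<integral>\<^sup>+ks. (\<integral>\<^sup>+i. W (n # ns) (i # ks) \<partial>count_space UNIV) \<partial>count_space UNIV) = distinct_sum x (n # ns)"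
    unfolding D by (rule nn_integral_count_space_list_Cons[symmetric]) (simp add: W_def)
  also have "(\<integral>\<^sup>+ks. (\<Sum>j<length ns. W (ns[j := ns ! j + n]) ks) \<partial>count_space UNIV)
      = (\<Sum>j<length ns. distinct_sum x (ns[j := ns ! j + n]))"
    unfolding D by (rule nn_integral_sum) auto
  finally show ?thesis by simp
qed

lemma distinct_sum_le_prod:
  "distinct_sum x ns \<le> (\<Prod>n\<leftarrow>ns. \<integral>\<^sup>+i. x i ^ n \<partial>count_space UNIV)"
proof (induction ns)
  case (Cons n ns)
  have "distinct_sum x (n # ns) \<le> distinct_sum x (n # ns) + (\<Sum>j<length ns. distinct_sum x (ns[j := ns ! j + n]))"
    by simp
  also have "\<dots> = (\<integral>\<^sup>+i. x i ^ n \<partial>count_space UNIV) * distinct_sum x ns"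
    by (rule distinct_sum_recursion)
  also have "\<dots> \<le> (\<integral>\<^sup>+i. x i ^ n \<partial>count_space UNIV) * (\<Prod>n\<leftarrow>ns. \<integral>\<^sup>+i. x i ^ n \<partial>count_space UNIV)"
    by (intro mult_left_mono Cons.IH) auto
  finally show ?case by simp
qed (simp add: distinct_sum_Nil)

lemma distinct_sum_finite:
  assumes "\<And>n. 0 < n \<Longrightarrow> (\<integral>\<^sup>+i. x i ^ n \<partial>count_space UNIV) < top" and "0 \<notin> set ns"
  shows "distinct_sum x ns < top"
proof -
  have "(\<Prod>n\<leftarrow>ns. \<integral>\<^sup>+i. x i ^ n \<partial>count_space UNIV) < top"
    using assms(2) by (induction ns) (auto intro!: ennreal_mult_less_top[THEN iffD2] simp: assms(1))
  then show ?thesis using distinct_sum_le_prod le_less_trans by blast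
qed

text \<open>
  By the recursion, \<open>distinct_sum\<close> is a polynomial in the power sums. Finiteness is what
  allows the subtraction.
\<close>
lemma distinct_sum_tendsto:
  fixes x :: "nat \<Rightarrow> nat \<Rightarrow> ennreal" and y :: "nat \<Rightarrow> ennreal"
  assumes lim: "\<And>n. 0 < n \<Longrightarrow> (\<lambda>m. \<integral>\<^sup>+i. x m i ^ n \<partial>count_space UNIV) \<longlonglongrightarrow> (\<integral>\<^sup>+i. y i ^ n \<partial>count_space UNIV)"
    and fin_x: "\<And>m n. 0 < n \<Longrightarrow> (\<integral>\<^sup>+i. x m i ^ n \<partial>count_space UNIV) < top"
    and fin_y: "\<And>n. 0 < n \<Longrightarrow> (\<integral>\<^sup>+i. y i ^ n \<partial>count_space UNIV) < top"
    and ns: "0 \<notin> set ns"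
  shows "(\<lambda>m. distinct_sum (x m) ns) \<longlonglongrightarrow> distinct_sum y ns"
  using ns
\<comment> \<open>The recursion changes the remaining exponents, so the induction is on their number.\<close>
proof (induction "length ns" arbitrary: ns)
  case 0
  then show ?case by (simp add: distinct_sum_Nil)
next
  case (Suc k)
  obtain n ms where ns: "ns = n # ms" and k: "length ms = k"
    using Suc.hyps(2) by (cases ns) auto
  have n: "0 < n" and ms: "0 \<notin> set ms" using Suc.prems ns by auto
  have upd: "0 \<notin> set (ms[j := ms ! j + n])" for j
    using ms n set_update_subset_insert[of ms j "ms ! j + n"] by auto
  have rest_fin: "(\<Sum>j<k. distinct_sum z (ms[j := ms ! j + n])) < top"
    if "\<And>n. 0 < n \<Longrightarrow> (\<integral>\<^sup>+i. z i ^ n \<partial>count_space UNIV) < top" for z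
    using distinct_sum_finite[OF that upd] by (simp add: ennreal_sum_less_top)
  have eq: "distinct_sum z ns = (\<integral>\<^sup>+i. z i ^ n \<partial>count_space UNIV) * distinct_sum z ms
      - (\<Sum>j<k. distinct_sum z (ms[j := ms ! j + n]))"
    if "\<And>n. 0 < n \<Longrightarrow> (\<integral>\<^sup>+i. z i ^ n \<partial>count_space UNIV) < top" for z
    using distinct_sum_recursion[of z n ms] rest_fin[OF that] unfolding ns k
    by (metis ennreal_add_diff_cancel_right less_irrefl infinity_ennreal_def)
  have l1: "(\<lambda>m. distinct_sum (x m) ms) \<longlonglongrightarrow> distinct_sum y ms"
    using Suc.hyps(1)[OF k[symmetric] ms] .
  have l2: "(\<lambda>m. \<Sum>j<k. distinct_sum (x m) (ms[j := ms ! j + n])) \<longlonglongrightarrow> (\<Sum>j<k. distinct_sum y (ms[j := ms ! j + n]))"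
    by (intro tendsto_sum Suc.hyps(1)[OF _ upd]) (simp add: k)
  have f: "distinct_sum y ms < top" by (rule distinct_sum_finite[OF fin_y ms])
  have l3: "(\<lambda>m. (\<integral>\<^sup>+i. x m i ^ n \<partial>count_space UNIV) * distinct_sum (x m) ms)
      \<longlonglongrightarrow> (\<integral>\<^sup>+i. y i ^ n \<partial>count_space UNIV) * distinct_sum y ms"
    using f fin_y[OF n] by (intro tendsto_mult_ennreal lim n l1) auto
  have eq_x: "distinct_sum (x m) ns = (\<integral>\<^sup>+i. x m i ^ n \<partial>count_space UNIV) * distinct_sum (x m) ms
      - (\<Sum>j<k. distinct_sum (x m) (ms[j := ms ! j + n]))" for m
    by (rule eq) (rule fin_x)
  have eq_y: "distinct_sum y ns = (\<integral>\<^sup>+i. y i ^ n \<partial>count_space UNIV) * distinct_sum y ms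
      - (\<Sum>j<k. distinct_sum y (ms[j := ms ! j + n]))"
    by (rule eq) (rule fin_y)
  have r: "(\<Sum>j<k. distinct_sum y (ms[j := ms ! j + n])) < top"
    by (rule rest_fin) (rule fin_y)
  show ?case
    unfolding eq_x eq_y
    using f fin_y[OF n] less_imp_neq[OF r]
    by (intro tendsto_diff_ennreal l3 l2) (simp_all add: ennreal_mult_eq_top_iff less_top)
qed

text \<open>
  Homogeneity of degree \<open>sum_list ns\<close> is what lets the normalised jumps be replaced by the
  jumps.
\<close>
lemma distinct_sum_scale:
  "distinct_sum (\<lambda>i. c * x i) ns = c ^ sum_list ns * distinct_sum x ns"
proof -
  have "index_weight (\<lambda>i. c * x i) ns ks = c ^ sum_list ns * index_weight x ns ks" for ks
    unfolding index_weight_def power_mult_distrib prod.distrib power_sum[symmetric]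
    by (simp add: sum_list_sum_nth atLeast0LessThan)
  then have "(if length ks = length ns \<and> distinct ks then index_weight (\<lambda>i. c * x i) ns ks else 0)
      = c ^ sum_list ns * (if length ks = length ns \<and> distinct ks then index_weight x ns ks else 0)" for ks
    by simp
  then show ?thesis
    unfolding distinct_sum_def by (simp only: nn_integral_cmult borel_measurable_count_space)
qed

lemma measurable_index_weight:
  assumes "\<And>i. (\<lambda>\<omega>. X \<omega> i) \<in> borel_measurable M"
  shows "(\<lambda>\<omega>. index_weight (X \<omega>) ns ks) \<in> borel_measurable M"
  unfolding index_weight_def
  by (intro borel_measurable_prod_ennreal borel_measurable_power_ennreal assms)

lemma nn_integral_distinct_sum:
  assumes X: "\<And>i. (\<lambda>\<omega>. X \<omega> i) \<in> borel_measurable M" and g: "g \<in> borel_measurable M"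
  shows "(\<integral>\<^sup>+\<omega>. g \<omega> * distinct_sum (X \<omega>) ns \<partial>M) =
    (\<integral>\<^sup>+ks. (if length ks = length ns \<and> distinct ks then \<integral>\<^sup>+\<omega>. g \<omega> * index_weight (X \<omega>) ns ks \<partial>M else 0) \<partial>count_space UNIV)"
proof -
  note [measurable] = g measurable_index_weight[OF X]
  have "(\<integral>\<^sup>+\<omega>. g \<omega> * distinct_sum (X \<omega>) ns \<partial>M) =
    (\<integral>\<^sup>+\<omega>. \<integral>\<^sup>+ks. g \<omega> * (if length ks = length ns \<and> distinct ks then index_weight (X \<omega>) ns ks else 0) \<partial>count_space UNIV \<partial>M)"
    unfolding distinct_sum_def by (simp only: nn_integral_cmult borel_measurable_count_space)
  also have "\<dots> = (\<integral>\<^sup>+ks. \<integral>\<^sup>+\<omega>. g \<omega> * (if length ks = length ns \<and> distinct ks then index_weight (X \<omega>) ns ks else 0) \<partial>M \<partial>count_space UNIV)"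
    by (rule nn_integral_count_space_nn_integral) auto
  also have "\<dots> = (\<integral>\<^sup>+ks. (if length ks = length ns \<and> distinct ks then \<integral>\<^sup>+\<omega>. g \<omega> * index_weight (X \<omega>) ns ks \<partial>M else 0) \<partial>count_space UNIV)"
    by (intro nn_integral_cong) auto
  finally show ?thesis .
qed

lemma measurable_distinct_sum:
  assumes X: "\<And>i. (\<lambda>\<omega>. X \<omega> i) \<in> borel_measurable M"
  shows "(\<lambda>\<omega>. distinct_sum (X \<omega>) ns) \<in> borel_measurable M"
proof -
  interpret sigma_finite_measure "count_space (UNIV :: nat list set)"
    by (rule sigma_finite_measure_count_space_countable) auto
  note [measurable] = measurable_index_weight[OF X]
  show ?thesis
    unfolding distinct_sum_def
  proof (rule borel_measurable_nn_integral)
    show "(\<lambda>(\<omega>, ks). if length ks = length ns \<and> distinct ks then index_weight (X \<omega>) ns ks else 0)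
      \<in> borel_measurable (M \<Otimes>\<^sub>M count_space UNIV)"
    proof -
      have "(\<lambda>p. (\<lambda>ks p. if length ks = length ns \<and> distinct ks then index_weight (X (fst p)) ns ks else 0) (snd p) p)
        \<in> borel_measurable (M \<Otimes>\<^sub>M count_space UNIV)"
        by (rule measurable_compose_countable) auto
      then show ?thesis by (simp add: case_prod_beta')
    qed
  qed
qed

lemma power_sum_le:
  fixes x :: "nat \<Rightarrow> ennreal"
  assumes "0 < n"
  shows "(\<integral>\<^sup>+i. x i ^ n \<partial>count_space UNIV) \<le> (\<integral>\<^sup>+i. x i \<partial>count_space UNIV) ^ n"
proof -
  let ?S = "\<integral>\<^sup>+i. x i \<partial>count_space UNIV"
  obtain r where n: "n = Suc r" using assms by (cases n) auto
  have "x i \<le> ?S" for i by (rule nn_integral_ge_point) simp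
  then have "(\<integral>\<^sup>+i. x i ^ n \<partial>count_space UNIV) \<le> (\<integral>\<^sup>+i. x i * ?S ^ r \<partial>count_space UNIV)"
    by (intro nn_integral_mono) (auto simp: n intro!: mult_left_mono power_mono)
  also have "\<dots> = ?S ^ n" by (simp add: n nn_integral_multc)
  finally show ?thesis .
qed

lemma distinct_sum_le_power:
  assumes "0 \<notin> set ns"
  shows "distinct_sum x ns \<le> (\<integral>\<^sup>+i. x i \<partial>count_space UNIV) ^ sum_list ns"
proof -
  have "(\<Prod>n\<leftarrow>ns. \<integral>\<^sup>+i. x i ^ n \<partial>count_space UNIV) \<le> (\<integral>\<^sup>+i. x i \<partial>count_space UNIV) ^ sum_list ns"
    using assms
  proof (induction ns)
    case (Cons n ns)
    then show ?case by (auto simp: power_add intro!: mult_mono power_sum_le)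
  qed simp
  then show ?thesis using distinct_sum_le_prod order_trans by blast
qed

text \<open>
  For distinct indices, the weight of a tuple is a product over all grid cells, in which
  cell \<open>i\<close> carries the exponent of the block sent to \<open>i\<close>, or 0. In that form independence
  applies.
\<close>
definition multiplicity_at :: "nat list \<Rightarrow> nat list \<Rightarrow> nat \<Rightarrow> nat" where
  "multiplicity_at ns ks i = (\<Sum>j<length ns. if ks ! j = i then ns ! j else 0)"

lemma index_weight_eq_prod_over_range:
  assumes "length ks = length ns" "set ks \<subseteq> {..<N}"
  shows "index_weight x ns ks = (\<Prod>i<N. x i ^ multiplicity_at ns ks i)"
proof -
  have "(\<Prod>i<N. x i ^ multiplicity_at ns ks i) = (\<Prod>i<N. \<Prod>j<length ns. if ks ! j = i then x i ^ (ns ! j) else 1)"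
    unfolding multiplicity_at_def power_sum by (intro prod.cong refl) auto
  also have "\<dots> = (\<Prod>j<length ns. \<Prod>i<N. if ks ! j = i then x i ^ (ns ! j) else 1)"
    by (rule prod.swap)
  also have "\<dots> = index_weight x ns ks"
    unfolding index_weight_def
  proof (intro prod.cong refl)
    fix j assume "j \<in> {..<length ns}"
    then have "ks ! j \<in> set ks" using assms(1) by simp
    then have "ks ! j \<in> {..<N}" using assms(2) by (rule subsetD[rotated])
    then show "(\<Prod>i<N. if ks ! j = i then x i ^ (ns ! j) else 1) = x (ks ! j) ^ (ns ! j)"
      by simp
  qed
  finally show ?thesis by simp
qed

lemma prod_over_range_multiplicity:
  fixes f :: "nat \<Rightarrow> ennreal"
  assumes len: "length ks = length ns" and "distinct ks" and sub: "set ks \<subseteq> {..<N}"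
  shows "(\<Prod>i<N. f (multiplicity_at ns ks i)) = (\<Prod>j<length ns. f (ns ! j)) * f 0 ^ (N - length ns)"
proof -
  have "(\<Prod>i<N. f (multiplicity_at ns ks i)) = (\<Prod>i\<in>{..<N} - set ks. f (multiplicity_at ns ks i)) * (\<Prod>i\<in>set ks. f (multiplicity_at ns ks i))"
    by (rule prod.subset_diff[OF sub]) simp
  also have "(\<Prod>i\<in>{..<N} - set ks. f (multiplicity_at ns ks i)) = (\<Prod>i\<in>{..<N} - set ks. f 0)"
  proof (intro prod.cong refl)
    fix i assume "i \<in> {..<N} - set ks"
    then have "ks ! j \<noteq> i" if "j < length ns" for j using that len by auto
    then have "multiplicity_at ns ks i = 0" by (simp add: multiplicity_at_def)
    then show "f (multiplicity_at ns ks i) = f 0" by simp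
  qed
  also have "\<dots> = f 0 ^ (N - length ns)"
    using sub \<open>distinct ks\<close> len by (simp add: card_Diff_subset distinct_card)
  also have "(\<Prod>i\<in>set ks. f (multiplicity_at ns ks i)) = (\<Prod>j<length ks. f (multiplicity_at ns ks (ks ! j)))"
    using \<open>distinct ks\<close> by (intro prod.reindex_bij_betw[symmetric] bij_betw_nth) auto
  also have "\<dots> = (\<Prod>j<length ns. f (ns ! j))"
  proof (intro prod.cong)
    fix j assume j: "j \<in> {..<length ns}"
    have "multiplicity_at ns ks (ks ! j) = (\<Sum>i<length ns. if i = j then ns ! i else 0)"
      unfolding multiplicity_at_def using j len \<open>distinct ks\<close>
      by (intro sum.cong refl) (auto simp: nth_eq_iff_index_eq)
    then show "f (multiplicity_at ns ks (ks ! j)) = f (ns ! j)" using j by simp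
  qed (use len in simp)
  finally show ?thesis by (simp add: mult.commute)
qed

lemma card_distinct_lists:
  "real (card {ks :: nat list. length ks = k \<and> distinct ks \<and> set ks \<subseteq> {..<N}}) = (\<Prod>j<k. real N - real j)"
proof (cases "k \<le> N")
  case True
  have "card {ks :: nat list. length ks = k \<and> distinct ks \<and> set ks \<subseteq> {..<N}} = \<Prod>{N - k + 1 .. N}"
    using card_lists_distinct_length_eq[of "{..<N}" k] True by simp
  also have "\<dots> = (\<Prod>j<k. N - j)"
    by (rule prod.reindex_bij_witness[where i="\<lambda>j. N - j" and j="\<lambda>j. N - j"]) (use True in auto)
  finally show ?thesis using True by (simp add: of_nat_diff)
next
  case False
  have "{ks :: nat list. length ks = k \<and> distinct ks \<and> set ks \<subseteq> {..<N}} = {}"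
  proof safe
    fix ks :: "nat list" assume "distinct ks" "set ks \<subseteq> {..<N}" "k = length ks"
    then have "k \<le> N" using card_mono[of "{..<N}" "set ks"] by (simp add: distinct_card)
    then show "ks \<in> {}" using False by simp
  qed
  moreover have "(\<Prod>j<k. real N - real j) = 0" using False by (intro prod_zero) auto
  ultimately show ?thesis by (simp only: card.empty of_nat_0)
qed

text \<open>
  The factor left by the cells that carry no block.
\<close>
lemma exp_rest_tendsto:
  fixes \<alpha> c l :: real
  shows "(\<lambda>m. exp (- ((2 ^ m - c) / 2 ^ m) * l powr \<alpha>)) \<longlonglongrightarrow> exp (- (l powr \<alpha>))"
proof -
  have "(\<lambda>m. exp (- (1 - c * (1 / 2 ^ m)) * l powr \<alpha>)) \<longlonglongrightarrow> exp (- (1 - c * 0) * l powr \<alpha>)"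
    by (intro tendsto_intros inverse_dyadic_tendsto)
  moreover have "1 - c * (1 / 2 ^ m) = (2 ^ m - c) / 2 ^ m" for m
    by (simp add: diff_divide_distrib)
  ultimately show ?thesis by (simp only: mult_zero_right diff_zero mult_minus_left mult_1_left)
qed

section \<open>Jumps of the stable subordinator\<close>

locale stable_subordinator =
  fixes \<alpha> :: real and M :: "'a measure" and X :: "real \<Rightarrow> 'a \<Rightarrow> real" and J :: "nat \<Rightarrow> 'a \<Rightarrow> real"
  assumes \<alpha>: "0 < \<alpha>" "\<alpha> < 1"
    and subord: "subordinator M X (stable_levy_density \<alpha>)"
    and jumps: "ranked_jumps M X J"
begin

sublocale prob_space M
  using subord by (simp add: subordinator_def)

lemma X_measurable: "t \<in> {0..1} \<Longrightarrow> X t \<in> borel_measurable M"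
  using subord by (simp add: subordinator_def)

lemma J_measurable[measurable]: "J i \<in> borel_measurable M"
  using jumps by (simp add: ranked_jumps_def)

text \<open>
  Gathers the almost sure path properties, so that the pathwise lemmas concern one monotone
  function.
\<close>
definition regular_path :: "'a \<Rightarrow> bool" where
  "regular_path \<omega> \<longleftrightarrow> X 0 \<omega> = 0 \<and> mono_on {0..1} (\<lambda>t. X t \<omega>) \<and>
    (\<forall>t\<in>{0..<1}. continuous (at_right t) (\<lambda>u. X u \<omega>)) \<and>
    (\<exists>\<tau>. bij_betw \<tau> UNIV {t \<in> {0<..1}. 0 < X t \<omega> - Lim (at_left t) (\<lambda>u. X u \<omega>)} \<and>
       (\<forall>i. J i \<omega> = X (\<tau> i) \<omega> - Lim (at_left (\<tau> i)) (\<lambda>u. X u \<omega>)))"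

lemma AE_regular_path: "AE \<omega> in M. regular_path \<omega>"
proof -
  have "AE \<omega> in M. X 0 \<omega> = 0 \<and> mono_on {0..1} (\<lambda>t. X t \<omega>) \<and>
        (\<forall>t\<in>{0..<1}. continuous (at_right t) (\<lambda>u. X u \<omega>))"
    using subord by (simp add: subordinator_def)
  moreover have "AE \<omega> in M. \<exists>\<tau>. bij_betw \<tau> (UNIV :: nat set) {t \<in> {0<..1}. 0 < jump X \<omega> t} \<and>
             (\<forall>i. J i \<omega> = jump X \<omega> (\<tau> i))"
    using jumps by (auto simp: ranked_jumps_def elim!: eventually_mono)
  ultimately show ?thesis
    by eventually_elim (simp add: regular_path_def jump_def)
qed

lemma regular_path_J_pos: "regular_path \<omega> \<Longrightarrow> 0 < J i \<omega>"
proof -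
  assume "regular_path \<omega>"
  then obtain \<tau> where \<tau>: "bij_betw \<tau> (UNIV :: nat set) {t \<in> {0<..1}. 0 < X t \<omega> - Lim (at_left t) (\<lambda>u. X u \<omega>)}"
    "\<forall>i. J i \<omega> = X (\<tau> i) \<omega> - Lim (at_left (\<tau> i)) (\<lambda>u. X u \<omega>)"
    unfolding regular_path_def by blast
  have "\<tau> i \<in> {t \<in> {0<..1}. 0 < X t \<omega> - Lim (at_left t) (\<lambda>u. X u \<omega>)}"
    using bij_betw_apply[OF \<tau>(1), of i] by simp
  then show ?thesis using \<tau>(2) by simp
qed

lemma Laplace_X:
  assumes "t \<in> {0..1}" "0 < l"
  shows "expectation (\<lambda>\<omega>. exp (- l * X t \<omega>)) = exp (- t * l powr \<alpha>)"
  using subord assms stable_Laplace_exponent[OF \<alpha> \<open>0 < l\<close>]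
  by (simp add: subordinator_def)

lemma X_nonneg: "t \<in> {0..1} \<Longrightarrow> AE \<omega> in M. 0 \<le> X t \<omega>"
  using AE_regular_path
proof eventually_elim
  case (elim \<omega>)
  then have "X 0 \<omega> \<le> X t \<omega>"
    by (intro mono_onD[of "{0..1}" "\<lambda>t. X t \<omega>"]) (auto simp: regular_path_def)
  then show ?case using elim by (simp add: regular_path_def)
qed

lemma Laplace_X_has_integral:
  assumes "t \<in> {0..1}" "0 < l"
  shows "has_bochner_integral M (\<lambda>\<omega>. exp (- l * X t \<omega>)) (exp (- t * l powr \<alpha>))"
proof -
  have [measurable]: "X t \<in> borel_measurable M" by (rule X_measurable[OF assms(1)])
  have "integrable M (\<lambda>\<omega>. exp (- l * X t \<omega>))"
    by (rule integrable_const_bound[where B=1])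
      (use X_nonneg[OF assms(1)] assms in \<open>auto elim!: eventually_mono\<close>)
  then show ?thesis using Laplace_X[OF assms] by (simp add: has_bochner_integral_iff)
qed

text \<open>
  The value of \<open>E[X t ^ r * exp (- l * X t)]\<close>.
\<close>
definition moment :: "real \<Rightarrow> real \<Rightarrow> nat \<Rightarrow> real" where
  "moment t l r = (\<Sum>j\<le>r. stable_coeff \<alpha> r j * t ^ j * l powr (real j * \<alpha> - real r)) * exp (- t * l powr \<alpha>)"

lemma nn_moment_X:
  assumes t: "t \<in> {0..1}" and l: "0 < l"
  shows "(\<integral>\<^sup>+\<omega>. ennreal (X t \<omega> ^ r * exp (- l * X t \<omega>)) \<partial>M) = ennreal (moment t l r)"
proof -
  have [measurable]: "X t \<in> borel_measurable M" by (rule X_measurable[OF t])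
  have int: "integrable M (\<lambda>\<omega>. exp (- l * X t \<omega>))" if "0 < l" for l
    using Laplace_X_has_integral[OF t that] by (rule has_bochner_integral_iff[THEN iffD1, THEN conjunct1])
  have "(\<integral>\<^sup>+\<omega>. ennreal (X t \<omega> ^ r * exp (- l * X t \<omega>)) \<partial>M) = ennreal (\<integral>\<omega>. X t \<omega> ^ r * exp (- l * X t \<omega>) \<partial>M)"
    by (rule nn_integral_eq_integral[OF integrable_moment_Laplace[OF _ X_nonneg[OF t] int l]])
      (use X_nonneg[OF t] in \<open>auto elim!: eventually_mono\<close>)
  also have "(\<integral>\<omega>. X t \<omega> ^ r * exp (- l * X t \<omega>) \<partial>M) = moment t l r"
    unfolding moment_def
    by (rule stable_moment[OF _ X_nonneg[OF t] Laplace_X_has_integral[OF t] l]) auto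
  finally show ?thesis .
qed

lemma moment_nonneg:
  assumes t: "t \<in> {0..1}" and l: "0 < l"
  shows "0 \<le> moment t l r"
proof -
  have [measurable]: "X t \<in> borel_measurable M" by (rule X_measurable[OF t])
  have "moment t l r = (\<integral>\<omega>. X t \<omega> ^ r * exp (- l * X t \<omega>) \<partial>M)"
    unfolding moment_def
    by (rule stable_moment[OF _ X_nonneg[OF t] Laplace_X_has_integral[OF t] l, symmetric]) auto
  also have "\<dots> \<ge> 0"
    using X_nonneg[OF t] by (intro integral_nonneg_AE) (auto elim!: eventually_mono)
  finally show ?thesis .
qed

abbreviation incr :: "nat \<Rightarrow> nat \<Rightarrow> 'a \<Rightarrow> real" where
  "incr m l \<omega> \<equiv> dyadic_increment (\<lambda>t. X t \<omega>) m l"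

lemma incr_measurable[measurable]: "incr m l \<in> borel_measurable M"
proof (cases "l < 2 ^ m")
  case True
  have [measurable]: "X (real l / 2 ^ m) \<in> borel_measurable M" "X (real (Suc l) / 2 ^ m) \<in> borel_measurable M"
    using True by (intro X_measurable dyadic_point_mem; simp)+
  show ?thesis unfolding dyadic_increment_def by simp
qed (simp add: dyadic_increment_def)

lemma regular_path_incr_nonneg: "regular_path \<omega> \<Longrightarrow> 0 \<le> incr m l \<omega>"
  by (rule dyadic_increment_nonneg) (simp add: regular_path_def)

lemma regular_path_sum_incr: "regular_path \<omega> \<Longrightarrow> (\<Sum>l<2 ^ m. incr m l \<omega>) = X 1 \<omega>"
  by (simp add: sum_dyadic_increment regular_path_def)

lemma nn_integral_incr:
  assumes "l < 2 ^ m" and [measurable]: "g \<in> borel_measurable borel"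
  shows "(\<integral>\<^sup>+\<omega>. g (incr m l \<omega>) \<partial>M) = (\<integral>\<^sup>+\<omega>. g (X (1 / 2 ^ m) \<omega>) \<partial>M)"
proof -
  let ?s = "real l / 2 ^ m" and ?t = "real (Suc l) / 2 ^ m"
  have s: "?s \<in> {0..1}" "?t \<in> {0..1}" "1 / 2 ^ m \<in> {0..(1::real)}"
    using assms(1) by (intro dyadic_point_mem; simp)+ simp
  note [measurable] = s[THEN X_measurable]
  have "?s \<le> ?t" by (simp add: divide_right_mono)
  then have "distr M borel (\<lambda>\<omega>. X ?t \<omega> - X ?s \<omega>) = distr M borel (X (?t - ?s))"
    using subord s by (simp add: subordinator_def)
  also have "?t - ?s = 1 / 2 ^ m" by (simp add: field_simps)
  finally have d: "distr M borel (\<lambda>\<omega>. X ?t \<omega> - X ?s \<omega>) = distr M borel (X (1 / 2 ^ m))" .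
  have "(\<integral>\<^sup>+\<omega>. g (incr m l \<omega>) \<partial>M) = (\<integral>\<^sup>+\<omega>. g (X ?t \<omega> - X ?s \<omega>) \<partial>M)"
    using assms(1) by (simp add: dyadic_increment_def)
  also have "\<dots> = (\<integral>\<^sup>+x. g x \<partial>distr M borel (\<lambda>\<omega>. X ?t \<omega> - X ?s \<omega>))"
    by (rule nn_integral_distr[symmetric]) measurable
  also have "\<dots> = (\<integral>\<^sup>+\<omega>. g (X (1 / 2 ^ m) \<omega>) \<partial>M)"
    unfolding d by (rule nn_integral_distr) measurable
  finally show ?thesis .
qed

lemma nn_integral_prod_incr:
  assumes [measurable]: "\<And>l. g l \<in> borel_measurable borel"
  shows "(\<integral>\<^sup>+\<omega>. (\<Prod>l<2 ^ m. g l (incr m l \<omega>)) \<partial>M) = (\<Prod>l<2 ^ m. \<integral>\<^sup>+\<omega>. g l (X (1 / 2 ^ m) \<omega>) \<partial>M)"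
proof -
  let ?t = "\<lambda>l. real l / 2 ^ m"
  have grid: "(0::real) \<le> ?t 0 \<and> (\<forall>i<2 ^ m. ?t i \<le> ?t (Suc i)) \<and> ?t (2 ^ m) \<le> 1"
    by (simp add: divide_right_mono)
  have "indep_vars (\<lambda>_. borel) (\<lambda>i \<omega>. X (?t (Suc i)) \<omega> - X (?t i) \<omega>) {..<2 ^ m}"
    by (rule subord[unfolded subordinator_def, THEN conjunct2, THEN conjunct2, THEN conjunct2,
      THEN conjunct1, THEN spec, THEN spec, THEN mp, OF grid])
  then have "indep_vars (\<lambda>_. borel) (\<lambda>i \<omega>. g i (X (?t (Suc i)) \<omega> - X (?t i) \<omega>)) {..<2 ^ m}"
    by (rule indep_vars_compose2) simp
  then have ind: "(\<integral>\<^sup>+\<omega>. (\<Prod>l<2 ^ m. g l (X (?t (Suc l)) \<omega> - X (?t l) \<omega>)) \<partial>M)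
      = (\<Prod>l<2 ^ m. \<integral>\<^sup>+\<omega>. g l (X (?t (Suc l)) \<omega> - X (?t l) \<omega>) \<partial>M)"
    by (intro indep_vars_nn_integral) auto
  have "(\<integral>\<^sup>+\<omega>. (\<Prod>l<2 ^ m. g l (incr m l \<omega>)) \<partial>M)
      = (\<integral>\<^sup>+\<omega>. (\<Prod>l<2 ^ m. g l (X (?t (Suc l)) \<omega> - X (?t l) \<omega>)) \<partial>M)"
    by (intro nn_integral_cong prod.cong refl) (simp add: dyadic_increment_def)
  also note ind
  also have "(\<Prod>l<2 ^ m. \<integral>\<^sup>+\<omega>. g l (X (?t (Suc l)) \<omega> - X (?t l) \<omega>) \<partial>M)
      = (\<Prod>l<2 ^ m. \<integral>\<^sup>+\<omega>. g l (incr m l \<omega>) \<partial>M)"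
    by (intro nn_integral_cong prod.cong refl) (simp add: dyadic_increment_def)
  also have "\<dots> = (\<Prod>l<2 ^ m. \<integral>\<^sup>+\<omega>. g l (X (1 / 2 ^ m) \<omega>) \<partial>M)"
    by (intro prod.cong refl nn_integral_incr) auto
  finally show ?thesis .
qed

lemma exp_X_1: "regular_path \<omega> \<Longrightarrow> ennreal (exp (- l * X 1 \<omega>)) = (\<Prod>i<2 ^ m. ennreal (exp (- l * incr m i \<omega>)))"
  unfolding regular_path_sum_incr[symmetric, of \<omega> m] sum_distrib_left exp_sum[OF finite_lessThan]
  by (simp add: prod_ennreal)

text \<open>
  \<open>exp (- l X 1)\<close> factorises over the increments, which are independent with a common law,
  so each of the \<open>2 ^ m\<close> summands contributes the same product.
\<close>
lemma nn_integral_one_increment: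
  assumes [measurable]: "g \<in> borel_measurable borel" and l: "0 < l"
  shows "(\<integral>\<^sup>+\<omega>. ennreal (exp (- l * X 1 \<omega>)) * (\<Sum>i<2 ^ m. g (incr m i \<omega>)) \<partial>M)
    = 2 ^ m * ((\<integral>\<^sup>+\<omega>. ennreal (exp (- l * X (1 / 2 ^ m) \<omega>)) * g (X (1 / 2 ^ m) \<omega>) \<partial>M)
        * ennreal (exp (- ((2 ^ m - 1) / 2 ^ m) * l powr \<alpha>)))"
proof -
  let ?Y = "X (1 / 2 ^ m)"
  note [measurable] = X_measurable[OF dyadic_time_mem[of m]]
  have [measurable]: "X 1 \<in> borel_measurable M" by (rule X_measurable) simp
  let ?E = "\<integral>\<^sup>+\<omega>. ennreal (exp (- l * ?Y \<omega>)) * g (?Y \<omega>) \<partial>M"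
  have e0: "(\<integral>\<^sup>+\<omega>. ennreal (exp (- l * ?Y \<omega>)) \<partial>M) = ennreal (exp (- (1 / 2 ^ m) * l powr \<alpha>))"
    using nn_moment_X[OF dyadic_time_mem l, of m 0] l by (simp add: moment_def)
  have "(\<integral>\<^sup>+\<omega>. ennreal (exp (- l * X 1 \<omega>)) * (\<Sum>i<2 ^ m. g (incr m i \<omega>)) \<partial>M)
      = (\<Sum>i<2 ^ m. \<integral>\<^sup>+\<omega>. ennreal (exp (- l * X 1 \<omega>)) * g (incr m i \<omega>) \<partial>M)"
    by (simp only: sum_distrib_left) (rule nn_integral_sum, measurable)
  also have "\<dots> = (\<Sum>i<(2 ^ m :: nat). ?E * ennreal (exp (- ((2 ^ m - 1) / 2 ^ m) * l powr \<alpha>)))"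
  proof (intro sum.cong refl)
    fix i :: nat assume i: "i \<in> {..<2 ^ m}"
    have "(\<integral>\<^sup>+\<omega>. ennreal (exp (- l * X 1 \<omega>)) * g (incr m i \<omega>) \<partial>M)
      = (\<integral>\<^sup>+\<omega>. (\<Prod>j<2 ^ m. (\<lambda>x. ennreal (exp (- l * x)) * (if j = i then g x else 1)) (incr m j \<omega>)) \<partial>M)"
      using AE_regular_path
    proof (intro nn_integral_cong_AE, eventually_elim)
      case (elim \<omega>)
      show ?case
        unfolding exp_X_1[OF elim(2), of l m] prod.distrib using i by simp
    qed
    also have "\<dots> = (\<Prod>j<2 ^ m. \<integral>\<^sup>+\<omega>. (\<lambda>x. ennreal (exp (- l * x)) * (if j = i then g x else 1)) (?Y \<omega>) \<partial>M)"
      by (rule nn_integral_prod_incr) auto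
    also have "\<dots> = (\<Prod>j<2 ^ m. if j = i then ?E else ennreal (exp (- (1 / 2 ^ m) * l powr \<alpha>)))"
      unfolding e0[symmetric] by (intro prod.cong) auto
    also have "\<dots> = ?E * ennreal (exp (- (1 / 2 ^ m) * l powr \<alpha>)) ^ (2 ^ m - 1)"
      using i by (subst prod.remove[of _ i]) auto
    also have "ennreal (exp (- (1 / 2 ^ m) * l powr \<alpha>)) ^ (2 ^ m - 1) = ennreal (exp (- ((2 ^ m - 1) / 2 ^ m) * l powr \<alpha>))"
      by (simp add: ennreal_power exp_of_nat_mult[symmetric] of_nat_diff)
    finally show "(\<integral>\<^sup>+\<omega>. ennreal (exp (- l * X 1 \<omega>)) * g (incr m i \<omega>) \<partial>M)
      = ?E * ennreal (exp (- ((2 ^ m - 1) / 2 ^ m) * l powr \<alpha>))" .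
  qed
  finally show ?thesis by simp
qed

text \<open>
  Each cell contributes a moment of size about \<open>2 ^ (- m)\<close>, so the \<open>2 ^ m\<close> cells together
  have a limit.
\<close>
lemma scaled_moment_tendsto:
  assumes "0 < l" "0 < r"
  shows "(\<lambda>m. 2 ^ m * moment (1 / 2 ^ m) l r) \<longlonglongrightarrow> \<alpha> * pochhammer (1 - \<alpha>) (r - 1) * l powr (\<alpha> - real r)"
  using filterlim_compose[OF stable_moment_asymptotics[OF assms, of \<alpha>] inverse_dyadic_at_right]
  by (simp add: moment_def mult_ac)

lemma regular_path_sums_tendsto:
  assumes \<omega>: "regular_path \<omega>"
    and q: "continuous_on UNIV q" "\<And>x. 0 \<le> x \<Longrightarrow> 0 \<le> q x" "q 0 = (0::real)"
  shows "(\<lambda>m. \<integral>\<^sup>+i. ennreal (incr m i \<omega> * q (incr m i \<omega>)) \<partial>count_space UNIV)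
    \<longlonglongrightarrow> (\<integral>\<^sup>+i. ennreal (J i \<omega> * q (J i \<omega>)) \<partial>count_space UNIV)"
proof -
  obtain \<tau> where \<tau>: "bij_betw \<tau> (UNIV :: nat set) {t \<in> {0<..1}. 0 < X t \<omega> - Lim (at_left t) (\<lambda>u. X u \<omega>)}"
    "\<forall>i. J i \<omega> = X (\<tau> i) \<omega> - Lim (at_left (\<tau> i)) (\<lambda>u. X u \<omega>)"
    using \<omega> unfolding regular_path_def by blast
  have "mono_on {0..1} (\<lambda>t. X t \<omega>)" "X 0 \<omega> = 0" "\<And>t. t \<in> {0..<1} \<Longrightarrow> continuous (at_right t) (\<lambda>u. X u \<omega>)"
    using \<omega> by (simp_all add: regular_path_def)
  from dyadic_sums_tendsto_jump_sum[OF this \<tau>(1) q] show ?thesis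
    using \<tau>(2) by simp
qed

lemma regular_path_sum_J_le:
  assumes \<omega>: "regular_path \<omega>"
  shows "(\<integral>\<^sup>+i. ennreal (J i \<omega>) \<partial>count_space UNIV) \<le> ennreal (X 1 \<omega>)"
proof -
  obtain \<tau> where \<tau>: "bij_betw \<tau> (UNIV :: nat set) {t \<in> {0<..1}. 0 < X t \<omega> - Lim (at_left t) (\<lambda>u. X u \<omega>)}"
    "\<forall>i. J i \<omega> = X (\<tau> i) \<omega> - Lim (at_left (\<tau> i)) (\<lambda>u. X u \<omega>)"
    using \<omega> unfolding regular_path_def by blast
  have "mono_on {0..1} (\<lambda>t. X t \<omega>)" "X 0 \<omega> = 0" "\<And>t. t \<in> {0..<1} \<Longrightarrow> continuous (at_right t) (\<lambda>u. X u \<omega>)"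
    using \<omega> by (simp_all add: regular_path_def)
  from sum_jumps_le[OF this \<tau>(1)] show ?thesis
    using \<tau>(2) by simp
qed

lemma nn_integral_count_incr:
  assumes "g 0 = (0::ennreal)"
  shows "(\<integral>\<^sup>+i. g (incr m i \<omega>) \<partial>count_space UNIV) = (\<Sum>i<2 ^ m. g (incr m i \<omega>))"
  by (rule nn_integral_count_space') (use assms in \<open>auto simp: dyadic_increment_def\<close>)

lemma regular_path_sum_incr_ennreal:
  "regular_path \<omega> \<Longrightarrow> (\<integral>\<^sup>+i. ennreal (incr m i \<omega>) \<partial>count_space UNIV) = ennreal (X 1 \<omega>)"
  by (simp add: nn_integral_count_incr sum_ennreal regular_path_incr_nonneg regular_path_sum_incr)

lemma X_1_measurable[measurable]: "X 1 \<in> borel_measurable M"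
  by (rule X_measurable) simp

lemma moment_1: "0 < l \<Longrightarrow> moment t l 1 = \<alpha> * t * l powr (\<alpha> - 1) * exp (- t * l powr \<alpha>)"
  by (simp add: moment_def)

text \<open>
  The weight \<open>1 - exp (- y x)\<close> vanishes at 0, so the increment sums converge to the jump
  sum. Their expectation is a difference of two first moments, at \<open>1\<close> and at \<open>1 + y\<close>.
\<close>
lemma Laplace_weighted_jump_sum:
  fixes y :: real
  assumes y: "0 < y"
  shows "(\<integral>\<^sup>+\<omega>. ennreal (exp (- X 1 \<omega>)) * (\<integral>\<^sup>+i. ennreal (J i \<omega> * (1 - exp (- y * J i \<omega>))) \<partial>count_space UNIV) \<partial>M)
    = ennreal (\<alpha> * (1 - (1 + y) powr (\<alpha> - 1)) * exp (- 1))"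
proof -
  let ?q = "\<lambda>x. 1 - exp (- y * x) :: real"
  let ?e = "\<lambda>\<omega>. ennreal (exp (- X 1 \<omega>))"
  define S where "S m \<omega> = (\<integral>\<^sup>+i. ennreal (incr m i \<omega> * ?q (incr m i \<omega>)) \<partial>count_space UNIV)" for m \<omega>
  have S: "S m \<omega> = (\<Sum>i<2 ^ m. ennreal (incr m i \<omega> * ?q (incr m i \<omega>)))" for m \<omega>
    unfolding S_def by (rule nn_integral_count_incr) simp
  have [measurable]: "S m \<in> borel_measurable M" for m unfolding S by measurable
  have val: "(\<integral>\<^sup>+\<omega>. ?e \<omega> * S m \<omega> \<partial>M) =
    ennreal ((2 ^ m * moment (1 / 2 ^ m) 1 1 - 2 ^ m * moment (1 / 2 ^ m) (1 + y) 1) * exp (- ((2 ^ m - 1) / 2 ^ m) * 1 powr \<alpha>))" for m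
  proof -
    let ?Y = "X (1 / 2 ^ m)" and ?t = "1 / 2 ^ m :: real"
    note [measurable] = X_measurable[OF dyadic_time_mem[of m]]
    define E where "E = (\<integral>\<^sup>+\<omega>. ennreal (exp (- 1 * ?Y \<omega>)) * ennreal (?Y \<omega> * ?q (?Y \<omega>)) \<partial>M)"
    have "E + ennreal (moment ?t (1 + y) 1) = ennreal (moment ?t 1 1)"
      unfolding E_def nn_moment_X[OF dyadic_time_mem zero_less_one, symmetric]
        nn_moment_X[OF dyadic_time_mem, of "1 + y", symmetric, OF add_pos_pos[OF zero_less_one y]]
    proof (subst nn_integral_add[symmetric], measurable, intro nn_integral_cong_AE)
      show "AE \<omega> in M. ennreal (exp (- 1 * ?Y \<omega>)) * ennreal (?Y \<omega> * ?q (?Y \<omega>)) + ennreal (?Y \<omega> ^ 1 * exp (- (1 + y) * ?Y \<omega>))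
        = ennreal (?Y \<omega> ^ 1 * exp (- 1 * ?Y \<omega>))"
        using X_nonneg[OF dyadic_time_mem[of m]]
      proof eventually_elim
        case (elim \<omega>)
        have q: "0 \<le> ?q (?Y \<omega>)" using elim y by simp
        have "ennreal (exp (- 1 * ?Y \<omega>)) * ennreal (?Y \<omega> * ?q (?Y \<omega>)) + ennreal (?Y \<omega> ^ 1 * exp (- (1 + y) * ?Y \<omega>))
          = ennreal (exp (- 1 * ?Y \<omega>) * (?Y \<omega> * ?q (?Y \<omega>)) + ?Y \<omega> ^ 1 * exp (- (1 + y) * ?Y \<omega>))"
          using elim q by (subst ennreal_plus) (auto simp: ennreal_mult)
        also have "exp (- 1 * ?Y \<omega>) * (?Y \<omega> * ?q (?Y \<omega>)) + ?Y \<omega> ^ 1 * exp (- (1 + y) * ?Y \<omega>) = ?Y \<omega> ^ 1 * exp (- 1 * ?Y \<omega>)"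
          by (simp add: algebra_simps exp_diff exp_add[symmetric] exp_minus divide_inverse)
        finally show ?case .
      qed
    qed
    \<comment> \<open>\<open>E\<close> is finite, so the identity for the sum can be solved for it.\<close>
    then have E: "E = ennreal (moment ?t 1 1 - moment ?t (1 + y) 1)"
      using moment_nonneg[OF dyadic_time_mem, of "1 + y" m 1] y
      by (metis add_pos_pos ennreal_add_diff_cancel_right ennreal_minus ennreal_neq_top infinity_ennreal_def zero_less_one)
    have "(\<integral>\<^sup>+\<omega>. ?e \<omega> * S m \<omega> \<partial>M) = 2 ^ m * (E * ennreal (exp (- ((2 ^ m - 1) / 2 ^ m) * 1 powr \<alpha>)))"
      using nn_integral_one_increment[of "\<lambda>x. ennreal (x * ?q x)" 1 m] unfolding S E_def by simp
    also have "\<dots> = ennreal (2 ^ m) * (ennreal (moment ?t 1 1 - moment ?t (1 + y) 1) * ennreal (exp (- ((2 ^ m - 1) / 2 ^ m) * 1 powr \<alpha>)))"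
      unfolding E by (simp add: ennreal_power[symmetric])
    also have "\<dots> = ennreal ((2 ^ m * moment ?t 1 1 - 2 ^ m * moment ?t (1 + y) 1) * exp (- ((2 ^ m - 1) / 2 ^ m) * 1 powr \<alpha>))"
      by (simp only: ennreal_mult'[symmetric] ennreal_mult''[symmetric] exp_ge_zero zero_le_power zero_le_numeral right_diff_distrib[symmetric] mult.assoc)
    finally show ?thesis .
  qed
  have "(\<lambda>m. \<integral>\<^sup>+\<omega>. ?e \<omega> * S m \<omega> \<partial>M) \<longlonglongrightarrow>
    ennreal ((\<alpha> * pochhammer (1 - \<alpha>) (1 - 1) * 1 powr (\<alpha> - real 1) - \<alpha> * pochhammer (1 - \<alpha>) (1 - 1) * (1 + y) powr (\<alpha> - real 1)) * exp (- (1 powr \<alpha>)))"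
    unfolding val using y
    by (intro tendsto_ennrealI tendsto_mult tendsto_diff scaled_moment_tendsto exp_rest_tendsto) auto
  moreover have "(\<lambda>m. \<integral>\<^sup>+\<omega>. ?e \<omega> * S m \<omega> \<partial>M) \<longlonglongrightarrow>
    (\<integral>\<^sup>+\<omega>. ?e \<omega> * (\<integral>\<^sup>+i. ennreal (J i \<omega> * ?q (J i \<omega>)) \<partial>count_space UNIV) \<partial>M)"
  proof (rule nn_integral_dominated_convergence[where w="\<lambda>\<omega>. ennreal (X 1 \<omega> ^ 1 * exp (- 1 * X 1 \<omega>))"])
    show "(\<lambda>\<omega>. ?e \<omega> * (\<integral>\<^sup>+i. ennreal (J i \<omega> * ?q (J i \<omega>)) \<partial>count_space UNIV)) \<in> borel_measurable M"
      unfolding nn_integral_count_space_nat by measurable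
    show "AE \<omega> in M. ?e \<omega> * S m \<omega> \<le> ennreal (X 1 \<omega> ^ 1 * exp (- 1 * X 1 \<omega>))" for m
      using AE_regular_path
    proof eventually_elim
      case (elim \<omega>)
      have D: "0 \<le> incr m i \<omega>" for i by (rule regular_path_incr_nonneg[OF elim])
      have "S m \<omega> \<le> (\<integral>\<^sup>+i. ennreal (incr m i \<omega>) \<partial>count_space UNIV)"
        unfolding S_def by (intro nn_integral_mono ennreal_leI) (use D y in \<open>auto intro: mult_left_le\<close>)
      also have "\<dots> = ennreal (X 1 \<omega>)" by (rule regular_path_sum_incr_ennreal[OF elim])
      finally show ?case
        by (auto simp: ennreal_mult'' mult.commute intro!: mult_right_mono)
    qed
    show "(\<integral>\<^sup>+\<omega>. ennreal (X 1 \<omega> ^ 1 * exp (- 1 * X 1 \<omega>)) \<partial>M) < \<infinity>"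
      by (subst nn_moment_X) auto
    show "AE \<omega> in M. (\<lambda>m. ?e \<omega> * S m \<omega>) \<longlonglongrightarrow> ?e \<omega> * (\<integral>\<^sup>+i. ennreal (J i \<omega> * ?q (J i \<omega>)) \<partial>count_space UNIV)"
      using AE_regular_path
    proof eventually_elim
      case (elim \<omega>)
      have "(\<lambda>m. S m \<omega>) \<longlonglongrightarrow> (\<integral>\<^sup>+i. ennreal (J i \<omega> * ?q (J i \<omega>)) \<partial>count_space UNIV)"
        unfolding S_def
        by (rule regular_path_sums_tendsto[OF elim, of ?q]) (use y in \<open>auto intro!: continuous_intros\<close>)
      then show ?case by (intro ennreal_tendsto_cmult) auto
    qed
  qed measurable
  ultimately show ?thesis
    using LIMSEQ_unique by (fastforce simp: right_diff_distrib)
qed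

text \<open>
  A path is the sum of its jumps almost surely: letting \<open>y\<close> tend to infinity in
  \<open>Laplace_weighted_jump_sum\<close>, the jumps account for at least \<open>\<alpha> * exp (- 1)\<close>, which
  is the expectation of \<open>exp (- X 1) * X 1\<close>. As the jump sum never exceeds \<open>X 1\<close>, the two
  agree.
\<close>
lemma AE_sum_J_eq: "AE \<omega> in M. (\<integral>\<^sup>+i. ennreal (J i \<omega>) \<partial>count_space UNIV) = ennreal (X 1 \<omega>)"
proof -
  let ?e = "\<lambda>\<omega>. ennreal (exp (- X 1 \<omega>))"
  define T where "T \<omega> = (\<integral>\<^sup>+i. ennreal (J i \<omega>) \<partial>count_space UNIV)" for \<omega>
  have [measurable]: "T \<in> borel_measurable M" unfolding T_def nn_integral_count_space_nat by measurable
  have T_le: "AE \<omega> in M. T \<omega> \<le> ennreal (X 1 \<omega>)"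
    using AE_regular_path by eventually_elim (simp add: T_def regular_path_sum_J_le)
  have tot: "(\<integral>\<^sup>+\<omega>. ?e \<omega> * ennreal (X 1 \<omega>) \<partial>M) = ennreal (\<alpha> * exp (- 1))"
  proof -
    have "(\<integral>\<^sup>+\<omega>. ?e \<omega> * ennreal (X 1 \<omega>) \<partial>M) = (\<integral>\<^sup>+\<omega>. ennreal (X 1 \<omega> ^ 1 * exp (- 1 * X 1 \<omega>)) \<partial>M)"
      by (intro nn_integral_cong) (simp add: ennreal_mult'' mult.commute)
    also have "\<dots> = ennreal (moment 1 1 1)"
      by (rule nn_moment_X) auto
    also have "\<dots> = ennreal (\<alpha> * exp (- 1))"
      unfolding moment_1[OF zero_less_one] by simp
    finally show ?thesis .
  qed
  have "ennreal (\<alpha> * (1 - 0) * exp (- 1)) \<le> (\<integral>\<^sup>+\<omega>. ?e \<omega> * T \<omega> \<partial>M)"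
  proof (rule LIMSEQ_le_const2)
    have "(\<lambda>n. (1 + real n) powr (\<alpha> - 1)) \<longlonglongrightarrow> 0"
      using \<alpha> by (intro tendsto_neg_powr filterlim_tendsto_add_at_top[OF tendsto_const] filterlim_real_sequentially) auto
    then show "(\<lambda>n. ennreal (\<alpha> * (1 - (1 + real n) powr (\<alpha> - 1)) * exp (- 1))) \<longlonglongrightarrow> ennreal (\<alpha> * (1 - 0) * exp (- 1))"
      by (intro tendsto_intros)
    have "ennreal (\<alpha> * (1 - (1 + real n) powr (\<alpha> - 1)) * exp (- 1)) \<le> (\<integral>\<^sup>+\<omega>. ?e \<omega> * T \<omega> \<partial>M)" if "1 \<le> n" for n
    proof -
      have n: "0 < real n" using that by simp
      show ?thesis
        unfolding Laplace_weighted_jump_sum[OF n, symmetric]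
      proof (intro nn_integral_mono_AE, use AE_regular_path in eventually_elim)
        case (elim \<omega>)
        show ?case
          unfolding T_def using regular_path_J_pos[OF elim] n
          by (intro mult_left_mono nn_integral_mono ennreal_leI) (auto intro!: mult_left_le less_imp_le)
      qed
    qed
    then show "\<exists>N. \<forall>n\<ge>N. ennreal (\<alpha> * (1 - (1 + real n) powr (\<alpha> - 1)) * exp (- 1)) \<le> (\<integral>\<^sup>+\<omega>. ?e \<omega> * T \<omega> \<partial>M)"
      by blast
  qed
  then have ge: "(\<integral>\<^sup>+\<omega>. ?e \<omega> * ennreal (X 1 \<omega>) \<partial>M) \<le> (\<integral>\<^sup>+\<omega>. ?e \<omega> * T \<omega> \<partial>M)"
    unfolding tot by simp
  have le: "AE \<omega> in M. ?e \<omega> * T \<omega> \<le> ?e \<omega> * ennreal (X 1 \<omega>)"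
    using T_le by eventually_elim (auto intro: mult_left_mono)
  have fin: "(\<integral>\<^sup>+\<omega>. ?e \<omega> * T \<omega> \<partial>M) \<noteq> \<infinity>"
    using nn_integral_mono_AE[OF le] unfolding tot by (auto simp: top_unique)
  have "(\<integral>\<^sup>+\<omega>. ?e \<omega> * ennreal (X 1 \<omega>) - ?e \<omega> * T \<omega> \<partial>M) = 0"
    using ge by (subst nn_integral_diff[OF _ _ fin le]) (auto simp: diff_eq_0_iff_ennreal tot)
  then have "AE \<omega> in M. ?e \<omega> * ennreal (X 1 \<omega>) - ?e \<omega> * T \<omega> = 0"
    by (subst (asm) nn_integral_0_iff_AE) auto
  then show ?thesis using T_le
  proof eventually_elim
    case (elim \<omega>)
    have "?e \<omega> * ennreal (X 1 \<omega>) \<le> ?e \<omega> * T \<omega>"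
      using elim(1) by (auto simp: diff_eq_0_iff_ennreal ennreal_mult_eq_top_iff)
    then have "ennreal (X 1 \<omega>) \<le> T \<omega>"
      by (simp add: ennreal_mult_le_mult_iff)
    then show ?case using elim(2) by (simp add: T_def)
  qed
qed

lemma AE_pure_jump_path: "AE \<omega> in M. regular_path \<omega> \<and> total_mass J \<omega> = X 1 \<omega> \<and>
  (\<integral>\<^sup>+i. ennreal (J i \<omega>) \<partial>count_space UNIV) = ennreal (X 1 \<omega>)"
  using AE_regular_path AE_sum_J_eq X_nonneg[of 1, simplified]
proof eventually_elim
  case (elim \<omega>)
  have pos: "0 \<le> J i \<omega>" for i using regular_path_J_pos[OF elim(1)] by (rule less_imp_le)
  have sum: "(\<Sum>i. ennreal (J i \<omega>)) = ennreal (X 1 \<omega>)"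
    using elim(2) by (simp add: nn_integral_count_space_nat)
  have "summable (\<lambda>i. J i \<omega>)"
    by (rule summable_suminf_not_top) (use pos sum in auto)
  then have "ennreal (\<Sum>i. J i \<omega>) = ennreal (X 1 \<omega>)"
    using suminf_ennreal2[OF pos] sum by simp
  moreover have "0 \<le> (\<Sum>i. J i \<omega>)" by (rule suminf_nonneg) (use \<open>summable _\<close> pos in auto)
  ultimately have "total_mass J \<omega> = X 1 \<omega>" using elim(3) by (simp add: total_mass_def)
  then show ?case using elim by simp
qed

lemma total_mass_measurable[measurable]: "total_mass J \<in> borel_measurable M"
  unfolding total_mass_def[abs_def] by measurable

text \<open>
  The tuples of distinct cells all have the same expectation by independence; there are
  \<open>2 ^ m (2 ^ m - 1) ...\<close> of them, whose factors are distributed here over the moments.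
\<close>
lemma Laplace_distinct_sum_incr:
  assumes l: "0 < l" and ns: "0 \<notin> set ns"
  shows "(\<integral>\<^sup>+\<omega>. ennreal (exp (- l * X 1 \<omega>)) * distinct_sum (\<lambda>i. ennreal (incr m i \<omega>)) ns \<partial>M)
    = ennreal ((\<Prod>j<length ns. (1 - real j * (1 / 2 ^ m)) * (2 ^ m * moment (1 / 2 ^ m) l (ns ! j)))
        * exp (- ((2 ^ m - real (length ns)) / 2 ^ m) * l powr \<alpha>))"
proof -
  let ?Y = "X (1 / 2 ^ m)" and ?t = "1 / 2 ^ m :: real" and ?N = "2 ^ m :: nat" and ?k = "length ns"
  note [measurable] = X_measurable[OF dyadic_time_mem[of m]]
  define C where "C = (\<Prod>j<?k. ennreal (moment ?t l (ns ! j))) * ennreal (moment ?t l 0) ^ (?N - ?k)"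
  define R where "R = {ks :: nat list. length ks = ?k \<and> distinct ks \<and> set ks \<subseteq> {..<?N}}"
  have fin: "finite R"
    unfolding R_def by (rule finite_subset[OF _ finite_lists_length_eq[of "{..<?N}" ?k]]) auto
  have summand: "(\<integral>\<^sup>+\<omega>. ennreal (exp (- l * X 1 \<omega>)) * index_weight (\<lambda>i. ennreal (incr m i \<omega>)) ns ks \<partial>M)
      = (if set ks \<subseteq> {..<?N} then C else 0)" if ks: "length ks = ?k" "distinct ks" for ks
  proof (cases "set ks \<subseteq> {..<?N}")
    case True
    have "(\<integral>\<^sup>+\<omega>. ennreal (exp (- l * X 1 \<omega>)) * index_weight (\<lambda>i. ennreal (incr m i \<omega>)) ns ks \<partial>M)
      = (\<integral>\<^sup>+\<omega>. (\<Prod>i<?N. (\<lambda>x. ennreal (exp (- l * x)) * ennreal x ^ multiplicity_at ns ks i) (incr m i \<omega>)) \<partial>M)"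
      using AE_regular_path
    proof (intro nn_integral_cong_AE, eventually_elim)
      case (elim \<omega>)
      show ?case
        unfolding exp_X_1[OF elim(2), of l m] prod.distrib index_weight_eq_prod_over_range[OF ks(1) True] ..
    qed
    also have "\<dots> = (\<Prod>i<?N. \<integral>\<^sup>+\<omega>. (\<lambda>x. ennreal (exp (- l * x)) * ennreal x ^ multiplicity_at ns ks i) (?Y \<omega>) \<partial>M)"
      by (rule nn_integral_prod_incr) auto
    also have "\<dots> = (\<Prod>i<?N. ennreal (moment ?t l (multiplicity_at ns ks i)))"
    proof (intro prod.cong refl)
      fix i
      show "(\<integral>\<^sup>+\<omega>. (\<lambda>x. ennreal (exp (- l * x)) * ennreal x ^ multiplicity_at ns ks i) (?Y \<omega>) \<partial>M)
        = ennreal (moment ?t l (multiplicity_at ns ks i))"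
        unfolding nn_moment_X[OF dyadic_time_mem l, symmetric]
        using X_nonneg[OF dyadic_time_mem[of m]]
        by (intro nn_integral_cong_AE) (auto elim!: eventually_mono simp: ennreal_power ennreal_mult mult.commute)
    qed
    also have "\<dots> = C"
      unfolding C_def by (rule prod_over_range_multiplicity[OF ks True])
    finally show ?thesis using True by simp
  next
    case False
    then obtain j where j: "j < ?k" "?N \<le> ks ! j"
      using ks(1) by (metis in_set_conv_nth lessThan_iff not_le subsetI)
    have "0 < ns ! j" using ns j(1) by (metis gr0I nth_mem)
    then have "index_weight (\<lambda>i. ennreal (incr m i \<omega>)) ns ks = 0" for \<omega>
      unfolding index_weight_def using j
      by (intro prod_zero bexI[of _ j]) (auto simp: dyadic_increment_def zero_power)
    then show ?thesis using False by simp
  qed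
  have "(\<integral>\<^sup>+\<omega>. ennreal (exp (- l * X 1 \<omega>)) * distinct_sum (\<lambda>i. ennreal (incr m i \<omega>)) ns \<partial>M)
    = (\<integral>\<^sup>+ks. (if length ks = ?k \<and> distinct ks then
        \<integral>\<^sup>+\<omega>. ennreal (exp (- l * X 1 \<omega>)) * index_weight (\<lambda>i. ennreal (incr m i \<omega>)) ns ks \<partial>M else 0) \<partial>count_space UNIV)"
    by (rule nn_integral_distinct_sum) measurable
  also have "\<dots> = (\<integral>\<^sup>+ks. C * indicator R ks \<partial>count_space UNIV)"
  proof (intro nn_integral_cong)
    fix ks
    show "(if length ks = ?k \<and> distinct ks then
        \<integral>\<^sup>+\<omega>. ennreal (exp (- l * X 1 \<omega>)) * index_weight (\<lambda>i. ennreal (incr m i \<omega>)) ns ks \<partial>M else 0) = C * indicator R ks"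
    proof (cases "length ks = ?k \<and> distinct ks")
      case True
      then show ?thesis
        unfolding summand[OF conjunct1[OF True] conjunct2[OF True]] by (simp add: R_def)
    qed (auto simp: R_def)
  qed
  also have "\<dots> = C * ennreal (real (card R))"
    using fin by (simp add: nn_integral_cmult_indicator emeasure_count_space_finite ennreal_of_nat_eq_real_of_nat)
  also have "real (card R) = (\<Prod>j<?k. real ?N - real j)"
    unfolding R_def by (rule card_distinct_lists)
  also have "C * ennreal (\<Prod>j<?k. real ?N - real j) = ennreal ((\<Prod>j<?k. (1 - real j * (1 / 2 ^ m)) * (2 ^ m * moment (1 / 2 ^ m) l (ns ! j)))
        * exp (- ((2 ^ m - real ?k) / 2 ^ m) * l powr \<alpha>))"
  proof (cases "?k \<le> ?N")
    case True
    have e0: "moment ?t l 0 = exp (- ?t * l powr \<alpha>)" using l by (simp add: moment_def)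
    have k: "real ?k \<le> 2 ^ m" using True by (metis of_nat_le_iff of_nat_numeral of_nat_power)
    have "C = ennreal ((\<Prod>j<?k. moment ?t l (ns ! j)) * exp (- ?t * l powr \<alpha>) ^ (?N - ?k))"
      unfolding C_def e0
      using moment_nonneg[OF dyadic_time_mem l] by (simp add: prod_ennreal ennreal_power ennreal_mult prod_nonneg)
    also have "exp (- ?t * l powr \<alpha>) ^ (?N - ?k) = exp (- ((2 ^ m - real ?k) / 2 ^ m) * l powr \<alpha>)"
      using True by (simp add: exp_of_nat_mult[symmetric] of_nat_diff)
    finally have C: "C = ennreal ((\<Prod>j<?k. moment ?t l (ns ! j)) * exp (- ((2 ^ m - real ?k) / 2 ^ m) * l powr \<alpha>))" .
    have "(\<Prod>j<?k. (1 - real j * (1 / 2 ^ m)) * (2 ^ m * moment (1 / 2 ^ m) l (ns ! j)))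
      = (\<Prod>j<?k. moment ?t l (ns ! j)) * (\<Prod>j<?k. real ?N - real j)"
      unfolding prod.distrib[symmetric] by (intro prod.cong refl) (simp add: field_simps)
    moreover have "0 \<le> (\<Prod>j<?k. real ?N - real j)" using k by (intro prod_nonneg) auto
    ultimately show ?thesis unfolding C
      using moment_nonneg[OF dyadic_time_mem l]
      by (subst ennreal_mult[symmetric]) (auto intro!: prod_nonneg mult_nonneg_nonneg simp: mult_ac)
  next
    case False
    then have z: "(\<Prod>j<?k. real ?N - real j) = 0" by (intro prod_zero) auto
    have z': "(\<Prod>j<?k. (1 - real j * (1 / 2 ^ m)) * (2 ^ m * moment (1 / 2 ^ m) l (ns ! j))) = 0"
      using False by (intro prod_zero bexI[of _ ?N]) auto
    show ?thesis by (simp only: z z' mult_zero_left mult_zero_right ennreal_0)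
  qed
  finally show ?thesis .
qed

text \<open>
  The limit of the dyadic formula. The power sums of the increments of order at least 2
  converge to those of the jumps, the first one by \<open>AE_sum_J_eq\<close>, and
  \<open>X 1 ^ n * exp (- l * X 1)\<close> dominates. This replaces the Palm formula for the Poisson
  process of jumps.
\<close>
theorem Laplace_distinct_sum_jumps:
  assumes l: "0 < l" and ns: "0 \<notin> set ns"
  shows "(\<integral>\<^sup>+\<omega>. ennreal (exp (- l * total_mass J \<omega>)) * distinct_sum (\<lambda>i. ennreal (J i \<omega>)) ns \<partial>M)
    = ennreal ((\<Prod>j<length ns. \<alpha> * pochhammer (1 - \<alpha>) (ns ! j - 1) * l powr (\<alpha> - real (ns ! j))) * exp (- (l powr \<alpha>)))"
proof -
  let ?k = "length ns" and ?n = "sum_list ns"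
  let ?e = "\<lambda>\<omega>. ennreal (exp (- l * X 1 \<omega>))"
  let ?D = "\<lambda>m \<omega>. distinct_sum (\<lambda>i. ennreal (incr m i \<omega>)) ns"
  let ?T = "\<lambda>\<omega>. distinct_sum (\<lambda>i. ennreal (J i \<omega>)) ns"
  have [measurable]: "?D m \<in> borel_measurable M" "?T \<in> borel_measurable M" for m
    by (intro measurable_distinct_sum; measurable)+
  have "(\<lambda>m. \<integral>\<^sup>+\<omega>. ?e \<omega> * ?D m \<omega> \<partial>M) \<longlonglongrightarrow>
    ennreal ((\<Prod>j<?k. (1 - real j * 0) * (\<alpha> * pochhammer (1 - \<alpha>) (ns ! j - 1) * l powr (\<alpha> - real (ns ! j)))) * exp (- (l powr \<alpha>)))"
    unfolding Laplace_distinct_sum_incr[OF l ns]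
    by (intro tendsto_ennrealI tendsto_mult tendsto_prod tendsto_diff tendsto_const
        inverse_dyadic_tendsto scaled_moment_tendsto[OF l] exp_rest_tendsto)
      (use ns in \<open>metis gr0I lessThan_iff nth_mem\<close>)
  moreover have "(\<lambda>m. \<integral>\<^sup>+\<omega>. ?e \<omega> * ?D m \<omega> \<partial>M) \<longlonglongrightarrow> (\<integral>\<^sup>+\<omega>. ?e \<omega> * ?T \<omega> \<partial>M)"
  proof (rule nn_integral_dominated_convergence[where w="\<lambda>\<omega>. ennreal (X 1 \<omega> ^ ?n * exp (- l * X 1 \<omega>))"])
    show "AE \<omega> in M. ?e \<omega> * ?D m \<omega> \<le> ennreal (X 1 \<omega> ^ ?n * exp (- l * X 1 \<omega>))" for m
      using AE_regular_path X_nonneg[of 1, simplified]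
    proof eventually_elim
      case (elim \<omega>)
      have "?D m \<omega> \<le> ennreal (X 1 \<omega>) ^ ?n"
        using distinct_sum_le_power[OF ns, of "\<lambda>i. ennreal (incr m i \<omega>)"]
        unfolding regular_path_sum_incr_ennreal[OF elim(1)] .
      then have "?e \<omega> * ?D m \<omega> \<le> ?e \<omega> * ennreal (X 1 \<omega>) ^ ?n"
        by (rule mult_left_mono) simp
      also have "\<dots> = ennreal (X 1 \<omega> ^ ?n * exp (- l * X 1 \<omega>))"
        using elim(2) by (simp add: ennreal_power ennreal_mult mult.commute)
      finally show ?case .
    qed
    show "(\<integral>\<^sup>+\<omega>. ennreal (X 1 \<omega> ^ ?n * exp (- l * X 1 \<omega>)) \<partial>M) < \<infinity>"
      using l by (subst nn_moment_X) auto
    show "AE \<omega> in M. (\<lambda>m. ?e \<omega> * ?D m \<omega>) \<longlonglongrightarrow> ?e \<omega> * ?T \<omega>"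
      using AE_pure_jump_path
    proof eventually_elim
      case (elim \<omega>)
      then have reg: "regular_path \<omega>" by simp
      have fin: "(\<integral>\<^sup>+i. x i ^ n \<partial>count_space UNIV) < top"
        if "(\<integral>\<^sup>+i. x i \<partial>count_space UNIV) = ennreal (X 1 \<omega>)" "0 < n" for x :: "nat \<Rightarrow> ennreal" and n
        using power_sum_le[OF that(2), of x] that(1) by (simp add: le_less_trans power_less_top_ennreal)
      have "(\<lambda>m. ?D m \<omega>) \<longlonglongrightarrow> ?T \<omega>"
      proof (rule distinct_sum_tendsto[OF _ _ _ ns])
        fix n :: nat assume n: "0 < n"
        show "(\<integral>\<^sup>+i. ennreal (incr m i \<omega>) ^ n \<partial>count_space UNIV) < top" for m
          by (rule fin[OF regular_path_sum_incr_ennreal[OF reg] n])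
        show "(\<integral>\<^sup>+i. ennreal (J i \<omega>) ^ n \<partial>count_space UNIV) < top"
          by (rule fin[OF _ n]) (use elim in simp)
        show "(\<lambda>m. \<integral>\<^sup>+i. ennreal (incr m i \<omega>) ^ n \<partial>count_space UNIV) \<longlonglongrightarrow> (\<integral>\<^sup>+i. ennreal (J i \<omega>) ^ n \<partial>count_space UNIV)"
        proof (cases "n = 1")
          case True
          then show ?thesis using elim regular_path_sum_incr_ennreal[OF reg] by simp
        next
          case False
          then obtain r where r: "n = Suc r" "0 < r" using n by (cases n) auto
          have "(\<lambda>m. \<integral>\<^sup>+i. ennreal (incr m i \<omega> * incr m i \<omega> ^ r) \<partial>count_space UNIV)
            \<longlonglongrightarrow> (\<integral>\<^sup>+i. ennreal (J i \<omega> * J i \<omega> ^ r) \<partial>count_space UNIV)"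
            by (rule regular_path_sums_tendsto[OF reg, of "\<lambda>x. x ^ r"]) (use r in \<open>auto intro!: continuous_intros\<close>)
          moreover have "ennreal (incr m i \<omega>) ^ n = ennreal (incr m i \<omega> * incr m i \<omega> ^ r)" for m i
            using regular_path_incr_nonneg[OF reg] by (simp add: r ennreal_mult ennreal_power)
          moreover have "ennreal (J i \<omega>) ^ n = ennreal (J i \<omega> * J i \<omega> ^ r)" for i
            using regular_path_J_pos[OF reg, of i] by (simp add: r ennreal_mult ennreal_power less_imp_le)
          ultimately show ?thesis by simp
        qed
      qed
      then show ?case by (intro ennreal_tendsto_cmult) auto
    qed
  qed measurable
  ultimately have "(\<integral>\<^sup>+\<omega>. ?e \<omega> * ?T \<omega> \<partial>M) =
    ennreal ((\<Prod>j<?k. (1 - real j * 0) * (\<alpha> * pochhammer (1 - \<alpha>) (ns ! j - 1) * l powr (\<alpha> - real (ns ! j)))) * exp (- (l powr \<alpha>)))"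
    by (rule LIMSEQ_unique[rotated])
  moreover have "(\<integral>\<^sup>+\<omega>. ennreal (exp (- l * total_mass J \<omega>)) * ?T \<omega> \<partial>M) = (\<integral>\<^sup>+\<omega>. ?e \<omega> * ?T \<omega> \<partial>M)"
    by (intro nn_integral_cong_AE, use AE_pure_jump_path in eventually_elim) simp
  ultimately show ?thesis by simp
qed

end

section \<open>Laws of quotients of tilted stable and beta variables\<close>

lemma ennreal_mult3:
  "0 \<le> a \<Longrightarrow> 0 \<le> b \<Longrightarrow> 0 \<le> c \<Longrightarrow> ennreal a * (ennreal b * ennreal c) = ennreal (a * (b * c))"
  by (simp add: ennreal_mult)

text \<open>
  The substitution \<open>t = s / u\<close>. The map reverses the orientation, so \<open>u\<close> is replaced by
  \<open>- u\<close>; the formula for compact intervals is then extended by monotone convergence.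
\<close>
lemma nn_integral_inversion_substitution:
  fixes F :: "real \<Rightarrow> ennreal" and s :: real
  assumes [measurable]: "F \<in> borel_measurable borel" and s: "0 < s"
  shows "(\<integral>\<^sup>+u. indicator {0<..<1} u * F (s / u) \<partial>lborel) = (\<integral>\<^sup>+t. indicator {s<..} t * (F t * ennreal (s / t\<^sup>2)) \<partial>lborel)"
proof -
  define H where "H u = indicator {0<..<1} u * F (s / u)" for u :: real
  have [measurable]: "H \<in> borel_measurable borel" unfolding H_def by measurable
  define a where "a m = 1 / (real m + 1)" for m :: nat
  define b where "b m = real m + 2" for m :: nat
  have a: "0 < a m" "a m \<le> 1" and b: "2 \<le> b m" for m by (auto simp: a_def b_def field_simps)
  have ab: "a m < b m" for m using a[of m] b[of m] by linarith
  define L where "L m y = H (- y) * indicator {- s / a m..- s / b m} y" for m y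
  define R where "R m x = H (s / x) * ennreal (s / x\<^sup>2) * indicator {a m..b m} x" for m x
  have [measurable]: "L m \<in> borel_measurable borel" "R m \<in> borel_measurable borel" for m
    unfolding L_def R_def by measurable
  have sets_mono: "{a m..b m} \<subseteq> {a m'..b m'}" "{- s / a m..- s / b m} \<subseteq> {- s / a m'..- s / b m'}" if "m \<le> m'" for m m'
  proof -
    have *: "a m' \<le> a m" "b m \<le> b m'" using that by (auto simp: a_def b_def frac_le)
    then show "{a m..b m} \<subseteq> {a m'..b m'}" by auto
    have "s / a m \<le> s / a m'" using * a s by (intro divide_left_mono) (auto intro: mult_pos_pos)
    moreover have "s / b m' \<le> s / b m" using * b[of m] b[of m'] s by (intro divide_left_mono) (auto intro: mult_pos_pos)
    ultimately show "{- s / a m..- s / b m} \<subseteq> {- s / a m'..- s / b m'}" by auto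
  qed
  have ind_mono: "indicator A x \<le> (indicator B x :: ennreal)" if "A \<subseteq> B" for A B :: "real set" and x
    using that by (auto simp: indicator_def)
  have mono: "mono L" "mono R"
    unfolding L_def R_def by (intro monoI le_funI mult_left_mono ind_mono sets_mono; simp)+
  have piece: "(\<integral>\<^sup>+y. L m y \<partial>lborel) = (\<integral>\<^sup>+x. R m x \<partial>lborel)" for m
  proof -
    have "(\<integral>\<^sup>+y. H (- y) * indicator {- s / a m..- s / b m} y \<partial>lborel)
      = (\<integral>\<^sup>+x. H (- (- s / x)) * ennreal (s / x\<^sup>2) * indicator {a m..b m} x \<partial>lborel)"
    proof (rule nn_integral_substitution_aux[where g="\<lambda>x. - s / x" and g'="\<lambda>x. s / x\<^sup>2"])
      show "((\<lambda>x. - s / x) has_real_derivative s / x\<^sup>2) (at x)" if "x \<in> {a m..b m}" for x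
        using that a(1)[of m] by (auto intro!: derivative_eq_intros simp: power2_eq_square)
      show "continuous_on {a m..b m} (\<lambda>x. s / x\<^sup>2)"
        using a(1)[of m] by (intro continuous_intros) auto
    qed (use s ab in auto)
    then show ?thesis by (simp add: L_def R_def)
  qed
  have ev: "\<forall>\<^sub>F m in sequentially. z \<le> real m" for z
    using filterlim_real_sequentially by (simp add: filterlim_at_top)
  have lim_L: "(\<lambda>m. L m y) \<longlonglongrightarrow> H (- y)" for y
  proof (cases "y < 0")
    case True
    have "\<forall>\<^sub>F m in sequentially. - y / s \<le> real m \<and> s / - y \<le> real m"
      by (intro eventually_conj ev)
    then have "\<forall>\<^sub>F m in sequentially. L m y = H (- y)"
    proof eventually_elim
      case (elim m)
      have "- y \<le> s * (real m + 1)" using elim s by (simp add: field_simps)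
      moreover have "s \<le> - y * (real m + 2)" using elim True by (simp add: field_simps)
      ultimately have "y \<in> {- s / a m..- s / b m}"
        by (auto simp: a_def b_def field_simps)
      then show ?case by (simp add: L_def)
    qed
    then show ?thesis by (rule tendsto_eventually)
  next
    case False
    then have "L m y = H (- y)" for m by (simp add: L_def H_def)
    then show ?thesis by simp
  qed
  have lim_R: "(\<lambda>m. R m x) \<longlonglongrightarrow> H (s / x) * ennreal (s / x\<^sup>2)" for x
  proof (cases "0 < x")
    case True
    have "\<forall>\<^sub>F m in sequentially. 1 / x \<le> real m \<and> x \<le> real m"
      by (intro eventually_conj ev)
    then have "\<forall>\<^sub>F m in sequentially. R m x = H (s / x) * ennreal (s / x\<^sup>2)"
    proof eventually_elim
      case (elim m)
      have "x \<in> {a m..b m}" using elim True by (auto simp: a_def b_def field_simps)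
      then show ?case by (simp add: R_def)
    qed
    then show ?thesis by (rule tendsto_eventually)
  next
    case False
    then have "s / x \<le> 0" using s by (simp add: divide_nonneg_nonpos)
    then have "H (s / x) = 0" by (simp add: H_def)
    then show ?thesis by (simp add: R_def)
  qed
  have "(\<lambda>m. \<integral>\<^sup>+y. L m y \<partial>lborel) \<longlonglongrightarrow> (\<integral>\<^sup>+y. H (- y) \<partial>lborel)"
    by (rule nn_integral_LIMSEQ[OF mono(1) _ lim_L]) simp
  moreover have "(\<lambda>m. \<integral>\<^sup>+y. L m y \<partial>lborel) \<longlonglongrightarrow> (\<integral>\<^sup>+x. H (s / x) * ennreal (s / x\<^sup>2) \<partial>lborel)"
    unfolding piece by (rule nn_integral_LIMSEQ[OF mono(2) _ lim_R]) simp
  ultimately have "(\<integral>\<^sup>+y. H (- y) \<partial>lborel) = (\<integral>\<^sup>+x. H (s / x) * ennreal (s / x\<^sup>2) \<partial>lborel)"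
    by (rule LIMSEQ_unique)
  moreover have "(\<integral>\<^sup>+y. H y \<partial>lborel) = (\<integral>\<^sup>+y. H (- y) \<partial>lborel)"
    using nn_integral_real_affine[of H "- 1" 0] by simp
  moreover have "H (s / x) * ennreal (s / x\<^sup>2) = indicator {s<..} x * (F x * ennreal (s / x\<^sup>2))" for x
  proof (cases "s < x")
    case True
    then have "s / x \<in> {0<..<1}" "s / (s / x) = x" using s by auto
    then show ?thesis using True by (simp add: H_def)
  next
    case False
    then have "s / x \<notin> {0<..<1}" using s by (auto simp: field_simps zero_less_divide_iff)
    then show ?thesis using False by (simp add: H_def)
  qed
  ultimately show ?thesis by (simp add: H_def)
qed

text \<open>
  With \<open>t = s / u\<close> the beta density becomes a power of \<open>t - s\<close>, and as \<open>a + b = n\<close> all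
  powers of \<open>t\<close> cancel, which leaves a Gamma integral.
\<close>
lemma nn_integral_beta_law_quotient:
  fixes a b l s :: real
  assumes "0 < a" "0 < b" "0 < l" "0 < s" and n: "a + b = real n"
  shows "(\<integral>\<^sup>+u. ennreal ((s / u) ^ n * exp (- l * (s / u))) \<partial>beta_law a b)
    = ennreal (Gamma (real n) / Gamma a * l powr (- b)) * ennreal (s powr a * exp (- l * s))"
proof -
  have B: "0 < Beta a b" using assms by (simp add: Beta_def Gamma_real_pos)
  define F where "F t = ennreal (t ^ n * exp (- l * t) * ((s / t) powr (a - 1) * (1 - s / t) powr (b - 1) / Beta a b))" for t
  have [measurable]: "F \<in> borel_measurable borel" unfolding F_def by measurable
  have "(\<integral>\<^sup>+u. ennreal ((s / u) ^ n * exp (- l * (s / u))) \<partial>beta_law a b)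
    = (\<integral>\<^sup>+u. ennreal (indicator {0<..<1} u * (u powr (a - 1) * (1 - u) powr (b - 1) / Beta a b)) * ennreal ((s / u) ^ n * exp (- l * (s / u))) \<partial>lborel)"
    using assms unfolding beta_law_def by (simp add: nn_integral_density)
  also have "\<dots> = (\<integral>\<^sup>+u. indicator {0<..<1} u * F (s / u) \<partial>lborel)"
  proof (intro nn_integral_cong)
    fix u :: real
    show "ennreal (indicator {0<..<1} u * (u powr (a - 1) * (1 - u) powr (b - 1) / Beta a b)) * ennreal ((s / u) ^ n * exp (- l * (s / u)))
      = indicator {0<..<1} u * F (s / u)"
    proof (cases "u \<in> {0<..<1}")
      case True
      then show ?thesis using B assms
        by (simp add: F_def ennreal_mult[symmetric] mult.commute)
    qed simp
  qed
  also have "\<dots> = (\<integral>\<^sup>+t. indicator {s<..} t * (F t * ennreal (s / t\<^sup>2)) \<partial>lborel)"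
    by (rule nn_integral_inversion_substitution) (use assms in auto)
  also have "\<dots> = (\<integral>\<^sup>+t. ennreal (s powr a / Beta a b) * ennreal (indicator {0<..} (t - s) * ((t - s) powr (b - 1) * exp (- l * t))) \<partial>lborel)"
  proof (intro nn_integral_cong)
    fix t :: real
    show "indicator {s<..} t * (F t * ennreal (s / t\<^sup>2)) = ennreal (s powr a / Beta a b) * ennreal (indicator {0<..} (t - s) * ((t - s) powr (b - 1) * exp (- l * t)))"
    proof (cases "s < t")
      case True
      then have t: "0 < t" using assms by linarith
      have "1 - s / t = (t - s) / t" using t by (simp add: field_simps)
      then have "t ^ n * ((s / t) powr (a - 1) * (1 - s / t) powr (b - 1)) * (s / t\<^sup>2)
        = (t powr (a + b) * t powr (- 2) * t powr (1 - a) * t powr (1 - b)) * (s powr (a - 1) * s powr 1) * (t - s) powr (b - 1)"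
        using True t assms by (simp add: powr_divide n powr_realpow powr_minus_divide powr_diff field_simps)
      also have "t powr (a + b) * t powr (- 2) * t powr (1 - a) * t powr (1 - b) = 1"
        using t by (simp add: powr_add[symmetric])
      also have "s powr (a - 1) * s powr 1 = s powr a" using assms by (subst powr_add[symmetric]) simp
      finally have key: "t ^ n * ((s / t) powr (a - 1) * (1 - s / t) powr (b - 1)) * (s / t\<^sup>2) = s powr a * (t - s) powr (b - 1)" by simp
      have "(t ^ n * exp (- l * t) * ((s / t) powr (a - 1) * (1 - s / t) powr (b - 1) / Beta a b)) * (s / t\<^sup>2)
        = (t ^ n * ((s / t) powr (a - 1) * (1 - s / t) powr (b - 1)) * (s / t\<^sup>2)) * (exp (- l * t) / Beta a b)"
        by (simp add: mult_ac)
      also have "\<dots> = s powr a / Beta a b * ((t - s) powr (b - 1) * exp (- l * t))"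
        unfolding key by (simp add: mult_ac)
      finally show ?thesis using True t B assms
        by (simp add: F_def ennreal_mult[symmetric] ennreal_mult''[symmetric])
    qed simp
  qed
  also have "\<dots> = ennreal (s powr a / Beta a b) * (\<integral>\<^sup>+t. ennreal (indicator {0<..} (t - s) * ((t - s) powr (b - 1) * exp (- l * t))) \<partial>lborel)"
    by (rule nn_integral_cmult) simp
  also have "(\<integral>\<^sup>+t. ennreal (indicator {0<..} (t - s) * ((t - s) powr (b - 1) * exp (- l * t))) \<partial>lborel)
    = (\<integral>\<^sup>+v. ennreal (indicator {0<..} v * (v powr (b - 1) * exp (- l * (s + v)))) \<partial>lborel)"
    by (subst nn_integral_real_affine[where c=1 and t=s]) simp_all
  also have "\<dots> = (\<integral>\<^sup>+v. ennreal (exp (- l * s)) * ennreal (indicator {0<..} v * (v powr (b - 1) * exp (- l * v))) \<partial>lborel)"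
    by (intro nn_integral_cong) (auto simp: indicator_def ennreal_mult[symmetric] exp_add[symmetric] algebra_simps)
  also have "\<dots> = ennreal (exp (- l * s)) * ennreal (Gamma b * l powr (- b))"
    using assms by (subst nn_integral_cmult, simp, subst nn_integral_Gamma_scaled) auto
  finally have "(\<integral>\<^sup>+u. ennreal ((s / u) ^ n * exp (- l * (s / u))) \<partial>beta_law a b)
    = ennreal (s powr a / Beta a b) * (ennreal (exp (- l * s)) * ennreal (Gamma b * l powr (- b)))" .
  also have "\<dots> = ennreal (s powr a / Beta a b * (exp (- l * s) * (Gamma b * l powr (- b))))"
  proof -
    have "0 \<le> s powr a / Beta a b" "0 \<le> Gamma b * l powr (- b)"
      using B Gamma_real_pos[OF assms(2)] by simp_all
    then show ?thesis by (simp only: ennreal_mult exp_ge_zero mult_nonneg_nonneg)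
  qed
  also have "s powr a / Beta a b * (exp (- l * s) * (Gamma b * l powr (- b)))
    = Gamma (real n) / Gamma a * l powr (- b) * (s powr a * exp (- l * s))"
    using Gamma_real_pos[OF assms(1)] Gamma_real_pos[OF assms(2)] Gamma_real_pos[OF add_pos_pos[OF assms(1,2)]]
    unfolding Beta_def n[symmetric] by (simp add: field_simps)
  also have "ennreal \<dots> = ennreal (Gamma (real n) / Gamma a * l powr (- b)) * ennreal (s powr a * exp (- l * s))"
    by (rule ennreal_mult'') simp
  finally show ?thesis .
qed

lemma nn_integral_quotient_law:
  fixes g :: "real \<Rightarrow> ennreal"
  assumes sets: "sets \<sigma> = sets borel" "sets \<beta> = sets borel" and \<beta>: "sigma_finite_measure \<beta>"
    and [measurable]: "g \<in> borel_measurable borel"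
  shows "(\<integral>\<^sup>+x. g x \<partial>distr (\<sigma> \<Otimes>\<^sub>M \<beta>) borel (\<lambda>(s, u). s / u)) = (\<integral>\<^sup>+s. \<integral>\<^sup>+u. g (s / u) \<partial>\<beta> \<partial>\<sigma>)"
proof -
  interpret sigma_finite_measure \<beta> by fact
  note [measurable_cong] = sets
  have [measurable]: "(\<lambda>(s, u). s / u) \<in> borel_measurable (\<sigma> \<Otimes>\<^sub>M \<beta>)" by measurable
  have "(\<integral>\<^sup>+x. g x \<partial>distr (\<sigma> \<Otimes>\<^sub>M \<beta>) borel (\<lambda>(s, u). s / u)) = (\<integral>\<^sup>+p. g (case p of (s, u) \<Rightarrow> s / u) \<partial>(\<sigma> \<Otimes>\<^sub>M \<beta>))"
    by (rule nn_integral_distr) auto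
  also have "\<dots> = (\<integral>\<^sup>+s. \<integral>\<^sup>+u. g (case (s, u) of (s, u) \<Rightarrow> s / u) \<partial>\<beta> \<partial>\<sigma>)"
    by (rule nn_integral_fst[symmetric]) measurable
  finally show ?thesis by simp
qed

lemma beta_law_sets: "sets (beta_law a b) = sets borel"
  by (simp add: beta_law_def)

lemma sigma_finite_beta_law: "sigma_finite_measure (beta_law a b)"
proof (cases "b = 0")
  case True
  then show ?thesis
    by (simp add: beta_law_def prob_space_return prob_space_imp_sigma_finite)
next
  case False
  then show ?thesis
    unfolding beta_law_def
    by (simp add: sigma_finite_measure.sigma_finite_iff_density_finite[OF lborel.sigma_finite_measure_axioms])
qed

lemma AE_beta_law_pos: "AE u in beta_law a b. 0 < u"
proof (cases "b = 0")
  case True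
  have "AE u in return borel (1::real). 0 < u"
    by (rule AE_I[where N="{..0}"]) (auto simp: emeasure_return)
  moreover have "beta_law a b = return borel 1" using True by (simp add: beta_law_def)
  ultimately show ?thesis by (simp only:)
next
  case False
  then show ?thesis
    unfolding beta_law_def by (simp, subst AE_density) (auto simp: indicator_def)
qed

lemma tilted_stable_law_sets: "sets (tilted_stable_law f \<alpha> \<theta>) = sets borel"
  by (simp add: tilted_stable_law_def)

text \<open>
  The common feature of all laws in the theorem: their transform
  \<open>l \<mapsto> \<integral> t^n exp (- l t)\<close> is a multiple of
  \<open>l^(k \<alpha> - n) exp (- l^\<alpha>)\<close>. As the transform is injective, such laws differ
  only by a constant factor.
\<close>
definition gibbs_transform :: "real \<Rightarrow> nat \<Rightarrow> nat \<Rightarrow> real \<Rightarrow> real measure \<Rightarrow> bool" where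
  "gibbs_transform \<alpha> n k c \<nu> \<longleftrightarrow> sets \<nu> = sets borel \<and> (AE x in \<nu>. 0 < x) \<and>
    (\<forall>l>0. (\<integral>\<^sup>+x. ennreal (x ^ n * exp (- l * x)) \<partial>\<nu>)
      = ennreal (c * (l powr (real k * \<alpha> - real n) * exp (- (l powr \<alpha>)))))"

lemma borel_measurable_power_exp: "(\<lambda>x. ennreal (x ^ n * exp (- l * x))) \<in> borel_measurable borel"
  by measurable

lemma gibbs_transform_unique:
  assumes \<nu>: "gibbs_transform \<alpha> n k c \<nu>" and \<nu>': "gibbs_transform \<alpha> n k c' \<nu>'"
    and c: "0 < c" "0 < c'" and g: "g \<in> borel_measurable borel"
  shows "ennreal c' * (\<integral>\<^sup>+x. g x \<partial>\<nu>) = ennreal c * (\<integral>\<^sup>+x. g x \<partial>\<nu>')"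
proof -
  have sets[measurable_cong]: "sets \<nu> = sets borel" "sets \<nu>' = sets borel"
    using \<nu> \<nu>' by (simp_all add: gibbs_transform_def)
  have dens: "(\<integral>\<^sup>+x. g x \<partial>density \<rho> (\<lambda>_. ennreal d)) = ennreal d * (\<integral>\<^sup>+x. g x \<partial>\<rho>)"
    if "sets \<rho> = sets borel" "g \<in> borel_measurable borel" for \<rho> :: "real measure" and d and g :: "real \<Rightarrow> ennreal"
  proof -
    note [measurable_cong] = that(1)
    note [measurable] = that(2)
    show ?thesis by (simp add: nn_integral_density nn_integral_cmult)
  qed
  have "density \<nu> (\<lambda>_. ennreal c') = density \<nu>' (\<lambda>_. ennreal c)"
  proof (rule measure_eq_if_moment_Laplace_eq[where n=n])
    show "AE x in density \<nu> (\<lambda>_. ennreal c'). 0 < x" "AE x in density \<nu>' (\<lambda>_. ennreal c). 0 < x"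
      using \<nu> \<nu>' by (auto simp: AE_density gibbs_transform_def)
    fix l :: real assume l: "0 < l"
    have v: "(\<integral>\<^sup>+x. ennreal (x ^ n * exp (- l * x)) \<partial>\<nu>) = ennreal (c * (l powr (real k * \<alpha> - real n) * exp (- (l powr \<alpha>))))"
      "(\<integral>\<^sup>+x. ennreal (x ^ n * exp (- l * x)) \<partial>\<nu>') = ennreal (c' * (l powr (real k * \<alpha> - real n) * exp (- (l powr \<alpha>))))"
      using \<nu> \<nu>' l by (simp_all add: gibbs_transform_def)
    show "(\<integral>\<^sup>+x. ennreal (x ^ n * exp (- l * x)) \<partial>density \<nu> (\<lambda>_. ennreal c'))
      = (\<integral>\<^sup>+x. ennreal (x ^ n * exp (- l * x)) \<partial>density \<nu>' (\<lambda>_. ennreal c))"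
      unfolding dens[OF sets(1) borel_measurable_power_exp] dens[OF sets(2) borel_measurable_power_exp] v
      using c by (simp add: ennreal_mult[symmetric] mult_ac)
    show "(\<integral>\<^sup>+x. ennreal (x ^ n * exp (- l * x)) \<partial>density \<nu>' (\<lambda>_. ennreal c)) < \<infinity>"
      unfolding dens[OF sets(2) borel_measurable_power_exp] v
      by (simp add: ennreal_mult_less_top)
  qed (simp_all add: sets)
  then show ?thesis using dens[OF sets(1) g, of c'] dens[OF sets(2) g, of c] by simp
qed

locale stable_density =
  fixes \<alpha> :: real and f :: "real \<Rightarrow> real"
  assumes \<alpha>: "0 < \<alpha>" "\<alpha> < 1" and f: "positive_stable_density \<alpha> f"
begin

lemma f_measurable[measurable]: "f \<in> borel_measurable borel"
  and f_nonneg: "0 \<le> f t" and f_nonpos: "t \<le> 0 \<Longrightarrow> f t = 0"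
  and f_Laplace: "0 < l \<Longrightarrow> has_bochner_integral lborel (\<lambda>t. exp (- l * t) * f t) (exp (- (l powr \<alpha>)))"
  using f by (auto simp: positive_stable_density_def)

lemma AE_density_f_pos: "AE x in density lborel (\<lambda>x. ennreal (f x)). 0 < x"
proof -
  have pos: "0 < ennreal (f x) \<longrightarrow> 0 < x" for x
    using f_nonpos[of x] by (cases "0 < x") auto
  show ?thesis by (subst AE_density, measurable) (intro AE_I2 pos)
qed

lemma Laplace_density_f:
  assumes "0 < l"
  shows "has_bochner_integral (density lborel (\<lambda>x. ennreal (f x))) (\<lambda>t. exp (- l * t)) (exp (- 1 * l powr \<alpha>))"
  by (rule has_bochner_integral_density)
    (use f_Laplace[OF assms] f_nonneg in \<open>auto simp: mult.commute\<close>)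

lemma nn_integral_density_f:
  assumes "0 < l"
  shows "(\<integral>\<^sup>+x. ennreal (exp (- l * x)) \<partial>density lborel (\<lambda>x. ennreal (f x))) = ennreal (exp (- (l powr \<alpha>)))"
proof -
  note * = Laplace_density_f[OF assms]
  have "(\<integral>\<^sup>+x. ennreal (exp (- l * x)) \<partial>density lborel (\<lambda>x. ennreal (f x)))
    = ennreal (\<integral>x. exp (- l * x) \<partial>density lborel (\<lambda>x. ennreal (f x)))"
    by (rule nn_integral_eq_integral) (use * in \<open>auto simp: has_bochner_integral_iff\<close>)
  then show ?thesis using has_bochner_integral_integral_eq[OF *] by simp
qed

lemma nn_integral_density_f_moment:
  assumes l: "0 < l"
  shows "(\<integral>\<^sup>+x. ennreal (x * exp (- l * x)) \<partial>density lborel (\<lambda>x. ennreal (f x))) = ennreal (\<alpha> * l powr (\<alpha> - 1) * exp (- (l powr \<alpha>)))"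
proof -
  let ?M = "density lborel (\<lambda>x. ennreal (f x))"
  have AE: "AE x in ?M. 0 \<le> x" using AE_density_f_pos by (auto elim!: eventually_mono)
  have id: "(\<lambda>x. x) \<in> borel_measurable ?M" by simp
  have int: "integrable ?M (\<lambda>x. exp (- l * x))" if "0 < l" for l
    using Laplace_density_f[OF that] by (rule has_bochner_integral_iff[THEN iffD1, THEN conjunct1])
  have "(\<integral>\<^sup>+x. ennreal (x ^ 1 * exp (- l * x)) \<partial>?M) = ennreal (\<integral>x. x ^ 1 * exp (- l * x) \<partial>?M)"
    by (rule nn_integral_eq_integral[OF integrable_moment_Laplace[OF id AE int l]])
      (use AE in \<open>auto elim!: eventually_mono\<close>)
  also have "(\<integral>x. x ^ 1 * exp (- l * x) \<partial>?M) = \<alpha> * l powr (\<alpha> - 1) * exp (- (l powr \<alpha>))"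
    by (subst stable_moment[OF id AE Laplace_density_f l]) auto
  finally show ?thesis by simp
qed

text \<open>
  Polynomial tilting cancels against the power of \<open>s\<close> that the beta integral produces.
\<close>
lemma nn_integral_tilted_stable_law:
  assumes "0 \<le> \<theta>" and a: "a = \<theta> + d" and [measurable]: "g \<in> borel_measurable borel"
  shows "(\<integral>\<^sup>+s. ennreal (s powr a) * g s \<partial>tilted_stable_law f \<alpha> \<theta>)
    = ennreal (Gamma (\<theta> + 1) / Gamma (\<theta> / \<alpha> + 1)) * (\<integral>\<^sup>+s. ennreal (s powr d) * g s \<partial>density lborel (\<lambda>x. ennreal (f x)))"
proof -
  define C where "C = Gamma (\<theta> + 1) / Gamma (\<theta> / \<alpha> + 1)"
  have C: "0 \<le> C"
    unfolding C_def using assms \<alpha> by (intro divide_nonneg_nonneg less_imp_le[OF Gamma_real_pos] add_nonneg_pos divide_nonneg_pos) auto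
  have "(\<integral>\<^sup>+s. ennreal (s powr a) * g s \<partial>tilted_stable_law f \<alpha> \<theta>)
    = (\<integral>\<^sup>+s. ennreal (C * s powr (- \<theta>) * f s) * (ennreal (s powr a) * g s) \<partial>lborel)"
    unfolding tilted_stable_law_def C_def[symmetric] by (simp add: nn_integral_density)
  also have "\<dots> = (\<integral>\<^sup>+s. ennreal C * (ennreal (f s) * (ennreal (s powr d) * g s)) \<partial>lborel)"
  proof (intro nn_integral_cong)
    fix s :: real
    show "ennreal (C * s powr (- \<theta>) * f s) * (ennreal (s powr a) * g s) = ennreal C * (ennreal (f s) * (ennreal (s powr d) * g s))"
    proof (cases "0 < s")
      case True
      have "ennreal (C * s powr (- \<theta>) * f s) * ennreal (s powr a) = ennreal (C * f s * (s powr (- \<theta>) * s powr a))"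
        using C f_nonneg by (simp add: ennreal_mult''[symmetric] mult_ac)
      also have "s powr (- \<theta>) * s powr a = s powr d" by (simp add: powr_add[symmetric] a)
      also have "ennreal (C * f s * s powr d) = ennreal C * (ennreal (f s) * ennreal (s powr d))"
        using C f_nonneg by (simp add: ennreal_mult mult.assoc)
      finally show ?thesis by (simp add: mult.assoc[symmetric])
    qed (simp add: f_nonpos)
  qed
  also have "\<dots> = ennreal C * (\<integral>\<^sup>+s. ennreal (s powr d) * g s \<partial>density lborel (\<lambda>x. ennreal (f x)))"
    by (simp add: nn_integral_cmult nn_integral_density)
  finally show ?thesis unfolding C_def .
qed

lemma AE_tilted_pos: "AE s in tilted_stable_law f \<alpha> \<theta>. 0 < s"
proof -
  have pos: "0 < ennreal (c * s powr (- \<theta>) * f s) \<longrightarrow> 0 < s" for c s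
    using f_nonpos[of s] by (cases "0 < s") auto
  show ?thesis
    unfolding tilted_stable_law_def by (subst AE_density, measurable) (intro AE_I2 pos)
qed

lemma AE_quotient_pos:
  "AE x in distr (tilted_stable_law f \<alpha> \<theta> \<Otimes>\<^sub>M beta_law a b) borel (\<lambda>(s, u). s / u). 0 < x"
proof -
  note [measurable_cong] = tilted_stable_law_sets beta_law_sets
  let ?q = "distr (tilted_stable_law f \<alpha> \<theta> \<Otimes>\<^sub>M beta_law a b) borel (\<lambda>(s, u). s / u)"
  have "(\<integral>\<^sup>+x. indicator {..0} x \<partial>?q) = (\<integral>\<^sup>+s. \<integral>\<^sup>+u. indicator {..0} (s / u) \<partial>beta_law a b \<partial>tilted_stable_law f \<alpha> \<theta>)"
    by (rule nn_integral_quotient_law) (auto simp: tilted_stable_law_sets beta_law_sets sigma_finite_beta_law)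
  also have "\<dots> = (\<integral>\<^sup>+s. 0 \<partial>tilted_stable_law f \<alpha> \<theta>)"
  proof (intro nn_integral_cong_AE, use AE_tilted_pos in eventually_elim)
    case (elim s)
    have "(\<integral>\<^sup>+u. indicator {..0} (s / u) \<partial>beta_law a b) = (\<integral>\<^sup>+u. 0 \<partial>beta_law a b)"
      by (intro nn_integral_cong_AE, use AE_beta_law_pos in eventually_elim)
        (use elim in \<open>simp add: indicator_def not_le\<close>)
    then show ?case by simp
  qed
  finally have "emeasure ?q {..0} = 0" by simp
  then show ?thesis by (intro AE_I[of _ _ "{..0}"]) auto
qed

text \<open>
  The beta integral turns the transform into \<open>E[S^(k \<alpha>) exp (- l S)]\<close>, where \<open>S\<close> is
  tilted by \<open>S^(- k \<alpha>)\<close>: the plain Laplace transform of the stable law remains.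
\<close>
lemma gibbs_transform_quotient_tilted_k:
  assumes k: "1 \<le> k" "k \<le> n"
  shows "gibbs_transform \<alpha> n k (\<alpha> * Gamma (real n) / Gamma (real k))
    (distr (tilted_stable_law f \<alpha> (real k * \<alpha>) \<Otimes>\<^sub>M beta_law (real k * \<alpha>) (real n - real k * \<alpha>)) borel (\<lambda>(s, u). s / u))"
  unfolding gibbs_transform_def
proof (intro conjI allI impI AE_quotient_pos)
  fix l :: real assume l: "0 < l"
  let ?a = "real k * \<alpha>" and ?b = "real n - real k * \<alpha>"
  have a: "0 < ?a" using k \<alpha> by simp
  have "?a < real k * 1" using k \<alpha> by (intro mult_strict_left_mono) auto
  moreover have "real k \<le> real n" using k by simp
  ultimately have b: "0 < ?b" by linarith
  have "(\<integral>\<^sup>+x. ennreal (x ^ n * exp (- l * x)) \<partial>distr (tilted_stable_law f \<alpha> ?a \<Otimes>\<^sub>M beta_law ?a ?b) borel (\<lambda>(s, u). s / u))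
    = (\<integral>\<^sup>+s. \<integral>\<^sup>+u. ennreal ((s / u) ^ n * exp (- l * (s / u))) \<partial>beta_law ?a ?b \<partial>tilted_stable_law f \<alpha> ?a)"
    by (rule nn_integral_quotient_law) (auto simp: tilted_stable_law_sets beta_law_sets sigma_finite_beta_law)
  also have "\<dots> = (\<integral>\<^sup>+s. ennreal (Gamma (real n) / Gamma ?a * l powr (- ?b)) * (ennreal (s powr ?a) * ennreal (exp (- l * s))) \<partial>tilted_stable_law f \<alpha> ?a)"
  proof (intro nn_integral_cong_AE, use AE_tilted_pos in eventually_elim)
    case (elim s)
    show ?case by (subst nn_integral_beta_law_quotient[OF a b l elim]) (auto simp: ennreal_mult)
  qed
  also have "\<dots> = ennreal (Gamma (real n) / Gamma ?a * l powr (- ?b)) *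
      (ennreal (Gamma (?a + 1) / Gamma (?a / \<alpha> + 1)) * (\<integral>\<^sup>+s. ennreal (s powr 0) * ennreal (exp (- l * s)) \<partial>density lborel (\<lambda>x. ennreal (f x))))"
    using a by (subst nn_integral_cmult, simp add: tilted_stable_law_def, subst nn_integral_tilted_stable_law[where d=0]) auto
  also have "(\<integral>\<^sup>+s. ennreal (s powr 0) * ennreal (exp (- l * s)) \<partial>density lborel (\<lambda>x. ennreal (f x))) = ennreal (exp (- (l powr \<alpha>)))"
    unfolding nn_integral_density_f[OF l, symmetric]
    by (intro nn_integral_cong_AE, use AE_density_f_pos in eventually_elim) simp
  also have "ennreal (Gamma (real n) / Gamma ?a * l powr (- ?b)) * (ennreal (Gamma (?a + 1) / Gamma (?a / \<alpha> + 1)) * ennreal (exp (- (l powr \<alpha>))))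
    = ennreal (\<alpha> * Gamma (real n) / Gamma (real k) * (l powr (real k * \<alpha> - real n) * exp (- (l powr \<alpha>))))"
  proof -
    have g1: "Gamma (?a + 1) = ?a * Gamma ?a" using a by (simp add: Gamma_plus1 nonpos_Ints_def)
    have g2: "Gamma (?a / \<alpha> + 1) = real k * Gamma (real k)"
      using k \<alpha> by (simp add: Gamma_plus1 nonpos_Ints_def)
    have pos: "0 < Gamma ?a" "0 < Gamma (real k)" "0 < Gamma (real n)"
      using a k by (auto intro!: Gamma_real_pos)
    have "Gamma (real n) / Gamma ?a * l powr (- ?b) * (Gamma (?a + 1) / Gamma (?a / \<alpha> + 1) * exp (- (l powr \<alpha>)))
      = \<alpha> * Gamma (real n) / Gamma (real k) * (l powr (real k * \<alpha> - real n) * exp (- (l powr \<alpha>)))"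
    proof -
      have gen: "N' / A * L * (real k * \<alpha> * A / (real k * K') * E) = \<alpha> * N' / K' * (L * E)"
        if "A \<noteq> 0" "K' \<noteq> 0" for A K' N' L E :: real
        using that k by (simp add: field_simps)
      have "Gamma ?a \<noteq> 0" "Gamma (real k) \<noteq> 0" using pos by linarith+
      from gen[OF this] show ?thesis unfolding g1 g2 by (simp only: minus_diff_eq)
    qed
    moreover have "0 \<le> Gamma (?a + 1) / Gamma (?a / \<alpha> + 1)"
      unfolding g1 g2 by (intro divide_nonneg_nonneg mult_nonneg_nonneg less_imp_le[OF pos(1)] less_imp_le[OF pos(2)]) (use a \<alpha> in auto)
    ultimately show ?thesis
      using pos(1,3) by (subst ennreal_mult3) (auto simp only: exp_ge_zero powr_ge_zero intro!: mult_nonneg_nonneg divide_nonneg_nonneg)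
  qed
  finally show "(\<integral>\<^sup>+x. ennreal (x ^ n * exp (- l * x)) \<partial>distr (tilted_stable_law f \<alpha> ?a \<Otimes>\<^sub>M beta_law ?a ?b) borel (\<lambda>(s, u). s / u))
    = ennreal (\<alpha> * Gamma (real n) / Gamma (real k) * (l powr (real k * \<alpha> - real n) * exp (- (l powr \<alpha>))))" .
qed simp

text \<open>
  The beta integral now produces the power \<open>(k - 1) \<alpha> + 1\<close>, one more than the tilt
  removes, so the first derivative of the stable Laplace transform remains. For \<open>n = k = 1\<close>
  the beta law is the unit mass at 1.
\<close>
lemma gibbs_transform_quotient_tilted_k_minus_1:
  assumes k: "1 \<le> k" "k \<le> n"
  shows "gibbs_transform \<alpha> n k (\<alpha> * Gamma (real n) / Gamma (real k))
    (distr (tilted_stable_law f \<alpha> ((real k - 1) * \<alpha>) \<Otimes>\<^sub>M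
        beta_law ((real k - 1) * \<alpha> + 1) (real n - 1 - (real k - 1) * \<alpha>)) borel (\<lambda>(s, u). s / u))"
  unfolding gibbs_transform_def
proof (intro conjI allI impI AE_quotient_pos)
  fix l :: real assume l: "0 < l"
  let ?\<theta> = "(real k - 1) * \<alpha>"
  let ?a = "?\<theta> + 1" and ?b = "real n - 1 - ?\<theta>"
  have \<theta>: "0 \<le> ?\<theta>" using k \<alpha> by simp
  then have a: "0 < ?a" by linarith
  have b: "0 < ?b" if "n \<noteq> 1"
  proof (cases "k = 1")
    case True
    then show ?thesis using that k by simp
  next
    case False
    then have "?\<theta> < (real k - 1) * 1" using k \<alpha> by (intro mult_strict_left_mono) auto
    also have "\<dots> \<le> real n - 1" using k by simp
    finally show ?thesis by (simp only: diff_gt_0_iff_gt)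
  qed
  have inner: "(\<integral>\<^sup>+u. ennreal ((s / u) ^ n * exp (- l * (s / u))) \<partial>beta_law ?a ?b)
    = ennreal (Gamma (real n) / Gamma ?a * l powr (- ?b)) * (ennreal (s powr ?a) * ennreal (exp (- l * s)))" if s: "0 < s" for s
  proof (cases "n = 1")
    case True
    then have "k = 1" using k by simp
    then show ?thesis using True s l
      by (simp add: beta_law_def nn_integral_return ennreal_mult)
  next
    case False
    show ?thesis by (subst nn_integral_beta_law_quotient[OF a b[OF False] l s]) (auto simp: ennreal_mult)
  qed
  have "(\<integral>\<^sup>+x. ennreal (x ^ n * exp (- l * x)) \<partial>distr (tilted_stable_law f \<alpha> ?\<theta> \<Otimes>\<^sub>M beta_law ?a ?b) borel (\<lambda>(s, u). s / u))
    = (\<integral>\<^sup>+s. \<integral>\<^sup>+u. ennreal ((s / u) ^ n * exp (- l * (s / u))) \<partial>beta_law ?a ?b \<partial>tilted_stable_law f \<alpha> ?\<theta>)"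
    by (rule nn_integral_quotient_law) (auto simp: tilted_stable_law_sets beta_law_sets sigma_finite_beta_law)
  also have "\<dots> = (\<integral>\<^sup>+s. ennreal (Gamma (real n) / Gamma ?a * l powr (- ?b)) * (ennreal (s powr ?a) * ennreal (exp (- l * s))) \<partial>tilted_stable_law f \<alpha> ?\<theta>)"
    by (intro nn_integral_cong_AE, use AE_tilted_pos in eventually_elim) (rule inner)
  also have "\<dots> = ennreal (Gamma (real n) / Gamma ?a * l powr (- ?b)) *
      (ennreal (Gamma (?\<theta> + 1) / Gamma (?\<theta> / \<alpha> + 1)) * (\<integral>\<^sup>+s. ennreal (s powr 1) * ennreal (exp (- l * s)) \<partial>density lborel (\<lambda>x. ennreal (f x))))"
    using \<theta> by (subst nn_integral_cmult, simp add: tilted_stable_law_def, subst nn_integral_tilted_stable_law[where d=1]) auto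
  also have "(\<integral>\<^sup>+s. ennreal (s powr 1) * ennreal (exp (- l * s)) \<partial>density lborel (\<lambda>x. ennreal (f x))) = ennreal (\<alpha> * l powr (\<alpha> - 1) * exp (- (l powr \<alpha>)))"
    unfolding nn_integral_density_f_moment[OF l, symmetric]
    by (intro nn_integral_cong_AE, use AE_density_f_pos in eventually_elim) (simp add: ennreal_mult)
  also have "ennreal (Gamma (real n) / Gamma ?a * l powr (- ?b)) * (ennreal (Gamma (?\<theta> + 1) / Gamma (?\<theta> / \<alpha> + 1)) * ennreal (\<alpha> * l powr (\<alpha> - 1) * exp (- (l powr \<alpha>))))
    = ennreal (\<alpha> * Gamma (real n) / Gamma (real k) * (l powr (real k * \<alpha> - real n) * exp (- (l powr \<alpha>))))"
  proof -
    have g2: "?\<theta> / \<alpha> + 1 = real k" using \<alpha> by simp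
    have pos: "0 < Gamma ?a" "0 < Gamma (real k)" "0 < Gamma (real n)"
      using a k by (auto intro!: Gamma_real_pos)
    have "l powr (- ?b) * l powr (\<alpha> - 1) = l powr (real k * \<alpha> - real n)"
      by (simp add: powr_add[symmetric] algebra_simps)
    then have "Gamma (real n) / Gamma ?a * l powr (- ?b) * (Gamma ?a / Gamma (?\<theta> / \<alpha> + 1) * (\<alpha> * l powr (\<alpha> - 1) * exp (- (l powr \<alpha>))))
      = \<alpha> * Gamma (real n) / Gamma (real k) * (l powr (real k * \<alpha> - real n) * exp (- (l powr \<alpha>)))"
    proof -
      assume e: "l powr (- ?b) * l powr (\<alpha> - 1) = l powr (real k * \<alpha> - real n)"
      have gen: "N' / A * L * (A / K' * (\<alpha> * L' * E)) = \<alpha> * N' / K' * ((L * L') * E)"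
        if "A \<noteq> 0" "K' \<noteq> 0" for A K' N' L L' E :: real
        using that by (simp add: field_simps)
      have "Gamma ?a \<noteq> 0" "Gamma (real k) \<noteq> 0" using pos by linarith+
      from gen[OF this] show ?thesis unfolding g2 by (simp only: e)
    qed
    moreover have "0 \<le> Gamma ?a / Gamma (?\<theta> / \<alpha> + 1)" unfolding g2 using pos by simp
    ultimately show ?thesis using pos \<alpha> by (simp add: ennreal_mult[symmetric])
  qed
  finally show "(\<integral>\<^sup>+x. ennreal (x ^ n * exp (- l * x)) \<partial>distr (tilted_stable_law f \<alpha> ?\<theta> \<Otimes>\<^sub>M beta_law ?a ?b) borel (\<lambda>(s, u). s / u))
    = ennreal (\<alpha> * Gamma (real n) / Gamma (real k) * (l powr (real k * \<alpha> - real n) * exp (- (l powr \<alpha>))))" .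
qed simp

end

section \<open>Partitions from sampled indices\<close>

text \<open>
  An ordered partition is encoded by the function \<open>b\<close> that maps an element to the position
  of its block.
\<close>
lemma partition_block_eq:
  assumes P: "partition_on S (set As)" and "distinct As"
    and b: "\<And>j. j \<in> S \<Longrightarrow> b j < length As \<and> j \<in> As ! b j"
    and l: "l < length As"
  shows "As ! l = {j \<in> S. b j = l}"
proof (intro equalityI subsetI)
  fix j assume j: "j \<in> As ! l"
  have mem: "As ! l \<in> set As" using l by (rule nth_mem)
  then have S: "j \<in> S" using partition_onD1[OF P] j by blast
  have "As ! b j \<inter> As ! l \<noteq> {}" using b[OF S] j by blast
  moreover have "As ! b j \<in> set As" using b[OF S] by (simp add: nth_mem)
  ultimately have "As ! b j = As ! l"
    using disjointD[OF partition_onD2[OF P] _ mem] by blast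
  then have "b j = l" using \<open>distinct As\<close> b[OF S] l by (simp add: nth_eq_iff_index_eq)
  then show "j \<in> {j \<in> S. b j = l}" using S by simp
qed (use b in auto)

text \<open>
  The witness \<open>ks\<close> lists the indices sampled by the blocks, so the events on the right are
  disjoint for different \<open>ks\<close>.
\<close>
lemma index_partition_eq_iff:
  assumes P: "partition_on {1..n} (set As)" and "distinct As"
    and b: "\<And>j. j \<in> {1..n} \<Longrightarrow> b j < length As \<and> j \<in> As ! b j"
  shows "index_partition I n \<omega> = set As \<longleftrightarrow> (\<exists>ks. length ks = length As \<and> distinct ks \<and> (\<forall>j\<in>{1..n}. I j \<omega> = ks ! b j))"
proof -
  let ?S = "{1..n}" and ?R = "{(i, j). i \<in> {1..n} \<and> j \<in> {1..n} \<and> I i \<omega> = I j \<omega>}"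
  have blocks: "As ! l = {j \<in> ?S. b j = l}" if "l < length As" for l
    by (rule partition_block_eq[OF P \<open>distinct As\<close> b that])
  have nonempty: "\<exists>j\<in>?S. b j = l" if "l < length As" for l
  proof -
    have "As ! l \<noteq> {}" using partition_onD3[OF P] nth_mem[OF that] by metis
    then show ?thesis using blocks[OF that] by auto
  qed
  have cls: "?R `` {i} = {j \<in> ?S. I i \<omega> = I j \<omega>}" if "i \<in> ?S" for i
    using that by auto
  have "index_partition I n \<omega> = set As \<longleftrightarrow> (\<forall>i\<in>?S. \<forall>j\<in>?S. I i \<omega> = I j \<omega> \<longleftrightarrow> b i = b j)"
  proof
    assume eq: "index_partition I n \<omega> = set As"
    show "\<forall>i\<in>?S. \<forall>j\<in>?S. I i \<omega> = I j \<omega> \<longleftrightarrow> b i = b j"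
    proof (intro ballI)
      fix i j assume i: "i \<in> ?S" and j: "j \<in> ?S"
      have "?R `` {i} \<in> index_partition I n \<omega>" unfolding index_partition_def using i by (rule quotientI)
      then have "?R `` {i} \<in> set As" by (simp only: eq)
      then obtain l where l: "l < length As" "As ! l = ?R `` {i}" by (auto simp: in_set_conv_nth)
      then have "i \<in> As ! l" using i cls[OF i] by simp
      then have "b i = l" using blocks[OF l(1)] by simp
      have "j \<in> {j \<in> ?S. I i \<omega> = I j \<omega>} \<longleftrightarrow> j \<in> {j \<in> ?S. b j = l}"
        by (simp only: blocks[OF l(1), symmetric] l(2) cls[OF i])
      then show "I i \<omega> = I j \<omega> \<longleftrightarrow> b i = b j" using j \<open>b i = l\<close> by auto
    qed
  next
    assume iff: "\<forall>i\<in>?S. \<forall>j\<in>?S. I i \<omega> = I j \<omega> \<longleftrightarrow> b i = b j"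
    have "?R `` {i} = As ! b i" if i: "i \<in> ?S" for i
    proof -
      have "b i < length As" using b[OF i] by simp
      then show ?thesis unfolding cls[OF i] using iff i by (subst blocks) auto
    qed
    then have "index_partition I n \<omega> = (\<lambda>i. As ! b i) ` ?S"
      unfolding index_partition_def quotient_def by auto
    also have "\<dots> = set As"
    proof (intro equalityI subsetI)
      fix A assume "A \<in> set As"
      then obtain l where l: "l < length As" "A = As ! l" by (auto simp: in_set_conv_nth)
      then show "A \<in> (\<lambda>i. As ! b i) ` ?S" using nonempty[OF l(1)] by auto
    qed (use b in auto)
    finally show "index_partition I n \<omega> = set As" .
  qed
  also have "\<dots> \<longleftrightarrow> (\<exists>ks. length ks = length As \<and> distinct ks \<and> (\<forall>j\<in>?S. I j \<omega> = ks ! b j))"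
  proof
    assume iff: "\<forall>i\<in>?S. \<forall>j\<in>?S. I i \<omega> = I j \<omega> \<longleftrightarrow> b i = b j"
    define r where "r l = (SOME j. j \<in> ?S \<and> b j = l)" for l
    have r: "r l \<in> ?S" "b (r l) = l" if "l < length As" for l
    proof -
      have "\<exists>j. j \<in> ?S \<and> b j = l" using nonempty[OF that] by blast
      from someI_ex[OF this] show "r l \<in> ?S" "b (r l) = l" unfolding r_def by simp_all
    qed
    define ks where "ks = map (\<lambda>l. I (r l) \<omega>) [0..<length As]"
    have "distinct ks" unfolding ks_def distinct_map
    proof (intro conjI inj_onI distinct_upt)
      fix l l' assume l: "l \<in> set [0..<length As]" "l' \<in> set [0..<length As]" and eq: "I (r l) \<omega> = I (r l') \<omega>"
      then have l': "l < length As" "l' < length As" by simp_all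
      have "b (r l) = b (r l')" using iff r(1)[OF l'(1)] r(1)[OF l'(2)] eq by blast
      then show "l = l'" using r(2)[OF l'(1)] r(2)[OF l'(2)] by simp
    qed
    moreover have "I j \<omega> = ks ! b j" if "j \<in> ?S" for j
      using iff r[of "b j"] b[OF that] that by (auto simp: ks_def)
    ultimately show "\<exists>ks. length ks = length As \<and> distinct ks \<and> (\<forall>j\<in>?S. I j \<omega> = ks ! b j)"
      by (intro exI[of _ ks]) (simp add: ks_def)
  next
    assume "\<exists>ks. length ks = length As \<and> distinct ks \<and> (\<forall>j\<in>?S. I j \<omega> = ks ! b j)"
    then obtain ks where "length ks = length As" "distinct ks" "\<forall>j\<in>?S. I j \<omega> = ks ! b j" by blast
    then show "\<forall>i\<in>?S. \<forall>j\<in>?S. I i \<omega> = I j \<omega> \<longleftrightarrow> b i = b j"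
      using b by (simp add: nth_eq_iff_index_eq)
  qed
  finally show ?thesis .
qed

text \<open>
  Sum the probabilities of the disjoint events that block \<open>l\<close> receives the index \<open>ks ! l\<close>;
  given the weights, such an event has probability \<open>index_weight P ns ks\<close>.
\<close>
lemma emeasure_index_partition:
  assumes iid: "iid_indices N \<mu> P I" and nonneg: "AE \<omega> in N. \<forall>i. 0 \<le> P \<omega> i"
    and P: "partition_on {1..n} (set As)" and As: "distinct As"
  shows "emeasure N {\<omega> \<in> space N. index_partition I n \<omega> = set As}
    = (\<integral>\<^sup>+\<omega>. distinct_sum (\<lambda>i. ennreal (P \<omega> i)) (map card As) \<partial>N)"
proof -
  interpret prob_space N using iid by (simp add: iid_indices_def)
  let ?S = "{1..n}" and ?k = "length As"
  have P_meas: "P \<in> N \<rightarrow>\<^sub>M seq_space" and I_meas: "\<And>j. I j \<in> N \<rightarrow>\<^sub>M count_space UNIV"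
    using iid by (simp_all add: iid_indices_def)
  have [measurable]: "(\<lambda>\<omega>. P \<omega> i) \<in> borel_measurable N" for i
    using P_meas unfolding seq_space_def by (rule measurable_compose) (simp add: measurable_component_singleton)
  have ex: "\<exists>l. l < ?k \<and> j \<in> As ! l" if "j \<in> ?S" for j
    using that partition_onD1[OF P] by (metis UnionE in_set_conv_nth)
  define b where "b j = (SOME l. l < ?k \<and> j \<in> As ! l)" for j
  have b: "b j < ?k \<and> j \<in> As ! b j" if "j \<in> ?S" for j
    unfolding b_def by (rule someI_ex[OF ex[OF that]])
  have blocks: "{j \<in> ?S. b j = l} = As ! l" if "l < ?k" for l
    by (rule partition_block_eq[OF P As b that, symmetric])
  define E where "E ks = {\<omega> \<in> space N. \<forall>j\<in>?S. I j \<omega> = ks ! b j}" for ks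
  define L where "L = {ks :: nat list. length ks = ?k \<and> distinct ks}"
  have E_sets: "E ks \<in> sets N" for ks
  proof -
    have "{\<omega> \<in> space N. I j \<omega> = ks ! b j} \<in> sets N" for j
    proof -
      have "{\<omega> \<in> space N. I j \<omega> = ks ! b j} = I j -` {ks ! b j} \<inter> space N" by auto
      then show ?thesis using measurable_sets[OF I_meas, of "{ks ! b j}" j] by simp
    qed
    then show ?thesis unfolding E_def by (intro sets.sets_Collect_finite_All) auto
  qed
  have "{\<omega> \<in> space N. index_partition I n \<omega> = set As} = (\<Union>ks\<in>L. E ks)"
    using index_partition_eq_iff[OF P As b, of I] unfolding E_def L_def by auto
  moreover have "disjoint_family_on E L"
  proof (unfold disjoint_family_on_def, intro ballI impI)
    fix ks ks' assume ks: "ks \<in> L" "ks' \<in> L" and "ks \<noteq> ks'"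
    then obtain l where l: "l < ?k" "ks ! l \<noteq> ks' ! l"
      by (auto simp: L_def list_eq_iff_nth_eq)
    have "As ! l \<noteq> {}" using partition_onD3[OF P] nth_mem[OF l(1)] by metis
    then obtain j where "j \<in> ?S" "b j = l" using blocks[OF l(1)] by blast
    then show "E ks \<inter> E ks' = {}" using l by (auto simp: E_def)
  qed
  ultimately have "emeasure N {\<omega> \<in> space N. index_partition I n \<omega> = set As} = (\<integral>\<^sup>+ks. emeasure N (E ks) \<partial>count_space L)"
    using E_sets by (simp add: emeasure_UN_countable)
  also have "\<dots> = (\<integral>\<^sup>+ks. emeasure N (E ks) * indicator L ks \<partial>count_space UNIV)"
    by (rule nn_integral_count_space_indicator) simp
  also have "\<dots> = (\<integral>\<^sup>+ks. (if length ks = length (map card As) \<and> distinct ks then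
      \<integral>\<^sup>+\<omega>. 1 * index_weight (\<lambda>i. ennreal (P \<omega> i)) (map card As) ks \<partial>N else 0) \<partial>count_space UNIV)"
  proof (intro nn_integral_cong)
    fix ks
    have "has_bochner_integral N (\<lambda>\<omega>. indicator (space seq_space) (P \<omega>) * (\<Prod>j=1..n. P \<omega> (ks ! b j)))
          (measure N {\<omega> \<in> space N. P \<omega> \<in> space seq_space \<and> (\<forall>j\<in>{1..n}. I j \<omega> = (\<lambda>j. ks ! b j) j)})"
    proof -
      have all: "\<forall>A\<in>sets seq_space. \<forall>n (i :: nat \<Rightarrow> nat).
        has_bochner_integral N (\<lambda>\<omega>. indicator A (P \<omega>) * (\<Prod>j=1..n. P \<omega> (i j)))
          (measure N {\<omega> \<in> space N. P \<omega> \<in> A \<and> (\<forall>j\<in>{1..n}. I j \<omega> = i j)})"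
        by (rule iid[unfolded iid_indices_def, THEN conjunct2, THEN conjunct2, THEN conjunct2, THEN conjunct2])
      show ?thesis by (rule spec[OF spec[OF bspec[OF all sets.top], of n], of "\<lambda>j. ks ! b j"])
    qed
    then have int: "has_bochner_integral N (\<lambda>\<omega>. \<Prod>j=1..n. P \<omega> (ks ! b j)) (measure N (E ks))"
      using measurable_space[OF P_meas] by (simp add: E_def seq_space_def space_PiM)
    have "emeasure N (E ks) = ennreal (\<integral>\<omega>. (\<Prod>j=1..n. P \<omega> (ks ! b j)) \<partial>N)"
      using int by (simp add: emeasure_eq_measure has_bochner_integral_iff)
    also have "\<dots> = (\<integral>\<^sup>+\<omega>. ennreal (\<Prod>j=1..n. P \<omega> (ks ! b j)) \<partial>N)"
    proof (rule nn_integral_eq_integral[symmetric])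
      show "integrable N (\<lambda>\<omega>. \<Prod>j=1..n. P \<omega> (ks ! b j))" using int by (simp add: has_bochner_integral_iff)
      show "AE \<omega> in N. 0 \<le> (\<Prod>j=1..n. P \<omega> (ks ! b j))"
        using nonneg by eventually_elim (simp add: prod_nonneg)
    qed
    also have "\<dots> = (\<integral>\<^sup>+\<omega>. 1 * index_weight (\<lambda>i. ennreal (P \<omega> i)) (map card As) ks \<partial>N)"
    proof (intro nn_integral_cong_AE, use nonneg in eventually_elim)
      case (elim \<omega>)
      have "ennreal (\<Prod>j=1..n. P \<omega> (ks ! b j)) = (\<Prod>j\<in>?S. ennreal (P \<omega> (ks ! b j)))"
        using elim by (simp add: prod_ennreal)
      also have "\<dots> = (\<Prod>l<?k. \<Prod>j\<in>{j \<in> ?S. b j = l}. ennreal (P \<omega> (ks ! b j)))"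
        by (rule prod.group[symmetric]) (use b in auto)
      also have "\<dots> = (\<Prod>l<?k. ennreal (P \<omega> (ks ! l)) ^ card (As ! l))"
      proof (intro prod.cong refl)
        fix l assume "l \<in> {..<?k}"
        then have "{j \<in> ?S. b j = l} = As ! l" using blocks by simp
        moreover have "(\<Prod>j\<in>{j \<in> ?S. b j = l}. ennreal (P \<omega> (ks ! b j))) = (\<Prod>j\<in>{j \<in> ?S. b j = l}. ennreal (P \<omega> (ks ! l)))"
          by (intro prod.cong) auto
        ultimately show "(\<Prod>j\<in>{j \<in> ?S. b j = l}. ennreal (P \<omega> (ks ! b j))) = ennreal (P \<omega> (ks ! l)) ^ card (As ! l)"
          by simp
      qed
      finally show ?case by (simp add: index_weight_def)
    qed
    finally show "emeasure N (E ks) * indicator L ks = (if length ks = length (map card As) \<and> distinct ks then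
      \<integral>\<^sup>+\<omega>. 1 * index_weight (\<lambda>i. ennreal (P \<omega> i)) (map card As) ks \<partial>N else 0)"
      by (simp add: L_def)
  qed
  also have "\<dots> = (\<integral>\<^sup>+\<omega>. 1 * distinct_sum (\<lambda>i. ennreal (P \<omega> i)) (map card As) \<partial>N)"
    by (rule nn_integral_distinct_sum[symmetric]) auto
  finally show ?thesis by simp
qed

section \<open>Partition probabilities of the Poisson-Kingman model\<close>

locale PK_model = stable_subordinator \<alpha> M X J + dens: stable_density \<alpha> f
  for \<alpha> :: real and M :: "'a measure" and X :: "real \<Rightarrow> 'a \<Rightarrow> real" and J :: "nat \<Rightarrow> 'a \<Rightarrow> real" and f :: "real \<Rightarrow> real" +
  fixes h :: "real \<Rightarrow> real" and K :: "real \<Rightarrow> (nat \<Rightarrow> real) measure"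
  assumes h[measurable]: "h \<in> borel_measurable borel" and h_nonneg: "\<And>t. 0 < t \<Longrightarrow> 0 \<le> h t"
    and K: "regular_conditional_law M (normalized_jumps J) (total_mass J) K"
begin

text \<open>
  The case of no blocks in \<open>Laplace_distinct_sum_jumps\<close>.
\<close>
lemma distr_total_mass: "distr M borel (total_mass J) = density lborel (\<lambda>x. ennreal (f x))"
proof (rule measure_eq_if_moment_Laplace_eq[where n=0])
  show "AE x in distr M borel (total_mass J). 0 < x"
  proof (subst AE_distr_iff)
    show "AE \<omega> in M. 0 < total_mass J \<omega>"
      using AE_pure_jump_path
    proof eventually_elim
      case (elim \<omega>)
      have "ennreal (J 0 \<omega>) \<le> (\<integral>\<^sup>+i. ennreal (J i \<omega>) \<partial>count_space UNIV)"
        by (rule nn_integral_ge_point) simp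
      then have "ennreal (J 0 \<omega>) \<le> ennreal (total_mass J \<omega>)" using elim by simp
      moreover have "0 < J 0 \<omega>" using elim regular_path_J_pos by blast
      ultimately show ?case by (metis ennreal_le_iff2 less_le_trans not_le)
    qed
  qed auto
  show "AE x in density lborel (\<lambda>x. ennreal (f x)). 0 < x" by (rule dens.AE_density_f_pos)
  fix l :: real assume l: "0 < l"
  have "(\<integral>\<^sup>+x. ennreal (x ^ 0 * exp (- l * x)) \<partial>distr M borel (total_mass J))
    = (\<integral>\<^sup>+\<omega>. ennreal (exp (- l * total_mass J \<omega>)) * distinct_sum (\<lambda>i. ennreal (J i \<omega>)) [] \<partial>M)"
    by (subst nn_integral_distr) (auto simp: distinct_sum_Nil)
  also have "\<dots> = ennreal (exp (- (l powr \<alpha>)))"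
    by (subst Laplace_distinct_sum_jumps[OF l]) auto
  also have "\<dots> = (\<integral>\<^sup>+x. ennreal (x ^ 0 * exp (- l * x)) \<partial>density lborel (\<lambda>x. ennreal (f x)))"
    using dens.nn_integral_density_f[OF l] by simp
  finally show "(\<integral>\<^sup>+x. ennreal (x ^ 0 * exp (- l * x)) \<partial>distr M borel (total_mass J))
    = (\<integral>\<^sup>+x. ennreal (x ^ 0 * exp (- l * x)) \<partial>density lborel (\<lambda>x. ennreal (f x)))" .
  show "(\<integral>\<^sup>+x. ennreal (x ^ 0 * exp (- l * x)) \<partial>density lborel (\<lambda>x. ennreal (f x))) < \<infinity>"
    using dens.nn_integral_density_f[OF l] by simp
qed auto

lemma AE_total_mass_pos: "AE \<omega> in M. 0 < total_mass J \<omega>"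
proof -
  have "AE x in distr M borel (total_mass J). 0 < x"
    unfolding distr_total_mass by (rule dens.AE_density_f_pos)
  then show ?thesis by (subst (asm) AE_distr_iff) auto
qed

lemma normalized_jumps_measurable[measurable]: "normalized_jumps J \<in> M \<rightarrow>\<^sub>M seq_space"
  unfolding seq_space_def
  by (rule measurable_PiM_single') (auto simp: normalized_jumps_def)

lemma normalized_jump_measurable[measurable]: "(\<lambda>\<omega>. normalized_jumps J \<omega> i) \<in> borel_measurable M"
  by (simp add: normalized_jumps_def)

lemma K_measurable: "K \<in> borel \<rightarrow>\<^sub>M subprob_algebra seq_space"
  using K by (auto simp: regular_conditional_law_def dest: measurable_prob_algebraD)

lemma K_emeasure_measurable[measurable]:
  assumes "A \<in> sets seq_space"
  shows "(\<lambda>t. emeasure (K t) A) \<in> borel_measurable borel"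
  using K_measurable measurable_emeasure_subprob_algebra[OF assms] by (rule measurable_compose)

lemma nn_integral_conditional_law:
  assumes A: "A \<in> sets seq_space" and [measurable]: "v \<in> borel_measurable borel"
  shows "(\<integral>\<^sup>+\<omega>. v (total_mass J \<omega>) * indicator A (normalized_jumps J \<omega>) \<partial>M)
    = (\<integral>\<^sup>+t. v t * emeasure (K t) A \<partial>distr M borel (total_mass J))"
proof -
  note [measurable] = A K_emeasure_measurable[OF A]
  let ?D = "density M (\<lambda>\<omega>. indicator A (normalized_jumps J \<omega>))"
  have "distr ?D borel (total_mass J) = density (distr M borel (total_mass J)) (\<lambda>t. emeasure (K t) A)"
  proof (rule measure_eqI)
    fix B assume "B \<in> sets (distr ?D borel (total_mass J))"
    then have B[measurable]: "B \<in> sets borel" by simp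
    have "emeasure (distr ?D borel (total_mass J)) B = emeasure ?D (total_mass J -` B \<inter> space M)"
      by (simp add: emeasure_distr)
    also have "\<dots> = (\<integral>\<^sup>+\<omega>. indicator A (normalized_jumps J \<omega>) * indicator (total_mass J -` B \<inter> space M) \<omega> \<partial>M)"
      by (rule emeasure_density) measurable
    also have "\<dots> = (\<integral>\<^sup>+\<omega>. indicator {\<omega> \<in> space M. normalized_jumps J \<omega> \<in> A \<and> total_mass J \<omega> \<in> B} \<omega> \<partial>M)"
      by (intro nn_integral_cong) (auto simp: indicator_def)
    also have "\<dots> = emeasure M {\<omega> \<in> space M. normalized_jumps J \<omega> \<in> A \<and> total_mass J \<omega> \<in> B}"
      by (rule nn_integral_indicator) measurable
    also have "\<dots> = (\<integral>\<^sup>+t\<in>B. emeasure (K t) A \<partial>distr M borel (total_mass J))"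
      using K A B by (auto simp: regular_conditional_law_def)
    also have "\<dots> = emeasure (density (distr M borel (total_mass J)) (\<lambda>t. emeasure (K t) A)) B"
      by (subst emeasure_density) auto
    finally show "emeasure (distr ?D borel (total_mass J)) B = emeasure (density (distr M borel (total_mass J)) (\<lambda>t. emeasure (K t) A)) B" .
  qed simp
  then have "(\<integral>\<^sup>+t. v t \<partial>distr ?D borel (total_mass J)) = (\<integral>\<^sup>+t. v t \<partial>density (distr M borel (total_mass J)) (\<lambda>t. emeasure (K t) A))"
    by simp
  moreover have "(\<integral>\<^sup>+t. v t \<partial>distr ?D borel (total_mass J)) = (\<integral>\<^sup>+\<omega>. indicator A (normalized_jumps J \<omega>) * v (total_mass J \<omega>) \<partial>M)"
    by (simp add: nn_integral_distr nn_integral_density)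
  ultimately show ?thesis by (simp add: nn_integral_density mult.commute)
qed

text \<open>
  Conditioning on the total mass and mixing over \<open>h t * f t\<close> is the same as weighting the
  unconditioned law by \<open>h\<close> of the total mass, since \<open>f\<close> is the density of the total mass.
\<close>
lemma PK_mixture_eq:
  "PK_mixture K (density lborel (\<lambda>t. ennreal (h t * f t)))
    = distr (density M (\<lambda>\<omega>. ennreal (h (total_mass J \<omega>)))) seq_space (normalized_jumps J)"
proof (rule measure_eqI)
  let ?\<gamma> = "density lborel (\<lambda>t. ennreal (h t * f t))"
  have Km: "K \<in> ?\<gamma> \<rightarrow>\<^sub>M subprob_algebra seq_space" using K_measurable by (simp cong: measurable_cong_sets)
  have sets: "sets (PK_mixture K ?\<gamma>) = sets seq_space"
    unfolding PK_mixture_def by (rule sets_bind[OF sets_kernel[OF Km]]) auto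
  then show "sets (PK_mixture K ?\<gamma>) = sets (distr (density M (\<lambda>\<omega>. ennreal (h (total_mass J \<omega>)))) seq_space (normalized_jumps J))"
    by simp
  fix A assume "A \<in> sets (PK_mixture K ?\<gamma>)"
  then have A[measurable]: "A \<in> sets seq_space" using sets by simp
  note [measurable] = K_emeasure_measurable[OF A]
  have "emeasure (PK_mixture K ?\<gamma>) A = (\<integral>\<^sup>+t. emeasure (K t) A \<partial>?\<gamma>)"
    unfolding PK_mixture_def by (rule emeasure_bind[OF _ Km A]) simp
  also have "\<dots> = (\<integral>\<^sup>+t. ennreal (h t * f t) * emeasure (K t) A \<partial>lborel)"
    by (simp add: nn_integral_density)
  also have "\<dots> = (\<integral>\<^sup>+t. ennreal (f t) * (ennreal (h t) * emeasure (K t) A) \<partial>lborel)"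
  proof (intro nn_integral_cong)
    fix t :: real
    show "ennreal (h t * f t) * emeasure (K t) A = ennreal (f t) * (ennreal (h t) * emeasure (K t) A)"
      using h_nonneg[of t] dens.f_nonneg[of t] dens.f_nonpos[of t]
      by (cases "0 < t") (auto simp: ennreal_mult mult_ac)
  qed
  also have "\<dots> = (\<integral>\<^sup>+t. ennreal (h t) * emeasure (K t) A \<partial>distr M borel (total_mass J))"
    unfolding distr_total_mass by (simp add: nn_integral_density)
  also have "\<dots> = (\<integral>\<^sup>+\<omega>. ennreal (h (total_mass J \<omega>)) * indicator A (normalized_jumps J \<omega>) \<partial>M)"
    by (rule nn_integral_conditional_law[symmetric]) auto
  also have "\<dots> = emeasure (density M (\<lambda>\<omega>. ennreal (h (total_mass J \<omega>)))) (normalized_jumps J -` A \<inter> space M)"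
    by (subst emeasure_density) (auto intro!: nn_integral_cong simp: indicator_def)
  also have "\<dots> = emeasure (distr (density M (\<lambda>\<omega>. ennreal (h (total_mass J \<omega>)))) seq_space (normalized_jumps J)) A"
    by (simp add: emeasure_distr)
  finally show "emeasure (PK_mixture K ?\<gamma>) A = emeasure (distr (density M (\<lambda>\<omega>. ennreal (h (total_mass J \<omega>)))) seq_space (normalized_jumps J)) A" .
qed

text \<open>
  The partition probability is the integral of \<open>h\<close> against this measure: the law of the
  total mass, weighted by the probability that samples from the normalised jumps realise the
  blocks.
\<close>
definition block_measure :: "nat list \<Rightarrow> real measure" where
  "block_measure ns = distr (density M (\<lambda>\<omega>. distinct_sum (\<lambda>i. ennreal (normalized_jumps J \<omega> i)) ns)) borel (total_mass J)"

lemma distinct_sum_normalized_measurable[measurable]: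
  "(\<lambda>\<omega>. distinct_sum (\<lambda>i. ennreal (normalized_jumps J \<omega> i)) ns) \<in> borel_measurable M"
  by (rule measurable_distinct_sum) measurable

lemma nn_integral_block_measure:
  assumes [measurable]: "g \<in> borel_measurable borel"
  shows "(\<integral>\<^sup>+t. g t \<partial>block_measure ns) = (\<integral>\<^sup>+\<omega>. distinct_sum (\<lambda>i. ennreal (normalized_jumps J \<omega> i)) ns * g (total_mass J \<omega>) \<partial>M)"
  unfolding block_measure_def by (simp add: nn_integral_distr nn_integral_density)

text \<open>
  The weight \<open>t ^ n\<close> in the transform undoes the normalisation of the jumps.
\<close>
lemma gibbs_transform_block_measure:
  assumes ns: "0 \<notin> set ns"
  shows "gibbs_transform \<alpha> (sum_list ns) (length ns) (\<alpha> ^ length ns * (\<Prod>m\<leftarrow>ns. pochhammer (1 - \<alpha>) (m - 1))) (block_measure ns)"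
  unfolding gibbs_transform_def
proof (intro conjI allI impI)
  show "sets (block_measure ns) = sets borel" by (simp add: block_measure_def)
  show "AE x in block_measure ns. 0 < x"
    unfolding block_measure_def using AE_total_mass_pos
    by (subst AE_distr_iff) (auto simp: AE_density elim!: eventually_mono)
  fix l :: real assume l: "0 < l"
  let ?n = "sum_list ns" and ?k = "length ns"
  have "(\<integral>\<^sup>+x. ennreal (x ^ ?n * exp (- l * x)) \<partial>block_measure ns)
    = (\<integral>\<^sup>+\<omega>. ennreal (exp (- l * total_mass J \<omega>)) * distinct_sum (\<lambda>i. ennreal (J i \<omega>)) ns \<partial>M)"
    unfolding nn_integral_block_measure[OF borel_measurable_power_exp]
    using AE_total_mass_pos AE_pure_jump_path
  proof (intro nn_integral_cong_AE, eventually_elim)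
    case (elim \<omega>)
    let ?S = "total_mass J \<omega>"
    have S: "0 < ?S" and reg: "regular_path \<omega>" using elim by simp_all
    have "ennreal (J i \<omega>) = ennreal ?S * ennreal (normalized_jumps J \<omega> i)" for i
      using S regular_path_J_pos[OF reg, of i]
      by (simp add: normalized_jumps_def ennreal_mult[symmetric])
    then have "distinct_sum (\<lambda>i. ennreal (J i \<omega>)) ns = ennreal ?S ^ ?n * distinct_sum (\<lambda>i. ennreal (normalized_jumps J \<omega> i)) ns"
      by (simp add: distinct_sum_scale)
    then show ?case using S by (simp add: ennreal_mult ennreal_power mult_ac)
  qed
  also have "\<dots> = ennreal ((\<Prod>j<?k. \<alpha> * pochhammer (1 - \<alpha>) (ns ! j - 1) * l powr (\<alpha> - real (ns ! j))) * exp (- (l powr \<alpha>)))"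
    by (rule Laplace_distinct_sum_jumps[OF l ns])
  also have "(\<Prod>j<?k. \<alpha> * pochhammer (1 - \<alpha>) (ns ! j - 1) * l powr (\<alpha> - real (ns ! j)))
    = \<alpha> ^ ?k * (\<Prod>m\<leftarrow>ns. pochhammer (1 - \<alpha>) (m - 1)) * l powr (real ?k * \<alpha> - real ?n)"
  proof -
    have "(\<Prod>j<?k. \<alpha> * pochhammer (1 - \<alpha>) (ns ! j - 1) * l powr (\<alpha> - real (ns ! j)))
      = (\<Prod>m\<leftarrow>ns. \<alpha> * pochhammer (1 - \<alpha>) (m - 1) * l powr (\<alpha> - real m))"
      by (simp add: prod.list_conv_set_nth atLeast0LessThan)
    also have "\<dots> = \<alpha> ^ ?k * (\<Prod>m\<leftarrow>ns. pochhammer (1 - \<alpha>) (m - 1)) * l powr (real ?k * \<alpha> - real ?n)"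
    proof (induction ns)
      case (Cons m ns)
      have "l powr (real (length (m # ns)) * \<alpha> - real (sum_list (m # ns)))
        = l powr (\<alpha> - real m) * l powr (real (length ns) * \<alpha> - real (sum_list ns))"
        by (simp add: powr_add[symmetric] algebra_simps)
      then show ?case using Cons by simp
    qed (use l in simp)
    finally show ?thesis .
  qed
  finally show "(\<integral>\<^sup>+x. ennreal (x ^ ?n * exp (- l * x)) \<partial>block_measure ns)
    = ennreal (\<alpha> ^ ?k * (\<Prod>m\<leftarrow>ns. pochhammer (1 - \<alpha>) (m - 1)) * (l powr (real ?k * \<alpha> - real ?n) * exp (- (l powr \<alpha>))))"
    by (simp add: mult.assoc)
qed

lemma emeasure_EPPF:
  assumes iid: "iid_indices N (PK_mixture K (density lborel (\<lambda>t. ennreal (h t * f t)))) P I"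
    and P: "partition_on {1..n} (set As)" and As: "distinct As"
  shows "emeasure N {\<omega> \<in> space N. index_partition I n \<omega> = set As}
    = (\<integral>\<^sup>+t. ennreal (h t) \<partial>block_measure (map card As))"
proof -
  let ?\<mu> = "PK_mixture K (density lborel (\<lambda>t. ennreal (h t * f t)))"
  have P_meas: "P \<in> N \<rightarrow>\<^sub>M seq_space" and P_distr: "distr N seq_space P = ?\<mu>"
    using iid by (simp_all add: iid_indices_def)
  have comp[measurable]: "(\<lambda>p. p i) \<in> borel_measurable seq_space" for i
    unfolding seq_space_def by (simp add: measurable_component_singleton)
  have ds[measurable]: "(\<lambda>p. distinct_sum (\<lambda>i. ennreal (p i)) ns) \<in> borel_measurable seq_space" for ns
    by (rule measurable_distinct_sum) measurable
  have "AE \<omega> in M. \<forall>i. 0 \<le> normalized_jumps J \<omega> i"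
    using AE_total_mass_pos AE_pure_jump_path
    by eventually_elim (auto simp: normalized_jumps_def less_imp_le regular_path_J_pos)
  then have "AE p in ?\<mu>. \<forall>i. 0 \<le> p i"
    unfolding PK_mixture_eq by (subst AE_distr_iff) (auto simp: AE_density elim!: eventually_mono)
  then have "AE \<omega> in N. \<forall>i. 0 \<le> P \<omega> i"
    unfolding P_distr[symmetric] by (subst (asm) AE_distr_iff[OF P_meas]) auto
  from emeasure_index_partition[OF iid this P As]
  have "emeasure N {\<omega> \<in> space N. index_partition I n \<omega> = set As}
    = (\<integral>\<^sup>+\<omega>. distinct_sum (\<lambda>i. ennreal (P \<omega> i)) (map card As) \<partial>N)" .
  also have "\<dots> = (\<integral>\<^sup>+p. distinct_sum (\<lambda>i. ennreal (p i)) (map card As) \<partial>?\<mu>)"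
    unfolding P_distr[symmetric] by (subst nn_integral_distr[OF P_meas]) (simp_all add: ds)
  also have "\<dots> = (\<integral>\<^sup>+\<omega>. ennreal (h (total_mass J \<omega>)) * distinct_sum (\<lambda>i. ennreal (normalized_jumps J \<omega> i)) (map card As) \<partial>M)"
    unfolding PK_mixture_eq by (simp add: nn_integral_distr nn_integral_density)
  also have "\<dots> = (\<integral>\<^sup>+t. ennreal (h t) \<partial>block_measure (map card As))"
    by (subst nn_integral_block_measure) (auto simp: mult.commute)
  finally show ?thesis .
qed

end

section \<open>Contour integrals of exponentially decaying functions\<close>

lemma set_integrable_exp_decay:
  fixes r a :: real
  assumes "0 < r"
  shows "set_integrable lborel {a..} (\<lambda>x. exp (- r * x))"
proof -
  have lim: "((\<lambda>x. - exp (- r * x) / r) \<longlongrightarrow> 0) at_top"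
    using assms by real_asymp
  have "(\<integral>\<^sup>+x. ennreal (exp (- r * x)) * indicator {a..} x \<partial>lborel) = ennreal (0 - (- exp (- r * a) / r))"
    by (rule nn_integral_FTC_atLeast[OF _ _ _ lim])
      (use assms in \<open>auto intro!: derivative_eq_intros\<close>)
  then have "(\<integral>\<^sup>+x. ennreal (indicator {a..} x * exp (- r * x)) \<partial>lborel) < \<infinity>"
    by (simp add: ennreal_mult' ennreal_indicator mult.commute)
  then show ?thesis
    unfolding set_integrable_def real_scaleR_def
    by (intro integrableI_nonneg) auto
qed

lemma set_integrable_exp_bounded:
  fixes f :: "real \<Rightarrow> complex"
  assumes "0 < r" and cont: "continuous_on {a..} f" and bound: "\<And>x. a \<le> x \<Longrightarrow> norm (f x) \<le> C * exp (- r * x)"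
  shows "set_integrable lborel {a..} f"
proof -
  have "integrable lborel (\<lambda>x. C * (indicator {a..} x *\<^sub>R exp (- r * x)))"
    using set_integrable_exp_decay[OF assms(1), of a] unfolding set_integrable_def by (rule integrable_mult_right)
  then show ?thesis
    unfolding set_integrable_def
  proof (rule Bochner_Integration.integrable_bound)
    show "(\<lambda>x. indicator {a..} x *\<^sub>R f x) \<in> borel_measurable lborel"
      using borel_measurable_continuous_on_indicator[OF _ cont] by simp
    show "AE x in lborel. norm (indicator {a..} x *\<^sub>R f x) \<le> norm (C * (indicator {a..} x *\<^sub>R exp (- r * x)))"
    proof (rule AE_I2)
      fix x show "norm (indicator {a..} x *\<^sub>R f x) \<le> norm (C * (indicator {a..} x *\<^sub>R exp (- r * x)))"
      proof (cases "a \<le> x")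
        case True
        have "C * exp (- r * x) \<le> \<bar>C\<bar> * exp (- r * x)" by (intro mult_right_mono) auto
        with bound[OF True] have "norm (f x) \<le> \<bar>C\<bar> * exp (- r * x)" by (rule order_trans)
        then show ?thesis using True by (simp add: abs_mult)
      qed simp
    qed
  qed
qed

lemma set_integral_primitive:
  fixes f G :: "real \<Rightarrow> complex"
  assumes "a \<le> b" and cont: "continuous_on {a..b} f"
    and G: "\<And>x. x \<in> {a..b} \<Longrightarrow> (G has_vector_derivative f x) (at x within {a..b})"
  shows "(LBINT x:{a..b}. f x) = G b - G a"
proof -
  have "set_integrable lborel {a..b} f"
    by (rule borel_integrable_atLeastAtMost') (rule cont)
  then have "(LBINT x:{a..b}. f x) = integral {a..b} f" by (rule set_borel_integral_eq_integral(2))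
  also have "\<dots> = G b - G a"
    by (rule integral_unique[OF fundamental_theorem_of_calculus[OF assms(1) G]])
  finally show ?thesis .
qed

lemma set_integral_tendsto_at_top:
  fixes f :: "real \<Rightarrow> complex"
  assumes "set_integrable lborel {a..} f"
  shows "(\<lambda>m. LBINT x:{a..real m}. f x) \<longlonglongrightarrow> (LBINT x:{a..}. f x)"
  unfolding set_lebesgue_integral_def
proof (rule integral_dominated_convergence[where w="\<lambda>x. norm (indicator {a..} x *\<^sub>R f x)"])
  have i: "integrable lborel (\<lambda>x. indicator {a..} x *\<^sub>R f x)" using assms by (simp add: set_integrable_def)
  show "(\<lambda>x. indicator {a..} x *\<^sub>R f x) \<in> borel_measurable lborel" using i by (rule borel_measurable_integrable)
  show "integrable lborel (\<lambda>x. norm (indicator {a..} x *\<^sub>R f x))" using i by (rule integrable_norm)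
  show "(\<lambda>x. indicator {a..real m} x *\<^sub>R f x) \<in> borel_measurable lborel" for m
  proof -
    have "(\<lambda>x. indicator {..real m} x *\<^sub>R (indicator {a..} x *\<^sub>R f x)) \<in> borel_measurable lborel"
      by (intro borel_measurable_scaleR borel_measurable_integrable[OF i]) auto
    also have "(\<lambda>x. indicator {..real m} x *\<^sub>R (indicator {a..} x *\<^sub>R f x)) = (\<lambda>x. indicator {a..real m} x *\<^sub>R f x)"
      by (auto simp: indicator_def fun_eq_iff)
    finally show ?thesis .
  qed
  show "AE x in lborel. (\<lambda>m. indicator {a..real m} x *\<^sub>R f x) \<longlonglongrightarrow> indicator {a..} x *\<^sub>R f x"
  proof (rule AE_I2, rule tendsto_eventually)
    fix x :: real
    have "\<forall>\<^sub>F m in sequentially. x \<le> real m"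
      using filterlim_real_sequentially by (simp add: filterlim_at_top)
    then show "\<forall>\<^sub>F m in sequentially. indicator {a..real m} x *\<^sub>R f x = indicator {a..} x *\<^sub>R f x"
      by eventually_elim (auto simp: indicator_def)
  qed
  show "AE x in lborel. norm (indicator {a..real m} x *\<^sub>R f x) \<le> norm (indicator {a..} x *\<^sub>R f x)" for m
    by (rule AE_I2) (auto simp: indicator_def)
qed

text \<open>
  Cauchy's theorem for the horizontal half-line to the right and the vertical half-line
  upwards from the same corner. A primitive on the upper half-plane reduces it to comparing
  two values of the primitive far out; the path joining them over the corner \<open>(m, m)\<close> stays
  in the region of exponential decay.
\<close>
lemma corner_contour_shift:
  fixes F :: "complex \<Rightarrow> complex"
  assumes hol: "F holomorphic_on {s. 0 < Im s}" and \<phi>: "0 < \<phi>" and \<kappa>: "0 < \<kappa>"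
    and bound: "\<And>s. c \<le> Re s \<Longrightarrow> \<phi> \<le> Im s \<Longrightarrow> norm (F s) \<le> C * exp (- Re s - \<kappa> * Im s)"
  shows "set_integrable lborel {c..} (\<lambda>x. F (Complex x \<phi>))"
    and "set_integrable lborel {\<phi>..} (\<lambda>y. F (Complex c y))"
    and "(LBINT x:{c..}. F (Complex x \<phi>)) = \<i> * (LBINT y:{\<phi>..}. F (Complex c y))"
proof -
  have cont: "continuous_on {s. 0 < Im s} F" using hol by (rule holomorphic_on_imp_continuous_on)
  have cont_h: "continuous_on S (\<lambda>x. F (Complex x \<phi>))" for S
    by (rule continuous_on_compose2[OF cont]) (use \<phi> in \<open>auto simp: Complex_eq intro!: continuous_intros\<close>)
  have cont_v: "continuous_on S (\<lambda>y. F (Complex c y))" if "S \<subseteq> {\<phi>..}" for S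
    by (rule continuous_on_compose2[OF cont]) (use \<phi> that in \<open>auto simp: Complex_eq intro!: continuous_intros\<close>)
  have C: "0 \<le> C"
  proof -
    have "0 \<le> norm (F (Complex c \<phi>))" by simp
    also have "\<dots> \<le> C * exp (- c - \<kappa> * \<phi>)" using bound[of "Complex c \<phi>"] by simp
    finally show ?thesis by (simp add: zero_le_mult_iff)
  qed
  show int_h: "set_integrable lborel {c..} (\<lambda>x. F (Complex x \<phi>))"
  proof (rule set_integrable_exp_bounded[where r=1 and C="C * exp (- \<kappa> * \<phi>)"])
    fix x assume "c \<le> x"
    then have "norm (F (Complex x \<phi>)) \<le> C * exp (- x - \<kappa> * \<phi>)" using bound[of "Complex x \<phi>"] by simp
    then show "norm (F (Complex x \<phi>)) \<le> C * exp (- \<kappa> * \<phi>) * exp (- 1 * x)"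
      by (simp add: exp_add[symmetric] mult.assoc add.commute exp_diff exp_minus field_simps)
  qed (simp_all add: cont_h)
  show int_v: "set_integrable lborel {\<phi>..} (\<lambda>y. F (Complex c y))"
  proof (rule set_integrable_exp_bounded[where r=\<kappa> and C="C * exp (- c)"])
    fix y assume "\<phi> \<le> y"
    then have "norm (F (Complex c y)) \<le> C * exp (- c - \<kappa> * y)" using bound[of "Complex c y"] by simp
    then show "norm (F (Complex c y)) \<le> C * exp (- c) * exp (- \<kappa> * y)"
      by (simp add: exp_diff exp_minus field_simps)
  qed (simp_all add: cont_v \<kappa>)
  obtain G where G: "\<And>s. 0 < Im s \<Longrightarrow> (G has_field_derivative F s) (at s)"
  proof -
    have op: "open {s. 0 < Im s}" by (rule open_halfspace_Im_gt)
    obtain g where g: "\<And>x. x \<in> {s. 0 < Im s} \<Longrightarrow> (g has_field_derivative F x) (at x within {s. 0 < Im s})"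
      using holomorphic_convex_primitive'[OF convex_halfspace_Im_gt op hol] by blast
    show ?thesis
    proof (rule that)
      fix s assume "0 < Im s"
      then have s: "s \<in> {s. 0 < Im s}" by simp
      show "(g has_field_derivative F s) (at s)" using g[OF s] unfolding at_within_open[OF s op] .
    qed
  qed
  have deriv_h: "((\<lambda>x. G (Complex x \<phi>)) has_vector_derivative F (Complex x \<phi>)) (at x within S)" for x S
  proof -
    have "((\<lambda>x. Complex x \<phi>) has_vector_derivative 1) (at x within S)"
      unfolding Complex_eq by (auto intro!: derivative_eq_intros)
    from field_vector_diff_chain_within[OF this, of G "F (Complex x \<phi>)"] G[of "Complex x \<phi>"] \<phi>
    show ?thesis by (simp add: o_def has_field_derivative_at_within)
  qed
  have deriv_v: "((\<lambda>y. G (Complex c y)) has_vector_derivative \<i> * F (Complex c y)) (at y within S)" if "0 < y" for y S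
  proof -
    have "((\<lambda>y. Complex c y) has_vector_derivative \<i>) (at y within S)"
      unfolding Complex_eq by (auto intro!: derivative_eq_intros)
    from field_vector_diff_chain_within[OF this, of G "F (Complex c y)"] G[of "Complex c y"] that
    show ?thesis by (simp add: o_def has_field_derivative_at_within)
  qed
  have lim_h: "(\<lambda>m. G (Complex (real m) \<phi>) - G (Complex c \<phi>)) \<longlonglongrightarrow> (LBINT x:{c..}. F (Complex x \<phi>))"
  proof (rule Lim_transform_eventually[OF set_integral_tendsto_at_top[OF int_h]])
    have "\<forall>\<^sub>F m in sequentially. c \<le> real m"
      using filterlim_real_sequentially by (simp add: filterlim_at_top)
    then show "\<forall>\<^sub>F m in sequentially. (LBINT x:{c..real m}. F (Complex x \<phi>)) = G (Complex (real m) \<phi>) - G (Complex c \<phi>)"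
      by eventually_elim (rule set_integral_primitive[OF _ cont_h deriv_h])
  qed
  have lim_v: "(\<lambda>m. G (Complex c (real m)) - G (Complex c \<phi>)) \<longlonglongrightarrow> \<i> * (LBINT y:{\<phi>..}. F (Complex c y))"
  proof (rule Lim_transform_eventually[OF tendsto_mult_left[OF set_integral_tendsto_at_top[OF int_v]]])
    have "\<forall>\<^sub>F m in sequentially. \<phi> \<le> real m"
      using filterlim_real_sequentially by (simp add: filterlim_at_top)
    then show "\<forall>\<^sub>F m in sequentially. \<i> * (LBINT y:{\<phi>..real m}. F (Complex c y)) = G (Complex c (real m)) - G (Complex c \<phi>)"
    proof eventually_elim
      case (elim m)
      have "\<i> * (LBINT y:{\<phi>..real m}. F (Complex c y)) = (LBINT y:{\<phi>..real m}. \<i> * F (Complex c y))"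
        by (rule set_integral_mult_right[symmetric])
      also have "\<dots> = G (Complex c (real m)) - G (Complex c \<phi>)"
        by (rule set_integral_primitive[OF elim]) (use \<phi> in \<open>auto intro!: continuous_intros cont_v deriv_v\<close>)
      finally show ?case .
    qed
  qed
  have diff: "norm (G (Complex (real m) \<phi>) - G (Complex c (real m)))
      \<le> C * exp (- real m - \<kappa> * \<phi>) * (real m - \<phi>) + C * exp (- c - \<kappa> * real m) * (real m - c)"
    if m: "c \<le> real m" "\<phi> \<le> real m" for m
  proof -
    let ?R = "real m"
    have b1: "norm (G (Complex ?R \<phi>) - G (Complex ?R ?R)) \<le> C * exp (- ?R - \<kappa> * \<phi>) * norm (Complex ?R \<phi> - Complex ?R ?R)"
    proof (rule field_differentiable_bound[where S="{s. ?R \<le> Re s} \<inter> {s. \<phi> \<le> Im s}" and f'=F])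
      show "convex ({s. ?R \<le> Re s} \<inter> {s. \<phi> \<le> Im s})"
        by (intro convex_Int convex_halfspace_Re_ge convex_halfspace_Im_ge)
      fix s assume s: "s \<in> {s. ?R \<le> Re s} \<inter> {s. \<phi> \<le> Im s}"
      show "(G has_field_derivative F s) (at s within {s. ?R \<le> Re s} \<inter> {s. \<phi> \<le> Im s})"
        by (rule has_field_derivative_at_within[OF G]) (use s \<phi> in auto)
      have "norm (F s) \<le> C * exp (- Re s - \<kappa> * Im s)" using s m by (intro bound) auto
      also have "\<dots> \<le> C * exp (- ?R - \<kappa> * \<phi>)"
        using s C \<kappa> by (intro mult_left_mono) (auto intro: diff_mono)
      finally show "norm (F s) \<le> C * exp (- ?R - \<kappa> * \<phi>)" .
    qed (use m in auto)
    have b2: "norm (G (Complex ?R ?R) - G (Complex c ?R)) \<le> C * exp (- c - \<kappa> * ?R) * norm (Complex ?R ?R - Complex c ?R)"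
    proof (rule field_differentiable_bound[where S="{s. c \<le> Re s} \<inter> {s. ?R \<le> Im s}" and f'=F])
      show "convex ({s. c \<le> Re s} \<inter> {s. ?R \<le> Im s})"
        by (intro convex_Int convex_halfspace_Re_ge convex_halfspace_Im_ge)
      fix s assume s: "s \<in> {s. c \<le> Re s} \<inter> {s. ?R \<le> Im s}"
      show "(G has_field_derivative F s) (at s within {s. c \<le> Re s} \<inter> {s. ?R \<le> Im s})"
        by (rule has_field_derivative_at_within[OF G]) (use s m \<phi> in auto)
      have "norm (F s) \<le> C * exp (- Re s - \<kappa> * Im s)" using s m by (intro bound) auto
      also have "\<dots> \<le> C * exp (- c - \<kappa> * ?R)"
        using s C \<kappa> by (intro mult_left_mono) (auto intro: diff_mono)
      finally show "norm (F s) \<le> C * exp (- c - \<kappa> * ?R)" .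
    qed (use m in auto)
    have "norm (Complex ?R \<phi> - Complex ?R ?R) = ?R - \<phi>" "norm (Complex ?R ?R - Complex c ?R) = ?R - c"
      using m by (simp_all add: complex_diff cmod_def)
    with b1 b2 norm_triangle_ineq[of "G (Complex ?R \<phi>) - G (Complex ?R ?R)" "G (Complex ?R ?R) - G (Complex c ?R)"]
    show ?thesis by simp
  qed
  have lim_0: "(\<lambda>m. G (Complex (real m) \<phi>) - G (Complex c (real m))) \<longlonglongrightarrow> 0"
  proof (rule Lim_null_comparison)
    have "\<forall>\<^sub>F m in sequentially. c \<le> real m \<and> \<phi> \<le> real m"
      using filterlim_real_sequentially by (simp add: filterlim_at_top eventually_conj)
    then show "\<forall>\<^sub>F m in sequentially. norm (G (Complex (real m) \<phi>) - G (Complex c (real m)))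
      \<le> C * exp (- real m - \<kappa> * \<phi>) * (real m - \<phi>) + C * exp (- c - \<kappa> * real m) * (real m - c)"
      by eventually_elim (rule diff; simp)
    show "(\<lambda>m. C * exp (- real m - \<kappa> * \<phi>) * (real m - \<phi>) + C * exp (- c - \<kappa> * real m) * (real m - c)) \<longlonglongrightarrow> 0"
    proof -
      have "(\<lambda>m. exp (- real m) * (real m - \<phi>)) \<longlonglongrightarrow> 0" by real_asymp
      moreover have "(\<lambda>m. exp (- \<kappa> * real m) * (real m - c)) \<longlonglongrightarrow> 0" using \<kappa> by real_asymp
      ultimately have "(\<lambda>m. C * exp (- \<kappa> * \<phi>) * (exp (- real m) * (real m - \<phi>)) + C * exp (- c) * (exp (- \<kappa> * real m) * (real m - c)))
        \<longlonglongrightarrow> C * exp (- \<kappa> * \<phi>) * 0 + C * exp (- c) * 0"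
        by (intro tendsto_add tendsto_mult_left)
      then show ?thesis by (simp add: exp_diff exp_minus field_simps)
    qed
  qed
  have "(\<lambda>m. G (Complex (real m) \<phi>) - G (Complex c (real m))) \<longlonglongrightarrow> (LBINT x:{c..}. F (Complex x \<phi>)) - \<i> * (LBINT y:{\<phi>..}. F (Complex c y))"
    using tendsto_diff[OF lim_h lim_v] by simp
  from LIMSEQ_unique[OF this lim_0]
  show "(LBINT x:{c..}. F (Complex x \<phi>)) = \<i> * (LBINT y:{\<phi>..}. F (Complex c y))"
    by simp
qed

section \<open>Bounds for the complex Gamma function\<close>

text \<open>
  In the logarithmic variable the Gamma integrand is an exponential of \<open>z * x\<close>: shifts of
  \<open>x\<close> and products become plain additions, and vertical lines in \<open>z\<close> give Fourier
  transforms.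
\<close>
lemma Gamma_integral_log_scale:
  fixes z :: complex
  assumes z: "0 < Re z"
  shows "has_bochner_integral lborel (\<lambda>x. exp (z * of_real x - of_real (exp x))) (Gamma z)"
proof -
  define g where "g t = complex_of_real t powr (z - 1) / of_real (exp t)" for t
  define F where "F x = exp (z * of_real x - of_real (exp x))" for x
  have range_exp: "exp ` (UNIV :: real set) = {0<..}"
    by (auto simp: image_iff) (metis exp_ln)
  have g_exp: "\<bar>exp x\<bar> *\<^sub>R g (exp x) = F x" for x
  proof -
    have "complex_of_real (exp x) powr (z - 1) = exp ((z - 1) * of_real x)"
      by (simp add: powr_def Ln_of_real)
    then show ?thesis
      by (simp add: g_def F_def scaleR_conv_of_real exp_of_real exp_diff exp_minus left_diff_distrib field_simps)
  qed
  have abs: "g absolutely_integrable_on {0<..}"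
    unfolding g_def by (rule absolutely_integrable_Gamma_integral'[OF z])
  have int: "integral {0<..} g = Gamma z"
    unfolding g_def by (rule integral_unique[OF Gamma_integral_complex'[OF z]])
  have part: "(\<lambda>x. p (F x)) absolutely_integrable_on UNIV \<and> integral UNIV (\<lambda>x. p (F x)) = p (Gamma z)"
    if p: "bounded_linear p" for p :: "complex \<Rightarrow> real"
  proof -
    have "(\<lambda>t. p (g t)) absolutely_integrable_on {0<..}"
      using absolutely_integrable_linear[OF abs p] by (simp add: o_def)
    moreover have "integral {0<..} (\<lambda>t. p (g t)) = p (Gamma z)"
      using integral_linear[OF _ p, of g "{0<..}"] abs int
      by (simp add: o_def set_lebesgue_integral_eq_integral(1))
    ultimately have "(\<lambda>x. \<bar>exp x\<bar> * p (g (exp x))) absolutely_integrable_on UNIV \<and> integral UNIV (\<lambda>x. \<bar>exp x\<bar> * p (g (exp x))) = p (Gamma z)"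
      using has_absolute_integral_change_of_variables_1'[of UNIV exp exp "\<lambda>t. p (g t)" "p (Gamma z)"]
      by (simp add: range_exp DERIV_exp inj_def)
    moreover have "\<bar>exp x\<bar> * p (g (exp x)) = p (F x)" for x
      using linear_scale[OF bounded_linear.linear[OF p], of "\<bar>exp x\<bar>" "g (exp x)"] g_exp[of x] by simp
    ultimately show ?thesis by simp
  qed
  have [measurable]: "F \<in> borel_measurable borel"
    unfolding F_def by (intro borel_measurable_continuous_onI continuous_intros)
  have lb: "integrable lborel (\<lambda>x. p (F x)) \<and> (\<integral>x. p (F x) \<partial>lborel) = p (Gamma z)"
    if p: "bounded_linear p" and [measurable]: "p \<in> borel_measurable borel" for p :: "complex \<Rightarrow> real"
  proof -
    have "integrable lebesgue (\<lambda>x. p (F x))"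
      using part[OF p] by (simp add: set_integrable_def)
    then have i: "integrable lborel (\<lambda>x. p (F x))" by (simp add: integrable_completion)
    moreover have "(\<integral>x. p (F x) \<partial>lborel) = integral UNIV (\<lambda>x. p (F x))"
      using i by (rule integral_lborel[symmetric])
    ultimately show ?thesis using part[OF p] by simp
  qed
  have F_eq: "F = (\<lambda>x. of_real (Re (F x)) + \<i> * of_real (Im (F x)))"
    by (rule ext) (rule complex_eq)
  have "integrable lborel F"
    by (subst F_eq) (use lb[OF bounded_linear_Re] lb[OF bounded_linear_Im] in \<open>auto intro!: Bochner_Integration.integrable_add\<close>)
  moreover have "(\<integral>x. F x \<partial>lborel) = Gamma z"
    using lb[OF bounded_linear_Re] lb[OF bounded_linear_Im] \<open>integrable lborel F\<close>
    by (simp add: complex_eq_iff)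
  ultimately show ?thesis unfolding F_def[symmetric] by (simp add: has_bochner_integral_iff)
qed

lemma Gamma_integral_log_scale_scaled:
  fixes z :: complex and t :: real
  assumes z: "0 < Re z" and t: "0 < t"
  shows "has_bochner_integral lborel (\<lambda>x. exp (z * of_real x - of_real (t * exp x))) (exp (- z * of_real (ln t)) * Gamma z)"
proof -
  have "has_bochner_integral lborel (\<lambda>x. exp (z * of_real (ln t + 1 * x) - of_real (exp (ln t + 1 * x)))) (Gamma z /\<^sub>R \<bar>1\<bar>)"
    using Gamma_integral_log_scale[OF z] by (subst lborel_has_bochner_integral_real_affine_iff[symmetric]) auto
  then have "has_bochner_integral lborel (\<lambda>x. exp (- z * of_real (ln t)) * exp (z * of_real (ln t + x) - of_real (exp (ln t + x)))) (exp (- z * of_real (ln t)) * Gamma z)"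
    by (intro has_bochner_integral_mult_right) simp_all
  also have "(\<lambda>x. exp (- z * of_real (ln t)) * exp (z * of_real (ln t + x) - of_real (exp (ln t + x))))
    = (\<lambda>x. exp (z * of_real x - of_real (t * exp x)))"
    using t by (simp add: exp_add[symmetric] algebra_simps exp_add)
  finally show ?thesis .
qed

text \<open>
  Shear the product of two log-scale Gamma integrals by \<open>y = x + r\<close> and integrate over \<open>x\<close>
  first.
\<close>
lemma Gamma_mult_eq_log_Beta:
  fixes a b :: complex
  assumes a: "0 < Re a" and b: "0 < Re b"
  shows "Gamma a * Gamma b = Gamma (a + b) * (\<integral>r. exp (b * of_real r - (a + b) * of_real (ln (1 + exp r))) \<partial>lborel)"
proof -
  define fa where "fa x = exp (a * of_real x - of_real (exp x))" for x
  define fb where "fb x = exp (b * of_real x - of_real (exp x))" for x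
  define H where "H = (\<lambda>(x, r). fa x * fb (x + r))"
  have [measurable]: "fa \<in> borel_measurable borel" "fb \<in> borel_measurable borel"
    unfolding fa_def fb_def by (intro borel_measurable_continuous_onI continuous_intros)+
  have [measurable]: "H \<in> borel_measurable (lborel \<Otimes>\<^sub>M lborel)"
    unfolding H_def by measurable
  have fa: "has_bochner_integral lborel fa (Gamma a)" and fb: "has_bochner_integral lborel fb (Gamma b)"
    using Gamma_integral_log_scale[OF a] Gamma_integral_log_scale[OF b] by (simp_all add: fa_def[abs_def] fb_def[abs_def])
  have shift: "has_bochner_integral lborel (\<lambda>r. g (x + r)) v" if "has_bochner_integral lborel g v"
    for g :: "real \<Rightarrow> 'c::{banach, second_countable_topology}" and x v
    using that lborel_has_bochner_integral_real_affine_iff[of 1 g v x] by simp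
  have fb_shift: "has_bochner_integral lborel (\<lambda>r. fb (x + r)) (Gamma b)" for x
    by (rule shift[OF fb])
  have norm_shift: "has_bochner_integral lborel (\<lambda>r. norm (fb (x + r))) (\<integral>r. norm (fb r) \<partial>lborel)" for x
  proof -
    have "has_bochner_integral lborel (\<lambda>r. norm (fb r)) (\<integral>r. norm (fb r) \<partial>lborel)"
      by (rule has_bochner_integral_integrable) (use fb in \<open>simp add: has_bochner_integral_iff\<close>)
    then show ?thesis by (rule shift)
  qed
  have int_r: "(\<integral>r. H (x, r) \<partial>lborel) = fa x * Gamma b" for x
    using fb_shift[of x] by (simp add: H_def has_bochner_integral_iff)
  have int_x: "(\<integral>x. H (x, r) \<partial>lborel) = exp (b * of_real r - (a + b) * of_real (ln (1 + exp r))) * Gamma (a + b)" for r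
  proof -
    have "0 < 1 + exp r" by (simp add: add_pos_pos)
    then have "has_bochner_integral lborel (\<lambda>x. exp ((a + b) * of_real x - of_real ((1 + exp r) * exp x)))
      (exp (- (a + b) * of_real (ln (1 + exp r))) * Gamma (a + b))"
      by (intro Gamma_integral_log_scale_scaled) (use a b in auto)
    then have "(\<integral>x. exp (b * of_real r) * exp ((a + b) * of_real x - of_real ((1 + exp r) * exp x)) \<partial>lborel)
      = exp (b * of_real r) * (exp (- (a + b) * of_real (ln (1 + exp r))) * Gamma (a + b))"
      by (simp add: has_bochner_integral_iff)
    also have "(\<lambda>x. exp (b * of_real r) * exp ((a + b) * of_real x - of_real ((1 + exp r) * exp x))) = (\<lambda>x. H (x, r))"
    proof
      fix x
      have "exp (b * r') * exp ((a + b) * x' - of_real ((1 + R) * E)) = exp (a * x' - of_real E) * exp (b * (x' + r') - of_real (E * R))"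
        for x' r' :: complex and R E :: real
        by (simp add: exp_add[symmetric] algebra_simps)
      then show "exp (b * of_real r) * exp ((a + b) * of_real x - of_real ((1 + exp r) * exp x)) = H (x, r)"
        by (simp add: H_def fa_def fb_def exp_add[of x r])
    qed
    finally show ?thesis by (simp add: exp_add[symmetric] exp_diff exp_minus field_simps)
  qed
  have "integrable (lborel \<Otimes>\<^sub>M lborel) H"
  proof (rule lborel_pair.Fubini_integrable)
    have "(\<integral>r. norm (H (x, r)) \<partial>lborel) = norm (fa x) * (\<integral>r. norm (fb r) \<partial>lborel)" for x
      using norm_shift[of x] by (simp add: H_def norm_mult has_bochner_integral_iff)
    then show "integrable lborel (\<lambda>x. \<integral>r. norm (H (x, r)) \<partial>lborel)"
      using fa by (simp add: has_bochner_integral_iff)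
    show "AE x in lborel. integrable lborel (\<lambda>r. H (x, r))"
      using fb_shift by (intro AE_I2) (simp add: H_def has_bochner_integral_iff)
  qed simp
  then have "(\<integral>r. \<integral>x. H (x, r) \<partial>lborel \<partial>lborel) = (\<integral>x. \<integral>r. H (x, r) \<partial>lborel \<partial>lborel)"
    using lborel_pair.Fubini_integral[of "\<lambda>x r. H (x, r)"] by simp
  moreover have "(\<integral>x. \<integral>r. H (x, r) \<partial>lborel \<partial>lborel) = Gamma a * Gamma b"
    unfolding int_r using fa by (simp add: has_bochner_integral_iff)
  ultimately show ?thesis
    unfolding int_x by (simp add: mult.commute)
qed

lemma Beta_le_1:
  fixes p q :: real
  assumes "1 \<le> p" "1 \<le> q"
  shows "Beta p q \<le> 1"
proof -
  have "((\<lambda>t. t powr (p - 1) * (1 - t) powr (q - 1)) has_integral Beta p q) {0..1}"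
    by (rule has_integral_Beta_real) (use assms in auto)
  moreover have "((\<lambda>t. 1) has_integral (1 :: real)) {0..1::real}"
    using has_integral_const_real[of "1::real" 0 1] by simp
  ultimately show ?thesis
  proof (rule has_integral_le)
    fix t :: real assume "t \<in> {0..1}"
    then show "t powr (p - 1) * (1 - t) powr (q - 1) \<le> 1"
      using assms by (intro mult_le_one powr_le1) auto
  qed
qed

text \<open>
  The log-scale Beta integral is bounded by its value at the real parts, which is at most 1.
\<close>
lemma norm_Gamma_mult_le:
  fixes a b :: complex
  assumes a: "1 \<le> Re a" and b: "1 \<le> Re b"
  shows "norm (Gamma a * Gamma b) \<le> norm (Gamma (a + b))"
proof -
  define k where "k r = exp (Re b * r - (Re a + Re b) * ln (1 + exp r))" for r
  have pos: "0 < Re a" "0 < Re b" using a b by auto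
  have "of_real (Gamma (Re a) * Gamma (Re b)) = Gamma (complex_of_real (Re a)) * Gamma (of_real (Re b))"
    by (simp add: Gamma_complex_of_real)
  also have "\<dots> = Gamma (of_real (Re a) + of_real (Re b)) *
      (\<integral>r. exp (of_real (Re b) * of_real r - (of_real (Re a) + of_real (Re b)) * of_real (ln (1 + exp r))) \<partial>lborel)"
    by (rule Gamma_mult_eq_log_Beta) (use pos in auto)
  also have "(\<lambda>r. exp (of_real (Re b) * of_real r - (of_real (Re a) + of_real (Re b)) * of_real (ln (1 + exp r)))) = (\<lambda>r. complex_of_real (k r))"
    by (simp add: k_def exp_of_real[symmetric])
  also have "Gamma (of_real (Re a) + of_real (Re b)) * (\<integral>r. complex_of_real (k r) \<partial>lborel) = of_real (Gamma (Re a + Re b) * (\<integral>r. k r \<partial>lborel))"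
    by (simp add: Gamma_complex_of_real[symmetric])
  finally have "Gamma (Re a) * Gamma (Re b) = Gamma (Re a + Re b) * (\<integral>r. k r \<partial>lborel)"
    by (simp only: of_real_eq_iff)
  moreover have "0 < Gamma (Re a + Re b)" using pos by (intro Gamma_real_pos) auto
  ultimately have "(\<integral>r. k r \<partial>lborel) = Beta (Re a) (Re b)"
    by (simp add: Beta_def field_simps)
  then have k_le: "(\<integral>r. k r \<partial>lborel) \<le> 1" using Beta_le_1[OF a b] by simp
  have "norm (\<integral>r. exp (b * of_real r - (a + b) * of_real (ln (1 + exp r))) \<partial>lborel)
    \<le> (\<integral>r. norm (exp (b * of_real r - (a + b) * of_real (ln (1 + exp r)))) \<partial>lborel)"
    by (rule integral_norm_bound)
  also have "\<dots> = (\<integral>r. k r \<partial>lborel)"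
    by (simp add: k_def norm_exp_eq_Re)
  finally have "norm (\<integral>r. exp (b * of_real r - (a + b) * of_real (ln (1 + exp r))) \<partial>lborel) \<le> 1"
    using k_le by linarith
  then show ?thesis
    unfolding Gamma_mult_eq_log_Beta[OF pos] norm_mult by (rule mult_left_le) simp
qed

lemma norm_sin_le: "norm (sin (z :: complex)) \<le> exp \<bar>Im z\<bar>"
proof (rule power2_le_imp_le)
  have "exp (2 * Im z) \<le> exp (2 * \<bar>Im z\<bar>)" "inverse (exp (2 * Im z)) \<le> exp (2 * \<bar>Im z\<bar>)"
    by (simp_all add: exp_minus[symmetric])
  moreover have "- 2 * cos (2 * Re z) \<le> 2 * exp (2 * \<bar>Im z\<bar>)"
  proof -
    have "- 1 \<le> cos (2 * Re z)" by (rule cos_ge_minus_one)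
    moreover have "1 \<le> exp (2 * \<bar>Im z\<bar>)" by simp
    ultimately show ?thesis by linarith
  qed
  moreover have "(p + q - 2 * c) / 4 \<le> e" if "p \<le> e" "q \<le> e" "- 2 * c \<le> 2 * e" for p q c e :: real
    using that by simp
  ultimately have "(norm (sin z))\<^sup>2 \<le> exp (2 * \<bar>Im z\<bar>)"
    unfolding norm_sin_squared by blast
  then show "(norm (sin z))\<^sup>2 \<le> (exp \<bar>Im z\<bar>)\<^sup>2" by (simp add: exp_double)
qed simp

text \<open>
  The bound is uniform away from the real axis, where the zeros lie.
\<close>
lemma norm_sin_ge:
  assumes v: "v \<le> \<bar>Im z\<bar>"
  shows "exp \<bar>Im z\<bar> * ((1 - exp (- 2 * v)) / 2) \<le> norm (sin (z :: complex))"
proof -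
  let ?E = "exp \<bar>Im z\<bar>"
  have "(?E - inverse ?E)\<^sup>2 / 4 \<le> (norm (sin z))\<^sup>2"
  proof -
    have "exp (2 * Im z) + inverse (exp (2 * Im z)) = ?E\<^sup>2 + (inverse ?E)\<^sup>2"
      by (cases "0 \<le> Im z") (simp_all add: exp_double exp_minus power2_eq_square)
    moreover have "cos (2 * Re z) \<le> 1" by (rule cos_le_one)
    ultimately show ?thesis
      unfolding norm_sin_squared by (simp add: power2_diff)
  qed
  then have "((?E - inverse ?E) / 2)\<^sup>2 \<le> (norm (sin z))\<^sup>2" by (simp add: power_divide)
  then have "(?E - inverse ?E) / 2 \<le> norm (sin z)" by (rule power2_le_imp_le) simp
  moreover have "?E * ((1 - exp (- 2 * v)) / 2) \<le> (?E - inverse ?E) / 2"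
  proof -
    have "inverse ?E = ?E * exp (- 2 * \<bar>Im z\<bar>)" by (simp add: exp_minus[symmetric] exp_add[symmetric])
    also have "\<dots> \<le> ?E * exp (- 2 * v)" using v by (intro mult_left_mono) auto
    finally show ?thesis by (simp add: right_diff_distrib)
  qed
  ultimately show ?thesis by linarith
qed

text \<open>
  On the line \<open>Re = 1/2\<close> the reflection formula gives the modulus. Comparing the Euler
  products factor by factor shows that the ratio to the value at the real part decreases
  with the real part.
\<close>
lemma norm_rGamma_le:
  assumes x: "1 / 2 \<le> x"
  shows "norm (rGamma (Complex x y)) \<le> exp (pi * \<bar>y\<bar> / 2) * rGamma x"
proof -
  let ?h = "1 / 2 :: real"
  have factor: "norm (Complex (x + real j) y) * (?h + real j) \<le> norm (Complex (?h + real j) y) * (x + real j)" for j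
  proof (rule power2_le_imp_le)
    have le: "(?h + real j)\<^sup>2 \<le> (x + real j)\<^sup>2" using x by (intro power_mono) auto
    have "((x + real j)\<^sup>2 + y\<^sup>2) * (?h + real j)\<^sup>2 \<le> ((?h + real j)\<^sup>2 + y\<^sup>2) * (x + real j)\<^sup>2"
      using mult_left_mono[OF le, of "y\<^sup>2"] by (simp add: algebra_simps)
    then show "(norm (Complex (x + real j) y) * (?h + real j))\<^sup>2 \<le> (norm (Complex (?h + real j) y) * (x + real j))\<^sup>2"
      by (simp add: power_mult_distrib cmod_power2)
  qed (use x in auto)
  have poch: "norm (pochhammer (Complex x y) n) * pochhammer ?h n \<le> norm (pochhammer (Complex ?h y) n) * pochhammer x n" for n
  proof -
    have "Complex r y + of_nat j = Complex (r + real j) y" for r j by (simp add: complex_eq_iff)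
    then show ?thesis
      unfolding pochhammer_prod prod_norm[symmetric] prod.distrib[symmetric]
      using factor x by (intro prod_mono) auto
  qed
  have series: "norm (rGamma_series (Complex r y) n) = norm (pochhammer (Complex r y) (n + 1)) / (fact n * exp (r * ln (real n)))"
    "rGamma_series r n = pochhammer r (n + 1) / (fact n * exp (r * ln (real n)))" for r n
    unfolding rGamma_series_def by (simp_all add: norm_divide norm_mult norm_exp_eq_Re)
  have step: "norm (rGamma_series (Complex x y) n) * rGamma_series ?h n \<le> norm (rGamma_series (Complex ?h y) n) * rGamma_series x n" for n
  proof -
    have "(norm (pochhammer (Complex x y) (n + 1)) * pochhammer ?h (n + 1)) / (fact n * exp (x * ln (real n)) * (fact n * exp (?h * ln (real n))))
      \<le> (norm (pochhammer (Complex ?h y) (n + 1)) * pochhammer x (n + 1)) / (fact n * exp (x * ln (real n)) * (fact n * exp (?h * ln (real n))))"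
      by (intro divide_right_mono poch) simp
    then show ?thesis unfolding series by (simp only: times_divide_times_eq mult.commute)
  qed
  have main: "norm (rGamma (Complex x y)) * rGamma ?h \<le> norm (rGamma (Complex ?h y)) * rGamma x"
    by (rule LIMSEQ_le[OF tendsto_mult[OF tendsto_norm[OF rGamma_series_LIMSEQ] rGamma_series_LIMSEQ]
      tendsto_mult[OF tendsto_norm[OF rGamma_series_LIMSEQ] rGamma_series_LIMSEQ]]) (intro exI allI impI step)
  have half: "rGamma ?h = 1 / sqrt pi" by (simp add: rGamma_inverse_Gamma Gamma_one_half_real field_simps)
  have x_pos: "0 < rGamma x" using x by (simp add: rGamma_inverse_Gamma Gamma_real_pos)
  have "norm (rGamma (Complex ?h y)) ^ 2 \<le> (exp (pi * \<bar>y\<bar> / 2) / sqrt pi) ^ 2"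
  proof -
    have "norm (rGamma (Complex ?h y)) ^ 2 = norm (rGamma (Complex ?h y) * rGamma (cnj (Complex ?h y)))"
      by (simp add: norm_mult power2_eq_square cnj_rGamma[symmetric])
    also have "cnj (Complex ?h y) = 1 - Complex ?h y" by (simp add: complex_eq_iff)
    also have "rGamma (Complex ?h y) * rGamma (1 - Complex ?h y) = sin (of_real pi * Complex ?h y) / of_real pi"
      by (rule rGamma_reflection_complex)
    also have "norm (sin (of_real pi * Complex ?h y) / of_real pi) \<le> exp (pi * \<bar>y\<bar>) / pi"
    proof -
      have "norm (sin (of_real pi * Complex ?h y)) \<le> exp \<bar>Im (of_real pi * Complex ?h y)\<bar>"
        by (rule norm_sin_le)
      then show ?thesis by (simp add: norm_divide abs_mult divide_right_mono)
    qed
    also have "exp (pi * \<bar>y\<bar>) / pi = (exp (pi * \<bar>y\<bar> / 2) / sqrt pi) ^ 2"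
      by (simp add: power_divide exp_double[symmetric])
    finally show ?thesis .
  qed
  then have "norm (rGamma (Complex ?h y)) \<le> exp (pi * \<bar>y\<bar> / 2) / sqrt pi"
    by (rule power2_le_imp_le) simp
  then have "norm (rGamma (Complex x y)) * rGamma ?h \<le> (exp (pi * \<bar>y\<bar> / 2) / sqrt pi) * rGamma x"
    using main x_pos by (meson less_imp_le mult_right_mono order_trans)
  then show ?thesis unfolding half by (simp add: field_simps)
qed

text \<open>
  The part of the Gamma integral over \<open>[B, B + 1]\<close> alone; as \<open>B\<close> is free, the Gamma function
  beats every exponential.
\<close>
lemma Gamma_ge_exponential:
  fixes y B :: real
  assumes y: "1 \<le> y" and B: "1 \<le> B"
  shows "exp (- (B + 1)) * B powr (y - 1) \<le> Gamma y"
proof -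
  have y0: "0 < y" using y by simp
  have "ennreal (exp (- (B + 1)) * B powr (y - 1)) = (\<integral>\<^sup>+t. ennreal (exp (- (B + 1)) * B powr (y - 1)) * indicator {B..B + 1} t \<partial>lborel)"
    by (simp add: nn_integral_cmult_indicator)
  also have "\<dots> \<le> (\<integral>\<^sup>+t. ennreal (indicator {0..} t * t powr (y - 1) / exp t) \<partial>lborel)"
  proof (intro nn_integral_mono)
    fix t :: real
    show "ennreal (exp (- (B + 1)) * B powr (y - 1)) * indicator {B..B + 1} t \<le> ennreal (indicator {0..} t * t powr (y - 1) / exp t)"
    proof (cases "t \<in> {B..B + 1}")
      case True
      have "exp (- (B + 1)) * B powr (y - 1) \<le> exp (- t) * t powr (y - 1)"
        using True y B by (intro mult_mono powr_mono2) auto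
      then show ?thesis using True B by (simp add: exp_minus field_simps ennreal_leI)
    qed simp
  qed
  also have "\<dots> = ennreal (Gamma y)" by (rule Gamma_conv_nn_integral_real[OF y0, symmetric])
  finally show ?thesis using Gamma_real_pos[OF y0] by (simp add: ennreal_le_iff)
qed

section \<open>The Fox integral on a vertical line\<close>

text \<open>
  The two horizontal legs of the loop are turned, by \<open>corner_contour_shift\<close>, into the two
  ends of the vertical line; the lower one follows by complex conjugation.
\<close>
lemma loop_integral_eq_vertical_integral:
  fixes F :: "complex \<Rightarrow> complex"
  assumes hol: "F holomorphic_on {s. 0 < Im s}" and cnj: "\<And>s. F (cnj s) = cnj (F s)"
    and bound: "\<And>\<phi>. 0 < \<phi> \<Longrightarrow> \<exists>C \<kappa>. 0 < \<kappa> \<and> (\<forall>s. c \<le> Re s \<longrightarrow> \<phi> \<le> Im s \<longrightarrow> norm (F s) \<le> C * exp (- Re s - \<kappa> * Im s))"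
    and cont: "continuous_on UNIV (\<lambda>y. F (Complex c y))"
    and \<phi>: "\<phi>1 < 0" "0 < \<phi>2"
  shows "contour_converges (Vertical c) F" and "contour_converges (Loop c \<phi>1 \<phi>2) F"
    and "fox_contour_integral (Loop c \<phi>1 \<phi>2) F = fox_contour_integral (Vertical c) F"
proof -
  define v where "v y = F (Complex c y)" for y
  have v_neg: "v (- y) = cnj (v y)" for y
    using cnj[of "Complex c y"] by (simp add: v_def complex_cnj)
  have corner: "set_integrable lborel {c..} (\<lambda>x. F (Complex x \<phi>)) \<and> set_integrable lborel {\<phi>..} v \<and>
     (LBINT x:{c..}. F (Complex x \<phi>)) = \<i> * (LBINT y:{\<phi>..}. v y)" if pos: "0 < \<phi>" for \<phi>
  proof -
    obtain C \<kappa> where "0 < \<kappa>" and "\<And>s. c \<le> Re s \<Longrightarrow> \<phi> \<le> Im s \<Longrightarrow> norm (F s) \<le> C * exp (- Re s - \<kappa> * Im s)"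
      using bound[OF pos] by blast
    from corner_contour_shift[OF hol pos this] show ?thesis unfolding v_def by blast
  qed
  have up: "set_integrable lborel {c..} (\<lambda>x. F (Complex x \<phi>2))" "set_integrable lborel {\<phi>2..} v"
      "(LBINT x:{c..}. F (Complex x \<phi>2)) = \<i> * (LBINT y:{\<phi>2..}. v y)"
    using corner[OF \<phi>(2)] by auto
  have \<phi>1: "0 < - \<phi>1" using \<phi> by simp
  have refl: "set_integrable lborel {c..} (\<lambda>x. F (Complex x (- \<phi>1)))" "set_integrable lborel {- \<phi>1..} v"
      "(LBINT x:{c..}. F (Complex x (- \<phi>1))) = \<i> * (LBINT y:{- \<phi>1..}. v y)"
    using corner[OF \<phi>1] by auto
  have low_F: "F (Complex x \<phi>1) = cnj (F (Complex x (- \<phi>1)))" for x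
    using cnj[of "Complex x (- \<phi>1)"] by (simp add: complex_cnj)
  have scale_cnj: "r *\<^sub>R cnj z = cnj (r *\<^sub>R z)" for r z by simp
  have low1: "set_integrable lborel {c..} (\<lambda>x. F (Complex x \<phi>1))"
    using refl(1) unfolding set_integrable_def low_F scale_cnj by (simp only: integrable_cnj)
  have low2: "(LBINT x:{c..}. F (Complex x \<phi>1)) = cnj (LBINT x:{c..}. F (Complex x (- \<phi>1)))"
    unfolding set_lebesgue_integral_def low_F scale_cnj by (rule Bochner_Integration.integral_cnj)
  have ind: "indicator {..\<phi>1} (0 + (- 1) * y) *\<^sub>R v (0 + (- 1) * y) = cnj (indicator {- \<phi>1..} y *\<^sub>R v y)" for y
    by (auto simp: indicator_def v_neg)
  have low3: "set_integrable lborel {..\<phi>1} v"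
  proof -
    have "integrable lborel (\<lambda>y. indicator {..\<phi>1} (0 + (- 1) * y) *\<^sub>R v (0 + (- 1) * y))"
      unfolding ind using refl(2) by (simp only: integrable_cnj set_integrable_def)
    then show ?thesis
      unfolding set_integrable_def using lborel_integrable_real_affine_iff[of "- 1" "\<lambda>y. indicator {..\<phi>1} y *\<^sub>R v y" 0] by simp
  qed
  have low4: "(LBINT y:{..\<phi>1}. v y) = cnj (LBINT y:{- \<phi>1..}. v y)"
  proof -
    have "(LBINT y:{..\<phi>1}. v y) = (\<integral>y. indicator {..\<phi>1} (0 + (- 1) * y) *\<^sub>R v (0 + (- 1) * y) \<partial>lborel)"
      unfolding set_lebesgue_integral_def by (subst lborel_integral_real_affine[of "- 1" _ 0]) simp_all
    also have "\<dots> = cnj (LBINT y:{- \<phi>1..}. v y)"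
      unfolding ind set_lebesgue_integral_def by (rule Bochner_Integration.integral_cnj)
    finally show ?thesis .
  qed
  have mid: "set_integrable lborel {\<phi>1..\<phi>2} v"
    by (rule borel_integrable_atLeastAtMost') (use cont continuous_on_subset in \<open>auto simp: v_def[abs_def]\<close>)
  let ?s = "\<lambda>y. indicator {..\<phi>1} y *\<^sub>R v y + indicator {\<phi>1..\<phi>2} y *\<^sub>R v y + indicator {\<phi>2..} y *\<^sub>R v y"
  have int_s: "integrable lborel ?s"
    using low3 mid up(2) unfolding set_integrable_def by (intro Bochner_Integration.integrable_add)
  have v_meas: "v \<in> borel_measurable lborel"
    using cont unfolding v_def[abs_def] by (simp add: borel_measurable_continuous_onI)
  \<comment> \<open>The three pieces overlap in the two points \<open>\<phi>1\<close> and \<open>\<phi>2\<close> only.\<close>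
  have AE_eq: "AE y in lborel. ?s y = v y"
    using AE_lborel_singleton[of \<phi>1] AE_lborel_singleton[of \<phi>2]
    by eventually_elim (use \<phi> in \<open>auto simp: indicator_def\<close>)
  have int_v: "integrable lborel v"
    using int_s AE_eq v_meas by (subst integrable_cong_AE[where g="?s"]) (auto simp: borel_measurable_integrable elim!: eventually_mono)
  have sum: "(\<integral>y. v y \<partial>lborel) = (LBINT y:{..\<phi>1}. v y) + (LBINT y:{\<phi>1..\<phi>2}. v y) + (LBINT y:{\<phi>2..}. v y)"
  proof -
    have "(\<integral>y. v y \<partial>lborel) = (\<integral>y. ?s y \<partial>lborel)"
      using AE_eq by (intro integral_cong_AE v_meas borel_measurable_integrable[OF int_s]) (auto elim!: eventually_mono)
    also have "\<dots> = (LBINT y:{..\<phi>1}. v y) + (LBINT y:{\<phi>1..\<phi>2}. v y) + (LBINT y:{\<phi>2..}. v y)"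
      using low3 mid up(2) unfolding set_integrable_def set_lebesgue_integral_def by simp
    finally show ?thesis .
  qed
  show "contour_converges (Vertical c) F" using int_v by (simp add: v_def[abs_def])
  show "contour_converges (Loop c \<phi>1 \<phi>2) F" using low1 mid up(1) by (simp add: v_def[abs_def])
  show "fox_contour_integral (Loop c \<phi>1 \<phi>2) F = fox_contour_integral (Vertical c) F"
    using low2 low4 refl(3) up(3) sum unfolding fox_contour_integral.simps v_def[symmetric]
    by (simp add: algebra_simps)
qed

lemma norm_pochhammer_ge:
  fixes s :: complex
  assumes "0 \<le> \<phi>" "\<phi> \<le> \<bar>Im s\<bar>"
  shows "\<phi> ^ m \<le> norm (pochhammer s m)"
proof -
  have "(\<Prod>j\<in>{0..<m}. \<phi>) \<le> (\<Prod>j\<in>{0..<m}. norm (s + of_nat j))"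
  proof (intro prod_mono conjI)
    fix j
    have "\<bar>Im (s + of_nat j)\<bar> \<le> norm (s + of_nat j)" by (rule abs_Im_le_cmod)
    then show "\<phi> \<le> norm (s + of_nat j)" using assms by simp
  qed (use assms in auto)
  then show ?thesis by (simp add: pochhammer_prod prod_norm)
qed

lemma norm_pochhammer_le:
  fixes s :: complex
  shows "norm (pochhammer s m) \<le> (norm s + real m) ^ m"
proof -
  have "(\<Prod>j\<in>{0..<m}. norm (s + of_nat j)) \<le> (\<Prod>j\<in>{0..<m}. norm s + real m)"
  proof (intro prod_mono conjI)
    fix j assume "j \<in> {0..<m}"
    then show "norm (s + of_nat j) \<le> norm s + real m"
      using norm_triangle_ineq[of s "of_nat j"] by simp
  qed auto
  then show ?thesis by (simp add: pochhammer_prod prod_norm)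
qed

lemma Im_nonzero_not_nonpos_Int: "Im z \<noteq> 0 \<Longrightarrow> z \<notin> \<int>\<^sub>\<le>\<^sub>0"
  by (auto elim!: nonpos_Ints_cases)

text \<open>
  With \<open>A = 1 / \<alpha>\<close>, the Fox integrand without its power factor. Its reciprocal Gamma
  factor is entire.
\<close>
definition gamma_ratio :: "real \<Rightarrow> nat \<Rightarrow> nat \<Rightarrow> complex \<Rightarrow> complex" where
  "gamma_ratio A k n s = Gamma (of_real A * (1 - s) + of_nat k) * rGamma (of_nat n + 1 - s)"

text \<open>
  Reflect both Gamma functions, so that their arguments have large real parts to the right:
  the ratio becomes \<open>sin (\<pi> u) / sin (\<pi> w) * Gamma u / Gamma (1 - w)\<close> with
  \<open>u = s - n\<close> and \<open>w = A (1 - s) + k\<close>. The quotient of the sines decays like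
  \<open>exp (- \<pi> (A - 1) Im s)\<close>. After integer shifts, \<open>norm_Gamma_mult_le\<close> bounds the Gamma
  quotient by the reciprocal of Gamma at the difference of the arguments, which is
  \<open>(A - 1) s\<close> plus a real constant; it grows at most like \<open>exp (\<pi> (A - 1) Im s / 2)\<close> in
  the imaginary part and decays faster than any exponential in the real part.
\<close>
lemma gamma_ratio_bound:
  fixes A c \<phi> \<tau> :: real
  assumes A: "1 < A" and \<phi>: "0 < \<phi>"
  shows "\<exists>C \<kappa>. 0 < \<kappa> \<and> (\<forall>s. c \<le> Re s \<longrightarrow> \<phi> \<le> Im s \<longrightarrow>
    norm (gamma_ratio A k n s * exp (- s * of_real \<tau>)) \<le> C * exp (- Re s - \<kappa> * Im s))"
proof -
  define \<beta> where "\<beta> = A - 1"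
  \<comment> \<open>Half of the remaining rate \<open>pi * \<beta> / 2\<close>; the other half absorbs the polynomial
    factor \<open>Z ^ m'\<close>.\<close>
  define \<kappa> where "\<kappa> = pi * \<beta> / 4"
  have \<beta>: "0 < \<beta>" and \<kappa>: "0 < \<kappa>" using A by (simp_all add: \<beta>_def \<kappa>_def)
  \<comment> \<open>The shifts \<open>m\<close> and \<open>m'\<close> make the real parts of \<open>a'\<close> and of \<open>b' - a'\<close> at least 1.\<close>
  define m where "m = nat \<lceil>real n + 1 - c\<rceil>"
  have m: "1 \<le> c - real n + real m" unfolding m_def by linarith
  define d0 where "d0 = 1 - A - real k"
  define m' where "m' = nat \<lceil>1 - \<beta> * c - d0 + real m - real n\<rceil>"
  define d where "d = d0 + real m' - real m + real n"
  have d: "1 \<le> \<beta> * c + d" unfolding d_def m'_def by linarith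
  define q where "q = (1 - exp (- 2 * (pi * A * \<phi>))) / 2"
  have q: "0 < q" using A \<phi> by (simp add: q_def)
  \<comment> \<open>Large enough that \<open>B powr (- \<beta> * Re s)\<close> outweighs \<open>exp (- \<tau> * Re s)\<close> and the
    polynomial factor.\<close>
  define B where "B = exp (max 0 ((\<kappa> - \<tau> + 1) / \<beta>))"
  have B: "1 \<le> B" by (simp add: B_def)
  have lnB: "\<kappa> - \<tau> + 1 \<le> \<beta> * ln B"
  proof -
    have "(\<kappa> - \<tau> + 1) / \<beta> \<le> ln B" by (simp add: B_def)
    then show ?thesis using \<beta> by (simp add: field_simps)
  qed
  define \<epsilon> where "\<epsilon> = \<kappa> / A"
  have \<epsilon>: "0 < \<epsilon>" using \<kappa> A by (simp add: \<epsilon>_def)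
  define D where "D = \<bar>d0\<bar> + real m'"
  define C1 where "C1 = fact m' / \<epsilon> ^ m'"
  define E where "E = c * (\<kappa> - \<tau> - \<beta> * ln B + 1) + 2 * \<kappa> * \<bar>c\<bar> + (1 - d) * ln B + \<epsilon> * D + B + 1"
  show ?thesis
  proof (rule exI[of _ "C1 * exp E / (q * \<phi> ^ m)"], rule exI[of _ \<kappa>], intro conjI \<kappa> allI impI)
    fix s assume x: "c \<le> Re s" and y: "\<phi> \<le> Im s"
    let ?x = "Re s" and ?y = "Im s"
    define w where "w = of_real A * (1 - s) + of_nat k"
    define u where "u = s - of_nat n"
    define a' where "a' = u + of_nat m"
    define b' where "b' = 1 - w + of_nat m'"
    have y0: "0 < ?y" using y \<phi> by linarith
    have Im_w: "Im w = - A * ?y" and Im_u: "Im u = ?y" by (simp_all add: w_def u_def)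
    have diff: "b' - a' = Complex (\<beta> * ?x + d) (\<beta> * ?y)"
      by (simp add: b'_def a'_def w_def u_def complex_eq_iff \<beta>_def d_def d0_def algebra_simps)
    have Re_a': "1 \<le> Re a'" using m x by (simp add: a'_def u_def)
    have Re_diff: "1 \<le> \<beta> * ?x + d" using d mult_left_mono[OF x, of \<beta>] \<beta> by linarith
    have Re_diff': "1 \<le> Re (b' - a')" unfolding diff using Re_diff by simp
    have Re_b': "1 < Re b'"
    proof -
      have "b' = a' + (b' - a')" by simp
      then have "Re b' = Re a' + (\<beta> * ?x + d)" unfolding diff by (simp add: complex_eq_iff)
      then show ?thesis using Re_a' Re_diff by linarith
    qed
    have w_nz: "w \<notin> \<int>\<^sub>\<le>\<^sub>0" and u_nz: "u \<notin> \<int>\<^sub>\<le>\<^sub>0"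
      using Im_w Im_u y0 A by (auto intro!: Im_nonzero_not_nonpos_Int)
    have nz: "z \<notin> \<int>\<^sub>\<le>\<^sub>0" if "1 \<le> Re z" for z :: complex
      using that by (auto elim!: nonpos_Ints_cases)
    have G_inv: "norm (Gamma z) * norm (rGamma z) = 1" if "z \<notin> \<int>\<^sub>\<le>\<^sub>0" for z :: complex
      using that by (simp add: Gamma_def norm_inverse rGamma_eq_zero_iff)
    have rG_pos: "0 < norm (rGamma z)" if "z \<notin> \<int>\<^sub>\<le>\<^sub>0" for z :: complex
      using that by (simp add: rGamma_eq_zero_iff)
    have sin_w: "exp (pi * A * ?y) * q \<le> norm (sin (of_real pi * w))"
    proof -
      have Im: "\<bar>Im (of_real pi * w)\<bar> = pi * A * ?y" using y0 A by (simp add: Im_w abs_mult)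
      have "pi * A * \<phi> \<le> \<bar>Im (of_real pi * w)\<bar>" unfolding Im using y A by simp
      from norm_sin_ge[OF this] show ?thesis unfolding Im q_def .
    qed
    have sin_w_pos: "0 < norm (sin (of_real pi * w))"
      using sin_w q by (meson exp_gt_zero less_le_trans mult_pos_pos)
    have N_w: "norm (Gamma w) \<le> norm (rGamma (1 - w)) * pi / (exp (pi * A * ?y) * q)"
    proof -
      have "norm (rGamma w) * norm (rGamma (1 - w)) = norm (sin (of_real pi * w)) / pi"
        using arg_cong[OF rGamma_reflection_complex[of w], of norm] by (simp add: norm_mult norm_divide)
      then have "norm (Gamma w) * (norm (rGamma w) * norm (rGamma (1 - w))) = norm (Gamma w) * (norm (sin (of_real pi * w)) / pi)"
        by simp
      then have "norm (rGamma (1 - w)) = norm (Gamma w) * (norm (sin (of_real pi * w)) / pi)"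
        using G_inv[OF w_nz] by (simp add: mult.assoc[symmetric])
      then have "norm (Gamma w) = norm (rGamma (1 - w)) * pi / norm (sin (of_real pi * w))"
        using sin_w_pos by (simp add: field_simps)
      also have "\<dots> \<le> norm (rGamma (1 - w)) * pi / (exp (pi * A * ?y) * q)"
        using sin_w q by (intro divide_left_mono) (auto intro!: mult_pos_pos sin_w_pos)
      finally show ?thesis .
    qed
    have N_u: "norm (rGamma (of_nat n + 1 - s)) \<le> exp (pi * ?y) / pi * (norm (Gamma a') / \<phi> ^ m)"
    proof -
      have "norm (rGamma u) * norm (rGamma (1 - u)) = norm (sin (of_real pi * u)) / pi"
        using arg_cong[OF rGamma_reflection_complex[of u], of norm] by (simp add: norm_mult norm_divide)
      also have "norm (sin (of_real pi * u)) \<le> exp (pi * ?y)"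
        using norm_sin_le[of "of_real pi * u"] y0 by (simp add: Im_u abs_mult)
      finally have 1: "norm (rGamma u) * norm (rGamma (1 - u)) \<le> exp (pi * ?y) / pi"
        by (simp add: divide_right_mono)
      have "norm (rGamma u) = norm (pochhammer u m) * norm (rGamma a')"
        unfolding a'_def using pochhammer_rGamma[of u m] by (simp add: norm_mult)
      moreover have "\<phi> ^ m \<le> norm (pochhammer u m)"
        using y \<phi> by (intro norm_pochhammer_ge) (auto simp: Im_u)
      ultimately have 2: "\<phi> ^ m * norm (rGamma a') \<le> norm (rGamma u)"
        by (simp add: mult_right_mono)
      have "norm (rGamma (1 - u)) * (\<phi> ^ m * norm (rGamma a')) \<le> exp (pi * ?y) / pi"
        using mult_left_mono[OF 2, of "norm (rGamma (1 - u))"] 1 by (simp add: mult.commute)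
      then have "norm (rGamma (1 - u)) * (\<phi> ^ m * norm (rGamma a')) * norm (Gamma a') \<le> exp (pi * ?y) / pi * norm (Gamma a')"
        by (rule mult_right_mono) simp
      then have "norm (rGamma (1 - u)) * \<phi> ^ m \<le> exp (pi * ?y) / pi * norm (Gamma a')"
        using G_inv[OF nz[OF Re_a']] by (simp add: mult.assoc mult.commute[of "norm (rGamma a')"])
      then have "norm (rGamma (1 - u)) \<le> exp (pi * ?y) / pi * (norm (Gamma a') / \<phi> ^ m)"
        using \<phi> by (simp add: field_simps)
      then show ?thesis by (simp add: u_def algebra_simps)
    qed
    define Z where "Z = norm (1 - w) + real m'"
    have N_b: "norm (rGamma (1 - w)) \<le> Z ^ m' * norm (rGamma b')"
      unfolding b'_def Z_def pochhammer_rGamma[of "1 - w" m'] norm_mult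
      by (intro mult_right_mono norm_pochhammer_le) simp
    have N_ab: "norm (Gamma a') * norm (rGamma b') \<le> norm (rGamma (b' - a'))"
    proof -
      have "norm (Gamma a') * norm (Gamma (b' - a')) \<le> norm (Gamma b')"
      proof -
        have e: "a' + (b' - a') = b'" by simp
        show ?thesis using norm_Gamma_mult_le[OF Re_a' Re_diff'] unfolding e norm_mult .
      qed
      then have "norm (Gamma a') * norm (Gamma (b' - a')) * (norm (rGamma b') * norm (rGamma (b' - a')))
        \<le> norm (Gamma b') * (norm (rGamma b') * norm (rGamma (b' - a')))"
        by (rule mult_right_mono) simp
      moreover have "norm (Gamma b') * norm (rGamma b') = 1" "norm (Gamma (b' - a')) * norm (rGamma (b' - a')) = 1"
        by (rule G_inv[OF nz[OF less_imp_le[OF Re_b']]], rule G_inv[OF nz[OF Re_diff']])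
      moreover have "p1 * p3 \<le> p4" if "p1 * p2 * (p3 * p4) \<le> p5 * (p3 * p4)" "p5 * p3 = 1" "p2 * p4 = 1" for p1 p2 p3 p4 p5 :: real
      proof -
        have a: "p1 * p2 * (p3 * p4) = p1 * p3 * (p2 * p4)" by (simp only: mult_ac)
        have b: "p5 * (p3 * p4) = p5 * p3 * p4" by (simp only: mult.assoc)
        from that(1) show ?thesis unfolding a b that(2,3) by (simp only: mult_1_left mult_1_right)
      qed
      ultimately show ?thesis by blast
    qed
    have N_d: "norm (rGamma (b' - a')) \<le> exp (pi * \<beta> * ?y / 2) * (exp (B + 1) * exp ((1 - \<beta> * ?x - d) * ln B))"
    proof -
      have "norm (rGamma (b' - a')) \<le> exp (pi * \<bar>\<beta> * ?y\<bar> / 2) * rGamma (\<beta> * ?x + d)"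
        unfolding diff by (rule norm_rGamma_le) (use Re_diff in linarith)
      moreover have "rGamma (\<beta> * ?x + d) \<le> exp (B + 1) * exp ((1 - \<beta> * ?x - d) * ln B)"
      proof -
        have "exp (- (B + 1)) * B powr (\<beta> * ?x + d - 1) \<le> Gamma (\<beta> * ?x + d)"
          by (rule Gamma_ge_exponential[OF Re_diff B])
        then have "inverse (Gamma (\<beta> * ?x + d)) \<le> inverse (exp (- (B + 1)) * B powr (\<beta> * ?x + d - 1))"
          using B by (intro le_imp_inverse_le) auto
        also have "\<dots> = exp (B + 1) * exp ((1 - \<beta> * ?x - d) * ln B)"
          using B by (simp add: powr_def exp_minus[symmetric] algebra_simps)
        finally show ?thesis by (simp add: rGamma_inverse_Gamma)
      qed
      ultimately show ?thesis
      proof -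
        assume 1: "norm (rGamma (b' - a')) \<le> exp (pi * \<bar>\<beta> * ?y\<bar> / 2) * rGamma (\<beta> * ?x + d)"
          and 2: "rGamma (\<beta> * ?x + d) \<le> exp (B + 1) * exp ((1 - \<beta> * ?x - d) * ln B)"
        have e: "pi * \<bar>\<beta> * ?y\<bar> / 2 = pi * \<beta> * ?y / 2" using \<beta> y0 by (simp add: abs_mult)
        show ?thesis using order_trans[OF 1 mult_left_mono[OF 2]] unfolding e by simp
      qed
    qed
    have N_Z: "Z ^ m' \<le> C1 * exp (\<kappa> * \<bar>?x\<bar> + \<kappa> * ?y + \<epsilon> * D)"
    proof -
      have Z0: "0 \<le> Z" by (simp add: Z_def)
      have "1 - w = of_real A * s + of_real d0" by (simp add: w_def d0_def algebra_simps)
      then have "norm (1 - w) \<le> A * norm s + \<bar>d0\<bar>"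
        using norm_triangle_ineq[of "of_real A * s" "of_real d0"] A by (simp add: norm_mult)
      also have "norm s \<le> \<bar>?x\<bar> + ?y" using cmod_le[of s] y0 by simp
      finally have Z_le: "Z \<le> A * (\<bar>?x\<bar> + ?y) + D" using A by (simp add: Z_def D_def)
      have "(\<epsilon> * Z) ^ m' \<le> fact m' * exp (\<epsilon> * Z)" using \<epsilon> Z0 by (intro power_le_fact_exp) simp
      then have "Z ^ m' \<le> C1 * exp (\<epsilon> * Z)" using \<epsilon> by (simp add: C1_def power_mult_distrib field_simps)
      also have "\<dots> \<le> C1 * exp (\<epsilon> * (A * (\<bar>?x\<bar> + ?y) + D))"
        using \<epsilon> Z_le by (intro mult_left_mono) (auto simp: C1_def)
      also have "\<epsilon> * (A * (\<bar>?x\<bar> + ?y) + D) = \<kappa> * \<bar>?x\<bar> + \<kappa> * ?y + \<epsilon> * D"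
        using A by (simp add: \<epsilon>_def field_simps)
      finally show ?thesis .
    qed
    have C1: "0 \<le> C1" using \<epsilon> by (simp add: C1_def)
    have "norm (gamma_ratio A k n s * exp (- s * of_real \<tau>)) = norm (Gamma w) * norm (rGamma (of_nat n + 1 - s)) * exp (- ?x * \<tau>)"
      by (simp add: gamma_ratio_def w_def norm_mult norm_exp_eq_Re)
    also have "\<dots> \<le> (norm (rGamma (1 - w)) * pi / (exp (pi * A * ?y) * q)) * (exp (pi * ?y) / pi * (norm (Gamma a') / \<phi> ^ m)) * exp (- ?x * \<tau>)"
      using q \<phi> by (intro mult_right_mono mult_mono N_w N_u) auto
    also have "\<dots> = norm (rGamma (1 - w)) * norm (Gamma a') * (exp (pi * ?y) * exp (- ?x * \<tau>) / exp (pi * A * ?y)) / (q * \<phi> ^ m)"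
      using q \<phi> by (simp add: field_simps)
    also have "\<dots> \<le> (Z ^ m' * norm (rGamma b')) * norm (Gamma a') * (exp (pi * ?y) * exp (- ?x * \<tau>) / exp (pi * A * ?y)) / (q * \<phi> ^ m)"
      using q \<phi> by (intro divide_right_mono mult_right_mono N_b) auto
    also have "\<dots> = (Z ^ m' * (norm (Gamma a') * norm (rGamma b'))) * (exp (pi * ?y) * exp (- ?x * \<tau>) / exp (pi * A * ?y)) / (q * \<phi> ^ m)"
      by (simp add: mult_ac)
    also have "\<dots> \<le> (C1 * exp (\<kappa> * \<bar>?x\<bar> + \<kappa> * ?y + \<epsilon> * D) * (exp (pi * \<beta> * ?y / 2) * (exp (B + 1) * exp ((1 - \<beta> * ?x - d) * ln B))))
        * (exp (pi * ?y) * exp (- ?x * \<tau>) / exp (pi * A * ?y)) / (q * \<phi> ^ m)"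
      using q \<phi> C1 by (intro divide_right_mono mult_right_mono mult_mono N_Z order_trans[OF N_ab N_d]) (auto simp: Z_def)
    also have "\<dots> = C1 * exp (\<kappa> * \<bar>?x\<bar> + \<kappa> * ?y + \<epsilon> * D + pi * \<beta> * ?y / 2 + (B + 1) + (1 - \<beta> * ?x - d) * ln B + pi * ?y + - ?x * \<tau> - pi * A * ?y) / (q * \<phi> ^ m)"
    proof -
      have "C1 * exp e1 * (exp e2 * (exp e3 * exp e4)) * (exp e5 * exp e6 / exp e7) = C1 * exp (e1 + e2 + e3 + e4 + e5 + e6 - e7)"
        for e1 e2 e3 e4 e5 e6 e7 :: real
        by (simp add: exp_add exp_diff)
      then show ?thesis by (simp only: mult.assoc)
    qed
    also have "\<dots> \<le> C1 * exp (E + (- ?x - \<kappa> * ?y)) / (q * \<phi> ^ m)"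
    proof -
      have "\<kappa> * \<bar>?x\<bar> \<le> \<kappa> * (?x + 2 * \<bar>c\<bar>)" using \<kappa> x by (intro mult_left_mono) auto
      moreover have "?x * (\<kappa> - \<tau> - \<beta> * ln B + 1) \<le> c * (\<kappa> - \<tau> - \<beta> * ln B + 1)"
        using x lnB by (intro mult_right_mono_neg) auto
      moreover have "\<kappa> * ?y + pi * \<beta> * ?y / 2 + pi * ?y - pi * A * ?y = - \<kappa> * ?y"
        by (simp add: \<kappa>_def \<beta>_def field_simps)
      ultimately have "\<kappa> * \<bar>?x\<bar> + \<kappa> * ?y + \<epsilon> * D + pi * \<beta> * ?y / 2 + (B + 1) + (1 - \<beta> * ?x - d) * ln B + pi * ?y + - ?x * \<tau> - pi * A * ?y
        \<le> E + (- ?x - \<kappa> * ?y)"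
        by (simp add: E_def algebra_simps)
      then show ?thesis using C1 q \<phi> by (intro divide_right_mono mult_left_mono) auto
    qed
    also have "\<dots> = C1 * exp E / (q * \<phi> ^ m) * exp (- ?x - \<kappa> * ?y)" by (simp add: exp_add)
    finally show "norm (gamma_ratio A k n s * exp (- s * of_real \<tau>)) \<le> C1 * exp E / (q * \<phi> ^ m) * exp (- Re s - \<kappa> * Im s)" .
  qed
qed

lemma gamma_ratio_cnj: "gamma_ratio A k n (cnj s) = cnj (gamma_ratio A k n s)"
  by (simp add: gamma_ratio_def cnj_Gamma cnj_rGamma)

lemma gamma_ratio_holomorphic:
  assumes "0 < A"
  shows "gamma_ratio A k n holomorphic_on {s. 0 < Im s}"
  unfolding gamma_ratio_def[abs_def]
proof (intro holomorphic_intros)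
  fix s assume "s \<in> {s. 0 < Im s}"
  then show "of_real A * (1 - s) + of_nat k \<notin> \<int>\<^sub>\<le>\<^sub>0"
    using assms by (intro Im_nonzero_not_nonpos_Int) auto
qed

lemma gamma_ratio_continuous_vertical:
  assumes A: "0 < A" and c: "0 < A * (1 - c) + real k"
  shows "continuous_on UNIV (\<lambda>y. gamma_ratio A k n (Complex c y))"
proof -
  have 1: "continuous_on {z. 0 < Re z} (Gamma :: complex \<Rightarrow> complex)"
    by (rule continuous_on_Gamma) (auto elim!: nonpos_Ints_cases)
  have 2: "continuous_on UNIV (rGamma :: complex \<Rightarrow> complex)" by (rule continuous_on_rGamma)
  have 3: "continuous_on UNIV (\<lambda>y. complex_of_real A * (1 - Complex c y) + of_nat k)"
    "continuous_on UNIV (\<lambda>y. of_nat n + 1 - Complex c y)"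
    unfolding Complex_eq by (intro continuous_intros)+
  have 4: "(\<lambda>y. complex_of_real A * (1 - Complex c y) + of_nat k) ` UNIV \<subseteq> {z. 0 < Re z}"
    using c by auto
  show ?thesis
    unfolding gamma_ratio_def
    by (intro continuous_on_mult continuous_on_compose2[OF 1 3(1) 4] continuous_on_compose2[OF 2 3(2) subset_UNIV])
qed

text \<open>
  The real part of the vertical line that replaces the contour.
\<close>
definition contour_abscissa :: "fox_contour \<Rightarrow> real" where
  "contour_abscissa L = (case L of Vertical c \<Rightarrow> c | Loop c _ _ \<Rightarrow> c)"

text \<open>
  Admissibility puts the first pole \<open>1 + k \<alpha>\<close> to the right of the contour: this fixes
  the side of the vertical line, and for a loop it forces the strip between the two legs to
  contain the real axis.
\<close>
lemma fox_contour_reduction: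
  fixes \<alpha> t :: real
  assumes \<alpha>: "0 < \<alpha>" "\<alpha> < 1" and t: "0 < t"
    and L: "fox_admissible L (1 - 1 / \<alpha> - real k) (1 / \<alpha>)"
  defines "c \<equiv> contour_abscissa L"
  shows "c < 1 + real k * \<alpha>"
    and "integrable lborel (\<lambda>y. gamma_ratio (1 / \<alpha>) k n (Complex c y) * exp (- Complex c y * of_real (ln t)))"
    and "fox_H_converges L (1 - 1 / \<alpha> - real k) (1 / \<alpha>) (- real n) 1 t"
    and "fox_weight L \<alpha> n k t = (\<integral>y. gamma_ratio (1 / \<alpha>) k n (Complex c y) * exp (- Complex c y * of_real (ln t)) \<partial>lborel) / of_real (2 * pi)"
proof -
  let ?A = "1 / \<alpha>"
  have A: "1 < ?A" using \<alpha> by simp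
  define F where "F s = gamma_ratio ?A k n s * exp (- s * of_real (ln t))" for s
  have F: "fox_integrand (1 - 1 / \<alpha> - real k) (1 / \<alpha>) (- real n) 1 t = F"
  proof
    fix s :: complex
    have "1 - of_real (1 - 1 / \<alpha> - real k) - of_real (1 / \<alpha>) * s = of_real ?A * (1 - s) + of_nat k"
      by (simp add: algebra_simps diff_divide_distrib add_divide_distrib)
    moreover have "1 - of_real (- real n) - of_real 1 * s = of_nat n + 1 - s" by simp
    moreover have "complex_of_real t powr (- s) = exp (- s * of_real (ln t))"
      using t by (simp add: powr_def Ln_of_real)
    ultimately show "fox_integrand (1 - 1 / \<alpha> - real k) (1 / \<alpha>) (- real n) 1 t s = F s"
      unfolding fox_integrand_def F_def gamma_ratio_def by (simp only: rGamma_inverse_Gamma divide_inverse)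
  qed
  have pole: "complex_of_real (1 + real k * \<alpha>) \<in> right_side L"
  proof -
    have "1 - of_real (1 - 1 / \<alpha> - real k) - of_real (1 / \<alpha>) * complex_of_real (1 + real k * \<alpha>) = 0"
      using \<alpha> by (simp add: field_simps)
    then show ?thesis using L by (auto simp: fox_admissible_def)
  qed
  show c: "c < 1 + real k * \<alpha>"
    using pole by (cases L) (auto simp: c_def contour_abscissa_def)
  have hol: "F holomorphic_on {s. 0 < Im s}"
    unfolding F_def[abs_def] by (intro holomorphic_intros gamma_ratio_holomorphic) (use A in linarith)
  have cnj: "F (cnj s) = cnj (F s)" for s
    by (simp add: F_def gamma_ratio_cnj exp_cnj)
  have bound: "\<exists>C \<kappa>. 0 < \<kappa> \<and> (\<forall>s. c \<le> Re s \<longrightarrow> \<phi> \<le> Im s \<longrightarrow> norm (F s) \<le> C * exp (- Re s - \<kappa> * Im s))" if "0 < \<phi>" for \<phi>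
    unfolding F_def by (rule gamma_ratio_bound[OF A that])
  have cont: "continuous_on UNIV (\<lambda>y. F (Complex c y))"
    unfolding F_def
  proof (intro continuous_on_mult gamma_ratio_continuous_vertical)
    have "?A * (1 - c) + real k = (1 - c + real k * \<alpha>) / \<alpha>" using \<alpha> by (simp add: field_simps)
    then show "0 < ?A * (1 - c) + real k" using c \<alpha> by simp
    show "continuous_on UNIV (\<lambda>y. exp (- Complex c y * complex_of_real (ln t)))"
      unfolding Complex_eq by (intro continuous_intros)
  qed (use \<alpha> in auto)
  note lv = loop_integral_eq_vertical_integral[OF hol cnj bound cont]
  have vert: "contour_converges (Vertical c) F" by (rule lv(1)[of "- 1" 1]) auto
  have *: "contour_converges L F \<and> fox_contour_integral L F = fox_contour_integral (Vertical c) F"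
  proof (cases L)
    case (Vertical c')
    then show ?thesis using vert by (simp add: c_def contour_abscissa_def)
  next
    case (Loop c' \<phi>1 \<phi>2)
    then have L_eq: "L = Loop c \<phi>1 \<phi>2" by (simp add: c_def contour_abscissa_def)
    have "\<phi>1 < 0" "0 < \<phi>2" using pole L_eq by auto
    then show ?thesis unfolding L_eq using lv(2,3) by blast
  qed
  show "integrable lborel (\<lambda>y. gamma_ratio (1 / \<alpha>) k n (Complex c y) * exp (- Complex c y * of_real (ln t)))"
    using vert by (simp add: F_def)
  show "fox_H_converges L (1 - 1 / \<alpha> - real k) (1 / \<alpha>) (- real n) 1 t"
    using * by (simp add: fox_H_converges_def F)
  have "fox_weight L \<alpha> n k t = 1 / (2 * of_real pi * \<i>) * fox_contour_integral (Vertical c) F"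
    using * by (simp add: fox_weight_def fox_H_def F)
  also have "\<dots> = (\<integral>y. F (Complex c y) \<partial>lborel) / of_real (2 * pi)"
    by simp
  finally show "fox_weight L \<alpha> n k t = (\<integral>y. gamma_ratio (1 / \<alpha>) k n (Complex c y) * exp (- Complex c y * of_real (ln t)) \<partial>lborel) / of_real (2 * pi)"
    unfolding F_def .
qed

section \<open>Fourier inversion for integrable characteristic functions\<close>

text \<open>
  The candidate for the density of a law with characteristic function \<open>\<phi>\<close>.
\<close>
definition inverse_Fourier :: "(real \<Rightarrow> complex) \<Rightarrow> real \<Rightarrow> complex" where
  "inverse_Fourier \<phi> x = (\<integral>t. iexp (- (t * x)) * \<phi> t \<partial>lborel) / of_real (2 * pi)"

lemma inverse_Fourier_integrable:
  assumes "integrable lborel \<phi>"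
  shows "integrable lborel (\<lambda>t. iexp (- (t * x)) * \<phi> t)"
proof (rule Bochner_Integration.integrable_bound[OF assms])
  have "(\<lambda>t. iexp (- (t * x))) \<in> borel_measurable borel"
    by (rule borel_measurable_continuous_onI) (intro continuous_intros)
  then show "(\<lambda>t. iexp (- (t * x)) * \<phi> t) \<in> borel_measurable lborel"
    using borel_measurable_integrable[OF assms] by measurable
qed (simp add: norm_mult)

lemma norm_inverse_Fourier_le:
  assumes "integrable lborel \<phi>"
  shows "norm (inverse_Fourier \<phi> x) \<le> (\<integral>t. norm (\<phi> t) \<partial>lborel) / (2 * pi)"
proof -
  have "norm (\<integral>t. iexp (- (t * x)) * \<phi> t \<partial>lborel) \<le> (\<integral>t. norm (iexp (- (t * x)) * \<phi> t) \<partial>lborel)"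
    by (rule integral_norm_bound)
  then have "norm (\<integral>t. iexp (- (t * x)) * \<phi> t \<partial>lborel) \<le> (\<integral>t. norm (\<phi> t) \<partial>lborel)"
    by (simp add: norm_mult)
  then show ?thesis by (simp add: inverse_Fourier_def norm_divide divide_right_mono)
qed

lemma continuous_inverse_Fourier:
  assumes int: "integrable lborel \<phi>"
  shows "continuous_on UNIV (inverse_Fourier \<phi>)"
  unfolding continuous_on_sequentially
proof (intro allI ballI impI)
  fix X and x :: real assume X: "(\<forall>n::nat. X n \<in> UNIV) \<and> X \<longlonglongrightarrow> x"
  have "(\<lambda>n. \<integral>t. iexp (- (t * X n)) * \<phi> t \<partial>lborel) \<longlonglongrightarrow> (\<integral>t. iexp (- (t * x)) * \<phi> t \<partial>lborel)"
  proof (rule integral_dominated_convergence[where w="\<lambda>t. norm (\<phi> t)"])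
    show "AE t in lborel. (\<lambda>n. iexp (- (t * X n)) * \<phi> t) \<longlonglongrightarrow> iexp (- (t * x)) * \<phi> t"
      using X by (intro AE_I2 tendsto_intros) auto
    show "integrable lborel (\<lambda>t. norm (\<phi> t))" using int by simp
    show "(\<lambda>t. iexp (- (t * x)) * \<phi> t) \<in> borel_measurable lborel"
      using inverse_Fourier_integrable[OF int] by (rule borel_measurable_integrable)
    show "(\<lambda>t. iexp (- (t * X n)) * \<phi> t) \<in> borel_measurable lborel" for n
      using inverse_Fourier_integrable[OF int] by (rule borel_measurable_integrable)
    show "AE t in lborel. norm (iexp (- (t * X n)) * \<phi> t) \<le> norm (\<phi> t)" for n
      by (intro AE_I2) (simp add: norm_mult)
  qed
  then show "(inverse_Fourier \<phi> \<circ> X) \<longlonglongrightarrow> inverse_Fourier \<phi> x"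
    unfolding inverse_Fourier_def[abs_def] o_def by (intro tendsto_intros) auto
qed

lemma integral_iexp_Icc:
  fixes a b t :: real
  assumes "a \<le> b" "t \<noteq> 0"
  shows "(\<integral>x. indicator {a..b} x *\<^sub>R iexp (- (t * x)) \<partial>lborel) = (iexp (- (t * a)) - iexp (- (t * b))) / (\<i> * t)"
proof -
  have "(\<integral>x. indicator {a..b} x *\<^sub>R iexp (- (t * x)) \<partial>lborel) = - iexp (- (t * b)) / (\<i> * t) - - iexp (- (t * a)) / (\<i> * t)"
  proof (rule integral_FTC_atLeastAtMost[OF assms(1)])
    fix x :: real
    show "((\<lambda>x. - iexp (- (t * x)) / (\<i> * t)) has_vector_derivative iexp (- (t * x))) (at x within {a..b})"
      using assms(2) by (auto intro!: derivative_eq_intros has_vector_derivative_real_field simp: field_simps)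
  qed (intro continuous_intros)
  then show ?thesis by (simp add: diff_divide_distrib)
qed

text \<open>
  Integrating the exponential over \<open>[a, b]\<close> first produces the kernel of the Levy inversion
  formula.
\<close>
lemma integral_inverse_Fourier_Icc:
  assumes int: "integrable lborel \<phi>" and ab: "a \<le> b"
  shows "(\<integral>x. indicator {a..b} x *\<^sub>R inverse_Fourier \<phi> x \<partial>lborel)
    = (\<integral>t. (iexp (- (t * a)) - iexp (- (t * b))) / (\<i> * t) * \<phi> t \<partial>lborel) / of_real (2 * pi)"
proof -
  let ?F = "\<lambda>(x, t). indicator {a..b} x *\<^sub>R (iexp (- (t * x)) * \<phi> t)"
  have [measurable]: "\<phi> \<in> borel_measurable borel" using borel_measurable_integrable[OF int] by simp
  have "(\<lambda>p::real \<times> real. iexp (- (snd p * fst p))) \<in> borel_measurable borel"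
    by (rule borel_measurable_continuous_onI) (intro continuous_intros)
  then have [measurable]: "(\<lambda>p::real \<times> real. iexp (- (snd p * fst p))) \<in> borel_measurable (borel \<Otimes>\<^sub>M borel)"
    by (simp add: borel_prod)
  have F_meas: "?F \<in> borel_measurable (lborel \<Otimes>\<^sub>M lborel)"
    unfolding case_prod_beta by measurable
  have F_int: "integrable (lborel \<Otimes>\<^sub>M lborel) ?F"
  proof (rule lborel_pair.Fubini_integrable[OF F_meas])
    have "(\<integral>t. norm (?F (x, t)) \<partial>lborel) = indicator {a..b} x * (\<integral>t. norm (\<phi> t) \<partial>lborel)" for x
      by (simp add: norm_mult)
    then have eq: "(\<lambda>x. \<integral>t. norm (?F (x, t)) \<partial>lborel) = (\<lambda>x. indicator {a..b} x * (\<integral>t. norm (\<phi> t) \<partial>lborel))"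
      by (rule ext)
    show "integrable lborel (\<lambda>x. \<integral>t. norm (?F (x, t)) \<partial>lborel)" unfolding eq
      by (intro integrable_mult_left integrable_real_indicator) (simp_all add: emeasure_lborel_Icc_eq)
    show "AE x in lborel. integrable lborel (\<lambda>t. ?F (x, t))"
      using inverse_Fourier_integrable[OF int] by simp
  qed
  have "(\<integral>x. indicator {a..b} x *\<^sub>R inverse_Fourier \<phi> x \<partial>lborel)
      = (\<integral>x. (\<integral>t. indicator {a..b} x *\<^sub>R (iexp (- (t * x)) * \<phi> t) \<partial>lborel) \<partial>lborel) / of_real (2 * pi)"
    unfolding inverse_Fourier_def scaleR_conv_of_real times_divide_eq_right
      integral_divide_zero integral_mult_right_zero by (rule refl)
  also have "(\<integral>x. (\<integral>t. indicator {a..b} x *\<^sub>R (iexp (- (t * x)) * \<phi> t) \<partial>lborel) \<partial>lborel)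
      = (\<integral>t. (\<integral>x. indicator {a..b} x *\<^sub>R (iexp (- (t * x)) * \<phi> t) \<partial>lborel) \<partial>lborel)"
    using lborel_pair.Fubini_integral[OF F_int] by simp
  also have "\<dots> = (\<integral>t. (iexp (- (t * a)) - iexp (- (t * b))) / (\<i> * t) * \<phi> t \<partial>lborel)"
  proof (rule integral_cong_AE)
    show "(\<lambda>t. \<integral>x. indicator {a..b} x *\<^sub>R (iexp (- (t * x)) * \<phi> t) \<partial>lborel) \<in> borel_measurable lborel"
      using lborel_pair.integrable_snd[OF F_int] by (simp add: borel_measurable_integrable)
    have "(\<lambda>t. iexp (- (t * a)) - iexp (- (t * b))) \<in> borel_measurable borel"
      by (rule borel_measurable_continuous_onI) (intro continuous_intros)
    then show "(\<lambda>t. (iexp (- (t * a)) - iexp (- (t * b))) / (\<i> * t) * \<phi> t) \<in> borel_measurable lborel"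
      by measurable
    show "AE t in lborel. (\<integral>x. indicator {a..b} x *\<^sub>R (iexp (- (t * x)) * \<phi> t) \<partial>lborel)
        = (iexp (- (t * a)) - iexp (- (t * b))) / (\<i> * t) * \<phi> t"
      using AE_lborel_singleton[of 0]
    proof eventually_elim
      case (elim t)
      have "(\<integral>x. indicator {a..b} x *\<^sub>R (iexp (- (t * x)) * \<phi> t) \<partial>lborel)
          = (\<integral>x. indicator {a..b} x *\<^sub>R iexp (- (t * x)) \<partial>lborel) * \<phi> t"
        unfolding mult_scaleR_left[symmetric] integral_mult_left_zero by (rule refl)
      then show ?case unfolding integral_iexp_Icc[OF ab elim] .
    qed
  qed
  finally show ?thesis .
qed

context real_distribution
begin

text \<open>
  The truncated integrals in the Levy inversion formula converge to a full integral by
  domination.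
\<close>
lemma measure_Ioc_inverse_Fourier:
  assumes int: "integrable lborel (char M)" and ab: "a \<le> b" and atoms: "measure M {a} = 0" "measure M {b} = 0"
  shows "complex_of_real (measure M {a<..b}) = (\<integral>x. indicator {a..b} x *\<^sub>R inverse_Fourier (char M) x \<partial>lborel)"
proof -
  let ?h = "\<lambda>t::real. (iexp (- (t * a)) - iexp (- (t * b))) / (\<i> * t) * char M t"
  have "(\<lambda>t. iexp (- (t * a)) - iexp (- (t * b))) \<in> borel_measurable borel"
    by (rule borel_measurable_continuous_onI) (intro continuous_intros)
  then have h_meas [measurable]: "?h \<in> borel_measurable lborel"
    using borel_measurable_integrable[OF int] by measurable
  have h_bound: "norm (?h t) \<le> (b - a) * norm (char M t)" for t
  proof (cases "t = 0")
    case False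
    have "norm ((iexp (- (t * a)) - iexp (- (t * b))) / (\<i> * t)) \<le> b - a"
      using Levy_Inversion_aux2[of "- b" "- a" t] ab False by simp
    then show ?thesis unfolding norm_mult by (rule mult_right_mono) simp
  qed (use ab in simp)
  have "(\<lambda>T. \<integral>t. indicator {- real T<..<real T} t *\<^sub>R ?h t \<partial>lborel) \<longlonglongrightarrow> (\<integral>t. ?h t \<partial>lborel)"
  proof (rule integral_dominated_convergence[where w="\<lambda>t. (b - a) * norm (char M t)"])
    show "integrable lborel (\<lambda>t. (b - a) * norm (char M t))" using int by simp
    show "AE t in lborel. (\<lambda>T. indicator {- real T<..<real T} t *\<^sub>R ?h t) \<longlonglongrightarrow> ?h t"
    proof (intro AE_I2)
      fix t
      obtain m :: nat where m: "\<bar>t\<bar> < real m" using reals_Archimedean2 by blast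
      have "indicator {- real T<..<real T} t *\<^sub>R ?h t = ?h t" if "m \<le> T" for T
      proof -
        have "t \<in> {- real T<..<real T}" using m that by auto
        then show ?thesis by simp
      qed
      then show "(\<lambda>T. indicator {- real T<..<real T} t *\<^sub>R ?h t) \<longlonglongrightarrow> ?h t"
        by (intro tendsto_eventually eventually_sequentiallyI)
    qed
    show "AE t in lborel. norm (indicator {- real T<..<real T} t *\<^sub>R ?h t) \<le> (b - a) * norm (char M t)" for T
    proof (intro AE_I2)
      fix t
      have "norm (indicator {- real T<..<real T} t *\<^sub>R ?h t) \<le> norm (?h t)"
        unfolding norm_scaleR by (rule mult_left_le_one_le) (auto simp: indicator_def)
      then show "norm (indicator {- real T<..<real T} t *\<^sub>R ?h t) \<le> (b - a) * norm (char M t)"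
        using h_bound order_trans by blast
    qed
  qed (use h_meas in measurable)
  then have "(\<lambda>T. 1 / (2 * pi) * (\<integral>t. indicator {- real T<..<real T} t *\<^sub>R ?h t \<partial>lborel)) \<longlonglongrightarrow> 1 / (2 * pi) * (\<integral>t. ?h t \<partial>lborel)"
    by (rule tendsto_mult_left)
  moreover have "(CLBINT t=- real T..real T. ?h t) = (\<integral>t. indicator {- real T<..<real T} t *\<^sub>R ?h t \<partial>lborel)" for T
    by (simp add: interval_lebesgue_integral_def set_lebesgue_integral_def)
  ultimately have "of_real (measure M {a<..b}) = 1 / (2 * pi) * (\<integral>t. ?h t \<partial>lborel)"
    using LIMSEQ_unique[OF Levy_Inversion[OF ab atoms]] by simp
  then show ?thesis unfolding integral_inverse_Fourier_Icc[OF int ab] by simp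
qed

text \<open>
  The candidate density is bounded, so small intervals between continuity points have small
  mass.
\<close>
lemma measure_singleton_eq_0_if_char_integrable:
  assumes int: "integrable lborel (char M)"
  shows "measure M {x} = 0"
proof (rule ccontr)
  assume "measure M {x} \<noteq> 0"
  then have pos: "0 < measure M {x}" by (simp add: zero_less_measure_iff)
  \<comment> \<open>The summand 1 keeps \<open>B\<close> positive.\<close>
  define B where "B = (\<integral>t. norm (char M t) \<partial>lborel) / (2 * pi) + 1"
  have B: "0 < B" by (auto simp: B_def intro!: add_nonneg_pos divide_nonneg_pos)
  have bound: "norm (inverse_Fourier (char M) y) \<le> B" for y
    using norm_inverse_Fourier_le[OF int, of y] by (simp add: B_def)
  define \<epsilon> where "\<epsilon> = measure M {x} / (4 * B)"
  have \<epsilon>: "0 < \<epsilon>" using pos B by (simp add: \<epsilon>_def)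
  obtain a where a: "x - \<epsilon> < a" "a < x" "measure M {a} = 0"
    using real_interval_avoid_countable_set[of "x - \<epsilon>" x, OF _ countable_support] \<epsilon> by auto
  obtain b where b: "x < b" "b < x + \<epsilon>" "measure M {b} = 0"
    using real_interval_avoid_countable_set[of x "x + \<epsilon>", OF _ countable_support] \<epsilon> by auto
  have ab: "a \<le> b" using a b by simp
  have "measure M {x} \<le> measure M {a<..b}" using a b by (intro finite_measure_mono) auto
  also have "\<dots> = norm (\<integral>y. indicator {a..b} y *\<^sub>R inverse_Fourier (char M) y \<partial>lborel)"
    unfolding measure_Ioc_inverse_Fourier[OF int ab a(3) b(3), symmetric] by simp
  also have "\<dots> \<le> (\<integral>y. indicator {a..b} y * B \<partial>lborel)"
  proof (rule Bochner_Integration.integral_norm_bound_integral)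
    show "integrable lborel (\<lambda>y. indicator {a..b} y *\<^sub>R inverse_Fourier (char M) y)"
      using borel_integrable_atLeastAtMost'[OF continuous_on_subset[OF continuous_inverse_Fourier[OF int]]]
      by (simp add: set_integrable_def)
    show "integrable lborel (\<lambda>y. indicator {a..b} y * B)"
      by (intro integrable_mult_left integrable_real_indicator) (simp_all add: emeasure_lborel_Icc_eq)
    show "norm (indicator {a..b} y *\<^sub>R inverse_Fourier (char M) y) \<le> indicator {a..b} y * B" for y
      using bound[of y] by (simp add: indicator_def)
  qed
  also have "\<dots> = (b - a) * B" using ab by simp
  also have "\<dots> \<le> (2 * \<epsilon>) * B" using a b B by (intro mult_right_mono) auto
  also have "\<dots> = measure M {x} / 2" using B by (simp add: \<epsilon>_def)
  finally show False using pos by simp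
qed

text \<open>
  A continuous function is the limit of its averages over \<open>[x, x + d]\<close>, and these are
  probabilities divided by \<open>d\<close>.
\<close>
lemma inverse_Fourier_char_nonneg:
  assumes int: "integrable lborel (char M)"
  shows "inverse_Fourier (char M) x \<in> \<real>\<^sub>\<ge>\<^sub>0"
proof -
  let ?g = "inverse_Fourier (char M)"
  have cont: "continuous_on UNIV ?g" by (rule continuous_inverse_Fourier[OF int])
  define d where "d n = 1 / real (Suc n)" for n
  have d: "0 < d n" for n by (simp add: d_def)
  have d0: "d \<longlonglongrightarrow> 0" unfolding d_def[abs_def] by (rule lim_1_over_n[THEN LIMSEQ_Suc])
  have "(\<lambda>n. \<integral>s. indicator {0..1} s *\<^sub>R ?g (x + d n * s) \<partial>lborel) \<longlonglongrightarrow> (\<integral>s. indicator {0..1::real} s *\<^sub>R ?g x \<partial>lborel)"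
  proof (rule integral_dominated_convergence[where w="\<lambda>s. indicator {0..1::real} s * ((\<integral>t. norm (char M t) \<partial>lborel) / (2 * pi))"])
    have g_meas [measurable]: "?g \<in> borel_measurable borel" by (rule borel_measurable_continuous_onI[OF cont])
    show "(\<lambda>s. indicator {0..1} s *\<^sub>R ?g (x + d n * s)) \<in> borel_measurable lborel" for n by measurable
    show "(\<lambda>s. indicator {0..1::real} s *\<^sub>R ?g x) \<in> borel_measurable lborel" by measurable
    show "AE s in lborel. (\<lambda>n. indicator {0..1} s *\<^sub>R ?g (x + d n * s)) \<longlonglongrightarrow> indicator {0..1} s *\<^sub>R ?g x"
    proof (intro AE_I2 tendsto_scaleR tendsto_const)
      fix s
      have "(\<lambda>n. x + d n * s) \<longlonglongrightarrow> x + 0 * s" using d0 by (intro tendsto_intros)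
      then show "(\<lambda>n. ?g (x + d n * s)) \<longlonglongrightarrow> ?g x"
        by (intro continuous_on_tendsto_compose[OF cont]) auto
    qed
    show "AE s in lborel. norm (indicator {0..1} s *\<^sub>R ?g (x + d n * s)) \<le> indicator {0..1::real} s * ((\<integral>t. norm (char M t) \<partial>lborel) / (2 * pi))" for n
      using norm_inverse_Fourier_le[OF int] by (intro AE_I2) (auto simp: indicator_def)
  qed simp
  then have lim: "(\<lambda>n. \<integral>s. indicator {0..1} s *\<^sub>R ?g (x + d n * s) \<partial>lborel) \<longlonglongrightarrow> ?g x" by simp
  have "(\<integral>s. indicator {0..1} s *\<^sub>R ?g (x + d n * s) \<partial>lborel) \<in> \<real>\<^sub>\<ge>\<^sub>0" for n
  proof -
    have ind: "indicator {x..x + d n} (x + d n * s) = (indicator {0..1} s :: real)" for s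
      using d[of n] by (auto simp: indicator_def zero_le_mult_iff)
    have "(\<integral>y. indicator {x..x + d n} y *\<^sub>R ?g y \<partial>lborel) = d n *\<^sub>R (\<integral>s. indicator {x..x + d n} (x + d n * s) *\<^sub>R ?g (x + d n * s) \<partial>lborel)"
      by (subst lborel_integral_real_affine[where c="d n" and t=x]) (use d[of n] in simp_all)
    then have "of_real (measure M {x<..x + d n}) = d n *\<^sub>R (\<integral>s. indicator {0..1} s *\<^sub>R ?g (x + d n * s) \<partial>lborel)"
      unfolding ind using d[of n] by (subst measure_Ioc_inverse_Fourier[OF int]) (auto simp: measure_singleton_eq_0_if_char_integrable[OF int])
    then have "(\<integral>s. indicator {0..1} s *\<^sub>R ?g (x + d n * s) \<partial>lborel) = of_real (measure M {x<..x + d n} / d n)"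
      using d[of n] by (simp add: scaleR_conv_of_real field_simps)
    then show ?thesis using d[of n] by (simp del: of_real_divide)
  qed
  then show ?thesis
    using closed_sequentially[OF closed_nonneg_Reals_complex _ lim] by blast
qed

theorem density_inverse_Fourier:
  assumes int: "integrable lborel (char M)"
  shows "M = density lborel (\<lambda>x. ennreal (Re (inverse_Fourier (char M) x)))"
proof (rule measure_eqI_generator_eq[where \<Omega>=UNIV and E="range (\<lambda>(a, b). {a<..b::real})"])
  let ?g = "inverse_Fourier (char M)"
  have cont: "continuous_on UNIV ?g" by (rule continuous_inverse_Fourier[OF int])
  have g_meas [measurable]: "?g \<in> borel_measurable borel" by (rule borel_measurable_continuous_onI[OF cont])
  show "emeasure M X = emeasure (density lborel (\<lambda>x. ennreal (Re (?g x)))) X" if X: "X \<in> range (\<lambda>(a, b). {a<..b::real})" for X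
  proof -
    obtain a b where X: "X = {a<..b}" using X by auto
    show ?thesis
    proof (cases "a \<le> b")
      case True
      have int_ab: "integrable lborel (\<lambda>y. indicator {a..b} y *\<^sub>R ?g y)"
        using borel_integrable_atLeastAtMost'[OF continuous_on_subset[OF cont]] by (simp add: set_integrable_def)
      have "measure M X = Re (\<integral>y. indicator {a..b} y *\<^sub>R ?g y \<partial>lborel)"
        unfolding measure_Ioc_inverse_Fourier[OF int True measure_singleton_eq_0_if_char_integrable[OF int] measure_singleton_eq_0_if_char_integrable[OF int], symmetric] X by simp
      also have "\<dots> = (\<integral>y. indicator {a..b} y * Re (?g y) \<partial>lborel)"
        using integral_Re[OF int_ab] by simp
      finally have "emeasure M X = ennreal (\<integral>y. indicator {a..b} y * Re (?g y) \<partial>lborel)"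
        by (simp add: emeasure_eq_measure)
      also have "\<dots> = (\<integral>\<^sup>+y. ennreal (indicator {a..b} y * Re (?g y)) \<partial>lborel)"
        using integrable_Re[OF int_ab] inverse_Fourier_char_nonneg[OF int]
        by (intro nn_integral_eq_integral[symmetric]) (auto simp: complex_nonneg_Reals_iff)
      also have "\<dots> = (\<integral>\<^sup>+y. ennreal (Re (?g y)) * indicator {a<..b} y \<partial>lborel)"
        by (rule nn_integral_cong_AE) (use AE_lborel_singleton[of a] in eventually_elim, auto simp: indicator_def)
      also have "\<dots> = emeasure (density lborel (\<lambda>x. ennreal (Re (?g x)))) X"
        by (subst emeasure_density) (auto simp: X)
      finally show ?thesis .
    qed (simp add: X)
  qed
  show "(\<Union>i. {- real (i::nat)<..real i}) = UNIV" by (rule UN_Ioc_eq_UNIV)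
qed (auto simp: borel_sigma_sets_Ioc Int_stable_def emeasure_eq_measure)

end

section \<open>Mellin transform and density of the Gibbs laws\<close>

text \<open>
  The formula for compact intervals, extended by monotone convergence.
\<close>
lemma nn_integral_exp_substitution:
  fixes G :: "real \<Rightarrow> ennreal"
  assumes [measurable]: "G \<in> borel_measurable borel"
  shows "(\<integral>\<^sup>+x. G (exp x) * ennreal (exp x) \<partial>lborel) = (\<integral>\<^sup>+t. indicator {0<..} t * G t \<partial>lborel)"
proof -
  define L where "L m y = G y * indicator {exp (- real m - 1)..exp (real m + 1)} y" for m :: nat and y
  define R where "R m x = G (exp x) * ennreal (exp x) * indicator {- real m - 1..real m + 1} x" for m :: nat and x
  have [measurable]: "L m \<in> borel_measurable borel" "R m \<in> borel_measurable borel" for m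
    unfolding L_def R_def by measurable
  have ind_mono: "indicator A x \<le> (indicator B x :: ennreal)" if "A \<subseteq> B" for A B :: "real set" and x
    using that by (auto simp: indicator_def)
  have mono: "mono L" "mono R"
    unfolding L_def R_def by (intro monoI le_funI mult_left_mono ind_mono; simp)+
  have piece: "(\<integral>\<^sup>+y. L m y \<partial>lborel) = (\<integral>\<^sup>+x. R m x \<partial>lborel)" for m
    unfolding L_def R_def
    by (rule nn_integral_substitution_aux[where g=exp and g'=exp]) (auto intro!: derivative_eq_intros continuous_intros)
  have ev: "\<forall>\<^sub>F m in sequentially. z \<le> real m" for z
    using filterlim_real_sequentially by (simp add: filterlim_at_top)
  have lim_R: "(\<lambda>m. R m x) \<longlonglongrightarrow> G (exp x) * ennreal (exp x)" for x
  proof (rule tendsto_eventually)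
    show "\<forall>\<^sub>F m in sequentially. R m x = G (exp x) * ennreal (exp x)"
      using ev[of x] ev[of "- x"] by eventually_elim (simp add: R_def)
  qed
  have lim_L: "(\<lambda>m. L m y) \<longlonglongrightarrow> indicator {0<..} y * G y" for y
  proof (cases "0 < y")
    case True
    show ?thesis
    proof (rule tendsto_eventually)
      show "\<forall>\<^sub>F m in sequentially. L m y = indicator {0<..} y * G y"
        using ev[of "ln y"] ev[of "- ln y"]
      proof eventually_elim
        case (elim m)
        have "exp (- real m - 1) \<le> exp (ln y)" "exp (ln y) \<le> exp (real m + 1)" using elim by simp_all
        then show ?case using True by (simp add: L_def)
      qed
    qed
  next
    case False
    have "y \<notin> {exp (- real m - 1)..exp (real m + 1)}" for m :: nat
    proof
      assume "y \<in> {exp (- real m - 1)..exp (real m + 1)}"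
      then have "exp (- real m - 1) \<le> y" by simp
      then have "0 < y" by (rule less_le_trans[OF exp_gt_zero])
      then show False using False by simp
    qed
    then show ?thesis using False by (simp add: L_def)
  qed
  have "(\<lambda>m. \<integral>\<^sup>+y. L m y \<partial>lborel) \<longlonglongrightarrow> (\<integral>\<^sup>+y. indicator {0<..} y * G y \<partial>lborel)"
    by (rule nn_integral_LIMSEQ[OF mono(1) _ lim_L]) simp
  moreover have "(\<lambda>m. \<integral>\<^sup>+y. L m y \<partial>lborel) \<longlonglongrightarrow> (\<integral>\<^sup>+x. G (exp x) * ennreal (exp x) \<partial>lborel)"
    unfolding piece by (rule nn_integral_LIMSEQ[OF mono(2) _ lim_R]) simp
  ultimately show ?thesis by (rule LIMSEQ_unique[symmetric])
qed

lemma sigma_finite_if_nn_integral_pos_finite: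
  fixes f :: "'a \<Rightarrow> real"
  assumes f [measurable]: "f \<in> borel_measurable M" and pos: "AE x in M. 0 < f x"
    and fin: "(\<integral>\<^sup>+x. ennreal (f x) \<partial>M) < \<infinity>"
  shows "sigma_finite_measure M"
proof -
  let ?D = "density M (\<lambda>x. ennreal (f x))"
  interpret D: finite_measure ?D
    by (rule finite_measureI) (use fin in \<open>simp add: emeasure_density\<close>)
  have "density ?D (\<lambda>x. ennreal (1 / f x)) = M" by (rule density_density_inverse[OF f pos])
  moreover have "sigma_finite_measure (density ?D (\<lambda>x. ennreal (1 / f x)))"
    by (subst D.sigma_finite_iff_density_finite) auto
  ultimately show ?thesis by simp
qed

text \<open>
  Multiply the transform at \<open>l = exp x\<close> by \<open>exp (p * x)\<close> and integrate over \<open>x\<close>. Over \<open>t\<close>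
  first, the closed form of the transform gives a Gamma integral in the variable
  \<open>\<alpha> * x\<close>; over \<open>x\<close> first, the integrand gives \<open>Gamma p\<close> times \<open>t\<close> to the power
  \<open>n - p = s - 1\<close>.
\<close>
lemma Mellin_transform_if_gibbs_transform:
  fixes s :: complex
  assumes \<nu>: "gibbs_transform \<alpha> n k C \<nu>" and C: "0 \<le> C" and \<alpha>: "0 < \<alpha>" "\<alpha> < 1"
    and k: "1 \<le> k" "k \<le> n" and s: "Re s < 1 + real k * \<alpha>"
  shows "has_bochner_integral \<nu> (\<lambda>t. exp ((s - 1) * of_real (ln t))) (of_real (C / \<alpha>) * gamma_ratio (1 / \<alpha>) k n s)"
proof -
  define p where "p = of_nat n + 1 - s"
  define z where "z = of_real (1 / \<alpha>) * (1 - s) + of_nat k"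
  have sets [measurable_cong]: "sets \<nu> = sets borel" and pos: "AE t in \<nu>. 0 < t"
    and tr: "\<And>l. 0 < l \<Longrightarrow> (\<integral>\<^sup>+t. ennreal (t ^ n * exp (- l * t)) \<partial>\<nu>) = ennreal (C * (l powr (real k * \<alpha> - real n) * exp (- (l powr \<alpha>))))"
    using \<nu> by (simp_all add: gibbs_transform_def)
  have k\<alpha>: "real k * \<alpha> \<le> real n"
  proof -
    have "real k * \<alpha> \<le> real k * 1" using \<alpha> by (intro mult_left_mono) auto
    moreover have "real k \<le> real n" using k by simp
    ultimately show ?thesis by linarith
  qed
  have p: "0 < Re p" using s k\<alpha> by (simp add: p_def)
  have z: "0 < Re z"
  proof -
    have "Re z = (1 - Re s + real k * \<alpha>) / \<alpha>" using \<alpha> by (simp add: z_def field_simps)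
    then show ?thesis using s \<alpha> by simp
  qed
  have sf: "sigma_finite_measure \<nu>"
  proof (rule sigma_finite_if_nn_integral_pos_finite)
    show "(\<lambda>t. t ^ n * exp (- 1 * t)) \<in> borel_measurable \<nu>" by measurable
    show "AE t in \<nu>. 0 < t ^ n * exp (- 1 * t)" using pos by eventually_elim simp
    show "(\<integral>\<^sup>+t. ennreal (t ^ n * exp (- 1 * t)) \<partial>\<nu>) < \<infinity>" unfolding tr[OF zero_less_one] by simp
  qed
  interpret P: pair_sigma_finite lborel \<nu>
    using sf by (simp add: pair_sigma_finite_def lborel.sigma_finite_measure_axioms)
  \<comment> \<open>The value of the transform at \<open>l = exp x\<close>.\<close>
  define E where "E x = C * exp ((real k * \<alpha> - real n) * x - exp (\<alpha> * x))" for x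
  have inner: "has_bochner_integral \<nu> (\<lambda>t. t ^ n * exp (- exp x * t)) (E x)" for x
  proof (rule has_bochner_integral_nn_integral)
    show "AE t in \<nu>. 0 \<le> t ^ n * exp (- exp x * t)" using pos by eventually_elim simp
    have "exp x powr a = exp (a * x)" for a by (simp add: powr_def)
    then show "(\<integral>\<^sup>+t. ennreal (t ^ n * exp (- exp x * t)) \<partial>\<nu>) = ennreal (E x)"
      using tr[of "exp x"] by (simp add: E_def exp_diff exp_minus divide_inverse)
  qed (use C in \<open>auto simp: E_def\<close>)
  define H where "H x t = exp (p * of_real x) * of_real (t ^ n * exp (- exp x * t))" for x t :: real
  have "(\<lambda>x. exp (p * complex_of_real x)) \<in> borel_measurable borel"
    by (intro borel_measurable_continuous_onI continuous_intros)
  then have H_meas: "case_prod H \<in> borel_measurable (lborel \<Otimes>\<^sub>M \<nu>)"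
    unfolding H_def case_prod_beta by measurable
  have H_inner: "has_bochner_integral \<nu> (H x) (exp (p * of_real x) * of_real (E x))" for x
    unfolding H_def by (intro has_bochner_integral_mult_right has_bochner_integral_of_real inner)
  have E_int: "has_bochner_integral lborel (\<lambda>x. exp (p * of_real x) * of_real (E x)) (of_real (C / \<alpha>) * Gamma z)"
  proof -
    have "has_bochner_integral lborel (\<lambda>x. exp (z * of_real (0 + \<alpha> * x) - of_real (exp (0 + \<alpha> * x)))) (Gamma z /\<^sub>R \<bar>\<alpha>\<bar>)"
      using Gamma_integral_log_scale[OF z] \<alpha> by (subst lborel_has_bochner_integral_real_affine_iff[symmetric]) auto
    then have "has_bochner_integral lborel (\<lambda>x. of_real C * exp (z * of_real (0 + \<alpha> * x) - of_real (exp (0 + \<alpha> * x)))) (of_real C * (Gamma z /\<^sub>R \<bar>\<alpha>\<bar>))"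
      by (intro has_bochner_integral_mult_right) simp_all
    moreover have "of_real C * exp (z * of_real (0 + \<alpha> * x) - of_real (exp (0 + \<alpha> * x))) = exp (p * of_real x) * of_real (E x)" for x
    proof -
      have "z * of_real \<alpha> = p + of_real (real k * \<alpha> - real n)"
        using \<alpha> by (simp add: z_def p_def field_simps)
      then have "z * of_real (\<alpha> * x) = p * of_real x + of_real ((real k * \<alpha> - real n) * x)"
        by (simp add: mult.assoc[symmetric] distrib_right)
      then have "z * of_real (0 + \<alpha> * x) - of_real (exp (0 + \<alpha> * x))
          = p * of_real x + of_real ((real k * \<alpha> - real n) * x - exp (\<alpha> * x))"
        by simp
      then show ?thesis
        unfolding E_def of_real_mult exp_of_real[symmetric] by (simp only: exp_add mult_ac)
    qed
    ultimately show ?thesis using \<alpha> by (simp add: scaleR_conv_of_real divide_inverse mult_ac)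
  qed
  have H_int: "integrable (lborel \<Otimes>\<^sub>M \<nu>) (case_prod H)"
  proof (rule P.Fubini_integrable[OF H_meas])
    have "(\<integral>t. norm (case_prod H (x, t)) \<partial>\<nu>) = norm (exp (p * of_real x) * of_real (E x))" for x
    proof -
      have "(\<integral>t. norm (case_prod H (x, t)) \<partial>\<nu>) = (\<integral>t. norm (exp (p * of_real x)) * (t ^ n * exp (- exp x * t)) \<partial>\<nu>)"
      proof (rule integral_cong_AE)
        show "AE t in \<nu>. norm (case_prod H (x, t)) = norm (exp (p * of_real x)) * (t ^ n * exp (- exp x * t))"
          using pos by eventually_elim (simp add: H_def norm_mult norm_power)
      qed (use H_inner[of x] inner[of x] in \<open>auto simp: has_bochner_integral_iff borel_measurable_integrable\<close>)
      also have "\<dots> = norm (exp (p * of_real x)) * E x"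
        using inner[of x] by (simp add: has_bochner_integral_iff)
      also have "\<dots> = norm (exp (p * of_real x) * of_real (E x))"
        using C by (simp add: norm_mult E_def)
      finally show ?thesis .
    qed
    then have eq: "(\<lambda>x. \<integral>t. norm (case_prod H (x, t)) \<partial>\<nu>) = (\<lambda>x. norm (exp (p * of_real x) * of_real (E x)))"
      by (rule ext)
    show "integrable lborel (\<lambda>x. \<integral>t. norm (case_prod H (x, t)) \<partial>\<nu>)"
      unfolding eq using E_int by (intro integrable_norm) (simp add: has_bochner_integral_iff)
    show "AE x in lborel. integrable \<nu> (\<lambda>t. case_prod H (x, t))"
      using H_inner by (simp add: has_bochner_integral_iff)
  qed
  have outer: "AE t in \<nu>. (\<integral>x. H x t \<partial>lborel) = Gamma p * exp ((s - 1) * of_real (ln t))"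
    using pos
  proof eventually_elim
    case (elim t)
    have "(\<integral>x. H x t \<partial>lborel) = (\<integral>x. of_real (t ^ n) * exp (p * of_real x - of_real (t * exp x)) \<partial>lborel)"
      by (rule arg_cong[where f="integral\<^sup>L lborel"]) (auto simp: H_def fun_eq_iff exp_diff exp_minus exp_of_real[symmetric] divide_inverse mult_ac)
    also have "\<dots> = of_real (t ^ n) * (exp (- p * of_real (ln t)) * Gamma p)"
      using Gamma_integral_log_scale_scaled[OF p elim] by (simp add: has_bochner_integral_iff)
    also have "of_real (t ^ n) = exp (of_nat n * complex_of_real (ln t))"
      using elim by (simp add: exp_of_nat_mult exp_of_real)
    also have "exp (of_nat n * complex_of_real (ln t)) * (exp (- p * of_real (ln t)) * Gamma p)
        = Gamma p * exp ((s - 1) * of_real (ln t))"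
      by (simp add: p_def mult.assoc[symmetric] exp_add[symmetric] algebra_simps)
    finally show ?case .
  qed
  have ln_meas: "(\<lambda>t. exp ((s - 1) * complex_of_real (ln t))) \<in> borel_measurable \<nu>"
  proof -
    have "(\<lambda>x. exp ((s - 1) * complex_of_real x)) \<in> borel_measurable borel"
      by (intro borel_measurable_continuous_onI continuous_intros)
    then show ?thesis by measurable
  qed
  have G_meas: "(\<lambda>t. \<integral>x. H x t \<partial>lborel) \<in> borel_measurable \<nu>"
    using P.integrable_snd[OF H_int] by (rule borel_measurable_integrable)
  have "has_bochner_integral \<nu> (\<lambda>t. \<integral>x. H x t \<partial>lborel) (of_real (C / \<alpha>) * Gamma z)"
    unfolding has_bochner_integral_iff
  proof
    show "integrable \<nu> (\<lambda>t. \<integral>x. H x t \<partial>lborel)" by (rule P.integrable_snd[OF H_int])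
    have "(\<integral>t. (\<integral>x. H x t \<partial>lborel) \<partial>\<nu>) = (\<integral>x. (\<integral>t. H x t \<partial>\<nu>) \<partial>lborel)" by (rule P.Fubini_integral[OF H_int])
    then show "(\<integral>t. (\<integral>x. H x t \<partial>lborel) \<partial>\<nu>) = of_real (C / \<alpha>) * Gamma z"
      using H_inner E_int by (simp add: has_bochner_integral_iff)
  qed
  then have "has_bochner_integral \<nu> (\<lambda>t. Gamma p * exp ((s - 1) * of_real (ln t))) (of_real (C / \<alpha>) * Gamma z)"
    using has_bochner_integral_cong_AE[OF G_meas _ outer] ln_meas by simp
  then have "has_bochner_integral \<nu> (\<lambda>t. rGamma p * (Gamma p * exp ((s - 1) * of_real (ln t)))) (rGamma p * (of_real (C / \<alpha>) * Gamma z))"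
    by (intro has_bochner_integral_mult_right) simp_all
  moreover have inv: "rGamma p * Gamma p = 1"
  proof -
    have "p \<notin> \<int>\<^sub>\<le>\<^sub>0" using p by (auto elim!: nonpos_Ints_cases)
    then show ?thesis by (simp add: Gamma_def rGamma_eq_zero_iff)
  qed
  moreover have "rGamma p * (Gamma p * w) = w" for w using inv by (simp add: mult.assoc[symmetric])
  moreover have "rGamma p * (of_real (C / \<alpha>) * Gamma z) = of_real (C / \<alpha>) * gamma_ratio (1 / \<alpha>) k n s"
    unfolding gamma_ratio_def p_def z_def by (simp only: mult_ac)
  ultimately show ?thesis by (simp only:)
qed

text \<open>
  Along a vertical line the Mellin transform is the characteristic function of the logarithm
  under \<open>\<nu>\<close> reweighted by \<open>t^(c - 1)\<close>. It is integrable, so Fourier inversion yields a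
  continuous nonnegative density, which in terms of \<open>t\<close> is the \<open>H\<close>-function up to a
  constant.
\<close>
theorem density_if_gibbs_transform:
  assumes \<nu>: "gibbs_transform \<alpha> n k C \<nu>" and C: "0 < C" and \<alpha>: "0 < \<alpha>" "\<alpha> < 1"
    and k: "1 \<le> k" "k \<le> n" and L: "fox_admissible L (1 - 1 / \<alpha> - real k) (1 / \<alpha>)"
  obtains w where "w \<in> borel_measurable borel" and "\<And>t. 0 \<le> w t"
    and "\<And>t. 0 < t \<Longrightarrow> fox_weight L \<alpha> n k t = of_real (w t)"
    and "\<And>q. q \<in> borel_measurable borel \<Longrightarrow>
      (\<integral>\<^sup>+t. q t \<partial>\<nu>) = ennreal (C / \<alpha>) * (\<integral>\<^sup>+t. indicator {0<..} t * (q t * ennreal (w t)) \<partial>lborel)"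
proof -
  define c where "c = contour_abscissa L"
  define R where "R y = gamma_ratio (1 / \<alpha>) k n (Complex c y)" for y
  have c: "c < 1 + real k * \<alpha>" unfolding c_def by (rule fox_contour_reduction(1)[OF \<alpha> zero_less_one L])
  have R_int: "integrable lborel R"
    using fox_contour_reduction(2)[OF \<alpha> zero_less_one L, of n] by (simp add: R_def[abs_def] c_def)
  have sets [measurable_cong]: "sets \<nu> = sets borel" and pos: "AE t in \<nu>. 0 < t"
    using \<nu> by (simp_all add: gibbs_transform_def)
  have mellin: "has_bochner_integral \<nu> (\<lambda>t. exp ((Complex c y - 1) * of_real (ln t))) (of_real (C / \<alpha>) * R y)" for y
    unfolding R_def by (rule Mellin_transform_if_gibbs_transform[OF \<nu> less_imp_le[OF C] \<alpha> k]) (use c in simp)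
  \<comment> \<open>The total mass under the weight \<open>t^(c - 1)\<close>, that is, the Mellin transform at \<open>s = c\<close>.\<close>
  define Z where "Z = C / \<alpha> * (Gamma (1 / \<alpha> * (1 - c) + real k) * rGamma (real n + 1 - c))"
  have k\<alpha>: "real k * \<alpha> \<le> real n"
  proof -
    have "real k * \<alpha> \<le> real k * 1" using \<alpha> by (intro mult_left_mono) auto
    moreover have "real k \<le> real n" using k by simp
    ultimately show ?thesis by linarith
  qed
  have Z: "0 < Z"
  proof -
    have "1 / \<alpha> * (1 - c) + real k = (1 + real k * \<alpha> - c) / \<alpha>" using \<alpha> by (simp add: field_simps)
    then have "0 < 1 / \<alpha> * (1 - c) + real k" using c \<alpha> by simp
    moreover have "0 < real n + 1 - c" using c k\<alpha> by simp
    ultimately show ?thesis using C \<alpha> by (simp add: Z_def rGamma_inverse_Gamma)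
  qed
  have R0: "of_real (C / \<alpha>) * R 0 = of_real Z"
  proof -
    have "Complex c 0 = of_real c" by (simp add: complex_eq_iff)
    then have "R 0 = Gamma (of_real (1 / \<alpha> * (1 - c) + real k)) * rGamma (of_real (real n + 1 - c))"
      by (simp add: R_def gamma_ratio_def)
    then show ?thesis unfolding Gamma_complex_of_real rGamma_complex_of_real Z_def by simp
  qed
  define v where "v t = exp ((c - 1) * ln t) / Z" for t
  have v_meas [measurable]: "v \<in> borel_measurable borel" unfolding v_def by measurable
  have v_pos: "0 < v t" for t using Z by (simp add: v_def)
  have v_int: "has_bochner_integral \<nu> v 1"
  proof -
    have "(\<lambda>t. exp ((Complex c 0 - 1) * of_real (ln t))) = (\<lambda>t. complex_of_real (exp ((c - 1) * ln t)))"
      by (simp add: exp_of_real[symmetric] complex_of_real_def[symmetric] fun_eq_iff Complex_eq)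
    then have "has_bochner_integral \<nu> (\<lambda>t. complex_of_real (exp ((c - 1) * ln t))) (of_real Z)"
      using mellin[of 0] R0 by simp
    then have "has_bochner_integral \<nu> (\<lambda>t. exp ((c - 1) * ln t)) Z"
      using has_bochner_integral_bounded_linear[OF bounded_linear_Re] by fastforce
    then have "has_bochner_integral \<nu> v (Z / Z)"
      unfolding v_def[abs_def] by (rule has_bochner_integral_divide_zero) 
    then show ?thesis using Z by simp
  qed
  define \<mu> where "\<mu> = distr (density \<nu> (\<lambda>t. ennreal (v t))) borel ln"
  have \<mu>_nn: "(\<integral>\<^sup>+x. q x \<partial>\<mu>) = (\<integral>\<^sup>+t. ennreal (v t) * q (ln t) \<partial>\<nu>)"
    if [measurable]: "q \<in> borel_measurable borel" for q
    unfolding \<mu>_def by (simp add: nn_integral_distr nn_integral_density)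
  have "prob_space \<mu>"
  proof
    have "emeasure \<mu> (space \<mu>) = (\<integral>\<^sup>+t. ennreal (v t) \<partial>\<nu>)"
      using \<mu>_nn[of "\<lambda>_. 1"] by simp
    also have "\<dots> = ennreal 1"
      using v_int v_pos by (subst nn_integral_eq_integral) (auto simp: has_bochner_integral_iff less_imp_le)
    finally show "emeasure \<mu> (space \<mu>) = 1" by simp
  qed
  then interpret \<mu>: real_distribution \<mu>
    by (rule real_distribution.intro) (simp add: real_distribution_axioms_def \<mu>_def)
  have char: "char \<mu> = (\<lambda>y. of_real (C / (\<alpha> * Z)) * R y)"
  proof
    fix y
    have [measurable]: "(\<lambda>x. iexp (y * x)) \<in> borel_measurable borel"
      by (intro borel_measurable_continuous_onI continuous_intros)
    have "char \<mu> y = (\<integral>t. v t *\<^sub>R iexp (y * ln t) \<partial>\<nu>)"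
      unfolding char_def \<mu>_def by (simp add: integral_distr integral_density less_imp_le[OF v_pos])
    also have "\<dots> = (\<integral>t. of_real (1 / Z) * exp ((Complex c y - 1) * of_real (ln t)) \<partial>\<nu>)"
    proof (rule arg_cong[where f="integral\<^sup>L \<nu>"], rule ext)
      fix t
      have e: "(Complex c y - 1) * of_real (ln t) = of_real ((c - 1) * ln t) + \<i> * of_real (y * ln t)"
        by (simp add: Complex_eq algebra_simps)
      show "v t *\<^sub>R iexp (y * ln t) = of_real (1 / Z) * exp ((Complex c y - 1) * of_real (ln t))"
        unfolding e exp_add exp_of_real v_def scaleR_conv_of_real by simp
    qed
    also have "\<dots> = of_real (1 / Z) * (of_real (C / \<alpha>) * R y)"
      using mellin[of y] by (simp only: has_bochner_integral_iff integral_mult_right_zero)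
    finally show "char \<mu> y = of_real (C / (\<alpha> * Z)) * R y" by (simp add: mult.commute)
  qed
  have char_int: "integrable lborel (char \<mu>)" unfolding char using R_int by simp
  define g where "g = inverse_Fourier (char \<mu>)"
  have g_nonneg: "g x \<in> \<real>\<^sub>\<ge>\<^sub>0" for x unfolding g_def by (rule \<mu>.inverse_Fourier_char_nonneg[OF char_int])
  have g_real: "g x = of_real (Re (g x))" "0 \<le> Re (g x)" for x
    using g_nonneg[of x] by (auto simp: complex_nonneg_Reals_iff complex_eq_iff)
  have [measurable]: "g \<in> borel_measurable borel"
    unfolding g_def by (rule borel_measurable_continuous_onI[OF continuous_inverse_Fourier[OF char_int]])
  define w where "w t = \<alpha> * Z / C * exp (- c * ln t) * Re (g (ln t))" for t
  show thesis
  proof (rule that)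
    show w_meas: "w \<in> borel_measurable borel" unfolding w_def by measurable
    show w_nonneg: "0 \<le> w t" for t using \<alpha> Z C g_real(2) by (simp add: w_def)
    show "fox_weight L \<alpha> n k t = of_real (w t)" if t: "0 < t" for t
    proof -
      have "of_real (\<alpha> * Z / C * exp (- c * ln t)) * g (ln t)
          = (\<integral>y. of_real (\<alpha> * Z / C * exp (- c * ln t)) * (iexp (- (y * ln t)) * (of_real (C / (\<alpha> * Z)) * R y)) \<partial>lborel) / of_real (2 * pi)"
        by (simp only: g_def inverse_Fourier_def char integral_mult_right_zero times_divide_eq_right)
      also have "(\<lambda>y. of_real (\<alpha> * Z / C * exp (- c * ln t)) * (iexp (- (y * ln t)) * (of_real (C / (\<alpha> * Z)) * R y)))
          = (\<lambda>y. R y * exp (- Complex c y * of_real (ln t)))"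
      proof
        fix y
        have e: "- Complex c y * of_real (ln t) = of_real (- c * ln t) + \<i> * of_real (- (y * ln t))"
          by (simp add: Complex_eq algebra_simps)
        have "\<alpha> * Z / C * (C / (\<alpha> * Z)) = 1" using \<alpha> Z C by simp
        then have f: "complex_of_real (\<alpha> * Z / C) * of_real (C / (\<alpha> * Z)) = 1"
          by (simp only: of_real_mult[symmetric] of_real_1)
        have "of_real (\<alpha> * Z / C * exp (- c * ln t)) * (iexp (- (y * ln t)) * (of_real (C / (\<alpha> * Z)) * R y))
            = (complex_of_real (\<alpha> * Z / C) * of_real (C / (\<alpha> * Z))) * (R y * (of_real (exp (- c * ln t)) * iexp (- (y * ln t))))"
          by (simp only: of_real_mult mult_ac)
        also have "\<dots> = R y * exp (- Complex c y * of_real (ln t))"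
          unfolding f e exp_add exp_of_real by (rule mult_1_left)
        finally show "of_real (\<alpha> * Z / C * exp (- c * ln t)) * (iexp (- (y * ln t)) * (of_real (C / (\<alpha> * Z)) * R y))
            = R y * exp (- Complex c y * of_real (ln t))" .
      qed
      also have "(\<integral>y. R y * exp (- Complex c y * of_real (ln t)) \<partial>lborel) / of_real (2 * pi) = fox_weight L \<alpha> n k t"
        unfolding R_def c_def by (rule fox_contour_reduction(4)[OF \<alpha> t L, symmetric])
      finally have "fox_weight L \<alpha> n k t = of_real (\<alpha> * Z / C * exp (- c * ln t)) * of_real (Re (g (ln t)))"
        using g_real(1)[of "ln t"] by simp
      then show ?thesis by (simp only: w_def of_real_mult)
    qed
    fix q :: "real \<Rightarrow> ennreal" assume [measurable]: "q \<in> borel_measurable borel"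
    note [measurable] = w_meas
    define Q where "Q x = q (exp x) * ennreal (Z * exp ((1 - c) * x))" for x
    have [measurable]: "Q \<in> borel_measurable borel" unfolding Q_def by measurable
    have "(\<integral>\<^sup>+t. q t \<partial>\<nu>) = (\<integral>\<^sup>+t. ennreal (v t) * Q (ln t) \<partial>\<nu>)"
    proof (rule nn_integral_cong_AE)
      show "AE t in \<nu>. q t = ennreal (v t) * Q (ln t)"
        using pos
      proof eventually_elim
        case (elim t)
        have "v t * (Z * exp ((1 - c) * ln t)) = 1"
          using Z by (simp add: v_def exp_add[symmetric] algebra_simps)
        then have "ennreal (v t) * ennreal (Z * exp ((1 - c) * ln t)) = 1"
          using v_pos[of t] Z by (simp only: ennreal_mult[symmetric] less_imp_le mult_nonneg_nonneg exp_ge_zero ennreal_1)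
        then show ?case using elim by (simp add: Q_def mult.left_commute)
      qed
    qed
    also have "\<dots> = (\<integral>\<^sup>+x. Q x \<partial>\<mu>)" by (rule \<mu>_nn[symmetric]) measurable
    also have "\<dots> = (\<integral>\<^sup>+x. ennreal (Re (g x)) * Q x \<partial>lborel)"
      by (subst \<mu>.density_inverse_Fourier[OF char_int]) (simp add: nn_integral_density g_def[symmetric])
    also have "\<dots> = (\<integral>\<^sup>+x. ennreal (C / \<alpha>) * (q (exp x) * ennreal (w (exp x)) * ennreal (exp x)) \<partial>lborel)"
    proof (rule nn_integral_cong)
      fix x
      have "Re (g x) * (Z * exp ((1 - c) * x)) = C / \<alpha> * (w (exp x) * exp x)"
      proof -
        have "exp ((1 - c) * x) = exp (- c * x) * exp x" by (simp add: exp_add[symmetric] algebra_simps)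
        then show ?thesis using \<alpha> C by (simp add: w_def)
      qed
      then have "ennreal (Re (g x)) * ennreal (Z * exp ((1 - c) * x)) = ennreal (C / \<alpha>) * (ennreal (w (exp x)) * ennreal (exp x))"
        using g_real(2)[of x] Z C \<alpha> w_nonneg[of "exp x"] by (simp add: ennreal_mult[symmetric])
      then show "ennreal (Re (g x)) * Q x = ennreal (C / \<alpha>) * (q (exp x) * ennreal (w (exp x)) * ennreal (exp x))"
        unfolding Q_def by (metis mult.assoc mult.left_commute)
    qed
    also have "\<dots> = ennreal (C / \<alpha>) * (\<integral>\<^sup>+x. q (exp x) * ennreal (w (exp x)) * ennreal (exp x) \<partial>lborel)"
      by (intro nn_integral_cmult) measurable
    also have "(\<integral>\<^sup>+x. q (exp x) * ennreal (w (exp x)) * ennreal (exp x) \<partial>lborel)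
        = (\<integral>\<^sup>+t. indicator {0<..} t * (q t * ennreal (w t)) \<partial>lborel)"
      by (intro nn_integral_exp_substitution) measurable
    finally show "(\<integral>\<^sup>+t. q t \<partial>\<nu>) = ennreal (C / \<alpha>) * (\<integral>\<^sup>+t. indicator {0<..} t * (q t * ennreal (w t)) \<partial>lborel)" .
  qed
qed

section \<open>The Gibbs weights\<close>

locale normalized_PK_model = PK_model +
  assumes h_mass: "(\<integral>\<^sup>+t. ennreal (h t) \<partial>density lborel (\<lambda>t. ennreal (f t))) = 1"
begin

text \<open>
  The sum over distinct indices is a probability, so it is at most 1, and \<open>h\<close> has mean 1
  under the law of the total mass.
\<close>
lemma nn_integral_block_measure_le_1:
  assumes ns: "0 \<notin> set ns"
  shows "(\<integral>\<^sup>+t. ennreal (h t) \<partial>block_measure ns) \<le> 1"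
proof -
  have "(\<integral>\<^sup>+t. ennreal (h t) \<partial>block_measure ns)
      = (\<integral>\<^sup>+\<omega>. distinct_sum (\<lambda>i. ennreal (normalized_jumps J \<omega> i)) ns * ennreal (h (total_mass J \<omega>)) \<partial>M)"
    by (rule nn_integral_block_measure) measurable
  also have "\<dots> \<le> (\<integral>\<^sup>+\<omega>. 1 * ennreal (h (total_mass J \<omega>)) \<partial>M)"
  proof (rule nn_integral_mono_AE)
    show "AE \<omega> in M. distinct_sum (\<lambda>i. ennreal (normalized_jumps J \<omega> i)) ns * ennreal (h (total_mass J \<omega>))
        \<le> 1 * ennreal (h (total_mass J \<omega>))"
      using AE_total_mass_pos AE_pure_jump_path
    proof eventually_elim
      case (elim \<omega>)
      let ?S = "total_mass J \<omega>"
      have reg: "regular_path \<omega>" and S: "0 < ?S" and sum: "(\<integral>\<^sup>+i. ennreal (J i \<omega>) \<partial>count_space UNIV) = ennreal ?S"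
        using elim by simp_all
      have "ennreal (normalized_jumps J \<omega> i) = ennreal (1 / ?S) * ennreal (J i \<omega>)" for i
        using S regular_path_J_pos[OF reg, of i] by (simp add: normalized_jumps_def ennreal_mult[symmetric])
      then have "(\<integral>\<^sup>+i. ennreal (normalized_jumps J \<omega> i) \<partial>count_space UNIV) = ennreal (1 / ?S) * ennreal ?S"
        by (simp add: nn_integral_cmult sum)
      also have "\<dots> = 1" using S by (simp add: ennreal_mult[symmetric])
      finally have "distinct_sum (\<lambda>i. ennreal (normalized_jumps J \<omega> i)) ns \<le> 1"
        using distinct_sum_le_power[OF ns, of "\<lambda>i. ennreal (normalized_jumps J \<omega> i)"] by simp
      then show ?case by (rule mult_right_mono) simp
    qed
  qed
  also have "\<dots> = (\<integral>\<^sup>+t. ennreal (h t) \<partial>distr M borel (total_mass J))"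
    by (simp add: nn_integral_distr)
  also have "\<dots> = 1" unfolding distr_total_mass by (rule h_mass)
  finally show ?thesis .
qed

lemma block_constant_pos: "0 < \<alpha> ^ length ns * (\<Prod>m\<leftarrow>ns. pochhammer (1 - \<alpha>) (m - 1))"
proof -
  have "0 < (\<Prod>m\<leftarrow>ns. pochhammer (1 - \<alpha>) (m - 1))"
    using \<alpha> by (induction ns) (auto intro!: mult_pos_pos pochhammer_pos)
  then show ?thesis using \<alpha> by simp
qed

text \<open>
  Some block sizes with \<open>k\<close> blocks and \<open>n\<close> elements; the choice is immaterial, since all
  laws with the same \<open>gibbs_transform\<close> are proportional.
\<close>
definition model_blocks :: "nat \<Rightarrow> nat \<Rightarrow> nat list" where
  "model_blocks n k = (n - k + 1) # replicate (k - 1) 1"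

text \<open>
  The integral of \<open>h\<close> against a law with this transform, per unit of the constant of the
  transform.
\<close>
definition gibbs_mass :: "nat \<Rightarrow> nat \<Rightarrow> real" where
  "gibbs_mass n k = enn2real (\<integral>\<^sup>+t. ennreal (h t) \<partial>block_measure (model_blocks n k))
     / (\<alpha> ^ k * (\<Prod>m\<leftarrow>model_blocks n k. pochhammer (1 - \<alpha>) (m - 1)))"

lemma gibbs_mass_nonneg: "1 \<le> k \<Longrightarrow> 0 \<le> gibbs_mass n k"
  using block_constant_pos[of "model_blocks n k"]
  by (auto simp: gibbs_mass_def model_blocks_def intro!: divide_nonneg_pos)

lemma gibbs_transform_model_blocks:
  assumes k: "1 \<le> k" "k \<le> n"
  shows "gibbs_transform \<alpha> n k (\<alpha> ^ k * (\<Prod>m\<leftarrow>model_blocks n k. pochhammer (1 - \<alpha>) (m - 1))) (block_measure (model_blocks n k))"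
proof -
  have "sum_list (model_blocks n k) = n" "length (model_blocks n k) = k" "0 \<notin> set (model_blocks n k)"
    using k by (auto simp: model_blocks_def sum_list_replicate)
  then show ?thesis using gibbs_transform_block_measure[of "model_blocks n k"] by simp
qed

text \<open>
  By uniqueness, the integral of \<open>h\<close> against any law with this transform is a multiple of
  one number that depends on \<open>n\<close> and \<open>k\<close> only. Finiteness is inherited from the block
  measures.
\<close>
lemma nn_integral_gibbs_transform:
  assumes \<nu>: "gibbs_transform \<alpha> n k C \<nu>" and C: "0 < C" and k: "1 \<le> k" "k \<le> n"
  shows "(\<integral>\<^sup>+t. ennreal (h t) \<partial>\<nu>) = ennreal (C * gibbs_mass n k)"
proof -
  let ?ns = "model_blocks n k"
  define B where "B = \<alpha> ^ k * (\<Prod>m\<leftarrow>?ns. pochhammer (1 - \<alpha>) (m - 1))"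
  define m where "m = enn2real (\<integral>\<^sup>+t. ennreal (h t) \<partial>block_measure ?ns)"
  have len: "length ?ns = k" and ns: "0 \<notin> set ?ns" using k by (auto simp: model_blocks_def)
  have B: "0 < B" using block_constant_pos[of ?ns] by (simp add: len B_def)
  have m: "(\<integral>\<^sup>+t. ennreal (h t) \<partial>block_measure ?ns) = ennreal m"
    using nn_integral_block_measure_le_1[OF ns] by (simp add: m_def le_less_trans[OF _ ennreal_one_less_top])
  have m0: "0 \<le> m" by (simp add: m_def)
  have "ennreal B * (\<integral>\<^sup>+t. ennreal (h t) \<partial>\<nu>) = ennreal C * ennreal m"
    unfolding m[symmetric] B_def
    by (rule gibbs_transform_unique[OF \<nu> gibbs_transform_model_blocks[OF k] C]) (use B in \<open>simp_all add: B_def\<close>)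
  then have "ennreal (1 / B) * (ennreal B * (\<integral>\<^sup>+t. ennreal (h t) \<partial>\<nu>)) = ennreal (1 / B) * (ennreal C * ennreal m)"
    by (rule arg_cong)
  moreover have "ennreal (1 / B) * ennreal B = 1" using B by (simp add: ennreal_mult[symmetric])
  moreover have "ennreal (1 / B) * (ennreal C * ennreal m) = ennreal (C * gibbs_mass n k)"
    unfolding gibbs_mass_def B_def[symmetric] m_def[symmetric]
    using B C m0 by (simp add: ennreal_mult[symmetric])
  ultimately show ?thesis by (simp add: mult.assoc[symmetric])
qed

definition gibbs_weight :: "nat \<Rightarrow> nat \<Rightarrow> real" where
  "gibbs_weight n k = \<alpha> ^ k * gibbs_mass n k"

lemma is_EPPF_gibbs_weight:
  assumes iid: "iid_indices N (PK_mixture K (density lborel (\<lambda>t. ennreal (h t * f t)))) P I"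
  shows "is_EPPF N (index_partition I)
    (\<lambda>ns. gibbs_weight (sum_list ns) (length ns) * (\<Prod>m\<leftarrow>ns. pochhammer (1 - \<alpha>) (m - 1)))"
  unfolding is_EPPF_def
proof (intro allI impI)
  fix n :: nat and As assume n: "1 \<le> n" and A: "distinct As \<and> partition_on {1..n} (set As)"
  then have As: "distinct As" and P: "partition_on {1..n} (set As)" by auto
  let ?ns = "map card As"
  let ?C = "\<alpha> ^ length ?ns * (\<Prod>m\<leftarrow>?ns. pochhammer (1 - \<alpha>) (m - 1))"
  have fin: "finite A" and ne: "A \<noteq> {}" if A: "A \<in> set As" for A
  proof -
    have "A \<subseteq> {1..n}" using P A by (auto simp: partition_on_def)
    then show "finite A" by (rule finite_subset) simp
    show "A \<noteq> {}" using P A by (auto simp: partition_on_def)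
  qed
  have ns: "0 \<notin> set ?ns" using fin ne by auto
  have "n = card (\<Union>(set As))" using P by (simp add: partition_on_def)
  also have "\<dots> = (\<Sum>A\<in>set As. card A)"
    using P fin by (intro card_Union_disjoint) (auto simp: partition_on_def disjoint_def pairwise_def disjnt_def)
  also have "\<dots> = sum_list ?ns" using As by (simp add: sum_list_distinct_conv_sum_set)
  finally have sum: "sum_list ?ns = n" by simp
  have len: "1 \<le> length ?ns" "length ?ns \<le> sum_list ?ns"
  proof -
    show "1 \<le> length ?ns" using sum n by (cases As) auto
    have "length ms \<le> sum_list ms" if "0 \<notin> set ms" for ms :: "nat list"
      using that by (induction ms) auto
    then show "length ?ns \<le> sum_list ?ns" using ns by blast
  qed
  have C: "0 < ?C" by (rule block_constant_pos)
  have "emeasure N {\<omega> \<in> space N. index_partition I n \<omega> = set As} = ennreal (?C * gibbs_mass (sum_list ?ns) (length ?ns))"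
    unfolding emeasure_EPPF[OF iid P As]
    by (rule nn_integral_gibbs_transform[OF gibbs_transform_block_measure[OF ns] C len])
  moreover have "0 \<le> ?C * gibbs_mass (sum_list ?ns) (length ?ns)"
    by (rule mult_nonneg_nonneg[OF less_imp_le[OF C] gibbs_mass_nonneg[OF len(1)]])
  ultimately have "measure N {\<omega> \<in> space N. index_partition I n \<omega> = set As} = ?C * gibbs_mass (sum_list ?ns) (length ?ns)"
    by (simp only: measure_def enn2real_ennreal)
  then show "measure N {\<omega> \<in> space N. index_partition I n \<omega> = set As}
    = gibbs_weight (sum_list ?ns) (length ?ns) * (\<Prod>m\<leftarrow>?ns. pochhammer (1 - \<alpha>) (m - 1))"
    by (simp only: gibbs_weight_def mult_ac)
qed

text \<open>
  A partition of one element has a single block with probability 1.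
\<close>
lemma gibbs_weight_1_1:
  assumes iid: "iid_indices N (PK_mixture K (density lborel (\<lambda>t. ennreal (h t * f t)))) P I"
  shows "gibbs_weight 1 1 = 1"
proof -
  interpret N: prob_space N using iid by (simp add: iid_indices_def)
  have "distinct [{1::nat}] \<and> partition_on {1..1::nat} (set [{1}])" by (simp add: partition_on_def)
  then have "measure N {\<omega> \<in> space N. index_partition I 1 \<omega> = set [{1}]} = gibbs_weight 1 1"
    using is_EPPF_gibbs_weight[OF iid] unfolding is_EPPF_def by fastforce
  moreover have "index_partition I 1 \<omega> = set [{1}]" for \<omega>
    by (auto simp: index_partition_def quotient_def)
  ultimately show ?thesis by (simp add: N.prob_space)
qed

text \<open>
  The constant \<open>\<alpha> * Gamma n / Gamma k\<close> of the quotient laws produces the prefactor of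
  the expectation.
\<close>
lemma gibbs_weight_eq_quotient_expectation:
  fixes \<sigma> \<beta> :: "real measure"
  assumes tr: "gibbs_transform \<alpha> n k (\<alpha> * Gamma (real n) / Gamma (real k)) (distr (\<sigma> \<Otimes>\<^sub>M \<beta>) borel (\<lambda>(s, u). s / u))"
    and sets [measurable_cong]: "sets \<sigma> = sets borel" "sets \<beta> = sets borel"
    and k: "1 \<le> k" "k \<le> n"
  shows "quotient_expectation_exists h \<sigma> \<beta> \<and>
    gibbs_weight n k = \<alpha> ^ (k - 1) * Gamma (real k) / Gamma (real n) * quotient_expectation h \<sigma> \<beta>"
proof -
  let ?D = "distr (\<sigma> \<Otimes>\<^sub>M \<beta>) borel (\<lambda>(s, u). s / u)"
  let ?C = "\<alpha> * Gamma (real n) / Gamma (real k)"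
  have \<Gamma>: "0 < Gamma (real n)" "0 < Gamma (real k)" using k by simp_all
  then have C: "0 < ?C" using \<alpha> by simp
  have "has_bochner_integral ?D h (?C * gibbs_mass n k)"
  proof (rule has_bochner_integral_nn_integral)
    have "AE x in ?D. 0 < x" using tr by (simp add: gibbs_transform_def)
    then show "AE x in ?D. 0 \<le> h x" by eventually_elim (rule h_nonneg)
    show "0 \<le> ?C * gibbs_mass n k" by (rule mult_nonneg_nonneg[OF less_imp_le[OF C] gibbs_mass_nonneg[OF k(1)]])
    show "(\<integral>\<^sup>+x. ennreal (h x) \<partial>?D) = ennreal (?C * gibbs_mass n k)"
      by (rule nn_integral_gibbs_transform[OF tr C k])
  qed simp
  moreover have "(\<lambda>p. h ((\<lambda>(s, u). s / u) p)) = (\<lambda>(s, u). h (s / u))" by auto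
  ultimately have "quotient_expectation_exists h \<sigma> \<beta>" and e: "quotient_expectation h \<sigma> \<beta> = ?C * gibbs_mass n k"
    unfolding quotient_expectation_exists_def quotient_expectation_def has_bochner_integral_iff
    by (simp_all add: integrable_distr_eq integral_distr)
  moreover have "\<alpha> ^ k = \<alpha> ^ (k - 1) * \<alpha>" using k(1) by (cases k) auto
  ultimately show ?thesis using \<Gamma> by (simp add: gibbs_weight_def)
qed

text \<open>
  Any law with this transform has the \<open>H\<close>-function as its density up to a constant; the
  block measure of \<open>model_blocks\<close> is such a law.
\<close>
lemma gibbs_weight_eq_fox_I:
  assumes k: "1 \<le> k" "k \<le> n" and L: "fox_admissible L (1 - 1 / \<alpha> - real k) (1 / \<alpha>)"
  shows "set_integrable lborel {0<..} (\<lambda>t. of_real (h t) * fox_weight L \<alpha> n k t) \<and>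
    of_real (gibbs_weight n k) = fox_I L \<alpha> n k h"
proof -
  let ?ns = "model_blocks n k"
  define C where "C = \<alpha> ^ k * (\<Prod>m\<leftarrow>?ns. pochhammer (1 - \<alpha>) (m - 1))"
  have C: "0 < C" using block_constant_pos[of ?ns] k by (simp add: C_def model_blocks_def)
  have tr: "gibbs_transform \<alpha> n k C (block_measure ?ns)"
    unfolding C_def by (rule gibbs_transform_model_blocks[OF k])
  obtain w where [measurable]: "w \<in> borel_measurable borel" and w0: "\<And>t. 0 \<le> w t"
    and w: "\<And>t. 0 < t \<Longrightarrow> fox_weight L \<alpha> n k t = of_real (w t)"
    and dens: "\<And>q. q \<in> borel_measurable borel \<Longrightarrow>
      (\<integral>\<^sup>+t. q t \<partial>block_measure ?ns) = ennreal (C / \<alpha>) * (\<integral>\<^sup>+t. indicator {0<..} t * (q t * ennreal (w t)) \<partial>lborel)"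
    using density_if_gibbs_transform[OF tr C \<alpha> k L] by metis
  let ?u = "\<lambda>t. indicator {0<..} t * (h t * w t)"
  have pos: "0 \<le> \<alpha> * gibbs_mass n k" using \<alpha> gibbs_mass_nonneg[OF k(1)] by simp
  have "has_bochner_integral lborel ?u (\<alpha> * gibbs_mass n k)"
  proof (rule has_bochner_integral_nn_integral[OF _ _ pos])
    show "AE t in lborel. 0 \<le> ?u t" using h_nonneg w0 by (intro AE_I2) (simp add: indicator_def)
    have "ennreal (C * gibbs_mass n k) = (\<integral>\<^sup>+t. ennreal (h t) \<partial>block_measure ?ns)"
      by (rule nn_integral_gibbs_transform[OF tr C k, symmetric])
    also have "\<dots> = ennreal (C / \<alpha>) * (\<integral>\<^sup>+t. indicator {0<..} t * (ennreal (h t) * ennreal (w t)) \<partial>lborel)"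
      by (rule dens) measurable
    also have "(\<integral>\<^sup>+t. indicator {0<..} t * (ennreal (h t) * ennreal (w t)) \<partial>lborel) = (\<integral>\<^sup>+t. ennreal (?u t) \<partial>lborel)"
      using w0 h_nonneg by (intro nn_integral_cong) (auto simp: indicator_def ennreal_mult)
    finally have "ennreal (\<alpha> / C) * ennreal (C * gibbs_mass n k) = ennreal (\<alpha> / C) * ennreal (C / \<alpha>) * (\<integral>\<^sup>+t. ennreal (?u t) \<partial>lborel)"
      by (simp add: mult.assoc)
    moreover have "ennreal (\<alpha> / C) * ennreal (C / \<alpha>) = 1" using \<alpha> C by (simp add: ennreal_mult[symmetric])
    moreover have "ennreal (\<alpha> / C) * ennreal (C * gibbs_mass n k) = ennreal (\<alpha> * gibbs_mass n k)"
      using \<alpha> C gibbs_mass_nonneg[OF k(1), of n] by (simp add: ennreal_mult[symmetric])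
    ultimately show "(\<integral>\<^sup>+t. ennreal (?u t) \<partial>lborel) = ennreal (\<alpha> * gibbs_mass n k)" by simp
  qed simp
  then have "has_bochner_integral lborel (\<lambda>t. complex_of_real (?u t)) (of_real (\<alpha> * gibbs_mass n k))"
    by (rule has_bochner_integral_of_real)
  moreover have "(\<lambda>t. complex_of_real (?u t)) = (\<lambda>t. indicator {0<..} t *\<^sub>R (of_real (h t) * fox_weight L \<alpha> n k t))"
    by (rule ext) (auto simp: indicator_def w)
  ultimately have "set_integrable lborel {0<..} (\<lambda>t. of_real (h t) * fox_weight L \<alpha> n k t)"
    and e: "(LBINT t:{0<..}. of_real (h t) * fox_weight L \<alpha> n k t) = of_real (\<alpha> * gibbs_mass n k)"
    by (simp_all add: set_integrable_def set_lebesgue_integral_def has_bochner_integral_iff)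
  moreover have "\<alpha> ^ k = \<alpha> ^ (k - 1) * \<alpha>" using k(1) by (cases k) auto
  ultimately show ?thesis unfolding fox_I_def e gibbs_weight_def by simp
qed

end

lemma normalized_PK_modelI:
  assumes \<alpha>: "0 < \<alpha>" "\<alpha> < 1" and f: "positive_stable_density \<alpha> f"
    and h: "h \<in> borel_measurable borel" "\<And>t. 0 < t \<Longrightarrow> 0 \<le> h t"
    and int: "set_integrable lborel {0<..} (\<lambda>t. h t * f t)" "(LBINT t:{0<..}. h t * f t) = 1"
    and K: "PK_kernel \<alpha> M X J K"
  shows "normalized_PK_model \<alpha> M X J f h K"
proof -
  interpret stable_density \<alpha> f using \<alpha> f by unfold_locales
  have model: "PK_model \<alpha> M X J f h K"
    using K \<alpha> h by unfold_locales (simp_all add: PK_kernel_def)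
  have [measurable]: "h \<in> borel_measurable borel" by (rule h)
  have "(\<integral>\<^sup>+t. ennreal (h t) \<partial>density lborel (\<lambda>t. ennreal (f t))) = (\<integral>\<^sup>+t. ennreal (f t) * ennreal (h t) \<partial>lborel)"
    by (simp add: nn_integral_density)
  also have "\<dots> = (\<integral>\<^sup>+t. ennreal (indicator {0<..} t * (h t * f t)) \<partial>lborel)"
    using h(2) f_nonneg f_nonpos by (intro nn_integral_cong) (simp add: indicator_def ennreal_mult mult.commute not_less)
  also have "\<dots> = ennreal (\<integral>t. indicator {0<..} t * (h t * f t) \<partial>lborel)"
    using int(1) h(2) f_nonneg by (intro nn_integral_eq_integral) (auto simp: set_integrable_def indicator_def)
  also have "\<dots> = 1" using int(2) by (simp add: set_lebesgue_integral_def)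
  finally show ?thesis using model by (simp add: normalized_PK_model_def normalized_PK_model_axioms_def)
qed

theorem theorem4p1:
  fixes \<alpha> :: real and f h :: "real \<Rightarrow> real"
    and M :: "'a measure" and X :: "real \<Rightarrow> 'a \<Rightarrow> real" and J :: "nat \<Rightarrow> 'a \<Rightarrow> real"
    and K :: "real \<Rightarrow> (nat \<Rightarrow> real) measure"
    and N :: "'b measure" and P :: "'b \<Rightarrow> nat \<Rightarrow> real" and I :: "nat \<Rightarrow> 'b \<Rightarrow> nat"
  assumes "0 < \<alpha>" and "\<alpha> < 1"
    and "positive_stable_density \<alpha> f"
    and "h \<in> borel_measurable borel" and "\<And>t. 0 < t \<Longrightarrow> 0 \<le> h t"
    and "set_integrable lborel {0<..} (\<lambda>t. h t * f t)"
    and "(LBINT t:{0<..}. h t * f t) = 1"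
    and "PK_kernel \<alpha> M X J K"
    and "iid_indices N (PK_mixture K (density lborel (\<lambda>t. ennreal (h t * f t)))) P I"
  shows "\<exists>V :: nat \<Rightarrow> nat \<Rightarrow> real.
    is_EPPF N (index_partition I)
      (\<lambda>ns. V (sum_list ns) (length ns) * (\<Prod>m\<leftarrow>ns. pochhammer (1 - \<alpha>) (m - 1))) \<and>
    (\<forall>n k. 1 \<le> k \<and> k \<le> n \<longrightarrow>
      (let \<sigma> = tilted_stable_law f \<alpha> (k * \<alpha>); \<beta> = beta_law (k * \<alpha>) (n - k * \<alpha>)
       in quotient_expectation_exists h \<sigma> \<beta> \<and>
          V n k = \<alpha> ^ (k - 1) * Gamma (real k) / Gamma (real n) * quotient_expectation h \<sigma> \<beta>) \<and>
      (let \<sigma> = tilted_stable_law f \<alpha> ((real k - 1) * \<alpha>);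
           \<beta> = beta_law ((real k - 1) * \<alpha> + 1) (real n - 1 - (real k - 1) * \<alpha>)
       in quotient_expectation_exists h \<sigma> \<beta> \<and>
          V n k = \<alpha> ^ (k - 1) * Gamma (real k) / Gamma (real n) * quotient_expectation h \<sigma> \<beta>) \<and>
      (\<forall>L. fox_admissible L (1 - 1 / \<alpha> - real k) (1 / \<alpha>) \<longrightarrow>
        (\<forall>t>0. fox_H_converges L (1 - 1 / \<alpha> - real k) (1 / \<alpha>) (- real n) 1 t) \<and>
        set_integrable lborel {0<..} (\<lambda>t. of_real (h t) * fox_weight L \<alpha> n k t) \<and>
        of_real (V n k) = fox_I L \<alpha> n k h)) \<and>
    V 1 1 = 1"
proof -
  interpret normalized_PK_model \<alpha> M X J f h K
    by (rule normalized_PK_modelI) (use assms in auto)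
  note iid = assms(9)
  show ?thesis
    unfolding Let_def
  proof (rule exI[of _ gibbs_weight], intro conjI is_EPPF_gibbs_weight[OF iid] gibbs_weight_1_1[OF iid], intro allI impI, elim conjE)
    fix n k :: nat assume k: "1 \<le> k" "k \<le> n"
    note q = gibbs_weight_eq_quotient_expectation[OF _ tilted_stable_law_sets beta_law_sets k]
    show "(quotient_expectation_exists h (tilted_stable_law f \<alpha> (k * \<alpha>)) (beta_law (k * \<alpha>) (n - k * \<alpha>)) \<and>
          gibbs_weight n k = \<alpha> ^ (k - 1) * Gamma (real k) / Gamma (real n) *
            quotient_expectation h (tilted_stable_law f \<alpha> (k * \<alpha>)) (beta_law (k * \<alpha>) (n - k * \<alpha>))) \<and>
      (quotient_expectation_exists h (tilted_stable_law f \<alpha> ((real k - 1) * \<alpha>))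
            (beta_law ((real k - 1) * \<alpha> + 1) (real n - 1 - (real k - 1) * \<alpha>)) \<and>
          gibbs_weight n k = \<alpha> ^ (k - 1) * Gamma (real k) / Gamma (real n) *
            quotient_expectation h (tilted_stable_law f \<alpha> ((real k - 1) * \<alpha>))
              (beta_law ((real k - 1) * \<alpha> + 1) (real n - 1 - (real k - 1) * \<alpha>))) \<and>
      (\<forall>L. fox_admissible L (1 - 1 / \<alpha> - real k) (1 / \<alpha>) \<longrightarrow>
        (\<forall>t>0. fox_H_converges L (1 - 1 / \<alpha> - real k) (1 / \<alpha>) (- real n) 1 t) \<and>
        set_integrable lborel {0<..} (\<lambda>t. of_real (h t) * fox_weight L \<alpha> n k t) \<and>
        of_real (gibbs_weight n k) = fox_I L \<alpha> n k h)"
    proof (intro conjI[OF q[OF dens.gibbs_transform_quotient_tilted_k[OF k]] conjI[OF q[OF dens.gibbs_transform_quotient_tilted_k_minus_1[OF k]]]] allI impI)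
      fix L assume L: "fox_admissible L (1 - 1 / \<alpha> - real k) (1 / \<alpha>)"
      have "\<forall>t>0. fox_H_converges L (1 - 1 / \<alpha> - real k) (1 / \<alpha>) (- real n) 1 t"
        using fox_contour_reduction(3)[OF \<alpha> _ L] by blast
      then show "(\<forall>t>0. fox_H_converges L (1 - 1 / \<alpha> - real k) (1 / \<alpha>) (- real n) 1 t) \<and>
        set_integrable lborel {0<..} (\<lambda>t. of_real (h t) * fox_weight L \<alpha> n k t) \<and>
        of_real (gibbs_weight n k) = fox_I L \<alpha> n k h"
        using gibbs_weight_eq_fox_I[OF k L] by blast
    qed
  qed
qed

end
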